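(* Let $d\ge3$, let $V\in RH_q$ for $q>d/2$ ($V\ge0$, not identically zero), let $L=-\Delta+V$ on $\mathbb{R}^d$, let $0<\gamma<d/2$ and $\theta\ge0$. Then, for any weight $w$, $$\int|V^\gamma L^{-\gamma}f|^p\,w\le C_\theta\int|f|^p\,M_r^\theta w\qquad\text{for }1\le p<q/\gamma,\ r=\left(\frac{q}{\gamma p}\right)',$$ and $$\int|L^{-\gamma}V^\gamma f|^p\,w\le C_\theta\int|f|^p\,M^\theta w\qquad\text{for }(q/\gamma)'<p<\infty.$$
   Context: For an exponent $t$, $t'$ is the conjugate exponent. A weight is a function $w\ge0$ in $L^1_{\mathrm{loc}}(\mathbb{R}^d)$. $C_\theta$ denotes a constant that does not depend on $f$ or $w$. $V\in RH_q$ means there is $C$ with $\left(\frac1{|B|}\int_BV^q\right)^{1/q}\le C\frac1{|B|}\int_BV$ for every ball $B\subset\mathbb{R}^d$. The function $$\rho(x)=\sup\left\{r>0:\frac{1}{r^{d-2}}\int_{B(x,r)}V\le1\right\}$$ is the critical radius function associated with $V$. For $\theta\ge0$ and $1\le r<\infty$, $$M_r^\theta w(x)=\sup_{B(x_0,r_0)\ni x}\left(1+\frac{r_0}{\rho(x_0)}\right)^{-\theta}\left(\frac{1}{|B(x_0,r_0)|}\int_{B(x_0,r_0)}w^r\right)^{1/r},\qquad M^\theta=M_1^\theta.$$ $L^{-\gamma}$ is the fractional integral operator of $L$, with kernel $J_\gamma(x,y)$; $V^\gamma L^{-\gamma}$ has kernel $V^\gamma(x)J_\gamma(x,y)$, and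 $L^{-\gamma}V^\gamma$ is its adjoint. *)

theory Defs
  imports "HOL-Analysis.Analysis"
begin

definition conj_exp :: "real \<Rightarrow> real" where
  "conj_exp t = t / (t - 1)"

definition weight :: "('a::euclidean_space \<Rightarrow> real) \<Rightarrow> bool" where
  "weight w \<longleftrightarrow> (\<forall>x. 0 \<le> w x) \<and> (\<forall>K. compact K \<longrightarrow> w absolutely_integrable_on K)"

(* Only used with s > 0. *)
definition ennreal_powr :: "ennreal \<Rightarrow> real \<Rightarrow> ennreal" where
  "ennreal_powr a s = (if a = \<infinity> then \<infinity> else ennreal (enn2real a powr s))"

definition power_mean :: "real \<Rightarrow> ('a::euclidean_space \<Rightarrow> real) \<Rightarrow> 'a set \<Rightarrow> ennreal" where
  "power_mean s w B =
     ennreal_powr ((\<integral>\<^sup>+y\<in>B. ennreal (w y powr s) \<partial>lebesgue) / emeasure lebesgue B) (1 / s)"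

definition reverse_holder :: "real \<Rightarrow> ('a::euclidean_space \<Rightarrow> real) \<Rightarrow> bool" where
  "reverse_holder q V \<longleftrightarrow>
     weight V \<and>
     (\<exists>C::real. \<forall>x0 r0. 0 < r0 \<longrightarrow>
        power_mean q V (ball x0 r0) \<le> ennreal C * power_mean 1 V (ball x0 r0))"

definition critical_radius :: "('a::euclidean_space \<Rightarrow> real) \<Rightarrow> 'a \<Rightarrow> real" where
  "critical_radius V x =
     Sup {r. 0 < r \<and> (LINT y:ball x r|lebesgue. V y) / r ^ (DIM('a) - 2) \<le> 1}"

definition maximal_fun ::
  "('a::euclidean_space \<Rightarrow> real) \<Rightarrow> real \<Rightarrow> real \<Rightarrow> ('a \<Rightarrow> real) \<Rightarrow> 'a \<Rightarrow> ennreal" where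
  "maximal_fun V \<theta> r w x =
     (SUP (x0, r0) \<in> {(x0, r0). 0 < r0 \<and> x \<in> ball x0 r0}.
        ennreal ((1 + r0 / critical_radius V x0) powr (- \<theta>)) * power_mean r w (ball x0 r0))"


definition square_integrable :: "('a::euclidean_space \<Rightarrow> 'b::euclidean_space) \<Rightarrow> bool" where
  "square_integrable u \<longleftrightarrow>
     u \<in> borel_measurable lebesgue \<and> integrable lebesgue (\<lambda>x. (norm (u x))\<^sup>2)"

definition l2_norm :: "('a::euclidean_space \<Rightarrow> real) \<Rightarrow> real" where
  "l2_norm u = sqrt (LINT x|lebesgue. (u x)\<^sup>2)"

(* Compactly supported C^1 test functions define the same weak gradient as smooth ones. *)
definition weak_gradient :: "('a::euclidean_space \<Rightarrow> real) \<Rightarrow> ('a \<Rightarrow> 'a) \<Rightarrow> bool" where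
  "weak_gradient u Du \<longleftrightarrow>
     (\<forall>\<phi> D\<phi>. (\<forall>x. GDERIV \<phi> x :> D\<phi> x) \<and> continuous_on UNIV D\<phi> \<and> bounded {x. \<phi> x \<noteq> 0} \<longrightarrow>
        (LINT x|lebesgue. u x *\<^sub>R D\<phi> x) = - (LINT x|lebesgue. \<phi> x *\<^sub>R Du x))"

(* Domain of the closed form Q(u,v) = \<integral> (\<nabla>u \<bullet> \<nabla>v + V u v); Du is the gradient of u. *)
definition form_domain ::
  "('a::euclidean_space \<Rightarrow> real) \<Rightarrow> ('a \<Rightarrow> real) \<Rightarrow> ('a \<Rightarrow> 'a) \<Rightarrow> bool" where
  "form_domain V u Du \<longleftrightarrow>
     square_integrable u \<and> square_integrable Du \<and> weak_gradient u Du \<and>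
     integrable lebesgue (\<lambda>x. V x * (u x)\<^sup>2)"

(* schrodinger V u g: u is in the domain of L = -\<Delta> + V and L u = g, where L is the
   self-adjoint operator on L^2 associated with the form Q. *)
definition schrodinger ::
  "('a::euclidean_space \<Rightarrow> real) \<Rightarrow> ('a \<Rightarrow> real) \<Rightarrow> ('a \<Rightarrow> real) \<Rightarrow> bool" where
  "schrodinger V u g \<longleftrightarrow>
     square_integrable g \<and>
     (\<exists>Du. form_domain V u Du \<and>
       (\<forall>v Dv. form_domain V v Dv \<longrightarrow>
          (LINT x|lebesgue. Du x \<bullet> Dv x + V x * u x * v x) = (LINT x|lebesgue. g x * v x)))"

(* u t = e^{-tL} f for t > 0: the solution of u' = - L u, u 0 = f in L^2. It is unique since L
   is nonnegative, and u t lies in the domain of L for every f in L^2 since L is self-adjoint. *)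
definition heat_flow ::
  "('a::euclidean_space \<Rightarrow> real) \<Rightarrow> ('a \<Rightarrow> real) \<Rightarrow> (real \<Rightarrow> 'a \<Rightarrow> real) \<Rightarrow> bool" where
  "heat_flow V f u \<longleftrightarrow>
     (\<forall>t>0. \<exists>g. schrodinger V (u t) g \<and>
        ((\<lambda>h. l2_norm (\<lambda>x. (u (t + h) x - u t x) / h + g x)) \<longlongrightarrow> 0) (at 0)) \<and>
     ((\<lambda>t. l2_norm (\<lambda>x. u t x - f x)) \<longlongrightarrow> 0) (at_right 0)"

(* k t is the integral kernel of e^{-tL}; this determines k t up to null sets for each t > 0. *)
definition heat_kernel ::
  "('a::euclidean_space \<Rightarrow> real) \<Rightarrow> (real \<Rightarrow> 'a \<Rightarrow> 'a \<Rightarrow> real) \<Rightarrow> bool" where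
  "heat_kernel V k \<longleftrightarrow>
     (\<lambda>(t, x, y). k t x y) \<in> borel_measurable borel \<and>
     (\<forall>f. square_integrable f \<longrightarrow>
        (\<forall>t>0. AE x in lebesgue. integrable lebesgue (\<lambda>y. k t x y * f y)) \<and>
        heat_flow V f (\<lambda>t x. LINT y|lebesgue. k t x y * f y))"

(* Kernel of L^{-\<gamma>} = 1/\<Gamma>(\<gamma>) \<integral>_0^\<infinity> t^{\<gamma>-1} e^{-tL} dt, where k is the kernel of e^{-tL}. *)
definition frac_kernel ::
  "(real \<Rightarrow> 'a \<Rightarrow> 'a \<Rightarrow> real) \<Rightarrow> real \<Rightarrow> 'a::euclidean_space \<Rightarrow> 'a \<Rightarrow> real" where
  "frac_kernel k \<gamma> x y = (LINT t:{0<..}|lebesgue. t powr (\<gamma> - 1) * k t x y) / Gamma \<gamma>"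

definition VL_kernel ::
  "('a \<Rightarrow> real) \<Rightarrow> (real \<Rightarrow> 'a \<Rightarrow> 'a \<Rightarrow> real) \<Rightarrow> real \<Rightarrow> 'a::euclidean_space \<Rightarrow> 'a \<Rightarrow> real" where
  "VL_kernel V k \<gamma> x y = V x powr \<gamma> * frac_kernel k \<gamma> x y"

(* The kernels are real, so the adjoint has the transposed kernel. *)
definition LV_kernel ::
  "('a \<Rightarrow> real) \<Rightarrow> (real \<Rightarrow> 'a \<Rightarrow> 'a \<Rightarrow> real) \<Rightarrow> real \<Rightarrow> 'a::euclidean_space \<Rightarrow> 'a \<Rightarrow> real" where
  "LV_kernel V k \<gamma> x y = VL_kernel V k \<gamma> y x"

definition kernel_op ::
  "('a::euclidean_space \<Rightarrow> 'a \<Rightarrow> real) \<Rightarrow> ('a \<Rightarrow> complex) \<Rightarrow> 'a \<Rightarrow> complex" where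
  "kernel_op K f x = (LINT y|lebesgue. K x y *\<^sub>R f y)"

(* A Bochner integral that does not exist is 0, so the first conjunct is needed: it says that
   kernel_op K f is well defined almost everywhere for w when the right-hand side is finite. *)
definition weighted_inequality ::
  "('a::euclidean_space \<Rightarrow> 'a \<Rightarrow> real) \<Rightarrow> real \<Rightarrow> real \<Rightarrow> ('a \<Rightarrow> real) \<Rightarrow> ('a \<Rightarrow> ennreal) \<Rightarrow>
     ('a \<Rightarrow> complex) \<Rightarrow> bool" where
  "weighted_inequality K p C w W f \<longleftrightarrow>
     ((\<integral>\<^sup>+x. ennreal (norm (f x) powr p) * W x \<partial>lebesgue) < \<infinity> \<longrightarrow>
        (AE x in lebesgue. 0 < w x \<longrightarrow> integrable lebesgue (\<lambda>y. K x y *\<^sub>R f y))) \<and>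
     (\<integral>\<^sup>+x. ennreal (norm (kernel_op K f x) powr p * w x) \<partial>lebesgue)
       \<le> ennreal C * (\<integral>\<^sup>+x. ennreal (norm (f x) powr p) * W x \<partial>lebesgue)"

end

(* The heat kernel of L is dominated by a Gaussian, because V is nonnegative and a shifted Gaussian is
 therefore a supersolution. The Fefferman-Phong inequality and Agmon's exponential weights add the decay
 exp (- c (|x - y| / rho y)^delta) for some delta > 0. Integrating a geometric mean of the two bounds in
 time gives |J(x, y)| <= C |x - y|^(2 gamma - d) (1 + |x - y| / rho y)^(- N) for every N.
 Both inequalities then follow from Schur's test with a power of |x - y| whose exponent changes at the
 critical radius, so that the sums over dyadic shells converge at both ends. On each shell, Hoelder's
 inequality and the reverse Hoelder condition bound the integral of V^(gamma p) w by the average that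
 defines the maximal function of w; for the adjoint they bound that of V^(gamma p') by a power of the
 radius, which leaves the plain average of w. *)
theory Submission imports Defs begin

text \<open>The heat kernel is given only through its action on square integrable functions and is
  determined only up to null sets. Every pointwise bound is therefore extracted from pairings of
  e^(-tL) 1_Q with 1_E for small sets E and Q, as these shrink. Neither kernel bound alone suffices
  for J: the Gaussian does not see the critical radius, and the other bound, of size min(rho^2,
  t)^(-d/2), is not integrable against t^(gamma - 1) at either end. In the geometric mean, a weight
  eta with gamma < d (1 - eta)/2 makes the integral converge at infinity, and the Gaussian factor
  makes it converge at 0. The exponent delta originates in the slow variation of the critical
  radius, which grows at most like |x - y|^(1 - delta), strictly less than linearly. Schur's test
  freezes each variable in turn, whereas the bound for J has its scale at one fixed argument; moving
  the scale to the other argument costs a factor delta in the decay rate, which the free choice of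
  exponents absorbs.\<close>

abbreviation (input) "LM \<equiv> borel_measurable lebesgue"
abbreviation (input) "LM2 \<equiv> borel_measurable (lebesgue \<Otimes>\<^sub>M lebesgue)"
abbreviation (input) "BM \<equiv> borel_measurable borel"
abbreviation (input) "L1 \<equiv> integrable lebesgue"
abbreviation (input) "L2 \<equiv> square_integrable"

syntax
 "_nnl" :: "pttrn => ennreal => ennreal" ("(2\<integral>_./ _)" [0, 60] 60)
 "_set_nnl" :: "pttrn => 'a set => ennreal => ennreal" ("(2\<integral>_\<in>_./ _)" [0, 110, 60] 60)
 "_Lint" :: "pttrn => real => real" ("(2LINT _./ _)" [0, 60] 60)
 "_AEl" :: "pttrn => bool => bool" ("(2AE _./ _)" [0, 10] 10)
translations
 "\<integral>x. f" => "CONST nn_integral CONST lebesgue (\<lambda>x. f)"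
 "\<integral>x\<in>A. f" => "CONST set_nn_integral CONST lebesgue A (\<lambda>x. f)"
 "LINT x. f" => "CONST lebesgue_integral CONST lebesgue (\<lambda>x. f)"
 "AE x. P" => "CONST almost_everywhere CONST lebesgue (\<lambda>x. P)"

lemmas Lint_add = Bochner_Integration.integral_add
 and Lint_cong = Bochner_Integration.integral_cong
 and Lint_diff = Bochner_Integration.integral_diff
 and Lint_nonneg = Bochner_Integration.integral_nonneg
 and Lint_sum = Bochner_Integration.integral_sum
 and BM_continuous = borel_measurable_continuous_onI

section \<open>Integration on Euclidean space\<close>

lemma sigma_finite_lebesgue: "sigma_finite_measure (lebesgue :: 'a::euclidean_space measure)"
proof -
 obtain A :: "'a set set" where A: "countable A" "A \<subseteq> sets lborel" "\<Union>A = space lborel"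
  "\<forall>a\<in>A. emeasure lborel a \<noteq> \<infinity>"
  using lborel.sigma_finite_countable by blast
 show ?thesis
 proof (unfold_locales, intro exI conjI)
  show "countable A" by fact
  show "A \<subseteq> sets lebesgue" using A(2) by auto
  show "\<Union>A = space lebesgue" using A(3) by simp
  show "\<forall>a\<in>A. emeasure lebesgue a \<noteq> \<infinity>"
   using A(2,4) by auto
 qed
qed

lemma pair_sigma_finite_lebesgue:
 "pair_sigma_finite (lebesgue :: 'a::euclidean_space measure) (lebesgue :: 'b::euclidean_space measure)"
 by (simp add: pair_sigma_finite.intro sigma_finite_lebesgue)

lemma Tonelli_lebesgue:
 fixes f :: "'a::euclidean_space => 'b::euclidean_space => ennreal"
 assumes "case_prod f \<in> LM2"
 shows "(\<integral>x. \<integral>y. f x y) = (\<integral>y. \<integral>x. f x y)"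
 using pair_sigma_finite.Fubini'[OF pair_sigma_finite_lebesgue assms] by simp

lemma measurable_ident_lebesgue_pair:
 "(\<lambda>z. z) \<in> (lebesgue :: 'a::euclidean_space measure) \<Otimes>\<^sub>M (lebesgue :: 'b::euclidean_space measure) \<rightarrow>\<^sub>M borel"
proof -
 have "fst \<in> (lebesgue :: 'a measure) \<Otimes>\<^sub>M (lebesgue :: 'b measure) \<rightarrow>\<^sub>M borel"
   "snd \<in> (lebesgue :: 'a measure) \<Otimes>\<^sub>M (lebesgue :: 'b measure) \<rightarrow>\<^sub>M borel"
  by (auto intro!: measurable_compose[OF measurable_fst] measurable_compose[OF measurable_snd]
    measurable_completion)
 hence "(\<lambda>z. (fst z, snd z)) \<in> (lebesgue :: 'a measure) \<Otimes>\<^sub>M (lebesgue :: 'b measure) \<rightarrow>\<^sub>M borel"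
  by (rule borel_measurable_Pair)
 thus ?thesis by simp
qed

lemma borel_measurable_lebesgue_pair:
 assumes "f \<in> BM"
 shows "f \<in> borel_measurable ((lebesgue :: 'a::euclidean_space measure) \<Otimes>\<^sub>M (lebesgue :: 'b::euclidean_space measure))"
 using measurable_compose[OF measurable_ident_lebesgue_pair assms] .

lemma LM_of_BM:
 "f \<in> BM ==> f \<in> LM"
 by (rule measurable_completion) simp

lemma ennreal_powr_ennreal: "0 \<le> a ==> ennreal_powr (ennreal a) s = ennreal (a powr s)"
 by (simp add: ennreal_powr_def)

lemma ennreal_powr_mono: "0 < s ==> a \<le> b ==> ennreal_powr a s \<le> ennreal_powr b s"
 by (cases a; cases b) (auto simp: ennreal_powr_def top_unique intro!: ennreal_leI powr_mono2)

lemma ennreal_powr_mult: "0 < s ==> 0 \<le> c ==> c \<noteq> 0 ==> ennreal_powr (ennreal c*a) s = ennreal (c powr s)*ennreal_powr a s"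
 by (cases a) (auto simp: ennreal_powr_def ennreal_mult_top powr_mult simp flip: ennreal_mult)

lemma ennreal_powr_powr: "0 < s ==> 0 < t ==> ennreal_powr (ennreal_powr a s) t = ennreal_powr a (s*t)"
 by (cases a) (auto simp: ennreal_powr_def powr_powr)

lemma ennreal_powr_one: "ennreal_powr a 1 = a"
 by (cases a) (auto simp: ennreal_powr_def)

lemma ennreal_powr_eq_0: "0 < s ==> ennreal_powr a s = 0 \<longleftrightarrow> a = 0"
 by (cases a) (auto simp: ennreal_powr_def)

text \<open>Stated with \<open>ennreal_powr\<close>, so that both norms may be zero or infinite.
  These cases are split off because Young's inequality is applied after division by the
  norms.\<close>

lemma Hoelder_nn_integral:
 fixes f g :: "'a => real"
 assumes [measurable]: "f \<in> borel_measurable M" "g \<in> borel_measurable M"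
  and nn: "\<And>x. 0 \<le> f x" "\<And>x. 0 \<le> g x"
  and s: "1 < s" "r = s/(s - 1)"
 shows "(\<integral>\<^sup>+x. ennreal (f x*g x) \<partial>M)
  \<le> ennreal_powr (\<integral>\<^sup>+x. ennreal (f x powr s) \<partial>M) (1/s)*ennreal_powr (\<integral>\<^sup>+x. ennreal (g x powr r) \<partial>M) (1/r)"
  (is "?L \<le> ennreal_powr ?a _*ennreal_powr ?b _")
proof -
 have r: "1 < r" using s by (simp add: less_divide_eq)
 have "1/r = (s - 1)/s" using s by simp
 hence r: "1 < r" "1/s + 1/r = 1" using s r by (auto simp: add_divide_distrib[symmetric])
 have zero: "?L = 0" if "?a = 0 \<or> ?b = 0"
 proof -
  have "AE x in M. f x = 0 \<or> g x = 0"
  proof (cases "?a = 0")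
   case True
   hence "AE x in M. ennreal (f x powr s) = 0" by (subst (asm) nn_integral_0_iff_AE) auto
   thus ?thesis by (auto elim!: eventually_mono)
  next
   case False
   hence "?b = 0" using that by simp
   hence "AE x in M. ennreal (g x powr r) = 0" by (subst (asm) nn_integral_0_iff_AE) auto
   thus ?thesis by (auto elim!: eventually_mono)
  qed
  hence "AE x in M. ennreal (f x*g x) = 0" by (auto elim!: eventually_mono)
  thus ?thesis by (subst nn_integral_0_iff_AE) auto
 qed
 consider "?a = 0 \<or> ?b = 0" | "?a \<noteq> 0" "?b \<noteq> 0" "?a = \<infinity> \<or> ?b = \<infinity>" |
  a b where "?a = ennreal a" "?b = ennreal b" "0 < a" "0 < b"
  by (cases ?a; cases ?b) (auto simp: less_le)
 thus ?thesis
 proof cases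
  case 1
  thus ?thesis using zero by simp
 next
  case 2
  hence "ennreal_powr ?a (1/s)*ennreal_powr ?b (1/r) = \<infinity>"
   using s r ennreal_powr_eq_0[of "1/s" ?a] ennreal_powr_eq_0[of "1/r" ?b]
   by (auto simp: ennreal_powr_def ennreal_mult_eq_top_iff)
  thus ?thesis by simp
 next
  case 3
  define A B where "A = a powr (1/s)" and "B = b powr (1/r)"
  have AB: "0 < A" "0 < B" using 3 by (auto simp: A_def B_def)
  have As: "A powr s = a" "B powr r = b" using 3 s r by (auto simp: A_def B_def powr_powr)
  have pt: "f x*g x \<le> A*B*(f x powr s/(s*a) + g x powr r/(r*b))" for x
  proof -
   have "(f x/A)*(g x/B) \<le> (f x/A) powr s/s + (g x/B) powr r/r"
    using nn AB s r by (intro Youngs_inequality) auto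
   also have "... = f x powr s/(s*a) + g x powr r/(r*b)"
    using nn AB r by (simp add: powr_divide As mult.commute)
   finally show ?thesis using AB by (simp add: field_simps)
  qed
  have "?L \<le> (\<integral>\<^sup>+x. ennreal (A*B/(s*a))*ennreal (f x powr s) + ennreal (A*B/(r*b))*ennreal (g x powr r) \<partial>M)"
   using pt AB 3 s(1) r by (intro nn_integral_mono) (simp add: ennreal_mult[symmetric] ennreal_plus[symmetric] distrib_left del: ennreal_plus)
  also have "... = ennreal (A*B/(s*a))*?a + ennreal (A*B/(r*b))*?b"
   by (subst nn_integral_add) (auto simp: nn_integral_cmult)
  also have "... = ennreal (A*B*(1/s + 1/r))"
   using AB 3 s(1) r(1) by (simp add: ennreal_mult[symmetric] ennreal_plus[symmetric] distrib_left del: ennreal_plus)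
  also have "... = ennreal_powr ?a (1/s)*ennreal_powr ?b (1/r)"
   using AB 3 r by (simp add: ennreal_powr_ennreal A_def B_def ennreal_mult)
  finally show ?thesis .
 qed
qed

section \<open>Mass growth on balls and sums over dyadic shells\<close>

text \<open>The exponent \<open>c\<close> is the natural growth of the mass; \<open>A1\<close> and
  \<open>A2\<close> measure the deviation from it relative to the scale \<open>m\<close>. The factor
  \<open>X\<close> is an \<open>ennreal\<close> because it will carry the value of a maximal
  function, which may be infinite.\<close>

definition ball_rate :: "real => real => real => real => 'a::euclidean_space => ennreal => ('a => real) => bool" where
 "ball_rate c A1 A2 m y X h \<longleftrightarrow> 0 < m \<and> h \<in> LM \<and> (\<forall>x. 0 \<le> h x) \<and>
  (\<forall>r>0. (\<integral>x\<in>ball y r. ennreal (h x)) \<le> X*ennreal (r powr c*(r/m) powr (if r \<le> m then A1 else A2)))"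

text \<open>The exponents enter with a minus sign, so that a shell of radius R with mass R^c (R/m)^A
  contributes (R/m)^(A - B). This is summable over the small shells if \<open>B1 < A1\<close> and
  over the large ones if \<open>A2 < B2\<close>.\<close>

definition shell_kernel :: "real => real => real => real => 'a::euclidean_space => 'a => real" where
 "shell_kernel c B1 B2 m y x = dist y x powr (- c)*(dist y x/m) powr (- (if dist y x \<le> m then B1 else B2))"

lemma powr_shell_le:
 assumes "0 < R" "R/2 \<le> s" "s \<le> R"
 shows "s powr b \<le> 2 powr \<bar>b\<bar> * R powr (b::real)"
proof (cases "0 \<le> b")
 case True
 hence "s powr b \<le> R powr b" using assms by (intro powr_mono2) auto
 also have "... \<le> 2 powr \<bar>b\<bar> * R powr b" using ge_one_powr_ge_zero[of 2 "\<bar>b\<bar>"] by (simp add: mult_le_cancel_right1)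
 finally show ?thesis .
next
 case False
 hence "s powr b \<le> (R/2) powr b" using assms by (intro powr_mono2') auto
 also have "... = 2 powr \<bar>b\<bar> * R powr b" using False assms by (simp add: powr_divide powr_minus_divide)
 finally show ?thesis .
qed

text \<open>The common engine of all kernel estimates: if the mass of \<open>h\<close> on balls around \<open>y\<close> grows at
 the rates \<open>A1\<close>, \<open>A2\<close> below and above the scale \<open>m\<close>, it may be integrated against a kernel whose
 decay rates \<open>B1\<close>, \<open>B2\<close> lie on the correct side. The proof sums over dyadic shells.\<close>

lemma nn_integral_shell_kernel:
 assumes AB: "B1 < A1" "A2 < B2"
 obtains C where "0 < C" "\<And>y m X h F k. ball_rate c A1 A2 m (y::'a::euclidean_space) X h ==> 0 \<le> k ==>
  (AE x. F x \<le> k*(h x * shell_kernel c B1 B2 m y x)) ==> (\<integral>x. ennreal (F x)) \<le> ennreal (k*C)*X"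
proof -
 \<comment> \<open>Each dyadic step away from the scale \<open>m\<close> gains the factor
   \<open>q\<close>; \<open>K\<close> absorbs the variation of the kernel within one shell.\<close>
 define \<epsilon> q K where "\<epsilon> = min (A1 - B1) (B2 - A2)" and "q = 2 powr (- \<epsilon>)" and "K = 2 powr (\<bar>c + B1\<bar> + \<bar>c + B2\<bar>)"
 have q: "0 < q" "q < 1" and K: "0 < K" using AB powr_less_mono[of "- \<epsilon>" 0 2] by (auto simp: q_def K_def \<epsilon>_def)
 have "(\<integral>x. ennreal (F x)) \<le> ennreal (k*(2*K*(1/(1 - q))))*X"
  if b: "ball_rate c A1 A2 m y X h" and k: "0 \<le> k" and F: "AE x. F x \<le> k*(h x * shell_kernel c B1 B2 m y x)"
  for y :: 'a and m X h F k
 proof -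
  note b' = b[unfolded ball_rate_def]
  have m: "0 < m" and [measurable]: "h \<in> LM" "ball y r \<in> sets lebesgue" and h: "0 \<le> h x" for x r
   using b' by auto
  define B R where "B j = (if j \<le> 0 then B1 else B2)" and "R j = m*2 powr real_of_int j" for j
  define G where "G j = K*(R j powr (- c)*(R j/m) powr (- B j))" for j
  define T where "T j x = ennreal (k*G j)*(ennreal (h x)*indicator (ball y (R j)) x)" for j x
  have G: "0 \<le> G j" for j using K by (simp add: G_def)
  have R: "0 < R j" "R j/m = 2 powr j" for j using m by (auto simp: R_def)
  have Rm: "R j \<le> m \<longleftrightarrow> j \<le> 0" for j using m powr_le_cancel_iff[of 2 "real_of_int j" 0] by (simp add: R_def)
  have [measurable]: "T j \<in> LM" for j unfolding T_def by measurable
  have cb: "s powr (- c)*(s/m) powr (- b) = m powr b * s powr (- (c + b))" if "0 < s" for s b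
  proof -
   have "s powr (- (c + b)) = s powr (- c) * s powr (- b)" by (simp flip: powr_add)
   thus ?thesis using that m by (simp add: powr_divide powr_minus_divide)
  qed
  \<comment> \<open>The integers are folded into a series over the natural numbers by pairing n with
    -n. The shell 0 is counted twice, which affects only the constant.\<close>
  have le: "ennreal (k*(h x * shell_kernel c B1 B2 m y x)) \<le> (\<Sum>n. T (int n) x + T (- int n) x)" if "x \<noteq> y" for x
  proof -
   define s j where "s = dist y x" and "j = \<lfloor>log 2 (s/m)\<rfloor> + 1"
   have s: "0 < s" using that by (simp add: s_def)
   have e: "s = m*2 powr log 2 (s/m)" using s m by simp
   have "2 powr (real_of_int j - 1) \<le> 2 powr log 2 (s/m)" "2 powr log 2 (s/m) < 2 powr real_of_int j"
    unfolding j_def by (intro powr_mono powr_less_mono; linarith)+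
   hence sR: "R j/2 \<le> s" "s < R j" unfolding R_def by (subst e, use m in \<open>simp add: powr_diff\<close>)+
   \<comment> \<open>If s = m then j = 1, so that \<open>B j\<close> is \<open>B2\<close> while
     \<open>shell_kernel\<close> uses \<open>B1\<close>; the two agree there because the base s/m is
     1.\<close>
   have "s \<le> m \<longleftrightarrow> j \<le> 0 \<or> s = m"
   proof (cases "j \<le> 0")
    case False
    hence "2 powr 1 \<le> 2 powr real_of_int j" by (intro powr_mono) auto
    hence "m*2 \<le> R j" unfolding R_def using m by (intro mult_left_mono) auto
    hence "m \<le> s" using sR(1) by simp
    thus ?thesis using False by auto
   qed (use sR(2) Rm[of j] in auto)
   hence "shell_kernel c B1 B2 m y x = s powr (- c)*(s/m) powr (- B j)"
    using m by (auto simp: shell_kernel_def s_def[symmetric] B_def)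
   also have "... = m powr B j * s powr (- (c + B j))" by (rule cb[OF s])
   also have "... \<le> m powr B j*(2 powr \<bar>- (c + B j)\<bar> * R j powr (- (c + B j)))"
    using R sR by (intro mult_left_mono powr_shell_le) auto
   also have "... \<le> m powr B j*(K * R j powr (- (c + B j)))"
    unfolding K_def by (intro mult_left_mono mult_right_mono powr_mono) (auto simp: B_def)
   also have "... = G j" using cb[OF R(1)[of j], of "B j"] unfolding G_def by (simp only: mult.left_commute)
   finally have "k*(h x * shell_kernel c B1 B2 m y x) \<le> k*(h x*G j)" using k h by (intro mult_left_mono) auto
   moreover have "x \<in> ball y (R j)" using sR by (simp add: s_def)
   ultimately have "ennreal (k*(h x * shell_kernel c B1 B2 m y x)) \<le> T j x"
    using k h G by (simp add: T_def ennreal_mult[symmetric] mult_ac ennreal_leI)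
   also have "... \<le> T (int (nat \<bar>j\<bar>)) x + T (- int (nat \<bar>j\<bar>)) x" by (cases "0 \<le> j") auto
   also have "... \<le> (\<Sum>n. T (int n) x + T (- int n) x)"
    using sum_le_suminf[of "\<lambda>n. T (int n) x + T (- int n) x" "{nat \<bar>j\<bar>}"] by auto
   finally show ?thesis .
  qed
  have int: "(\<integral>x. T j x) \<le> X*ennreal (k*K*q ^ nat \<bar>j\<bar>)" for j
  proof -
   define A where "A = (if R j \<le> m then A1 else A2)"
   have "real_of_int j*(A - B j) \<le> - \<epsilon>*\<bar>real_of_int j\<bar>"
    using mult_left_mono[of \<epsilon> "A1 - B1" "- real_of_int j"] mult_left_mono[of \<epsilon> "B2 - A2" j] Rm[of j]
    by (auto simp: A_def B_def \<epsilon>_def algebra_simps)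
   hence "2 powr (real_of_int j*(A - B j)) \<le> 2 powr (- \<epsilon>*\<bar>real_of_int j\<bar>)" by (intro powr_mono) auto
   also have "... = q ^ nat \<bar>j\<bar>" by (simp add: q_def powr_powr flip: powr_realpow)
   finally have "(R j/m) powr (A - B j) \<le> q ^ nat \<bar>j\<bar>" unfolding R(2) powr_powr .
   hence e: "k*K*(R j/m) powr (A - B j) \<le> k*K*q ^ nat \<bar>j\<bar>" using k K by (intro mult_left_mono) auto
   have "k*G j*(R j powr c*(R j/m) powr A) = k*K*((R j powr c * R j powr (- c))*((R j/m) powr A*(R j/m) powr (- B j)))"
    by (simp add: G_def)
   also have "... = k*K*(R j/m) powr (A - B j)" using R[of j] by (simp flip: powr_add)
   also note e
   finally have e: "k*G j*(R j powr c*(R j/m) powr A) \<le> k*K*q ^ nat \<bar>j\<bar>" .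
   have "(\<integral>x. T j x) = ennreal (k*G j)*(\<integral>x\<in>ball y (R j). ennreal (h x))"
    unfolding T_def by (rule nn_integral_cmult) measurable
   also have "... \<le> ennreal (k*G j)*(X*ennreal (R j powr c*(R j/m) powr A))"
    using b' R(1)[of j] unfolding A_def by (intro mult_left_mono) auto
   also have "... = X*ennreal (k*G j*(R j powr c*(R j/m) powr A))" using k G by (simp add: ennreal_mult mult_ac)
   also have "... \<le> X*ennreal (k*K*q ^ nat \<bar>j\<bar>)" by (intro mult_left_mono ennreal_leI e) simp
   finally show ?thesis .
  qed
  have "(\<integral>x. ennreal (F x)) \<le> (\<integral>x. (\<Sum>n. T (int n) x + T (- int n) x))"
  proof (rule nn_integral_mono_AE)
   have "AE x. x \<noteq> y" by (simp add: AE_completion_iff AE_lborel_singleton)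
   with F show "AE x. ennreal (F x) \<le> (\<Sum>n. T (int n) x + T (- int n) x)"
    by eventually_elim (rule order_trans[OF ennreal_leI le])
  qed
  also have "... = (\<Sum>n. (\<integral>x. T (int n) x) + (\<integral>x. T (- int n) x))"
   by (simp add: nn_integral_add nn_integral_suminf)
  also have "... \<le> (\<Sum>n. X*ennreal (2*(k*K)*q ^ n))"
  proof (intro suminf_le)
   fix n
   have "(\<integral>x. T (int n) x) + (\<integral>x. T (- int n) x) \<le> X*ennreal (k*K*q ^ n) + X*ennreal (k*K*q ^ n)"
    using add_mono[OF int[of "int n"] int[of "- int n"]] by simp
   also have "... = X*ennreal (2*(k*K)*q ^ n)"
    using k K q by (simp add: distrib_left[symmetric] ennreal_plus[symmetric] mult_ac del: ennreal_plus)
   finally show "(\<integral>x. T (int n) x) + (\<integral>x. T (- int n) x) \<le> X*ennreal (2*(k*K)*q ^ n)" .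
  qed auto
  also have "... = X*ennreal (2*(k*K)*(1/(1 - q)))"
  proof -
   have "(\<lambda>n. 2*(k*K)*q ^ n) sums (2*(k*K)*(1/(1 - q)))" using q by (intro sums_mult geometric_sums) auto
   hence "(\<Sum>n. ennreal (2*(k*K)*q ^ n)) = ennreal (2*(k*K)*(1/(1 - q)))"
    using k K q by (intro suminf_ennreal_eq) auto
   thus ?thesis by simp
  qed
  finally show ?thesis by (simp only: mult_ac)
 qed
 thus ?thesis using K q by (intro that[of "2*K*(1/(1 - q))"]) auto
qed

lemma ball_rate_const:
 "0 < m ==> ball_rate (real DIM('a)) 0 0 m y (ennreal (unit_ball_vol (real DIM('a)))) (\<lambda>_::'a::euclidean_space. 1)"
 by (auto simp: ball_rate_def emeasure_ball ennreal_mult[symmetric] powr_realpow)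

lemma shell_kernel_nonneg: "0 \<le> shell_kernel c B1 B2 m y x" by (simp add: shell_kernel_def)

lemma shell_kernel_commute: "shell_kernel c B1 B2 m y x = shell_kernel c B1 B2 m x y"
 by (simp add: shell_kernel_def dist_commute)

text \<open>Schur's test raises the kernel to the power p and the auxiliary kernel to the power 1 -
  p. Shell kernels are stable under this operation, as the exponents combine linearly. The factor
  with \<open>N\<close> helps only beyond the scale \<open>m\<close>, where 1 + R/m >= R/m; below it
  is estimated by 1.\<close>

lemma shell_kernel_Schur:
 assumes m: "0 < m" and p: "1 \<le> p" and N: "0 \<le> N"
 shows "(dist y x powr (- c0)*(1 + dist y x/m) powr (- N)) powr p * shell_kernel c B1 B2 m y x powr (1 - p)
  \<le> shell_kernel (c0*p + c*(1 - p)) (B1*(1 - p)) (N*p + B2*(1 - p)) m y x"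
proof (cases "x = y")
 case False
 define R X where "R = dist y x" and "X = R/m"
 have X: "0 < X" "R \<le> m \<longleftrightarrow> X \<le> 1" using False m by (auto simp: R_def X_def)
 define e where "e = (if X \<le> 1 then B1 else B2)"
 have "(1 + X) powr (- N*p) \<le> X powr (- (if X \<le> 1 then 0 else N*p))"
 proof (cases "X \<le> 1")
  case False
  have "(1 + X) powr (- N*p) \<le> X powr (- N*p)" using X N p by (intro powr_mono2') auto
  thus ?thesis using False by simp
 qed (use powr_mono[of "- (N*p)" 0 "1 + X"] X N p in simp)
 hence "(R powr (- c0*p) * R powr (- c*(1 - p)))*((1 + X) powr (- N*p)*X powr (- e*(1 - p)))
  \<le> (R powr (- c0*p) * R powr (- c*(1 - p)))*(X powr (- (if X \<le> 1 then 0 else N*p))*X powr (- e*(1 - p)))"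
  by (intro mult_left_mono mult_right_mono) auto
 also have "... = shell_kernel (c0*p + c*(1 - p)) (B1*(1 - p)) (N*p + B2*(1 - p)) m y x"
  unfolding shell_kernel_def R_def[symmetric] X_def[symmetric] X(2) powr_add[symmetric] by (simp add: e_def algebra_simps)
 finally show ?thesis
  unfolding shell_kernel_def R_def[symmetric] X_def[symmetric] X(2) powr_mult powr_powr e_def[symmetric] by (simp only: mult_ac)
qed (simp add: shell_kernel_def)

lemma exp_minus_le_powr:
 assumes "0 < (z::real)" "0 < M"
 shows "exp (- z) \<le> (M/z) powr M"
proof -
 have "z/M \<le> exp (z/M)" using exp_ge_add_one_self[of "z/M"] by linarith
 hence "(z/M) powr M \<le> exp (z/M) powr M" using assms by (intro powr_mono2) auto
 also have "... = exp z" using assms by (simp add: powr_def)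
 finally show ?thesis using assms by (simp add: exp_minus powr_divide field_simps)
qed

text \<open>Obtained from the shell summation at the scale sqrt s instead of a computation of the
  Gaussian integral. The denominator 8s, in place of 4s, leaves room for the loss in
  \<open>gauss_weighted_L2\<close>.\<close>

lemma nn_integral_exp_square_le:
 obtains C where "0 < C"
  "\<And>s (y :: 'a::euclidean_space). 0 < s ==>
   (\<integral>x. ennreal (s powr (- real DIM('a)/2)*exp (- ((norm (x - y))^2/(8 * s))))) \<le> ennreal C"
proof -
 let ?d = "real DIM('a)" and ?\<omega> = "unit_ball_vol (real DIM('a))"
 \<comment> \<open>With this exponent \<open>exp_minus_le_powr\<close> bounds the exponential beyond
   the scale by the power -d - 1 of R/m, which corresponds to \<open>B2 = 1\<close>.\<close>
 define M where "M = (?d + 1)/2"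
 define K where "K = max 1 ((8*M) powr M)"
 have M: "0 < M" by (simp add: M_def add_nonneg_pos)
 have K: "1 \<le> K" "(8*M) powr M \<le> K" by (auto simp: K_def)
 have "- ?d < 0" "(0::real) < 1" by auto
 then obtain C where C: "0 < C" and D: "\<And>y m X h F k. ball_rate ?d 0 0 m (y::'a) X h ==> 0 \<le> k ==>
  (AE x. F x \<le> k*(h x * shell_kernel ?d (- ?d) 1 m y x)) ==> (\<integral>x. ennreal (F x)) \<le> ennreal (k*C)*X"
  by (rule nn_integral_shell_kernel[where c="?d"]) (rule that; blast)
 show ?thesis
 proof (rule that[of "K*C*?\<omega> + 1"])
  show "0 < K*C*?\<omega> + 1" using C K by (intro add_nonneg_pos mult_nonneg_nonneg) auto
  fix s :: real and y :: 'a assume s: "0 < s"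
  define m where "m = sqrt s"
  have m: "0 < m" and sm: "s = m*m" using s by (auto simp: m_def)
  have sp: "s powr (- ?d/2) = m powr (- ?d)" using m by (simp add: sm powr_mult flip: powr_add)
  have "(\<integral>x. ennreal (s powr (- ?d/2)*exp (- ((norm (x - y))^2/(8 * s))))) \<le> ennreal (K*C)*ennreal ?\<omega>"
  proof (rule D[OF ball_rate_const[OF m]])
   have "s powr (- ?d/2)*exp (- ((norm (x - y))^2/(8 * s))) \<le> K*(1 * shell_kernel ?d (- ?d) 1 m y x)" if "x \<noteq> y" for x
   proof -
    define R where "R = dist y x"
    have R: "0 < R" "norm (x - y) = R" using that by (auto simp: R_def dist_norm norm_minus_commute)
    have "exp (- (R^2/(8 * s))) \<le> K*(if R \<le> m then 1 else (R/m) powr (- ?d - 1))"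
    proof (cases "R \<le> m")
     case False
     have "exp (- (R^2/(8 * s))) \<le> (M/(R^2/(8 * s))) powr M" using R s M by (intro exp_minus_le_powr) auto
     also have "M/(R^2/(8 * s)) = 8*M*(R/m) powr (- 2)"
      using R m by (simp add: sm powr_minus powr_numeral field_simps power2_eq_square)
     also have "(8*M*(R/m) powr (- 2)) powr M = (8*M) powr M*(R/m) powr (- ?d - 1)"
     proof -
      have e: "(- 2)*M = - ?d - 1" by (simp add: M_def)
      show ?thesis unfolding powr_mult powr_powr e ..
     qed
     also have "... \<le> K*(R/m) powr (- ?d - 1)" by (rule mult_right_mono[OF K(2)]) simp
     finally show ?thesis using False by simp
    qed (use K s in \<open>auto intro: order_trans[of _ 1]\<close>)
    hence "m powr (- ?d)*exp (- (R^2/(8 * s))) \<le> m powr (- ?d)*(K*(if R \<le> m then 1 else (R/m) powr (- ?d - 1)))"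
     by (rule mult_left_mono) simp
    moreover have e: "m powr (- ?d) = R powr (- ?d)*(R/m) powr ?d" using R m by (simp add: powr_divide powr_minus field_simps)
    have "m powr (- ?d)*(K*(if R \<le> m then 1 else (R/m) powr (- ?d - 1))) = K*(R powr (- ?d)*(R/m) powr (- (if R \<le> m then - ?d else 1)))"
     unfolding e by (simp flip: powr_add)
    ultimately show ?thesis by (simp only: sp R shell_kernel_def R_def[symmetric] mult_1_left)
   qed
   moreover have "AE x. x \<noteq> y" by (simp add: AE_completion_iff AE_lborel_singleton)
   ultimately show "AE x. s powr (- ?d/2)*exp (- ((norm (x - y))^2/(8 * s))) \<le> K*(1 * shell_kernel ?d (- ?d) 1 m y x)"
    by (auto elim: eventually_mono)
  qed (use K in simp)
  also have "... \<le> ennreal (K*C*?\<omega> + 1)" using K C by (simp add: ennreal_mult[symmetric] ennreal_leI)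
  finally show "(\<integral>x. ennreal (s powr (- ?d/2)*exp (- ((norm (x - y))^2/(8 * s))))) \<le> ennreal (K*C*?\<omega> + 1)" .
 qed
qed

subsection \<open>Square integrable functions\<close>

lemma L2_measurable: "L2 u ==> u \<in> LM"
 by (simp add: square_integrable_def)

lemma L2_integrable: "L2 u ==> L1 (\<lambda>x. (norm (u x))^2)"
 by (simp add: square_integrable_def)

lemma L2_bound:
 assumes v: "L2 v" and u: "u \<in> LM"
  and le: "AE x. norm (u x) \<le> norm (v x)"
 shows "L2 u"
 unfolding square_integrable_def
proof (intro conjI u Bochner_Integration.integrable_bound[OF L2_integrable[OF v]])
 show "(\<lambda>x. (norm (u x))^2) \<in> LM" using u by measurable
 show "AE x. norm ((norm (u x))^2) \<le> norm ((norm (v x))^2)"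
  using le by (auto elim!: eventually_mono intro!: power_mono)
qed

lemma L2_AE:
 assumes "L2 v" "u \<in> LM" "AE x. u x = v x"
 shows "L2 u"
 by (rule L2_bound[OF assms(1,2)]) (use assms(3) in \<open>auto elim!: eventually_mono\<close>)

lemma L2_scaleR:
 assumes "L2 u" shows "L2 (\<lambda>x. c *\<^sub>R u x)"
 using assms by (auto simp: square_integrable_def power_mult_distrib)

lemma L2_cmult:
 fixes u :: "'a::euclidean_space => real"
 shows "L2 u ==> L2 (\<lambda>x. c*u x)"
 using L2_scaleR[of u c] by simp

lemma L2_add:
 assumes u: "L2 u" and v: "L2 v"
 shows "L2 (\<lambda>x. u x + v x)"
proof -
 note [measurable] = L2_measurable[OF u] L2_measurable[OF v]
 have "L1 (\<lambda>x. (norm (u x + v x))^2)"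
 proof (rule Bochner_Integration.integrable_bound)
  show "L1 (\<lambda>x. 2*(norm (u x))^2 + 2*(norm (v x))^2)"
   using u v by (auto simp: square_integrable_def)
  have "(norm (u x + v x))^2 \<le> 2*(norm (u x))^2 + 2*(norm (v x))^2" for x
  proof -
   have "(norm (u x + v x))^2 \<le> (norm (u x) + norm (v x))^2"
    by (intro power_mono norm_triangle_ineq) auto
   also have "... \<le> 2*(norm (u x))^2 + 2*(norm (v x))^2"
    using sum_squares_bound[of "norm (u x)" "norm (v x)"] by (simp add: power2_sum)
   finally show ?thesis .
  qed
  thus "AE x. norm ((norm (u x + v x))^2) \<le> norm (2*(norm (u x))^2 + 2*(norm (v x))^2)"
   by simp
 qed measurable
 thus ?thesis by (simp add: square_integrable_def)
qed

lemma L2_diff: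
 assumes u: "L2 u" and v: "L2 v"
 shows "L2 (\<lambda>x. u x - v x)"
 using L2_add[OF u L2_scaleR[OF v, of "-1"]] by simp

lemma L2_mult_bounded:
 fixes \<psi> :: "'a::euclidean_space => real"
 assumes u: "L2 u" and \<psi>: "\<psi> \<in> LM" "\<And>x. \<bar>\<psi> x\<bar> \<le> B"
 shows "L2 (\<lambda>x. \<psi> x *\<^sub>R u x)"
proof (rule L2_bound[OF L2_scaleR[OF u, of B]])
 show "(\<lambda>x. \<psi> x *\<^sub>R u x) \<in> LM"
  using u \<psi> by (auto simp: square_integrable_def)
 have "0 \<le> B" using \<psi>(2) abs_ge_zero order_trans by blast
 thus "AE x. norm (\<psi> x *\<^sub>R u x) \<le> norm (B *\<^sub>R u x)"
  using \<psi>(2) by (auto intro!: mult_right_mono)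
qed

lemma integrable_norm_mult:
 assumes u: "L2 u" and v: "L2 v"
 shows "L1 (\<lambda>x. norm (u x)*norm (v x))"
proof (rule Bochner_Integration.integrable_bound)
 note [measurable] = L2_measurable[OF u] L2_measurable[OF v]
 show "(\<lambda>x. norm (u x)*norm (v x)) \<in> LM" by measurable
 show "L1 (\<lambda>x. (norm (u x))^2 + (norm (v x))^2)"
  using u v by (auto simp: square_integrable_def)
 have "norm (u x)*norm (v x) \<le> (norm (u x))^2 + (norm (v x))^2" for x
  using sum_squares_bound[of "norm (u x)" "norm (v x)"]
   mult_nonneg_nonneg[OF norm_ge_zero[of "u x"] norm_ge_zero[of "v x"]] by linarith
 thus "AE x. norm (norm (u x)*norm (v x)) \<le> norm ((norm (u x))^2 + (norm (v x))^2)"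
  by simp
qed

lemma Cauchy_Schwarz_norm:
 assumes u: "L2 u" and v: "L2 v"
 shows "(LINT x. norm (u x)*norm (v x))
  \<le> sqrt (LINT x. (norm (u x))^2) * sqrt (LINT x. (norm (v x))^2)"
proof -
 note [measurable] = L2_measurable[OF u] L2_measurable[OF v]
 let ?I = "LINT x. norm (u x)*norm (v x)"
 have "(ennreal ?I)^2 = (\<integral>x. ennreal (norm (u x))*ennreal (norm (v x)))^2"
  using integrable_norm_mult[OF u v] by (subst nn_integral_eq_integral[symmetric]) (auto simp: ennreal_mult)
 also have "... \<le> (\<integral>x. (ennreal (norm (u x)))^2)*(\<integral>x. (ennreal (norm (v x)))^2)"
  by (intro Cauchy_Schwarz_nn_integral) measurable
 also have "... = ennreal (LINT x. (norm (u x))^2)*ennreal (LINT x. (norm (v x))^2)"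
  using u v by (simp add: ennreal_power nn_integral_eq_integral L2_integrable)
 finally have "?I^2 \<le> (LINT x. (norm (u x))^2)*(LINT x. (norm (v x))^2)"
  by (simp add: ennreal_power ennreal_mult[symmetric])
 thus ?thesis by (simp add: real_le_rsqrt flip: real_sqrt_mult)
qed

lemma l2_norm_nonneg: "0 \<le> l2_norm u" by (simp add: l2_norm_def)

lemma l2_norm_power2: "(l2_norm u)^2 = (LINT x. (u x)^2)"
 by (simp add: l2_norm_def)

lemma
 fixes u v :: "'a::euclidean_space => real"
 assumes u: "L2 u" and v: "L2 v"
 shows integrable_mult_L2: "L1 (\<lambda>x. u x * v x)"
  and abs_integral_mult_le_l2_norm: "\<bar>LINT x. u x * v x\<bar> \<le> l2_norm u*l2_norm v"
proof -
 note [measurable] = L2_measurable[OF u] L2_measurable[OF v]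
 show i: "L1 (\<lambda>x. u x * v x)"
  by (rule Bochner_Integration.integrable_bound[OF integrable_norm_mult[OF u v]]) (auto simp: abs_mult)
 have "\<bar>LINT x. u x * v x\<bar> \<le> (LINT x. norm (u x)*norm (v x))"
  using integral_norm_bound[of lebesgue "\<lambda>x. u x * v x"] by (simp add: abs_mult)
 also have "... \<le> l2_norm u*l2_norm v"
  using Cauchy_Schwarz_norm[OF u v] by (simp add: l2_norm_def)
 finally show "\<bar>LINT x. u x * v x\<bar> \<le> l2_norm u*l2_norm v" .
qed

lemma integrable_inner_L2:
 assumes u: "L2 u" and v: "L2 v"
 shows "L1 (\<lambda>x. u x \<bullet> v x)"
 using u v Cauchy_Schwarz_ineq2
 by (intro Bochner_Integration.integrable_bound[OF integrable_norm_mult[OF u v]]) (auto simp: square_integrable_def)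

lemma integrable_scaleR_L2:
 fixes u :: "'a::euclidean_space => real"
 assumes u: "L2 u" and v: "L2 v"
 shows "L1 (\<lambda>x. u x *\<^sub>R v x)"
 using u v by (intro Bochner_Integration.integrable_bound[OF integrable_norm_mult[OF u v]]) (auto simp: square_integrable_def)

lemma l2_norm_triangle:
 fixes u v :: "'a::euclidean_space => real"
 assumes u: "L2 u" and v: "L2 v"
 shows "l2_norm (\<lambda>x. u x + v x) \<le> l2_norm u + l2_norm v"
proof -
 have "(l2_norm (\<lambda>x. u x + v x))^2 = (LINT x. (u x)^2 + (v x)^2 + 2*(u x * v x))"
  unfolding l2_norm_power2 by (intro Lint_cong) (auto simp: power2_sum)
 also have "... = (l2_norm u)^2 + (l2_norm v)^2 + 2*(LINT x. u x * v x)"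
  unfolding l2_norm_power2 using u v integrable_mult_L2[OF u v] by (simp add: square_integrable_def)
 also have "... \<le> (l2_norm u + l2_norm v)^2"
  using abs_integral_mult_le_l2_norm[OF u v] by (simp add: power2_sum)
 finally show ?thesis by (rule power2_le_imp_le) (simp add: l2_norm_nonneg)
qed

lemma l2_norm_cmult: "l2_norm (\<lambda>x. c*u x) = \<bar>c\<bar>*l2_norm u"
 by (simp add: l2_norm_def power_mult_distrib real_sqrt_mult)

lemma l2_norm_minus: "l2_norm (\<lambda>x. - u x) = l2_norm u"
 by (simp add: l2_norm_def)

lemma l2_norm_mono:
 fixes u v :: "'a::euclidean_space => real"
 assumes u: "u \<in> LM" and v: "L2 v" and le: "AE x. \<bar>u x\<bar> \<le> \<bar>v x\<bar>"
 shows "l2_norm u \<le> l2_norm v"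
 unfolding l2_norm_def
proof (intro real_sqrt_le_mono integral_mono_AE)
 have "L2 u" by (rule L2_bound[OF v u]) (use le in simp)
 thus "L1 (\<lambda>x. (u x)^2)" by (simp add: square_integrable_def)
 show "L1 (\<lambda>x. (v x)^2)" using v by (simp add: square_integrable_def)
 show "AE x. (u x)^2 \<le> (v x)^2"
  using le by (auto elim!: eventually_mono simp: abs_le_square_iff)
qed

subsection \<open>Test functions\<close>

definition test_function :: "('a::euclidean_space => real) => ('a => 'a) => bool" where
 "test_function \<phi> D\<phi> \<longleftrightarrow> (\<forall>x. GDERIV \<phi> x :> D\<phi> x) \<and> continuous_on UNIV D\<phi> \<and> bounded {x. \<phi> x \<noteq> 0}"

lemma weak_gradient_alt:
 "weak_gradient u Du \<longleftrightarrow>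
  (\<forall>\<phi> D\<phi>. test_function \<phi> D\<phi> -->
    (LINT x. u x *\<^sub>R D\<phi> x) = - (LINT x. \<phi> x *\<^sub>R Du x))"
 by (simp add: weak_gradient_def test_function_def)

text \<open>Because H' vanishes at 0, the corner of the positive part is not felt. The squared
  positive parts used for cut-offs and the penalty \<open>pen\<close> get their derivatives from
  this.\<close>

lemma has_real_derivative_max_0:
 assumes H: "\<And>m. 0 \<le> m ==> (H has_real_derivative H' m) (at m)" and 0: "H' 0 = 0"
 shows "((\<lambda>s::real. H (max 0 s)) has_real_derivative H' (max 0 s)) (at s)"
proof -
 consider "0 < s" | "s < 0" | "s = 0" by linarith
 thus ?thesis
 proof cases
  case 1
  have "(H has_real_derivative H' (max 0 s)) (at s)" using H[of s] 1 by simp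
  thus ?thesis
   by (rule has_field_derivative_transform_within_open[where S="{0<..}"]) (use 1 in auto)
 next
  case 2
  have "((\<lambda>s. H 0) has_real_derivative H' (max 0 s)) (at s)" using 2 0 by simp
  thus ?thesis
   by (rule has_field_derivative_transform_within_open[where S="{..<0}"]) (use 2 in auto)
 next
  case 3
  have "((\<lambda>h. (H (0 + h) - H 0)/h) \<longlongrightarrow> 0) (at 0)" using H[of 0] 0 by (simp add: DERIV_def)
  hence *: "((\<lambda>h. \<bar>(H (0 + h) - H 0)/h\<bar>) \<longlongrightarrow> 0) (at 0)" using tendsto_rabs_zero by blast
  have "((\<lambda>h. (H (max 0 (0 + h)) - H (max 0 0))/h) \<longlongrightarrow> 0) (at 0)"
  proof (rule Lim_null_comparison[OF always_eventually *], intro allI)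
   show "norm ((H (max 0 (0 + h)) - H (max 0 0))/h) \<le> \<bar>(H (0 + h) - H 0)/h\<bar>" for h
   proof (cases "0 \<le> h")
    case False
    hence "max 0 (0 + h) = 0" by simp
    thus ?thesis by (simp only: max.idem diff_self div_0 norm_zero abs_ge_zero)
   qed simp
  qed
  thus ?thesis using 3 0 by (simp add: DERIV_def)
 qed
qed

text \<open>Lebesgue's differentiation theorem along cubes that have the point as a corner.\<close>

lemma nonpos_AE_if_box_integrals_nonpos:
 fixes f :: "'a::euclidean_space => real"
 assumes f: "\<And>a b. f absolutely_integrable_on cbox a b"
  and le: "\<And>a b. (LINT x:cbox a b|lebesgue. f x) \<le> 0"
 shows "AE x. f x \<le> 0"
proof -
 have int: "f integrable_on cbox a b" for a b
  using f by (rule set_lebesgue_integral_eq_integral(1))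
 obtain N where N: "negligible N" and lim:
  "\<And>x e. x \<notin> N ==> 0 < e ==> \<exists>d>0. \<forall>h. 0 < h \<and> h < d -->
      norm (integral (cbox x (x + h *\<^sub>R One)) f /\<^sub>R h ^ DIM('a) - f x) < e"
  using integrable_ccontinuous_explicit[of f] int by blast
 have "f x \<le> 0" if "x \<notin> N" for x
 proof (rule field_le_epsilon)
  fix e :: real assume "0 < e"
  then obtain d where d: "d > 0" "\<And>h. 0 < h ==> h < d ==>
    norm (integral (cbox x (x + h *\<^sub>R One)) f /\<^sub>R h ^ DIM('a) - f x) < e"
   using lim[OF \<open>x \<notin> N\<close>, of e] by blast
  have "integral (cbox x (x + (d/2) *\<^sub>R One)) f \<le> 0"
   using le f by (metis set_lebesgue_integral_eq_integral(2))
  hence "integral (cbox x (x + (d/2) *\<^sub>R One)) f /\<^sub>R (d/2) ^ DIM('a) \<le> 0"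
   using d(1) by (simp add: mult_nonneg_nonpos)
  thus "f x \<le> 0 + e" using d(2)[of "d/2"] d(1) by auto
 qed
 hence "{x. \<not> f x \<le> 0} \<subseteq> N" by blast
 thus ?thesis using N eventually_ae_filter_negligible by blast
qed

lemma zero_AE_if_box_integrals_zero:
 fixes f :: "'a::euclidean_space => real"
 assumes f: "\<And>a b. f absolutely_integrable_on cbox a b"
  and eq: "\<And>a b. (LINT x:cbox a b|lebesgue. f x) = 0"
 shows "AE x. f x = 0"
proof -
 have "AE x. f x \<le> 0" by (rule nonpos_AE_if_box_integrals_nonpos) (use assms in auto)
 moreover have "AE x. - f x \<le> 0"
 proof (rule nonpos_AE_if_box_integrals_nonpos)
  show "(\<lambda>x. - f x) absolutely_integrable_on cbox a b" for a b
   using f[of a b] by (simp add: set_integrable_def)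
  show "(LINT x:cbox a b|lebesgue. - f x) \<le> 0" for a b
   using eq[of a b] by (simp add: set_lebesgue_integral_def)
 qed
 ultimately show ?thesis by eventually_elim simp
qed

text \<open>Squaring the positive parts makes the bump C^1 across the boundary of the box.\<close>

definition box_bump :: "'a::euclidean_space => 'a => 'a => real" where
 "box_bump a c x = (\<Prod>b\<in>Basis. (max 0 ((x \<bullet> b - a \<bullet> b)*(c \<bullet> b - x \<bullet> b)))^2)"

lemma box_bump_nonneg: "0 \<le> box_bump a c x"
 by (simp add: box_bump_def prod_nonneg)

lemma box_bump_pos_iff:
 assumes "\<And>b. b \<in> Basis ==> a \<bullet> b \<le> c \<bullet> b"
 shows "0 < box_bump a c x \<longleftrightarrow> x \<in> box a c"
proof -
 have *: "0 < (s - l)*(u - s) \<longleftrightarrow> l < s \<and> s < u" if "l \<le> u" for s l u :: real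
  using that by (auto simp: zero_less_mult_iff)
 have "0 < box_bump a c x \<longleftrightarrow> (\<forall>b\<in>Basis. max 0 ((x \<bullet> b - a \<bullet> b)*(c \<bullet> b - x \<bullet> b)) \<noteq> 0)"
  using box_bump_nonneg[of a c x] by (auto simp: box_bump_def less_le prod_nonneg)
 also have "... \<longleftrightarrow> (\<forall>b\<in>Basis. 0 < (x \<bullet> b - a \<bullet> b)*(c \<bullet> b - x \<bullet> b))"
  by (intro ball_cong refl) (auto simp: max_def less_le)
 also have "... \<longleftrightarrow> x \<in> box a c" using*assms by (auto simp: mem_box)
 finally show ?thesis .
qed

definition box_bump_grad :: "'a::euclidean_space => 'a => 'a => 'a" where
 "box_bump_grad a c x = (\<Sum>b\<in>Basis. (2*max 0 ((x \<bullet> b - a \<bullet> b)*(c \<bullet> b - x \<bullet> b))*(a \<bullet> b + c \<bullet> b - 2*(x \<bullet> b))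
   * (\<Prod>j\<in>Basis - {b}. (max 0 ((x \<bullet> j - a \<bullet> j)*(c \<bullet> j - x \<bullet> j)))^2)) *\<^sub>R b)"

lemma GDERIV_box_bump: "GDERIV (box_bump a c) x :> box_bump_grad a c x"
proof -
 define q where "q b x = (max 0 ((x \<bullet> b - a \<bullet> b)*(c \<bullet> b - x \<bullet> b)))^2" for b x
 have q: "(q b has_derivative (\<lambda>h. 2*max 0 ((x \<bullet> b - a \<bullet> b)*(c \<bullet> b - x \<bullet> b))*(a \<bullet> b + c \<bullet> b - 2*(x \<bullet> b))*(h \<bullet> b))) (at x)"
  (is "(_ has_derivative ?q' b) _") for b
 proof -
  have 1: "((\<lambda>s::real. (max 0 s)^2) has_real_derivative 2*max 0 s) (at s)" for s
   by (rule has_real_derivative_max_0[where H="\<lambda>s. s^2" and H'="\<lambda>s. 2 * s"]) (auto intro!: derivative_eq_intros)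
  have 2: "((\<lambda>x. (x \<bullet> b - a \<bullet> b)*(c \<bullet> b - x \<bullet> b)) has_derivative (\<lambda>h. (a \<bullet> b + c \<bullet> b - 2*(x \<bullet> b))*(h \<bullet> b))) (at x)"
   by (auto intro!: derivative_eq_intros simp: algebra_simps)
  show ?thesis unfolding q_def
   by (rule has_derivative_eq_rhs[OF has_derivative_compose[OF 2 1[unfolded has_field_derivative_def]]])
    (auto simp: fun_eq_iff)
 qed
 have "((\<lambda>x. \<Prod>b\<in>Basis. q b x) has_derivative (\<lambda>h. \<Sum>b\<in>Basis. ?q' b h*(\<Prod>j\<in>Basis - {b}. q j x))) (at x)"
  using q by (intro has_derivative_prod) auto
 moreover have "(\<lambda>h. \<Sum>b\<in>Basis. ?q' b h*(\<Prod>j\<in>Basis - {b}. q j x)) = (\<lambda>h. h \<bullet> box_bump_grad a c x)"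
  unfolding box_bump_grad_def inner_sum_right q_def by (intro ext sum.cong) (auto simp: mult_ac)
 ultimately show ?thesis by (simp add: gderiv_def box_bump_def[abs_def] q_def)
qed

lemma continuous_box_bump_grad: "continuous_on S (box_bump_grad a c)"
 unfolding box_bump_grad_def by (intro continuous_intros)

lemma GDERIV_continuous_on: "(\<And>x. GDERIV \<phi> x :> D\<phi> x) ==> continuous_on S \<phi>"
 unfolding gderiv_def by (meson has_derivative_continuous continuous_at_imp_continuous_on)

lemma test_function_box:
 fixes a c :: "'a::euclidean_space"
 assumes ac: "\<And>b. b \<in> Basis ==> a \<bullet> b \<le> c \<bullet> b" and n: "0 \<le> n"
 shows "\<exists>D. test_function (\<lambda>x. n*box_bump a c x/(1 + n*box_bump a c x)) D"
proof -
 let ?P = "box_bump a c"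
 have pos: "0 < 1 + n*?P x" for x using box_bump_nonneg[of a c x] n by (simp add: add_pos_nonneg)
 have D: "GDERIV (\<lambda>x. n*?P x/(1 + n*?P x)) x :> (n/(1 + n*?P x)^2) *\<^sub>R box_bump_grad a c x" for x
 proof -
  have "((\<lambda>p. n*p/(1 + n*p)) has_real_derivative n/(1 + n*?P x)^2) (at (?P x))"
   using pos[of x] by (auto intro!: derivative_eq_intros simp: power2_eq_square field_simps)
  from has_derivative_compose[OF GDERIV_box_bump[of a c x, unfolded gderiv_def] this[unfolded has_field_derivative_def]]
  show ?thesis by (simp add: gderiv_def)
 qed
 have "continuous_on UNIV ?P" using GDERIV_box_bump by (rule GDERIV_continuous_on)
 hence "continuous_on UNIV (\<lambda>x. (n/(1 + n*?P x)^2) *\<^sub>R box_bump_grad a c x)"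
  using pos by (intro continuous_intros continuous_box_bump_grad) (auto simp: less_imp_neq[symmetric])
 moreover have "{x. n*?P x/(1 + n*?P x) \<noteq> 0} \<subseteq> box a c"
  using box_bump_pos_iff[OF ac] box_bump_nonneg[of a c] by (auto simp: less_le)
 hence "bounded {x. n*?P x/(1 + n*?P x) \<noteq> 0}" using bounded_box bounded_subset by blast
 ultimately show ?thesis using D unfolding test_function_def
  by (intro exI[of _ "\<lambda>x. (n/(1 + n*?P x)^2) *\<^sub>R box_bump_grad a c x"]) simp
qed

text \<open>The test functions \<open>n P / (1 + n P)\<close>, with \<open>P\<close> the bump of a box, increase to its indicator.\<close>

lemma zero_AE_if_test_integrals_zero:
 fixes f :: "'a::euclidean_space => real"
 assumes f: "\<And>a b. f absolutely_integrable_on cbox a b"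
  and eq: "\<And>\<phi> D\<phi>. test_function \<phi> D\<phi> ==> (LINT x. f x*\<phi> x) = 0"
 shows "AE x. f x = 0"
proof (rule zero_AE_if_box_integrals_zero[OF f])
 fix a c :: 'a
 show "(LINT x:cbox a c|lebesgue. f x) = 0"
 proof (cases "\<forall>b\<in>Basis. a \<bullet> b \<le> c \<bullet> b")
  case False
  hence "cbox a c = {}" by (auto simp: box_eq_empty not_le)
  thus ?thesis by (simp add: set_lebesgue_integral_def)
 next
  case True
  define \<phi> where "\<phi> n x = real n*box_bump a c x/(1 + real n*box_bump a c x)" for n x
  have \<phi>01: "0 \<le> \<phi> n x" "\<phi> n x \<le> 1" for n x
  proof -
   have "0 \<le> real n*box_bump a c x" using box_bump_nonneg[of a c x] by simp
   thus "0 \<le> \<phi> n x" "\<phi> n x \<le> 1" by (auto simp: \<phi>_def divide_le_eq_1)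
  qed
  have pos: "0 < box_bump a c x \<longleftrightarrow> x \<in> box a c" for x by (rule box_bump_pos_iff) (use True in auto)
  have meas: "\<phi> n \<in> LM" for n
  proof -
   obtain D where "test_function (\<phi> n) D"
    using test_function_box[of a c "real n"] True unfolding \<phi>_def by auto
   hence "continuous_on UNIV (\<phi> n)" unfolding test_function_def by (auto intro: GDERIV_continuous_on)
   thus ?thesis by (intro LM_of_BM BM_continuous)
  qed
  have int: "L1 (\<lambda>x. indicator (cbox a c) x*f x)"
   using f[of a c] by (simp add: set_integrable_def)
  hence fm: "(\<lambda>x. indicator (cbox a c) x*f x) \<in> LM" by auto
  have eq0: "(LINT x. (indicator (cbox a c) x*f x)*\<phi> n x) = 0" for n
  proof -
   obtain D where "test_function (\<phi> n) D"
    using test_function_box[of a c "real n"] True unfolding \<phi>_def by auto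
   hence "(LINT x. f x*\<phi> n x) = 0" by (rule eq)
   moreover have "(indicator (cbox a c) x*f x)*\<phi> n x = f x*\<phi> n x" for x
   proof (cases "x \<in> cbox a c")
    case False
    hence "box_bump a c x = 0" using pos[of x] box_bump_nonneg[of a c x] box_subset_cbox[of a c] by (force simp: less_le)
    thus ?thesis by (simp add: \<phi>_def)
   qed simp
   ultimately show ?thesis by (simp only:)
  qed
  have lim: "(\<lambda>n. \<phi> n x) \<longlonglongrightarrow> indicator (box a c) x" for x
  proof (cases "x \<in> box a c")
   case True
   hence p: "0 < box_bump a c x" using pos by simp
   have "((\<lambda>n. real n*p/(1 + real n*p)) \<longlongrightarrow> 1) sequentially" if "0 < p" for p
   proof -
    have "filterlim (\<lambda>n. 1 + real n*p) at_top sequentially"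
     by (intro filterlim_tendsto_add_at_top[OF tendsto_const] filterlim_at_top_mult_tendsto_pos[OF tendsto_const that]
       filterlim_real_sequentially)
    hence "((\<lambda>n. 1 - inverse (1 + real n*p)) \<longlongrightarrow> 1 - 0) sequentially"
     by (intro tendsto_intros tendsto_inverse_0_at_top)
    moreover have "1 - inverse (1 + real n*p) = real n*p/(1 + real n*p)" for n
    proof -
     have "1 + real n*p > 0" using that by (simp add: add_pos_nonneg)
     thus ?thesis by (simp add: field_simps)
    qed
    ultimately show ?thesis by simp
   qed
   thus ?thesis using p True by (simp add: \<phi>_def)
  next
   case False
   hence "box_bump a c x = 0" using pos[of x] box_bump_nonneg[of a c x] by (simp add: less_le)
   thus ?thesis using False by (simp add: \<phi>_def)
  qed
  have "(\<lambda>n. LINT x. (indicator (cbox a c) x*f x)*\<phi> n x)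
    \<longlonglongrightarrow> (LINT x. (indicator (cbox a c) x*f x)*indicator (box a c) x)"
  proof (rule integral_dominated_convergence)
   show "(\<lambda>x. (indicator (cbox a c) x*f x)*indicator (box a c) x) \<in> LM"
    by (rule borel_measurable_times[OF fm borel_measurable_indicator]) simp
   show "(\<lambda>x. (indicator (cbox a c) x*f x)*\<phi> n x) \<in> LM" for n
    by (rule borel_measurable_times[OF fm meas])
   show "L1 (\<lambda>x. \<bar>indicator (cbox a c) x*f x\<bar>)" using int by (rule integrable_abs)
   show "AE x. (\<lambda>n. (indicator (cbox a c) x*f x)*\<phi> n x) \<longlonglongrightarrow> (indicator (cbox a c) x*f x)*indicator (box a c) x"
    using lim by (auto intro!: tendsto_mult_left always_eventually)
   show "AE x. norm ((indicator (cbox a c) x*f x)*\<phi> n x) \<le> \<bar>indicator (cbox a c) x*f x\<bar>" for n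
    using \<phi>01 by (auto simp: abs_mult intro!: always_eventually mult_left_le)
  qed
  hence "(LINT x. (indicator (cbox a c) x*f x)*indicator (box a c) x) = 0"
   unfolding eq0 using LIMSEQ_unique tendsto_const by blast
  moreover have "AE x. (indicator (cbox a c) x*f x)*indicator (box a c) x = indicator (cbox a c) x*f x"
  proof -
   have "negligible (cbox a c - box a c)" by (rule negligible_frontier_interval)
   thus ?thesis unfolding eventually_ae_filter_negligible
    by (rule exI[of _ "cbox a c - box a c", OF conjI]) (auto simp: indicator_def split: if_splits)
  qed
  moreover have "(\<lambda>x. (indicator (cbox a c) x*f x)*indicator (box a c) x) \<in> LM"
   by (rule borel_measurable_times[OF fm borel_measurable_indicator]) simp
  ultimately have "(LINT x. indicator (cbox a c) x*f x) = 0"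
   using integral_cong_AE[OF _ fm] by metis
  thus ?thesis by (simp add: set_lebesgue_integral_def)
 qed
qed

section \<open>Reverse Hoelder potentials\<close>

text \<open>Measurability is implicit in absolute integrability on balls and passes to the limit
  over an exhaustion.\<close>

lemma weight_measurable:
 fixes w :: "'a::euclidean_space => real"
 assumes "weight w"
 shows "w \<in> LM"
proof -

 have m: "(\<lambda>x. indicator (cball 0 (real n)) x *\<^sub>R w x) \<in> LM" for n
 proof -
  have "w absolutely_integrable_on cball 0 (real n)" using assms by (simp add: weight_def)
  thus ?thesis unfolding set_integrable_def by (rule borel_measurable_integrable)
 qed
 have "(\<lambda>n. indicator (cball 0 (real n)) x *\<^sub>R w x) \<longlonglongrightarrow> w x" for x
 proof (rule tendsto_eventually)
  obtain n0 :: nat where "norm x \<le> n0" using real_arch_simple by blast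
  thus "\<forall>\<^sub>F n in sequentially. indicator (cball 0 (real n)) x *\<^sub>R w x = w x"
   by (intro eventually_sequentiallyI[of n0]) (auto simp: indicator_def)
 qed
 thus ?thesis using m by (rule borel_measurable_LIMSEQ_real)
qed

lemma weight_nonneg: "weight w ==> 0 \<le> w x"
 by (simp add: weight_def)

lemma weight_nn_integral_finite:
 assumes "weight w" "bounded S"
 shows "(\<integral>x\<in>S. ennreal (w x)) < \<infinity>"
proof -
 obtain r where "S \<subseteq> cball 0 r" using assms(2) by (meson bounded_iff mem_cball_0 subsetI)
 hence "(\<integral>x\<in>S. ennreal (w x)) \<le> (\<integral>x. ennreal (norm (indicator (cball 0 r) x *\<^sub>R w x)))"
  by (intro nn_integral_mono) (auto simp: indicator_def weight_nonneg[OF assms(1)])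
 also have "... < \<infinity>"
 proof -
  have "w absolutely_integrable_on cball 0 r" using assms by (simp add: weight_def)
  thus ?thesis unfolding set_integrable_def integrable_iff_bounded by simp
 qed
 finally show ?thesis .
qed

text \<open>\<open>d\<close> is the dimension as a real number, since it occurs mostly in exponents
  of \<open>powr\<close>.\<close>

locale rh_potential =
 fixes V :: "'a::euclidean_space => real" and q d :: real
 assumes d: "d = real DIM('a)"
  and d3: "3 \<le> d"
  and q: "d/2 < q"
  and rh: "reverse_holder q V"
  and V_nonzero: "\<not> (AE x. V x = 0)"
begin

lemma q_gt_1: "1 < q" using q d3 by simp

lemma weight_V: "weight V" using rh by (simp add: reverse_holder_def)

lemma V_measurable[measurable]: "V \<in> LM"
 using weight_V by (rule weight_measurable)

lemma V_nonneg: "0 \<le> V x" using weight_V by (rule weight_nonneg)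

text \<open>An infinite integral would be sent to 0 by \<open>enn2real\<close>; the comparison facts
  below are therefore stated for bounded sets, where the integral is finite.\<close>

definition mass :: "'a set => real" where "mass S = enn2real (\<integral>x\<in>S. ennreal (V x))"

lemma ennreal_mass: "bounded S ==> ennreal (mass S) = (\<integral>x\<in>S. ennreal (V x))"
 using weight_nn_integral_finite[OF weight_V, of S] by (simp add: mass_def)

lemma mass_nonneg: "0 \<le> mass S" by (simp add: mass_def)

lemma mass_mono:
 assumes "bounded T" "S \<subseteq> T" shows "mass S \<le> mass T"
proof -
 have "bounded S" using assms bounded_subset by blast
 hence "ennreal (mass S) \<le> ennreal (mass T)"
  unfolding ennreal_mass[OF \<open>bounded S\<close>] ennreal_mass[OF \<open>bounded T\<close>]
  using assms by (intro nn_integral_mono) (auto simp: indicator_def)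
 thus ?thesis by (simp add: mass_nonneg)
qed

lemma set_integral_V:
 assumes "bounded S" "S \<in> sets lebesgue" shows "(LINT y:S|lebesgue. V y) = mass S"
proof -
 have "(LINT y:S|lebesgue. V y) = enn2real (\<integral>y. ennreal (indicator S y *\<^sub>R V y))"
  unfolding set_lebesgue_integral_def using assms V_nonneg
  by (intro integral_eq_nn_integral) (auto simp: indicator_def)
 also have "(\<integral>y. ennreal (indicator S y *\<^sub>R V y)) = (\<integral>x\<in>S. ennreal (V x))"
  by (intro nn_integral_cong) (auto simp: indicator_def)
 finally show ?thesis by (simp add: mass_def)
qed

definition vol :: "real => real" where "vol r = unit_ball_vol d*r powr d"

lemma emeasure_ball_vol: "0 \<le> r ==> emeasure lebesgue (ball (x::'a) r) = ennreal (vol r)"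
 by (cases "r = 0") (simp_all add: vol_def emeasure_ball powr_realpow[symmetric] flip: d)

lemma unit_ball_vol_pos': "0 < unit_ball_vol d" using d3 by simp

lemma vol_pos: "0 < r ==> 0 < vol r" using d3 by (simp add: vol_def)

text \<open>The reverse Hoelder constant, fixed once and made positive. The inequality is kept in
  its q-th power, the form in which Hoelder's inequality produces the integral of V^q.\<close>

definition RHC :: real where
 "RHC = (SOME C. 0 < C \<and> (\<forall>x0 r0. 0 < r0 -->
   (\<integral>y\<in>ball (x0::'a) r0. ennreal (V y powr q)) \<le> ennreal (vol r0*(C*mass (ball x0 r0)/vol r0) powr q)))"

lemma RHC: "0 < RHC"
 "0 < r ==> (\<integral>y\<in>ball x r. ennreal (V y powr q)) \<le> ennreal (vol r*(RHC*mass (ball x r)/vol r) powr q)"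
proof -
 obtain C0 where C0: "0 < r0 ==> power_mean q V (ball x0 r0) \<le> ennreal C0*power_mean 1 V (ball x0 r0)" for x0 r0
  using rh by (auto simp: reverse_holder_def)
 define C where "C = max C0 1"
 have le: "(\<integral>y\<in>ball x r. ennreal (V y powr q)) \<le> ennreal (vol r*(C*mass (ball x r)/vol r) powr q)"
  if "0 < r" for x r
 proof -
  define I where "I = (\<integral>y\<in>ball x r. ennreal (V y powr q))"
  have v: "0 < vol r" using that by (rule vol_pos)
  have em: "emeasure lebesgue (ball x r) = ennreal (vol r)" using that emeasure_ball_vol by simp
  have p1: "power_mean 1 V (ball x r) = ennreal (mass (ball x r)/vol r)"
   unfolding power_mean_def using v V_nonneg
   by (simp add: em ennreal_powr_one ennreal_mass[symmetric] divide_ennreal mass_nonneg)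
  have "ennreal_powr (I/ennreal (vol r)) (1/q) \<le> ennreal C0*ennreal (mass (ball x r)/vol r)"
   using C0[OF that, of x] unfolding p1 by (simp add: power_mean_def I_def em)
  also have "... \<le> ennreal C*ennreal (mass (ball x r)/vol r)"
   by (intro mult_right_mono ennreal_leI) (auto simp: C_def)
  also have "... = ennreal (C*mass (ball x r)/vol r)"
   by (subst ennreal_mult[symmetric]) (auto simp: C_def mass_nonneg v less_imp_le)
  finally have "ennreal_powr (ennreal_powr (I/ennreal (vol r)) (1/q)) q \<le> ennreal_powr (ennreal (C*mass (ball x r)/vol r)) q"
   using q_gt_1 by (intro ennreal_powr_mono) auto
  hence "I/ennreal (vol r) \<le> ennreal ((C*mass (ball x r)/vol r) powr q)"
   using q_gt_1 v by (simp add: ennreal_powr_powr ennreal_powr_one ennreal_powr_ennreal C_def mass_nonneg)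
  hence "ennreal (vol r)*(I/ennreal (vol r)) \<le> ennreal (vol r)*ennreal ((C*mass (ball x r)/vol r) powr q)"
   by (rule mult_left_mono) simp
  also have "ennreal (vol r)*(I/ennreal (vol r)) = I"
   using v by (cases I) (auto simp: divide_ennreal ennreal_mult[symmetric] ennreal_top_divide ennreal_mult_top)
  finally show ?thesis using v by (simp add: I_def ennreal_mult)
 qed
 have "\<exists>C. 0 < C \<and> (\<forall>x0 r0. 0 < r0 -->
   (\<integral>y\<in>ball x0 r0. ennreal (V y powr q)) \<le> ennreal (vol r0*(C*mass (ball x0 r0)/vol r0) powr q))"
  using le by (intro exI[of _ C]) (auto simp: C_def)
 from someI_ex[OF this, folded RHC_def]
 show "0 < RHC" and "0 < r ==> (\<integral>y\<in>ball x r. ennreal (V y powr q)) \<le> ennreal (vol r*(RHC*mass (ball x r)/vol r) powr q)"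
  by blast+
qed

text \<open>The A_infinity property of V: Hoelder's inequality with exponent q between V and the
  indicator of E, followed by the reverse Hoelder inequality. Sets of small relative volume carry a
  small proportion of the mass.\<close>

lemma mass_subset:
 assumes r: "0 < r" and E: "E \<in> sets lebesgue" "E \<subseteq> ball x r"
 shows "mass E \<le> RHC*(measure lebesgue E/vol r) powr (1 - 1/q)*mass (ball x r)"
proof -
 have bE: "bounded E" using E(2) bounded_ball bounded_subset by blast
 have v: "0 < vol r" using r by (rule vol_pos)
 have emE: "emeasure lebesgue E = ennreal (measure lebesgue E)"
  using emeasure_mono[OF E(2), of lebesgue] emeasure_ball_vol[of r x] r
  by (intro emeasure_eq_ennreal_measure) (auto simp: top_unique)
 define s where "s = q/(q - 1)"
 have s: "1/s = 1 - 1/q" using q_gt_1 by (simp add: s_def field_simps)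
 define A where "A = RHC*mass (ball x r)/vol r"
 have A: "0 \<le> A" using RHC(1) v by (simp add: A_def mass_nonneg)
 have "ennreal (mass E) = (\<integral>y. ennreal ((V y*indicator (ball x r) y)*indicator E y))"
  unfolding ennreal_mass[OF bE] using E(2) by (intro nn_integral_cong) (auto simp: indicator_def)
 also have "... \<le> ennreal_powr (\<integral>y. ennreal ((V y*indicator (ball x r) y) powr q)) (1/q)
   * ennreal_powr (\<integral>y. ennreal (indicator E y powr s)) (1/s)"
 proof (rule Hoelder_nn_integral)
  show "(\<lambda>y. V y*indicator (ball x r) y) \<in> LM"
   by (intro borel_measurable_times V_measurable borel_measurable_indicator) simp
  show "indicat_real E \<in> LM" using E by (intro borel_measurable_indicator)
 qed (use V_nonneg q_gt_1 in \<open>auto simp: s_def\<close>)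
 also have "(\<integral>y. ennreal ((V y*indicator (ball x r) y) powr q)) = (\<integral>y\<in>ball x r. ennreal (V y powr q))"
  using q_gt_1 by (intro nn_integral_cong) (auto simp: indicator_def)
 also have "(\<integral>y. ennreal (indicator E y powr s)) = (\<integral>y. indicator E y)"
  using q_gt_1 by (intro nn_integral_cong) (auto simp: indicator_def s_def)
 also have "... = ennreal (measure lebesgue E)" using E emE by simp
 also have "ennreal_powr (\<integral>y\<in>ball x r. ennreal (V y powr q)) (1/q) \<le> ennreal_powr (ennreal (vol r*A powr q)) (1/q)"
  using RHC(2)[OF r, of x] q_gt_1 by (intro ennreal_powr_mono) (auto simp: A_def)
 also have "... = ennreal (vol r powr (1/q)*A)"
  using v A q_gt_1 by (simp add: ennreal_powr_ennreal powr_mult powr_powr)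
 finally have "ennreal (mass E) \<le> ennreal (vol r powr (1/q)*A)*ennreal (measure lebesgue E powr (1/s))"
  by (simp add: ennreal_powr_ennreal mult_right_mono)
 hence "mass E \<le> vol r powr (1/q)*A*measure lebesgue E powr (1/s)"
  using A by (simp add: ennreal_mult[symmetric] mass_nonneg)
 also have "... = RHC*(measure lebesgue E/vol r) powr (1 - 1/q)*mass (ball x r)"
  using v by (simp add: A_def s powr_divide powr_diff field_simps)
 finally show ?thesis .
qed

text \<open>The sum of 2 - d, from the normalisation of \<open>\<Psi>\<close>, and d (1 - 1/q), from
  \<open>mass_subset\<close>. It is positive because q > d/2.\<close>

definition \<delta>0 :: real where "\<delta>0 = 2 - d/q"

lemma \<delta>0_pos: "0 < \<delta>0" using q d3 q_gt_1 by (simp add: \<delta>0_def field_simps)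

text \<open>The scale invariant mass: passing from V to t^2 V(t x) only rescales centre and
  radius.\<close>

definition \<Psi> :: "'a => real => real" where "\<Psi> x r = r powr (2 - d)*mass (ball x r)"

lemma \<Psi>_nonneg: "0 \<le> \<Psi> x r" by (simp add: \<Psi>_def mass_nonneg)

lemma measure_ball_vol: "0 \<le> r ==> measure lebesgue (ball (x::'a) r) = vol r"
proof -
 have "0 \<le> vol r" using d3 by (simp add: vol_def)
 thus "0 \<le> r ==> measure lebesgue (ball (x::'a) r) = vol r"
  using emeasure_ball_vol[of r x] by (simp only: measure_def enn2real_ennreal)
qed

text \<open>Allowing two different centres is what later makes the critical radii at two points
  comparable.\<close>

lemma \<Psi>_upper:
 assumes "0 < r" "0 < R" "ball x r \<subseteq> ball y R"
 shows "\<Psi> x r \<le> RHC*(r / R) powr \<delta>0*\<Psi> y R"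
proof -
 have "mass (ball x r) \<le> RHC*(measure lebesgue (ball x r)/vol R) powr (1 - 1/q)*mass (ball y R)"
  using assms by (intro mass_subset) auto
 also have "measure lebesgue (ball x r)/vol R = (r / R) powr d"
  unfolding measure_ball_vol[OF less_imp_le[OF assms(1)]]
  using less_imp_neq[OF unit_ball_vol_pos', symmetric] assms d3 by (simp add: vol_def powr_divide)
 also have "((r / R) powr d) powr (1 - 1/q) = (r / R) powr (d*(1 - 1/q))" by (simp add: powr_powr)
 finally have "\<Psi> x r \<le> r powr (2 - d)*(RHC*(r / R) powr (d*(1 - 1/q))*mass (ball y R))"
  unfolding \<Psi>_def by (intro mult_left_mono) auto
 also have "r powr (2 - d) = (r / R) powr (2 - d) * R powr (2 - d)"
  using assms by (simp add: powr_divide)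
 also have "(r / R) powr (2 - d) * R powr (2 - d)*(RHC*(r / R) powr (d*(1 - 1/q))*mass (ball y R))
  = RHC*((r / R) powr (2 - d)*(r / R) powr (d*(1 - 1/q)))*\<Psi> y R"
  by (simp add: \<Psi>_def)
 also have "(r / R) powr (2 - d)*(r / R) powr (d*(1 - 1/q)) = (r / R) powr \<delta>0"
  by (simp add: \<delta>0_def right_diff_distrib flip: powr_add)
 finally show ?thesis .
qed

lemma mass_Un_disjoint:
 assumes "bounded A" "bounded B" "A \<in> sets lebesgue" "B \<in> sets lebesgue" "A \<inter> B = {}"
 shows "mass (A \<union> B) = mass A + mass B"
proof -
 have "ennreal (mass (A \<union> B)) = (\<integral>x. ennreal (V x)*indicator A x + ennreal (V x)*indicator B x)"
  using assms by (subst ennreal_mass) (auto intro!: nn_integral_cong simp: indicator_def)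
 also have "... = ennreal (mass A) + ennreal (mass B)"
  using assms by (subst nn_integral_add) (auto simp: ennreal_mass intro!: borel_measurable_times_ennreal borel_measurable_indicator)
 finally show ?thesis by (simp add: mass_nonneg ennreal_plus[symmetric] del: ennreal_plus)
qed

text \<open>An annulus carrying a small proportion of the volume of the larger ball carries at most half of
 its mass, which gives doubling for a dilation factor close to one, hence for all factors.\<close>

lemma mass_doubling:
 obtains l where "1 < l" "\<And>x r. 0 < r ==> mass (ball x (l*r)) \<le> 2*mass (ball x r)"
proof -
 define a where "a = 1 - 1/q"
 have a: "0 < a" using q_gt_1 by (simp add: a_def)
 \<comment> \<open>Makes \<open>RHC\<close> times \<epsilon>^a at most 1/2; the minimum with 1/2
   keeps \<open>\<epsilon>\<close> below 1. The dilation \<open>l\<close> is then chosen so that the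
   annulus has relative volume \<open>\<epsilon>\<close> in the larger ball.\<close>
 define \<epsilon> where "\<epsilon> = min (1/2) ((1/(2 * RHC)) powr (1/a))"
 have \<epsilon>: "0 < \<epsilon>" "\<epsilon> < 1" using RHC by (auto simp: \<epsilon>_def)
 have "\<epsilon> powr a \<le> ((1/(2 * RHC)) powr (1/a)) powr a"
  using \<epsilon> a by (intro powr_mono2) (auto simp: \<epsilon>_def)
 hence \<epsilon>a: "RHC*\<epsilon> powr a \<le> 1/2"
  using RHC a by (simp add: powr_powr field_simps)
 define l where "l = (1/(1 - \<epsilon>)) powr (1/d)"
 have "(1/(1 - \<epsilon>)) powr (1/d) > 1 powr (1/d)"
  using \<epsilon> d3 by (intro powr_less_mono2) auto
 hence l: "1 < l" by (simp add: l_def)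
 have ld: "l powr d = 1/(1 - \<epsilon>)" using \<epsilon> d3 by (simp add: l_def powr_powr)
 show ?thesis
 proof (rule that[OF l])
  fix x :: 'a and r :: real assume r: "0 < r"
  let ?B = "ball x (l*r)" and ?A = "ball x r"
  let ?E = "?B - ?A"
  have sub: "?A \<subseteq> ?B" using l r by (intro subset_ball) simp
  have "mass (?A \<union> ?E) = mass ?A + mass ?E"
   by (rule mass_Un_disjoint) (auto intro: bounded_subset[OF bounded_ball])
  moreover have "?A \<union> ?E = ?B" using sub by blast
  moreover have "mass ?E \<le> RHC*(measure lebesgue ?E/vol (l*r)) powr (1 - 1/q)*mass ?B"
   using l r by (intro mass_subset) auto
  moreover have "measure lebesgue ?E/vol (l*r) = \<epsilon>"
  proof -
   have "measure lebesgue ?E = vol (l*r) - vol r"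
   proof -
    have "measure lebesgue ?E = measure lebesgue ?B - measure lebesgue ?A"
     using sub l r emeasure_ball_vol[of "l*r" x] by (intro measure_Diff) auto
    thus ?thesis using l r measure_ball_vol[of "l*r" x] measure_ball_vol[of r x] by simp
   qed
   also have "... = (1 - 1/l powr d) * vol (l*r)"
    using l r by (simp add: vol_def powr_mult field_simps)
   also have "1 - 1/l powr d = \<epsilon>" using ld \<epsilon> by simp
   finally show ?thesis using vol_pos[of "l*r"] l r by simp
  qed
  ultimately have "mass ?B \<le> mass ?A + (RHC*\<epsilon> powr a)*mass ?B" by (simp add: a_def)
  also have "... \<le> mass ?A + (1/2)*mass ?B"
   using \<epsilon>a by (intro add_left_mono mult_right_mono mass_nonneg)
  finally show "mass ?B \<le> 2*mass ?A" by simp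
 qed
qed

definition k0 :: real where
 "k0 = (SOME k. 0 \<le> k \<and> (\<forall>x r R. 0 < r --> r \<le> R --> \<Psi> x R \<le> 2*(R/r) powr k*\<Psi> x r))"

text \<open>Doubling is iterated n times, where n is least with R/r <= l^n. If l^k = 2, the loss 2^n
  is at most 2 (R/r)^k, and the factor r^(2 - d) in \<open>\<Psi>\<close> can only decrease when the
  radius grows.\<close>

lemma k0_nonneg: "0 \<le> k0" (is ?A)
 and \<Psi>_growth: "0 < r ==> r \<le> R ==> \<Psi> x R \<le> 2*(R/r) powr k0*\<Psi> x r" (is "PROP ?B")
proof -
 obtain l where l: "1 < l" and dbl: "\<And>x r. 0 < r ==> mass (ball x (l*r)) \<le> 2*mass (ball x r)"
  using mass_doubling by blast
 have pow: "mass (ball x (l ^ n*r)) \<le> 2 ^ n*mass (ball x r)" if "0 < r" for x r n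
 proof (induction n)
  case (Suc n)
  have "mass (ball x (l*(l ^ n*r))) \<le> 2*mass (ball x (l ^ n*r))"
   using that l by (intro dbl) simp
  thus ?case using Suc by (simp add: mult.assoc)
 qed simp
 define k where "k = ln 2/ln l"
 have k: "0 \<le> k" using l by (simp add: k_def)
 have lk: "l powr k = 2" using l by (simp add: k_def powr_def)
 have "\<Psi> x R \<le> 2*(R/r) powr k*\<Psi> x r" if r: "0 < r" "r \<le> R" for x r R
 proof -
  obtain n0 where "R/r < l ^ n0" using real_arch_pow[OF l] by blast
  define n where "n = (LEAST n. R/r \<le> l ^ n)"
  have n: "R/r \<le> l ^ n" unfolding n_def by (rule LeastI[of _ n0]) (use \<open>R/r < l ^ n0\<close> in simp)
  have "2 ^ n \<le> 2*(R/r) powr k"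
  proof (cases n)
   case 0
   have "1 \<le> (R/r) powr k" using r k by (intro ge_one_powr_ge_zero) auto
   thus ?thesis using 0 by simp
  next
   case (Suc m)
   have "\<not> R/r \<le> l ^ m" using not_less_Least[of m "\<lambda>n. R/r \<le> l ^ n"] Suc by (simp add: n_def)
   hence "(l ^ m) powr k \<le> (R/r) powr k" using l k by (intro powr_mono2) auto
   also have "(l ^ m) powr k = 2 ^ m"
    using l lk by (simp add: powr_powr mult.commute flip: powr_realpow) (simp flip: powr_powr)
   finally show ?thesis using Suc by simp
  qed
  have "mass (ball x R) \<le> mass (ball x (l ^ n*r))"
   using n r by (intro mass_mono subset_ball) (auto simp: field_simps)
  also have "... \<le> 2 ^ n*mass (ball x r)" using pow r by blast
  also have "... \<le> 2*(R/r) powr k*mass (ball x r)"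
   using \<open>2 ^ n \<le> _\<close> by (intro mult_right_mono mass_nonneg)
  finally have *: "mass (ball x R) \<le> 2*(R/r) powr k*mass (ball x r)" .
  have "\<Psi> x R \<le> r powr (2 - d)*mass (ball x R)"
   unfolding \<Psi>_def using r d3 by (intro mult_right_mono mass_nonneg powr_mono2') auto
  also have "... \<le> r powr (2 - d)*(2*(R/r) powr k*mass (ball x r))"
   using*by (intro mult_left_mono) auto
  also have "... = 2*(R/r) powr k*\<Psi> x r" by (simp add: \<Psi>_def)
  finally show ?thesis .
 qed
 hence "\<exists>k. 0 \<le> k \<and> (\<forall>x r R. 0 < r --> r \<le> R --> \<Psi> x R \<le> 2*(R/r) powr k*\<Psi> x r)"
  using k by blast
 from someI_ex[OF this, folded k0_def] show ?A "PROP ?B" by blast+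
qed

text \<open>Otherwise the growth bound would spread the zero to all concentric balls, and V would
  vanish almost everywhere.\<close>

lemma \<Psi>_pos: assumes "0 < r" shows "0 < \<Psi> x r"
proof (rule ccontr)
 assume "\<not> 0 < \<Psi> x r"
 hence 0: "\<Psi> x r = 0" using \<Psi>_nonneg[of x r] by simp
 have "mass (ball x (r + real n)) = 0" for n
  using \<Psi>_growth[OF assms, of "r + real n" x] 0 \<Psi>_nonneg[of x "r + real n"] assms
  by (simp add: \<Psi>_def)
 hence "(\<integral>y\<in>ball x (r + real n). ennreal (V y)) = 0" for n
  by (simp flip: ennreal_mass)
 hence "AE y. ennreal (V y)*indicator (ball x (r + real n)) y = 0" for n
  by (subst (asm) nn_integral_0_iff_AE) (auto intro!: borel_measurable_times_ennreal borel_measurable_indicator)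
 hence "AE y. \<forall>n::nat. ennreal (V y)*indicator (ball x (r + real n)) y = 0"
  unfolding AE_all_countable by blast
 hence "AE y. V y = 0"
 proof eventually_elim
  case (elim y)
  obtain n :: nat where "dist x y < real n" using reals_Archimedean2 by blast
  hence "y \<in> ball x (r + real n)" using assms by simp
  thus ?case using elim[rule_format, of n] V_nonneg[of y] by simp
 qed
 thus False using V_nonzero by simp
qed

subsection \<open>The critical radius\<close>

abbreviation \<rho> :: "'a => real" where "\<rho> \<equiv> critical_radius V"

lemma \<rho>_eq: "\<rho> x = Sup {r. 0 < r \<and> \<Psi> x r \<le> 1}"
proof -
 have "(LINT y:ball x r|lebesgue. V y)/r ^ (DIM('a) - 2) = \<Psi> x r" if "0 < r" for r
 proof -
  have "real (DIM('a) - 2) = d - 2" using d d3 by simp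
  hence "r ^ (DIM('a) - 2) = r powr (d - 2)" using that by (simp flip: powr_realpow)
  thus ?thesis using powr_minus_divide[of r "d - 2"] by (simp add: set_integral_V \<Psi>_def)
 qed
 thus ?thesis by (simp add: critical_radius_def cong: conj_cong)
qed

text \<open>By \<open>\<Psi>_upper\<close> and \<delta>0 > 0, \<open>\<Psi> x r\<close> tends to 0
  as r tends to 0 and to infinity with r. The supremum in the definition of the critical radius is
  thus a genuine positive number.\<close>

lemma \<rho>_set: "bdd_above {r. 0 < r \<and> \<Psi> x r \<le> 1}" "{r. 0 < r \<and> \<Psi> x r \<le> 1} \<noteq> {}"
proof -
 define p where "p = \<Psi> x 1"
 have p: "0 < p" using \<Psi>_pos[of 1] by (simp add: p_def)
 have "r \<le> max 1 ((RHC/p) powr (1/\<delta>0))" if "0 < r" "\<Psi> x r \<le> 1" for r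
 proof (cases "r \<le> 1")
  case False
  have "p \<le> RHC*(1/r) powr \<delta>0*\<Psi> x r"
   unfolding p_def using False by (intro \<Psi>_upper) auto
  also have "... \<le> RHC*(1/r) powr \<delta>0*1"
   using that RHC by (intro mult_left_mono) auto
  finally have "r powr \<delta>0 \<le> RHC/p" using p False by (simp add: powr_divide field_simps)
  hence "(r powr \<delta>0) powr (1/\<delta>0) \<le> (RHC/p) powr (1/\<delta>0)"
   using \<delta>0_pos by (intro powr_mono2) auto
  thus ?thesis using \<delta>0_pos that by (simp add: powr_powr)
 qed simp
 thus "bdd_above {r. 0 < r \<and> \<Psi> x r \<le> 1}" by (intro bdd_aboveI) auto
 define r where "r = min 1 ((1/(RHC*p)) powr (1/\<delta>0))"
 have r: "0 < r" "r \<le> 1" using p RHC by (auto simp: r_def)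
 have "\<Psi> x r \<le> RHC*(r/1) powr \<delta>0*p"
  unfolding p_def using r by (intro \<Psi>_upper) auto
 also have "r powr \<delta>0 \<le> ((1/(RHC*p)) powr (1/\<delta>0)) powr \<delta>0"
  using \<delta>0_pos r by (intro powr_mono2) (auto simp: r_def)
 hence "RHC*(r/1) powr \<delta>0*p \<le> 1"
  using p RHC \<delta>0_pos by (simp add: powr_powr field_simps)
 finally show "{r. 0 < r \<and> \<Psi> x r \<le> 1} \<noteq> {}" using r by blast
qed

lemma \<rho>_pos: "0 < \<rho> x"
proof -
 obtain r where "0 < r" "\<Psi> x r \<le> 1" using \<rho>_set(2)[of x] by blast
 hence "r \<le> \<rho> x" unfolding \<rho>_eq using \<rho>_set(1)[of x] by (intro cSup_upper) auto
 thus ?thesis using \<open>0 < r\<close> by simp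
qed

definition KA :: real where "KA = max 2 (2*4 powr k0)"

text \<open>The value at the supremum is compared with neighbouring ones: \<open>\<Psi>\<close>
  exceeds 1 at twice the critical radius and is at most 1 at some radius r above half of it. The 4
  in \<open>KA\<close> bounds the quotient of twice the critical radius by r.\<close>

lemma \<Psi>_\<rho>: "1/KA \<le> \<Psi> x (\<rho> x)" "\<Psi> x (\<rho> x) \<le> RHC*KA"
proof -
 note p = \<rho>_pos[of x]
 have "1 < \<Psi> x (2*\<rho> x)"
 proof (rule ccontr)
  assume "\<not> 1 < \<Psi> x (2*\<rho> x)"
  hence "2*\<rho> x \<le> \<rho> x" using p \<rho>_set(1)[of x] by (subst (2) \<rho>_eq, intro cSup_upper) auto
  thus False using p by simp
 qed
 also have "\<Psi> x (2*\<rho> x) \<le> 2*(2*\<rho> x/\<rho> x) powr k0*\<Psi> x (\<rho> x)"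
  using p by (intro \<Psi>_growth) auto
 also have "... \<le> KA*\<Psi> x (\<rho> x)"
 proof (rule mult_right_mono[OF _ \<Psi>_nonneg])
  have "2 powr k0 \<le> 4 powr k0" using k0_nonneg by (intro powr_mono2) auto
  thus "2*(2*\<rho> x/\<rho> x) powr k0 \<le> KA" using p by (simp add: KA_def)
 qed
 finally show "1/KA \<le> \<Psi> x (\<rho> x)" by (simp add: KA_def divide_le_eq mult.commute)
 have "\<rho> x/2 < Sup {r. 0 < r \<and> \<Psi> x r \<le> 1}" using p by (simp add: \<rho>_eq[symmetric])
 then obtain r where r: "0 < r" "\<Psi> x r \<le> 1" "\<rho> x/2 < r"
  using less_cSup_iff[OF \<rho>_set(2,1)] by auto
 have "r \<le> \<rho> x" using r \<rho>_set(1)[of x] by (subst \<rho>_eq, intro cSup_upper) auto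
 have "\<Psi> x (\<rho> x) \<le> RHC*(\<rho> x/(2*\<rho> x)) powr \<delta>0*\<Psi> x (2*\<rho> x)"
  using p by (intro \<Psi>_upper subset_ball) auto
 also have "... \<le> RHC*1*\<Psi> x (2*\<rho> x)"
  using p RHC \<delta>0_pos by (intro mult_right_mono mult_left_mono powr_le1 \<Psi>_nonneg) auto
 also have "\<Psi> x (2*\<rho> x) \<le> 2*(2*\<rho> x/r) powr k0*\<Psi> x r"
  using p \<open>r \<le> \<rho> x\<close> r by (intro \<Psi>_growth) auto
 also have "... \<le> 2*4 powr k0*1"
  using r k0_nonneg p by (intro mult_mono powr_mono2 \<Psi>_nonneg) (auto simp: field_simps)
 also have "... \<le> KA" by (simp add: KA_def)
 finally show "\<Psi> x (\<rho> x) \<le> RHC*KA" using RHC by simp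
qed

text \<open>The critical radius itself is replaced by a comparable function with values in the powers of two,
 whose measurability is evident. All its properties follow from \<open>\<Psi> x (m x)\<close> being bounded above and
 below.\<close>

definition KB :: real where "KB = max (RHC * RHC*KA) (KA*KA)"

definition mrad :: "'a => real" where
 "mrad x = 2 powr (real_of_int (from_nat (LEAST n. 1/KB \<le> \<Psi> x (2 powr (real_of_int (from_nat n)))
   \<and> \<Psi> x (2 powr (real_of_int (from_nat n))) \<le> KB)))"

lemma KB: "1 \<le> KB"
proof -
 have "1*1 \<le> KA*KA" by (intro mult_mono) (auto simp: KA_def)
 thus ?thesis by (simp add: KB_def)
qed

lemma mrad_pos: "0 < mrad x" by (simp add: mrad_def)

text \<open>The \<open>LEAST\<close> exists because the power of two just below the critical radius
  qualifies: descending to it by a factor of at most 2 costs \<open>RHC\<close> in the upper bound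
  and \<open>KA\<close> in the lower one. \<open>from_nat\<close> enumerates the integer
  exponents.\<close>

lemma \<Psi>_mrad: "1/KB \<le> \<Psi> x (mrad x)" "\<Psi> x (mrad x) \<le> KB"
proof -
 note p = \<rho>_pos[of x]
 define j where "j = \<lfloor>log 2 (\<rho> x)\<rfloor>"
 define r where "r = 2 powr real_of_int j"
 have "r \<le> 2 powr log 2 (\<rho> x)" unfolding r_def j_def by (intro powr_mono) auto
 hence r1: "r \<le> \<rho> x" using p by simp
 have "2 powr log 2 (\<rho> x) \<le> 2 powr (1 + real_of_int j)" unfolding j_def by (intro powr_mono) linarith+
 hence r2: "\<rho> x \<le> 2*r" using p by (simp add: r_def powr_add)
 have r0: "0 < r" by (simp add: r_def)
 have "\<Psi> x r \<le> RHC*(r/\<rho> x) powr \<delta>0*\<Psi> x (\<rho> x)"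
  using p r0 r1 by (intro \<Psi>_upper subset_ball) auto
 also have "... \<le> RHC*1*(RHC*KA)"
  using p RHC \<delta>0_pos r0 r1 by (intro mult_mono powr_le1 \<Psi>_nonneg \<Psi>_\<rho>) auto
 also have "... \<le> KB" by (simp add: KB_def)
 finally have a: "\<Psi> x r \<le> KB" .
 have "1/KA \<le> 2*(\<rho> x/r) powr k0*\<Psi> x r"
  using \<Psi>_\<rho>(1)[of x] \<Psi>_growth[OF r0 r1, of x] by linarith
 also have "... \<le> KA*\<Psi> x r"
 proof (rule mult_right_mono[OF _ \<Psi>_nonneg])
  have "(\<rho> x/r) powr k0 \<le> 4 powr k0" using r0 r1 r2 k0_nonneg by (intro powr_mono2) (auto simp: field_simps)
  thus "2*(\<rho> x/r) powr k0 \<le> KA" by (simp add: KA_def)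
 qed
 finally have low: "1/KA \<le> KA*\<Psi> x r" .
 have "0 < KA" by (simp add: KA_def)
 with low have "1/(KA*KA) \<le> \<Psi> x r" by (simp add: divide_le_eq mult_ac)
 moreover have "1/KB \<le> 1/(KA*KA)"
 proof (rule frac_le)
  show "0 < KA*KA" using \<open>0 < KA\<close> by simp
  show "KA*KA \<le> KB" by (simp add: KB_def)
 qed auto
 ultimately have "1/KB \<le> \<Psi> x r" by linarith
 hence "\<exists>n. 1/KB \<le> \<Psi> x (2 powr (real_of_int (from_nat n))) \<and> \<Psi> x (2 powr (real_of_int (from_nat n))) \<le> KB"
  using a by (intro exI[of _ "to_nat j"]) (simp add: r_def)
 from LeastI_ex[OF this, folded mrad_def]
 show "1/KB \<le> \<Psi> x (mrad x)" "\<Psi> x (mrad x) \<le> KB" by blast+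
qed

lemma mrad_measurable[measurable]: "mrad \<in> BM"
proof -
 interpret sigma_finite_measure "lebesgue :: 'a measure" by (rule sigma_finite_lebesgue)
 have \<Psi>m: "(\<lambda>x. \<Psi> x r) \<in> BM" for r
 proof -
  have "(\<lambda>z. (fst z, snd z)) \<in> (borel :: 'a measure) \<Otimes>\<^sub>M (lebesgue :: 'a measure) \<rightarrow>\<^sub>M borel"
   by (intro borel_measurable_Pair measurable_compose[OF measurable_fst] measurable_compose[OF measurable_snd] measurable_completion) auto
  hence id: "(\<lambda>z. z) \<in> (borel :: 'a measure) \<Otimes>\<^sub>M (lebesgue :: 'a measure) \<rightarrow>\<^sub>M borel" by simp
  have "open {z::'a \<times> 'a. dist (fst z) (snd z) < r}" by (intro open_Collect_less continuous_intros)
  hence "indicator {z::'a \<times> 'a. dist (fst z) (snd z) < r} \<in> borel_measurable (borel :: ('a \<times> 'a) measure)"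
   by (intro borel_measurable_indicator) simp
  from measurable_compose[OF id this]
  have "(\<lambda>z. ennreal (V (snd z))*indicator {z::'a \<times> 'a. dist (fst z) (snd z) < r} z) \<in> borel_measurable (borel \<Otimes>\<^sub>M lebesgue)"
  proof (rule borel_measurable_times_ennreal[rotated])
   show "(\<lambda>z. ennreal (V (snd z))) \<in> borel_measurable (borel \<Otimes>\<^sub>M lebesgue)"
    by (rule measurable_compose[OF measurable_snd measurable_compose[OF V_measurable measurable_ennreal]])
  qed
  hence "(\<lambda>x. \<integral>y. ennreal (V y)*indicator {z. dist (fst z) (snd z) < r} (x, y)) \<in> BM"
   by (intro borel_measurable_nn_integral) (simp add: case_prod_beta')
  also have "(\<lambda>x. \<integral>y. ennreal (V y)*indicator {z. dist (fst z) (snd z) < r} (x, y))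
   = (\<lambda>x. \<integral>y\<in>ball x r. ennreal (V y))"
   by (intro ext nn_integral_cong) (auto simp: indicator_def)
  finally have I: "(\<lambda>x. \<integral>y\<in>ball x r. ennreal (V y)) \<in> BM" .
  show ?thesis unfolding \<Psi>_def mass_def
   by (intro borel_measurable_times borel_measurable_const borel_measurable_enn2real I)
 qed
 define P where "P n x \<longleftrightarrow> 1/KB \<le> \<Psi> x (2 powr (real_of_int (from_nat n))) \<and> \<Psi> x (2 powr (real_of_int (from_nat n))) \<le> KB" for n x
 have "Measurable.pred borel (P n)" for n
 proof -
  let ?f = "\<lambda>x. \<Psi> x (2 powr (real_of_int (from_nat n)))"
  have "?f -` {1/KB..KB} \<inter> space borel \<in> sets borel" by (rule measurable_sets[OF \<Psi>m]) simp
  thus ?thesis by (simp add: pred_def P_def vimage_def)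
 qed
 hence "(\<lambda>x. LEAST n. P n x) \<in> borel \<rightarrow>\<^sub>M count_space UNIV" by (rule measurable_Least)
 moreover have "(\<lambda>n. 2 powr (real_of_int (from_nat n)) :: real) \<in> count_space UNIV \<rightarrow>\<^sub>M borel"
  by (simp add: measurable_count_space_eq1)
 ultimately have "(\<lambda>x. 2 powr (real_of_int (from_nat (LEAST n. P n x))) :: real) \<in> BM"
  by (rule measurable_compose)
 thus ?thesis unfolding mrad_def[abs_def] P_def .
qed

text \<open>The ball of radius s around y lies in the ball of radius 2 L around x, where L = r + |x
  - y|. Ascending from radius r to 2 L costs the power \<open>k0\<close>, descending to the ball
  around y gains the power \<open>\<delta>0\<close>. Since \<open>\<Psi>\<close> is at most A at the
  start and at least 1/A at the end, s cannot be too small; \<open>k1\<close> is the quotient of the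
  two exponents.\<close>

lemma critical_comparison:
 assumes A: "1 \<le> A"
 obtains C k1 where "1 \<le> C" "0 \<le> k1"
  "\<And>x y r s. 0 < r ==> 0 < s ==> \<Psi> x r \<le> A ==> 1/A \<le> \<Psi> y s ==> r/C*(1 + dist x y/r) powr (- k1) \<le> s"
proof -
 define K where "K = max (2 * RHC*A*A) 1"
 define k1 where "k1 = k0/\<delta>0"
 define C where "C = K powr (1/\<delta>0)*2 powr k1"
 have k1: "0 \<le> k1" using k0_nonneg \<delta>0_pos by (simp add: k1_def)
 have "1*1 \<le> C" unfolding C_def using k1 \<delta>0_pos by (intro mult_mono ge_one_powr_ge_zero) (auto simp: K_def)
 hence C: "1 \<le> C" by simp
 show ?thesis
 proof (rule that[OF C k1])
  fix x y r s assume r: "0 < r" and s: "0 < s" and x: "\<Psi> x r \<le> A" and y: "1/A \<le> \<Psi> y s"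
  define L where "L = r + dist x y"
  have L: "r \<le> L" by (simp add: L_def)
  have lr: "1 + dist x y/r = L/r" using r by (simp add: L_def field_simps)
  show "r/C*(1 + dist x y/r) powr (- k1) \<le> s"
  proof (cases "s \<le> L")
   case False
   have "r/C*(1 + dist x y/r) powr (- k1) \<le> r*1"
    using r C k1 L lr by (intro mult_mono) (auto simp: divide_le_eq powr_minus_divide ge_one_powr_ge_zero)
   thus ?thesis using False L by simp
  next
   case True
   have sub: "ball y s \<subseteq> ball x (2*L)"
   proof
    fix z assume "z \<in> ball y s"
    thus "z \<in> ball x (2*L)"
     using dist_triangle[of x z y] True r by (simp add: L_def)
   qed
   have "1/A \<le> RHC*(s/(2*L)) powr \<delta>0*\<Psi> x (2*L)"
    using \<Psi>_upper[OF s _ sub] y r L by simp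
   also have "... \<le> RHC*(s/(2*L)) powr \<delta>0*(2*(2*L/r) powr k0*\<Psi> x r)"
    using r L RHC by (intro mult_left_mono \<Psi>_growth) auto
   also have "... \<le> RHC*(s/(2*L)) powr \<delta>0*(2*(2*L/r) powr k0*A)"
    using x RHC by (intro mult_left_mono) auto
   finally have "1 \<le> (2 * RHC*A*A)*(s/(2*L)) powr \<delta>0*(2*L/r) powr k0"
    using A by (simp add: divide_le_eq mult_ac)
   also have "... \<le> K*(s/(2*L)) powr \<delta>0*(2*L/r) powr k0"
    by (intro mult_right_mono) (auto simp: K_def)
   finally have "1 \<le> (K*(s/(2*L)) powr \<delta>0*(2*L/r) powr k0) powr (1/\<delta>0)"
    using \<delta>0_pos by (intro ge_one_powr_ge_zero) auto
   also have "... = K powr (1/\<delta>0)*(s/(2*L))*(2*L/r) powr k1"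
    using \<delta>0_pos r s L by (simp add: powr_mult powr_powr K_def k1_def)
   also have "(2*L/r) powr k1 = 2 powr k1*(L/r) powr k1"
    using r L by (simp flip: powr_mult)
   also have "K powr (1/\<delta>0)*(s/(2*L))*(2 powr k1*(L/r) powr k1) = C*(L/r) powr k1 * s/(2*L)"
    by (simp add: C_def)
   finally have "2*L/(C*(L/r) powr k1) \<le> s" using C r L by (simp add: field_simps)
   moreover have "r/C*(L/r) powr (- k1) \<le> 2*L/(C*(L/r) powr k1)"
    using C r L by (simp add: powr_minus_divide field_simps)
   ultimately show ?thesis by (simp add: lr)
  qed
 qed
qed

text \<open>Collects what later arguments use about the critical scale.
  \<open>critical_comparison\<close> is applied at one point, to relate \<open>mrad\<close> to the
  critical radius, and at two points, for the slow variation of \<open>mrad\<close>.\<close>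

lemma critical_scale:
 obtains C k k1 where "1 \<le> C" "0 \<le> k" "0 \<le> k1"
  "\<And>x r. 0 < r ==> r \<le> mrad x ==> \<Psi> x r \<le> C*(r/mrad x) powr \<delta>0"
  "\<And>x r. mrad x \<le> r ==> \<Psi> x r \<le> C*(r/mrad x) powr k"
  "\<And>x. 1/C \<le> \<Psi> x (mrad x)"
  "\<And>x. mrad x \<le> C*\<rho> x"
  "\<And>x y. mrad x/C*(1 + dist x y/mrad x) powr (- k1) \<le> mrad y"
proof -
 define A where "A = max KB (max KA (RHC*KA))"
 have A: "1 \<le> A" using KB by (simp add: A_def)
 have inv: "1/A \<le> 1/KB" "1/A \<le> 1/KA"
  using KB by (auto intro!: divide_left_mono simp: A_def KA_def)
 obtain C1 k1 where C1: "1 \<le> C1" "0 \<le> k1" and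
  cmp: "\<And>x y r s. 0 < r ==> 0 < s ==> \<Psi> x r \<le> A ==> 1/A \<le> \<Psi> y s ==> r/C1*(1 + dist x y/r) powr (- k1) \<le> s"
  using critical_comparison[OF A] by blast
 have mA: "\<Psi> x (mrad x) \<le> A" "1/A \<le> \<Psi> x (mrad x)" and \<rho>A: "\<Psi> x (\<rho> x) \<le> A" "1/A \<le> \<Psi> x (\<rho> x)" for x
  using \<Psi>_mrad[of x] \<Psi>_\<rho>[of x] inv by (auto simp: A_def)
 define C where "C = max C1 (max A (max (RHC*A) (2*A)))"
 have C: "C1 \<le> C" "A \<le> C" "RHC*A \<le> C" "2*A \<le> C" by (auto simp: C_def)
 show ?thesis
 proof (rule that[of C k0 k1])
  show "1 \<le> C" using C1 C by simp
  show "0 \<le> k0" "0 \<le> k1" by (fact k0_nonneg, fact C1(2))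
  fix x
  note m = mrad_pos[of x]
  show "\<Psi> x r \<le> C*(r/mrad x) powr \<delta>0" if r: "0 < r" "r \<le> mrad x" for r
  proof -
   have "\<Psi> x r \<le> RHC*(r/mrad x) powr \<delta>0*\<Psi> x (mrad x)"
    using r m by (intro \<Psi>_upper subset_ball) auto
   also have "... \<le> RHC*(r/mrad x) powr \<delta>0*A" using RHC mA by (intro mult_left_mono) auto
   also have "... \<le> C*(r/mrad x) powr \<delta>0" using C(3) mult_right_mono[OF C(3), of "(r/mrad x) powr \<delta>0"] by (simp add: mult_ac)
   finally show ?thesis .
  qed
  show "\<Psi> x r \<le> C*(r/mrad x) powr k0" if r: "mrad x \<le> r" for r
  proof -
   have "\<Psi> x r \<le> 2*(r/mrad x) powr k0*\<Psi> x (mrad x)" using r m by (intro \<Psi>_growth)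
   also have "... \<le> 2*(r/mrad x) powr k0*A" using mA by (intro mult_left_mono) auto
   also have "... \<le> C*(r/mrad x) powr k0" using mult_right_mono[OF C(4), of "(r/mrad x) powr k0"] by (simp add: mult_ac)
   finally show ?thesis .
  qed
  have "1/C \<le> 1/A" using A C by (intro divide_left_mono) auto
  thus "1/C \<le> \<Psi> x (mrad x)" using mA[of x] by linarith
  have "mrad x/C1*(1 + dist x x/mrad x) powr (- k1) \<le> \<rho> x"
   using m \<rho>_pos[of x] mA \<rho>A by (intro cmp) auto
  hence "mrad x \<le> C1*\<rho> x" using C1 by (simp add: divide_le_eq mult.commute)
  also have "... \<le> C*\<rho> x" using C \<rho>_pos[of x] by (intro mult_right_mono) auto
  finally show "mrad x \<le> C*\<rho> x" .
  fix y
  have "mrad x/C*(1 + dist x y/mrad x) powr (- k1) \<le> mrad x/C1*(1 + dist x y/mrad x) powr (- k1)"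
   using m C C1 by (intro mult_right_mono divide_left_mono) auto
  also have "... \<le> mrad y" using m mrad_pos[of y] mA by (intro cmp) auto
  finally show "mrad x/C*(1 + dist x y/mrad x) powr (- k1) \<le> mrad y" .
 qed
qed

end

section \<open>Weak gradients\<close>

lemma norm_integral_le_nn_integral:
 fixes f :: "'a => 'b::{banach, second_countable_topology}"
 shows "ennreal (norm (integral\<^sup>L M f)) \<le> (\<integral>\<^sup>+x. ennreal (norm (f x)) \<partial>M)"
 by (cases "integrable M f") (auto simp: integral_norm_bound_ennreal not_integrable_integral_eq)

lemma nn_integral_translate:
 fixes f :: "'a::euclidean_space => ennreal"
 assumes "f \<in> BM"
 shows "(\<integral>\<^sup>+x. f (x + h) \<partial>lborel) = (\<integral>\<^sup>+x. f x \<partial>lborel)"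
proof -
 have "(\<integral>\<^sup>+x. f x \<partial>distr lborel borel ((+) h)) = (\<integral>\<^sup>+x. f (h + x) \<partial>lborel)"
  using assms by (intro nn_integral_distr) auto
 thus ?thesis by (simp add: lborel_distr_plus add.commute)
qed

lemma
 fixes f :: "'a::euclidean_space => 'b::{banach, second_countable_topology}"
 assumes f: "f \<in> BM"
 shows integral_translate: "(LINT x|lborel. f (x + h)) = (LINT x|lborel. f x)"
  and integrable_translate_iff: "integrable lborel (\<lambda>x. f (x + h)) \<longleftrightarrow> integrable lborel f"
proof -
 have "(LINT x|distr lborel borel ((+) h). f x) = (LINT x|lborel. f (h + x))"
  using assms by (intro integral_distr) auto
 thus "(LINT x|lborel. f (x + h)) = (LINT x|lborel. f x)" by (simp add: lborel_distr_plus add.commute)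
 have "integrable (distr lborel borel ((+) h)) f \<longleftrightarrow> integrable lborel (\<lambda>x. f (h + x))"
  using assms by (intro integrable_distr_eq) auto
 thus "integrable lborel (\<lambda>x. f (x + h)) \<longleftrightarrow> integrable lborel f" by (simp add: lborel_distr_plus add.commute)
qed

lemma L2_lborel:
 assumes "u \<in> BM"
 shows "L2 u \<longleftrightarrow> integrable lborel (\<lambda>x. (norm (u x))^2)"
 using assms LM_of_BM[OF assms] by (simp add: square_integrable_def integrable_completion)

lemma l2_norm_lborel:
 assumes "u \<in> BM"
 shows "l2_norm u = sqrt (LINT x|lborel. (u x)^2)"
 using assms by (simp add: l2_norm_def integral_completion)

lemma integral_lebesgue_lborel:
 fixes f :: "'a::euclidean_space => 'b::{banach, second_countable_topology}"
 shows "f \<in> BM ==> (LINT x. f x) = (LINT x|lborel. f x)"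
 by (simp add: integral_completion)

lemma integrable_lebesgue_lborel:
 fixes f :: "'a::euclidean_space => 'b::{banach, second_countable_topology}"
 shows "f \<in> BM ==> L1 f \<longleftrightarrow> integrable lborel f"
 by (simp add: integrable_completion)

lemma L2_translate:
 assumes [measurable]: "u \<in> BM" and u: "L2 u"
 shows "L2 (\<lambda>x. u (x + h))"
proof -
 have "integrable lborel (\<lambda>x. (norm (u (x + h)))^2)"
  using u by (subst integrable_translate_iff) (auto simp: L2_lborel)
 thus ?thesis by (simp add: L2_lborel)
qed

lemma continuous_compact_support_bounded:
 fixes f :: "'a::euclidean_space => 'b::real_normed_vector"
 assumes "continuous_on UNIV f" "bounded {x. f x \<noteq> 0}"
 obtains B where "0 \<le> B" "\<And>x. norm (f x) \<le> B"
proof -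
 obtain r where r: "{x. f x \<noteq> 0} \<subseteq> cball 0 r" using assms(2) by (meson bounded_iff mem_cball_0 subsetI)
 have "compact (f ` cball 0 r)" using assms(1) by (intro compact_continuous_image) (auto intro: continuous_on_subset)
 then obtain B where B: "\<And>x. x \<in> cball 0 r ==> norm (f x) \<le> B"
  using compact_imp_bounded bounded_iff by (metis imageI)
 show ?thesis
 proof (rule that[of "max B 0"])
  show "norm (f x) \<le> max B 0" for x using B[of x] r by (cases "f x = 0") (auto simp: le_max_iff_disj)
 qed simp
qed

lemma continuous_compact_support_integrable:
 fixes f :: "'a::euclidean_space => 'b::euclidean_space"
 assumes "continuous_on UNIV f" "bounded {x. f x \<noteq> 0}"
 shows "integrable lborel f" "L2 f"
proof -
 have [measurable]: "f \<in> BM" using assms(1) by (rule BM_continuous)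
 obtain B where B: "0 \<le> B" "\<And>x. norm (f x) \<le> B"
  using continuous_compact_support_bounded[OF assms] by blast
 obtain r where r: "{x. f x \<noteq> 0} \<subseteq> cball 0 r" using assms(2) by (meson bounded_iff mem_cball_0 subsetI)
 have fin: "emeasure lborel (cball (0::'a) r) < \<infinity>" by (rule emeasure_bounded_finite) simp
 have i: "integrable lborel (\<lambda>x. indicat_real (cball (0::'a) r) x*c)" for c
  using fin by (intro integrable_mult_left integrable_real_indicator) auto
 show "integrable lborel f"
  by (rule Bochner_Integration.integrable_bound[OF i[of B]]) (use r B in \<open>auto simp: indicator_def intro!: always_eventually\<close>)
 have "integrable lborel (\<lambda>x. (norm (f x))^2)"
  by (rule Bochner_Integration.integrable_bound[OF i[of "B^2"]])
   (use r B in \<open>auto simp: indicator_def intro!: always_eventually power_mono\<close>)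
 thus "L2 f" by (simp add: L2_lborel)
qed

lemma test_functionD:
 assumes "test_function \<phi> D\<phi>"
 shows "GDERIV \<phi> x :> D\<phi> x" "continuous_on UNIV D\<phi>" "continuous_on UNIV \<phi>"
  "bounded {x. \<phi> x \<noteq> 0}" "bounded {x. D\<phi> x \<noteq> 0}"
  "\<phi> \<in> BM" "D\<phi> \<in> BM"
  "L2 \<phi>" "L2 D\<phi>" "integrable lborel D\<phi>"
proof -
 show D: "GDERIV \<phi> x :> D\<phi> x" for x
  using assms by (auto simp: test_function_def)
 show cD: "continuous_on UNIV D\<phi>" and b: "bounded {x. \<phi> x \<noteq> 0}"
  using assms by (auto simp: test_function_def)
 show c: "continuous_on UNIV \<phi>" using D by (rule GDERIV_continuous_on)
 obtain r where r: "{x. \<phi> x \<noteq> 0} \<subseteq> cball 0 r" using b by (meson bounded_iff mem_cball_0 subsetI)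
 have "D\<phi> x = 0" if "x \<notin> cball 0 r" for x
 proof -
  have "(\<phi> has_derivative (\<lambda>h. 0)) (at x)"
  proof (rule has_derivative_transform_within_open[where f="\<lambda>_. 0"])
   show "open (- cball 0 r :: 'a set)" "x \<in> - cball 0 r" using that by auto
   show "0 = \<phi> y" if "y \<in> - cball 0 r" for y using that r by auto
  qed simp
  hence "(\<lambda>h. h \<bullet> D\<phi> x) = (\<lambda>h. 0)" using D[of x] unfolding gderiv_def by (rule has_derivative_unique[rotated])
  hence "D\<phi> x \<bullet> D\<phi> x = 0" by (rule fun_cong)
  thus ?thesis by simp
 qed
 hence "{x. D\<phi> x \<noteq> 0} \<subseteq> cball 0 r" by blast
 thus b': "bounded {x. D\<phi> x \<noteq> 0}" using bounded_cball bounded_subset by blast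
 show "\<phi> \<in> BM" "D\<phi> \<in> BM"
  using c cD by (auto intro: BM_continuous)
 show "L2 \<phi>" "L2 D\<phi>" "integrable lborel D\<phi>"
  using continuous_compact_support_integrable[OF c b] continuous_compact_support_integrable[OF cD b'] by auto
qed

lemma test_function_translate:
 assumes "test_function \<phi> D\<phi>"
 shows "test_function (\<lambda>x. \<phi> (x + h)) (\<lambda>x. D\<phi> (x + h))"
 unfolding test_function_def
proof (intro conjI allI)
 fix x
 have "((\<lambda>x. x + h) has_derivative (\<lambda>k. k)) (at x)" by (auto intro!: derivative_eq_intros)
 from has_derivative_compose[OF this test_functionD(1)[OF assms, unfolded gderiv_def]]
 have "((\<lambda>x. \<phi> (x + h)) has_derivative (\<lambda>k. k \<bullet> D\<phi> (x + h))) (at x)" .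
 thus "GDERIV (\<lambda>x. \<phi> (x + h)) x :> D\<phi> (x + h)" by (simp add: gderiv_def)
 show "continuous_on UNIV (\<lambda>x. D\<phi> (x + h))"
  by (intro continuous_on_compose2[OF test_functionD(2)[OF assms]] continuous_intros) auto
 have "{x. \<phi> (x + h) \<noteq> 0} = (\<lambda>x. x - h) ` {x. \<phi> x \<noteq> 0}"
  by (auto simp: image_iff) (metis add_diff_cancel)
 thus "bounded {x. \<phi> (x + h) \<noteq> 0}"
  using bounded_translation_minus[OF test_functionD(4)[OF assms]] by simp
qed

lemma line_integral_C1:
 fixes \<phi> :: "'a::euclidean_space => real"
 assumes D: "\<And>x. GDERIV \<phi> x :> D\<phi> x" and c: "continuous_on UNIV D\<phi>"
 shows "(LINT s|lborel. indicator {0..1} s*(D\<phi> (x + s *\<^sub>R h) \<bullet> h)) = \<phi> (x + h) - \<phi> x"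
proof -
 have "(LINT s|lborel. (D\<phi> (x + s *\<^sub>R h) \<bullet> h)*indicator {0..1} s) = \<phi> (x + 1 *\<^sub>R h) - \<phi> (x + 0 *\<^sub>R h)"
 proof (rule integral_FTC_Icc_real)
  fix s :: real
  have "((\<lambda>s. x + s *\<^sub>R h) has_derivative (\<lambda>k. k *\<^sub>R h)) (at s)"
   by (auto intro!: derivative_eq_intros)
  from has_derivative_compose[OF this D[unfolded gderiv_def]]
  show "((\<lambda>s. \<phi> (x + s *\<^sub>R h)) has_real_derivative D\<phi> (x + s *\<^sub>R h) \<bullet> h) (at s)"
   by (simp add: has_field_derivative_def inner_commute mult_commute_abs)
  have "continuous_on UNIV (\<lambda>s. D\<phi> (x + s *\<^sub>R h) \<bullet> h)"
   by (intro continuous_intros continuous_on_compose2[OF c]) auto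
  thus "isCont (\<lambda>s. D\<phi> (x + s *\<^sub>R h) \<bullet> h) s" by (simp add: continuous_on_eq_continuous_at)
 qed simp
 thus ?thesis by (simp add: mult.commute)
qed

text \<open>The integrability behind \<open>swap_line_integral\<close>: the product is dominated by
  squares, whose integrals in x do not depend on s by translation invariance.\<close>

lemma integrable_line_product:
 fixes \<psi> :: "'a::euclidean_space => real" and G :: "'a => 'a"
 assumes [measurable]: "\<psi> \<in> BM" "G \<in> BM"
  and \<psi>: "L2 \<psi>" and G: "L2 G"
 shows "integrable (lborel \<Otimes>\<^sub>M lborel) (\<lambda>(s, x). indicator {0..1::real} s*(\<psi> x*(G (x + s *\<^sub>R h) \<bullet> k)))"
proof (rule Bochner_Integration.integrable_bound)
 let ?g = "\<lambda>(s, x). indicator {0..1::real} s*((\<psi> x)^2 + (norm k)^2*(norm (G (x + s *\<^sub>R h)))^2)"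
 define A where "A = (LINT x|lborel. (\<psi> x)^2) + (norm k)^2*(LINT x|lborel. (norm (G x))^2)"
 have i: "integrable lborel (\<lambda>x. (\<psi> x)^2)" "integrable lborel (\<lambda>x. (norm (G x))^2)"
  using \<psi> G by (auto simp: L2_lborel)
 have inner: "(\<integral>\<^sup>+x. ennreal ((\<psi> x)^2 + (norm k)^2*(norm (G (x + s *\<^sub>R h)))^2) \<partial>lborel) = ennreal A" for s :: real
 proof -
  have tr: "integrable lborel (\<lambda>x. (norm (G (x + s *\<^sub>R h)))^2)"
   "(LINT x|lborel. (norm (G (x + s *\<^sub>R h)))^2) = (LINT x|lborel. (norm (G x))^2)"
   using i integrable_translate_iff[of "\<lambda>x. (norm (G x))^2"] integral_translate[of "\<lambda>x. (norm (G x))^2"] by auto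
  show ?thesis
   by (subst nn_integral_eq_integral) (use i tr in \<open>auto simp: A_def\<close>)
 qed
 show "integrable (lborel \<Otimes>\<^sub>M lborel) ?g"
 proof (rule integrableI_bounded)
  have "(\<integral>\<^sup>+z. ennreal (norm (?g z)) \<partial>(lborel \<Otimes>\<^sub>M lborel)) = (\<integral>\<^sup>+s. \<integral>\<^sup>+x. ennreal (norm (?g (s, x))) \<partial>lborel \<partial>lborel)"
   by (rule lborel.nn_integral_fst[symmetric]) measurable
  also have "... = (\<integral>\<^sup>+s. indicator {0..1::real} s*ennreal A \<partial>lborel)"
  proof (rule nn_integral_cong)
   fix s :: real
   have "(\<integral>\<^sup>+x. ennreal (norm (?g (s, x))) \<partial>lborel)
     = (\<integral>\<^sup>+x. indicator {0..1} s*ennreal ((\<psi> x)^2 + (norm k)^2*(norm (G (x + s *\<^sub>R h)))^2) \<partial>lborel)"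
    by (intro nn_integral_cong) (auto simp: indicator_def)
   also have "... = indicator {0..1} s*ennreal A"
    unfolding inner[of s, symmetric] by (rule nn_integral_cmult) measurable
   finally show "(\<integral>\<^sup>+x. ennreal (norm (?g (s, x))) \<partial>lborel) = indicator {0..1} s*ennreal A" .
  qed
  also have "... < \<infinity>" by (subst nn_integral_multc) (auto simp: ennreal_mult_less_top)
  finally show "(\<integral>\<^sup>+z. ennreal (norm (?g z)) \<partial>(lborel \<Otimes>\<^sub>M lborel)) < \<infinity>" .
 qed measurable
 show "(\<lambda>(s, x). indicator {0..1::real} s*(\<psi> x*(G (x + s *\<^sub>R h) \<bullet> k))) \<in> borel_measurable (lborel \<Otimes>\<^sub>M lborel)"
  by measurable
 have "\<bar>a*(b \<bullet> k)\<bar> \<le> a^2 + (norm k)^2*(norm b)^2" for a :: real and b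
 proof -
  have "\<bar>a*(b \<bullet> k)\<bar> \<le> \<bar>a\<bar>*(norm b*norm k)"
   by (simp add: abs_mult mult_left_mono Cauchy_Schwarz_ineq2)
  also have "... \<le> a^2 + (norm k)^2*(norm b)^2"
  proof -
   have "2*\<bar>a\<bar>*(norm b*norm k) \<le> \<bar>a\<bar>^2 + (norm b*norm k)^2" by (rule sum_squares_bound)
   moreover have "0 \<le> \<bar>a\<bar>*(norm b*norm k)" by simp
   ultimately have "\<bar>a\<bar>*(norm b*norm k) \<le> \<bar>a\<bar>^2 + (norm b*norm k)^2" by linarith
   thus ?thesis by (simp add: power_mult_distrib mult.commute)
  qed
  finally show ?thesis .
 qed
 thus "AE z in lborel \<Otimes>\<^sub>M lborel. norm (case z of (s, x) => indicator {0..1::real} s*(\<psi> x*(G (x + s *\<^sub>R h) \<bullet> k))) \<le> norm (?g z)"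
  by (intro always_eventually) (auto simp: indicator_def)
qed

lemma swap_line_integral:
 fixes \<psi> :: "'a::euclidean_space => real" and G :: "'a => 'a"
 assumes m: "\<psi> \<in> BM" "G \<in> BM"
  and "L2 \<psi>" "L2 G"
 shows "(LINT x|lborel. \<psi> x*(LINT s|lborel. indicator {0..1} s*(G (x + s *\<^sub>R h) \<bullet> k)))
   = (LINT s|lborel. indicator {0..1} s*(LINT x|lborel. \<psi> x*(G (x + s *\<^sub>R h) \<bullet> k)))" (is "?L = ?R")
  and "integrable lborel (\<lambda>x. \<psi> x*(LINT s|lborel. indicator {0..1} s*(G (x + s *\<^sub>R h) \<bullet> k)))"
proof -
 note i = integrable_line_product[OF assms, of h k]
 have inner: "(LINT s|lborel. indicator {0..1} s*(\<psi> x*(G (x + s *\<^sub>R h) \<bullet> k)))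
  = \<psi> x*(LINT s|lborel. indicator {0..1} s*(G (x + s *\<^sub>R h) \<bullet> k))" for x
  by (simp add: mult.left_commute)
 have "?L = (LINT x|lborel. LINT s|lborel. indicator {0..1} s*(\<psi> x*(G (x + s *\<^sub>R h) \<bullet> k)))"
  by (simp only: inner)
 also have "... = (LINT s|lborel. LINT x|lborel. indicator {0..1} s*(\<psi> x*(G (x + s *\<^sub>R h) \<bullet> k)))"
  using i by (rule lborel_pair.Fubini_integral)
 also have "... = ?R" by simp
 finally show "?L = ?R" .
 show "integrable lborel (\<lambda>x. \<psi> x*(LINT s|lborel. indicator {0..1} s*(G (x + s *\<^sub>R h) \<bullet> k)))"
  using lborel_pair.integrable_snd[OF i] by (simp only: inner)
qed

text \<open>A weakly differentiable function satisfies the fundamental theorem of calculus along almost every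
 translate of a fixed segment. This replaces mollification in what follows.\<close>

lemma weak_gradient_line:
 fixes u :: "'a::euclidean_space => real"
 assumes m[measurable]: "u \<in> BM" "Du \<in> BM"
  and u: "L2 u" and Du: "L2 Du" and wg: "weak_gradient u Du"
 shows "AE x in lborel. u (x + h) - u x = (LINT s|lborel. indicator {0..1} s*(Du (x + s *\<^sub>R h) \<bullet> h))"
proof -
 define I where "I x = (LINT s|lborel. indicator {0..1} s*(Du (x + s *\<^sub>R h) \<bullet> h))" for x
 have [measurable]: "I \<in> BM" unfolding I_def by measurable
 define f where "f x = u (x + h) - u x - I x" for x
 have [measurable]: "f \<in> BM" unfolding f_def by measurable
 have "AE x. f x = 0"
 proof (rule zero_AE_if_test_integrals_zero)
  fix a b :: 'a
  let ?\<psi> = "indicat_real (cbox a b)"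
  have \<psi>: "L2 ?\<psi>"
  proof -
   have "integrable lborel (indicat_real (cbox a b))"
    by (intro integrable_real_indicator emeasure_bounded_finite bounded_cbox) simp
   moreover have "(\<lambda>x. (norm (indicat_real (cbox a b) x))^2) = indicat_real (cbox a b)"
    by (auto simp: indicator_def)
   ultimately show ?thesis by (simp add: L2_lborel)
  qed
  have "L1 (\<lambda>x. ?\<psi> x*u (x + h))" "L1 (\<lambda>x. ?\<psi> x*u x)"
   using integrable_mult_L2[OF \<psi> u] integrable_mult_L2[OF \<psi> L2_translate[OF m(1) u]] by auto
  moreover have "integrable lborel (\<lambda>x. ?\<psi> x*I x)"
   unfolding I_def using \<psi> Du by (intro swap_line_integral(2)) auto
  hence "L1 (\<lambda>x. ?\<psi> x*I x)" by (simp add: integrable_lebesgue_lborel)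
  ultimately have "L1 (\<lambda>x. ?\<psi> x*u (x + h) - ?\<psi> x*u x - ?\<psi> x*I x)" by simp
  thus "f absolutely_integrable_on cbox a b"
   by (simp add: set_integrable_def f_def right_diff_distrib)
 next
  \<comment> \<open>A discrete integration by parts: the translation is moved from u to \<phi>, the
    difference of \<phi> becomes a line integral of its gradient, the weak gradient is applied to
    the translates of \<phi>, and the translation is moved back.\<close>
  fix \<phi> :: "'a => real" and D\<phi> assume t: "test_function \<phi> D\<phi>"
  note [measurable] = test_functionD(6,7)[OF t]
  note t2 = test_functionD(8,9)[OF t]
  have t2': "L2 (\<lambda>x. \<phi> (x + k))" for k
   using t2 by (intro L2_translate) auto
  have i: "integrable lborel (\<lambda>x. u (x + h)*\<phi> x)" "integrable lborel (\<lambda>x. u x*\<phi> x)" "integrable lborel (\<lambda>x. u x*\<phi> (x - h))"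
   using integrable_mult_L2[OF u t2(1)] integrable_mult_L2[OF L2_translate[OF m(1) u, of h] t2(1)]
   integrable_mult_L2[OF u t2'[of "- h"]]
   by (auto simp: integrable_lebesgue_lborel)
  have i3: "integrable lborel (\<lambda>x. \<phi> x*I x)"
   unfolding I_def using t2 Du by (intro swap_line_integral(2)) auto
  have "(LINT x|lborel. u (x + h)*\<phi> x) - (LINT x|lborel. u x*\<phi> x)
    = (LINT x|lborel. u x*\<phi> (x - h)) - (LINT x|lborel. u x*\<phi> x)"
   using integral_translate[of "\<lambda>x. u x*\<phi> (x - h)" h] by simp
  also have "... = (LINT x|lborel. u x*(\<phi> (x + (- h)) - \<phi> x))"
   using i by (simp add: right_diff_distrib)
  also have "... = (LINT x|lborel. u x*(LINT s|lborel. indicator {0..1} s*(D\<phi> (x + s *\<^sub>R (- h)) \<bullet> (- h))))"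
   by (simp only: line_integral_C1[OF test_functionD(1)[OF t] test_functionD(2)[OF t]])
  also have "... = (LINT s|lborel. indicator {0..1} s*(LINT x|lborel. u x*(D\<phi> (x + s *\<^sub>R (- h)) \<bullet> (- h))))"
   using u t2 by (intro swap_line_integral(1)) auto
  also have "... = (LINT s|lborel. indicator {0..1} s*(LINT x|lborel. \<phi> x*(Du (x + s *\<^sub>R h) \<bullet> h)))"
  proof -
   have "(LINT x|lborel. u x*(D\<phi> (x + s *\<^sub>R (- h)) \<bullet> (- h))) = (LINT x|lborel. \<phi> x*(Du (x + s *\<^sub>R h) \<bullet> h))" for s :: real
   proof -
    let ?k = "s *\<^sub>R (- h)"
    have "(LINT x. u x *\<^sub>R D\<phi> (x + ?k)) = - (LINT x. \<phi> (x + ?k) *\<^sub>R Du x)"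
     using wg test_function_translate[OF t, of ?k] unfolding weak_gradient_alt by blast
    hence e: "(LINT x|lborel. u x *\<^sub>R D\<phi> (x + ?k)) = - (LINT x|lborel. \<phi> (x + ?k) *\<^sub>R Du x)"
     by (simp add: integral_lebesgue_lborel)
    have "L1 (\<lambda>x. u x *\<^sub>R D\<phi> (x + ?k))" "L1 (\<lambda>x. \<phi> (x + ?k) *\<^sub>R Du x)"
     by (rule integrable_scaleR_L2[OF u L2_translate[OF test_functionD(7)[OF t] t2(2)]],
       rule integrable_scaleR_L2[OF t2' Du])
    hence ii: "integrable lborel (\<lambda>x. u x *\<^sub>R D\<phi> (x + ?k))" "integrable lborel (\<lambda>x. \<phi> (x + ?k) *\<^sub>R Du x)"
     by (auto simp: integrable_lebesgue_lborel)
    have "(LINT x|lborel. u x*(D\<phi> (x + ?k) \<bullet> (- h))) = (LINT x|lborel. u x *\<^sub>R D\<phi> (x + ?k)) \<bullet> (- h)"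
     using integral_inner_left[OF ii(1), of "- h"] by simp
    also have "... = (LINT x|lborel. \<phi> (x + ?k) *\<^sub>R Du x) \<bullet> h"
     by (simp only: e inner_minus_left inner_minus_right minus_minus)
    also have "... = (LINT x|lborel. \<phi> (x + ?k)*(Du x \<bullet> h))"
     using integral_inner_left[OF ii(2), of h] by simp
    also have "... = (LINT x|lborel. \<phi> (x + s *\<^sub>R h + ?k)*(Du (x + s *\<^sub>R h) \<bullet> h))"
     by (rule integral_translate[of "\<lambda>x. \<phi> (x + ?k)*(Du x \<bullet> h)", symmetric]) measurable
    finally show ?thesis by simp
   qed
   thus ?thesis by simp
  qed
  also have "... = (LINT x|lborel. \<phi> x*I x)"
   unfolding I_def using t2 Du by (intro swap_line_integral(1)[symmetric]) auto
  finally have "(LINT x|lborel. f x*\<phi> x) = 0"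
   using i i3 by (simp add: f_def left_diff_distrib mult.commute[of "I _"])
  thus "(LINT x. f x*\<phi> x) = 0" by (simp add: integral_lebesgue_lborel)
 qed
 thus ?thesis by (simp add: AE_completion_iff f_def I_def)
qed

text \<open>Convexity keeps the whole segment from x to x + h inside B, so the indicator of B can be
  inserted under the line integral. Cauchy-Schwarz in s and translation invariance do the
  rest.\<close>

lemma nn_integral_line_estimate:
 fixes u :: "'a::euclidean_space => real"
 assumes m[measurable]: "u \<in> BM" "Du \<in> BM"
  and u: "L2 u" and Du: "L2 Du" and wg: "weak_gradient u Du"
  and B[measurable]: "B \<in> sets borel" and cB: "convex B"
 shows "(\<integral>\<^sup>+x. ennreal ((u (x + h) - u x)^2)*indicator B x*indicator B (x + h) \<partial>lborel)
  \<le> ennreal ((norm h)^2)*(\<integral>\<^sup>+x\<in>B. ennreal ((norm (Du x))^2) \<partial>lborel)"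
proof -
 let ?Q = "\<lambda>z. ennreal ((norm h)^2)*(ennreal ((norm (Du z))^2)*indicator B z)"
 have "(\<integral>\<^sup>+x. ennreal ((u (x + h) - u x)^2)*indicator B x*indicator B (x + h) \<partial>lborel)
  \<le> (\<integral>\<^sup>+x. \<integral>\<^sup>+s. indicator {0..1::real} s*?Q (x + s *\<^sub>R h) \<partial>lborel \<partial>lborel)"
 proof (rule nn_integral_mono_AE)
  show "AE x in lborel. ennreal ((u (x + h) - u x)^2)*indicator B x*indicator B (x + h)
    \<le> (\<integral>\<^sup>+s. indicator {0..1::real} s*?Q (x + s *\<^sub>R h) \<partial>lborel)"
   using weak_gradient_line[OF m u Du wg, of h]
  proof eventually_elim
   case (elim x)
   show ?case
   proof (cases "x \<in> B \<and> x + h \<in> B")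
    case True
    have inB: "x + s *\<^sub>R h \<in> B" if "0 \<le> s" "s \<le> 1" for s
    proof -
     have "(1 - s) *\<^sub>R x + s *\<^sub>R (x + h) \<in> B" using cB True that by (intro convexD) auto
     moreover have "(1 - s) *\<^sub>R x + s *\<^sub>R (x + h) = x + s *\<^sub>R h" by (simp add: algebra_simps)
     ultimately show ?thesis by simp
    qed
    have "ennreal \<bar>u (x + h) - u x\<bar> \<le> (\<integral>\<^sup>+s. ennreal \<bar>indicator {0..1} s*(Du (x + s *\<^sub>R h) \<bullet> h)\<bar> \<partial>lborel)"
     unfolding elim using norm_integral_le_nn_integral[of lborel "\<lambda>s. indicator {0..1} s*(Du (x + s *\<^sub>R h) \<bullet> h)"] by simp
    also have "... = (\<integral>\<^sup>+s. indicator {0..1} s*ennreal \<bar>indicator {0..1} s*(Du (x + s *\<^sub>R h) \<bullet> h)\<bar> \<partial>lborel)"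
     by (intro nn_integral_cong) (auto simp: indicator_def)
    finally have "(ennreal \<bar>u (x + h) - u x\<bar>)^2
      \<le> (\<integral>\<^sup>+s. indicator {0..1} s*ennreal \<bar>indicator {0..1} s*(Du (x + s *\<^sub>R h) \<bullet> h)\<bar> \<partial>lborel)^2"
     by (intro power_mono) auto
    also have "... \<le> (\<integral>\<^sup>+s. (indicator {0..1::real} s)^2 \<partial>lborel)*(\<integral>\<^sup>+s. (ennreal \<bar>indicator {0..1} s*(Du (x + s *\<^sub>R h) \<bullet> h)\<bar>)^2 \<partial>lborel)"
     by (intro Cauchy_Schwarz_nn_integral) measurable
    also have "(\<integral>\<^sup>+s. (indicator {0..1::real} s)^2 \<partial>lborel) = (\<integral>\<^sup>+s. indicator {0..1::real} s \<partial>lborel)"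
     by (intro nn_integral_cong) (auto simp: indicator_def)
    also have "... = 1" by simp
    also have "(\<integral>\<^sup>+s. (ennreal \<bar>indicator {0..1} s*(Du (x + s *\<^sub>R h) \<bullet> h)\<bar>)^2 \<partial>lborel)
      \<le> (\<integral>\<^sup>+s. indicator {0..1::real} s*?Q (x + s *\<^sub>R h) \<partial>lborel)"
    proof (rule nn_integral_mono)
     fix s :: real
     have "(Du (x + s *\<^sub>R h) \<bullet> h)^2 \<le> (norm h)^2*(norm (Du (x + s *\<^sub>R h)))^2"
      using Cauchy_Schwarz_ineq[of "Du (x + s *\<^sub>R h)" h] by (simp add: power2_norm_eq_inner mult.commute)
     thus "(ennreal \<bar>indicator {0..1} s*(Du (x + s *\<^sub>R h) \<bullet> h)\<bar>)^2 \<le> indicator {0..1::real} s*?Q (x + s *\<^sub>R h)"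
      using inB[of s] by (auto simp: indicator_def ennreal_power ennreal_mult[symmetric] intro!: ennreal_leI)
    qed
    finally show ?thesis using True by (simp add: ennreal_power)
   qed (auto simp: indicator_def)
  qed
 qed
 also have "... = (\<integral>\<^sup>+s. \<integral>\<^sup>+x. indicator {0..1::real} s*?Q (x + s *\<^sub>R h) \<partial>lborel \<partial>lborel)"
  by (rule lborel_pair.Fubini') measurable
 also have "... = (\<integral>\<^sup>+s. indicator {0..1::real} s*(\<integral>\<^sup>+x. ?Q x \<partial>lborel) \<partial>lborel)"
 proof (rule nn_integral_cong)
  fix s :: real
  have "(\<integral>\<^sup>+x. indicator {0..1::real} s*?Q (x + s *\<^sub>R h) \<partial>lborel) = indicator {0..1} s*(\<integral>\<^sup>+x. ?Q (x + s *\<^sub>R h) \<partial>lborel)"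
   by (rule nn_integral_cmult) measurable
  also have "(\<integral>\<^sup>+x. ?Q (x + s *\<^sub>R h) \<partial>lborel) = (\<integral>\<^sup>+x. ?Q x \<partial>lborel)"
   by (rule nn_integral_translate) measurable
  finally show "(\<integral>\<^sup>+x. indicator {0..1::real} s*?Q (x + s *\<^sub>R h) \<partial>lborel) = indicator {0..1} s*(\<integral>\<^sup>+x. ?Q x \<partial>lborel)" .
 qed
 also have "... = (\<integral>\<^sup>+x. ?Q x \<partial>lborel)"
  by (subst nn_integral_multc) auto
 also have "... = ennreal ((norm h)^2)*(\<integral>\<^sup>+x\<in>B. ennreal ((norm (Du x))^2) \<partial>lborel)"
  by (rule nn_integral_cmult) measurable
 finally show ?thesis .
qed

lemma l2_norm_translate_diff:
 fixes u :: "'a::euclidean_space => real"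
 assumes m[measurable]: "u \<in> BM" "Du \<in> BM"
  and u: "L2 u" and Du: "L2 Du" and wg: "weak_gradient u Du"
 shows "l2_norm (\<lambda>x. u (x + h) - u x) \<le> norm h * sqrt (LINT x. (norm (Du x))^2)"
proof -
 have sq: "L2 (\<lambda>x. u (x + h) - u x)"
  using u by (intro L2_diff L2_translate) auto
 have "ennreal (LINT x|lborel. (u (x + h) - u x)^2) = (\<integral>\<^sup>+x. ennreal ((u (x + h) - u x)^2)*indicator UNIV x*indicator UNIV (x + h) \<partial>lborel)"
  using sq by (subst nn_integral_eq_integral[symmetric]) (auto simp: L2_lborel)
 also have "... \<le> ennreal ((norm h)^2)*(\<integral>\<^sup>+x\<in>UNIV. ennreal ((norm (Du x))^2) \<partial>lborel)"
  by (rule nn_integral_line_estimate[OF m u Du wg]) auto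
 also have "... = ennreal ((norm h)^2*(LINT x|lborel. (norm (Du x))^2))"
  using Du by (simp add: nn_integral_eq_integral L2_lborel ennreal_mult)
 finally have "(LINT x|lborel. (u (x + h) - u x)^2) \<le> (norm h)^2*(LINT x|lborel. (norm (Du x))^2)"
  by (simp add: ennreal_le_iff)
 hence "sqrt (LINT x|lborel. (u (x + h) - u x)^2) \<le> sqrt ((norm h)^2*(LINT x|lborel. (norm (Du x))^2))" by simp
 thus ?thesis by (simp add: l2_norm_lborel real_sqrt_mult integral_lebesgue_lborel)
qed

text \<open>Substitute y = x + h. Two points of the ball differ by less than 2r, so
  \<open>nn_integral_line_estimate\<close> is integrated over |h| < 2r. The double integral takes
  the place of the deviation from the mean.\<close>

lemma Poincare_ball:
 fixes u :: "'a::euclidean_space => real"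
 assumes m[measurable]: "u \<in> BM" "Du \<in> BM"
  and u: "L2 u" and Du: "L2 Du" and wg: "weak_gradient u Du" and r: "0 < r"
 shows "(\<integral>\<^sup>+x\<in>ball z r. \<integral>\<^sup>+y\<in>ball z r. ennreal ((u x - u y)^2) \<partial>lborel \<partial>lborel)
  \<le> ennreal ((2*r)^2)*emeasure lborel (ball (0::'a) (2*r))*(\<integral>\<^sup>+x\<in>ball z r. ennreal ((norm (Du x))^2) \<partial>lborel)"
proof -
 let ?B = "ball z r"
 have [measurable]: "?B \<in> sets borel" "ball 0 (2*r) \<in> sets (borel :: 'a measure)" by simp_all
 let ?G = "\<integral>\<^sup>+x\<in>?B. ennreal ((norm (Du x))^2) \<partial>lborel"
 let ?F = "\<lambda>x h. ennreal ((u (x + h) - u x)^2)*indicator ?B x*indicator ?B (x + h)"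
 have "(\<integral>\<^sup>+x\<in>?B. \<integral>\<^sup>+y\<in>?B. ennreal ((u x - u y)^2) \<partial>lborel \<partial>lborel)
   = (\<integral>\<^sup>+x. \<integral>\<^sup>+h. ?F x h \<partial>lborel \<partial>lborel)"
 proof (rule nn_integral_cong)
  fix x
  have "(\<integral>\<^sup>+y\<in>?B. ennreal ((u x - u y)^2) \<partial>lborel)*indicator ?B x
    = (\<integral>\<^sup>+y. ennreal ((u x - u y)^2)*indicator ?B y*indicator ?B x \<partial>lborel)"
   by (rule nn_integral_multc[symmetric]) measurable
  also have "... = (\<integral>\<^sup>+h. ennreal ((u x - u (h + x))^2)*indicator ?B (h + x)*indicator ?B x \<partial>lborel)"
   by (rule nn_integral_translate[symmetric]) measurable
  also have "... = (\<integral>\<^sup>+h. ?F x h \<partial>lborel)"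
   by (intro nn_integral_cong) (simp add: add.commute power2_commute mult_ac)
  finally show "(\<integral>\<^sup>+y\<in>?B. ennreal ((u x - u y)^2) \<partial>lborel)*indicator ?B x = (\<integral>\<^sup>+h. ?F x h \<partial>lborel)" .
 qed
 also have "... = (\<integral>\<^sup>+h. \<integral>\<^sup>+x. ?F x h \<partial>lborel \<partial>lborel)"
  by (rule lborel_pair.Fubini') measurable
 also have "... \<le> (\<integral>\<^sup>+h. indicator (ball (0::'a) (2*r)) h*(ennreal ((2*r)^2)*?G) \<partial>lborel)"
 proof (rule nn_integral_mono)
  fix h :: 'a
  show "(\<integral>\<^sup>+x. ?F x h \<partial>lborel) \<le> indicator (ball 0 (2*r)) h*(ennreal ((2*r)^2)*?G)"
  proof (cases "norm h < 2*r")
   case True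
   have "(\<integral>\<^sup>+x. ?F x h \<partial>lborel) \<le> ennreal ((norm h)^2)*?G"
    by (rule nn_integral_line_estimate[OF m u Du wg]) auto
   also have "... \<le> ennreal ((2*r)^2)*?G"
    using True by (intro mult_right_mono ennreal_leI power_mono) auto
   finally show ?thesis using True by simp
  next
   case False
   have "?F x h = 0" for x
   proof (rule ccontr)
    assume "?F x h \<noteq> 0"
    hence "dist z x < r" "dist z (x + h) < r" by (auto simp: indicator_def split: if_splits)
    hence "dist x (x + h) < 2*r" using dist_triangle3[of x "x + h" z] by linarith
    thus False using False by (simp add: dist_norm)
   qed
   thus ?thesis by (simp only: nn_integral_const mult_zero_left zero_le)
  qed
 qed
 also have "... = emeasure lborel (ball (0::'a) (2*r))*(ennreal ((2*r)^2)*?G)"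
  by (subst nn_integral_multc) auto
 finally show ?thesis by (simp add: mult_ac)
qed

lemma weak_gradient_AE:
 fixes u :: "'a::euclidean_space => real"
 assumes wg: "weak_gradient u Du"
  and m: "u \<in> LM" "Du \<in> LM"
   "u' \<in> LM" "Du' \<in> LM"
  and ae: "AE x. u x = u' x" "AE x. Du x = Du' x"
 shows "weak_gradient u' Du'"
 unfolding weak_gradient_alt
proof (intro allI impI)
 fix \<phi> :: "'a => real" and D\<phi> assume t: "test_function \<phi> D\<phi>"
 have [measurable]: "\<phi> \<in> LM" "D\<phi> \<in> LM"
  using test_functionD(6,7)[OF t] by (auto intro: LM_of_BM)
 note [measurable] = m
 have "(LINT x. u' x *\<^sub>R D\<phi> x) = (LINT x. u x *\<^sub>R D\<phi> x)"
  by (rule integral_cong_AE) (use ae(1) in \<open>auto elim!: eventually_mono\<close>)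
 also have "... = - (LINT x. \<phi> x *\<^sub>R Du x)" using wg t unfolding weak_gradient_alt by blast
 also have "(LINT x. \<phi> x *\<^sub>R Du x) = (LINT x. \<phi> x *\<^sub>R Du' x)"
  by (rule integral_cong_AE) (use ae(2) in \<open>auto elim!: eventually_mono\<close>)
 finally show "(LINT x. u' x *\<^sub>R D\<phi> x) = - (LINT x. \<phi> x *\<^sub>R Du' x)" .
qed

lemma borel_version:
 fixes f :: "'a::euclidean_space => 'b::euclidean_space"
 assumes "f \<in> LM"
 obtains g where "g \<in> BM" "AE x. f x = g x"
proof -
 have "\<forall>b. \<exists>g. g \<in> BM \<and> (AE x in lborel. f x \<bullet> b = g x)"
  using completion_ex_borel_measurable_real[of "\<lambda>x. f x \<bullet> b" lborel for b] assms by (fastforce intro: borel_measurable_inner)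
 then obtain g where g: "\<And>b. g b \<in> BM" "\<And>b. AE x in lborel. f x \<bullet> b = g b x"
  by metis
 have "AE x in lborel. \<forall>b\<in>Basis. f x \<bullet> b = g b x"
  using g(2) by (intro AE_finite_allI) auto
 hence "AE x in lborel. f x = (\<Sum>b\<in>Basis. g b x *\<^sub>R b)"
  by eventually_elim (metis (no_types, lifting) euclidean_representation sum.cong)
 moreover have "(\<lambda>x. \<Sum>b\<in>Basis. g b x *\<^sub>R b) \<in> BM"
  using g(1) by measurable
 ultimately show ?thesis using that AE_completion by blast
qed

lemma weak_gradient_borel_version:
 fixes u :: "'a::euclidean_space => real"
 assumes u: "L2 u" and Du: "L2 Du" and wg: "weak_gradient u Du"
 obtains u' Du' where "u' \<in> BM" "Du' \<in> BM"
  "AE x. u x = u' x" "AE x. Du x = Du' x"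
  "L2 u'" "L2 Du'" "weak_gradient u' Du'"
proof -
 note m = L2_measurable[OF u] L2_measurable[OF Du]
 obtain u' where u': "u' \<in> BM" "AE x. u x = u' x" using borel_version[OF m(1)] .
 obtain Du' where Du': "Du' \<in> BM" "AE x. Du x = Du' x" using borel_version[OF m(2)] .
 note m' = LM_of_BM[OF u'(1)] LM_of_BM[OF Du'(1)]
 show ?thesis
 proof (rule that[OF u'(1) Du'(1) u'(2) Du'(2)])
  show "L2 u'" by (rule L2_AE[OF u m'(1)]) (use u' in \<open>auto elim!: eventually_mono\<close>)
  show "L2 Du'" by (rule L2_AE[OF Du m'(2)]) (use Du' in \<open>auto elim!: eventually_mono\<close>)
  show "weak_gradient u' Du'" by (rule weak_gradient_AE[OF wg m m' u'(2) Du'(2)])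
 qed
qed

lemma borel_measurable_lebesgue_continuous:
 fixes f :: "'a::euclidean_space => 'b::euclidean_space"
 shows "continuous_on UNIV f ==> f \<in> LM"
 by (intro LM_of_BM BM_continuous)

lemma test_function_mult:
 assumes t: "test_function \<phi> D\<phi>" and D: "\<And>x. GDERIV \<psi> x :> D\<psi> x" and c: "continuous_on UNIV D\<psi>"
 shows "test_function (\<lambda>x. \<psi> x*\<phi> x) (\<lambda>x. \<psi> x *\<^sub>R D\<phi> x + \<phi> x *\<^sub>R D\<psi> x)"
 unfolding test_function_def
proof (intro conjI allI)
 show "GDERIV (\<lambda>x. \<psi> x*\<phi> x) x :> \<psi> x *\<^sub>R D\<phi> x + \<phi> x *\<^sub>R D\<psi> x" for x
  by (rule GDERIV_mult[OF D test_functionD(1)[OF t]])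
 show "continuous_on UNIV (\<lambda>x. \<psi> x *\<^sub>R D\<phi> x + \<phi> x *\<^sub>R D\<psi> x)"
  by (intro continuous_intros GDERIV_continuous_on[OF D] test_functionD[OF t] c)
 have "{x. \<psi> x*\<phi> x \<noteq> 0} \<subseteq> {x. \<phi> x \<noteq> 0}" by auto
 thus "bounded {x. \<psi> x*\<phi> x \<noteq> 0}" using test_functionD(4)[OF t] bounded_subset by blast
qed

text \<open>The integral of \<eta> is invariant under translation by h, while the translation adds
  the line integral of D\<eta> along h. The indicator of a ball of radius \<open>R\<close>, equal to
  1 wherever the integrands live, supplies the square integrable factor required by
  \<open>swap_line_integral\<close>.\<close>

lemma integral_test_gradient:
 fixes \<eta> :: "'a::euclidean_space => real"
 assumes t: "test_function \<eta> D\<eta>"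
 shows "(LINT x|lborel. D\<eta> x) = 0"
proof -
 note [measurable] = test_functionD(6,7)[OF t]
 have "(LINT x|lborel. D\<eta> x) \<bullet> h = 0" for h
 proof -
  obtain R1 where R1: "{x. \<eta> x \<noteq> 0} \<subseteq> cball 0 R1" using test_functionD(4)[OF t] by (meson bounded_iff mem_cball_0 subsetI)
  obtain R2 where R2: "{x. D\<eta> x \<noteq> 0} \<subseteq> cball 0 R2" using test_functionD(5)[OF t] by (meson bounded_iff mem_cball_0 subsetI)
  define R where "R = max R1 R2 + norm h"
  let ?\<psi> = "indicat_real (cball (0::'a) R)"
  have far: "x \<in> cball 0 R" if "0 \<le> s" "s \<le> 1" "\<eta> (x + s *\<^sub>R h) \<noteq> 0 \<or> D\<eta> (x + s *\<^sub>R h) \<noteq> 0" for x s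
  proof -
   have "norm (x + s *\<^sub>R h) \<le> max R1 R2" using that(3) R1 R2 by (auto simp: le_max_iff_disj)
   moreover have "norm x \<le> norm (x + s *\<^sub>R h) + norm (s *\<^sub>R h)"
    using norm_triangle_ineq4[of "x + s *\<^sub>R h" "s *\<^sub>R h"] by simp
   moreover have "norm (s *\<^sub>R h) \<le> norm h" using that by (simp add: mult_left_le_one_le)
   ultimately show ?thesis by (simp add: R_def)
  qed
  have \<psi>: "L2 ?\<psi>"
  proof -
   have "integrable lborel ?\<psi>" by (intro integrable_real_indicator emeasure_bounded_finite) auto
   moreover have "(\<lambda>x. (norm (?\<psi> x))^2) = ?\<psi>" by (auto simp: indicator_def)
   ultimately show ?thesis by (simp add: L2_lborel)
  qed
  have \<psi>m: "?\<psi> \<in> BM" by (intro borel_measurable_indicator) simp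
  have i\<eta>: "integrable lborel \<eta>" using test_functionD[OF t] continuous_compact_support_integrable(1) by blast
  have "0 = (LINT x|lborel. \<eta> (x + h)) - (LINT x|lborel. \<eta> x)"
   by (simp add: integral_translate)
  also have "... = (LINT x|lborel. \<eta> (x + h) - \<eta> x)"
   using i\<eta> by (intro Lint_diff[symmetric]) (auto simp: integrable_translate_iff)
  also have "... = (LINT x|lborel. ?\<psi> x*(\<eta> (x + h) - \<eta> x))"
  proof (rule Lint_cong[OF refl])
   show "\<eta> (x + h) - \<eta> x = ?\<psi> x*(\<eta> (x + h) - \<eta> x)" for x
   proof (cases "x \<in> cball 0 R")
    case False
    have "\<eta> (x + h) = 0" by (rule ccontr) (use far[of 1 x] False in simp)
    moreover have "\<eta> x = 0" by (rule ccontr) (use far[of 0 x] False in simp)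
    ultimately show ?thesis by simp
   qed simp
  qed
  also have "... = (LINT x|lborel. ?\<psi> x*(LINT s|lborel. indicator {0..1} s*(D\<eta> (x + s *\<^sub>R h) \<bullet> h)))"
   by (simp only: line_integral_C1[OF test_functionD(1)[OF t] test_functionD(2)[OF t]])
  also have "... = (LINT s|lborel. indicator {0..1} s*(LINT x|lborel. ?\<psi> x*(D\<eta> (x + s *\<^sub>R h) \<bullet> h)))"
   by (rule swap_line_integral(1)[OF \<psi>m test_functionD(7)[OF t] \<psi> test_functionD(9)[OF t]])
  also have "... = (LINT s|lborel. indicator {0..1::real} s*((LINT x|lborel. D\<eta> x) \<bullet> h))"
  proof (rule Lint_cong[OF refl])
   fix s :: real
   show "indicator {0..1} s*(LINT x|lborel. ?\<psi> x*(D\<eta> (x + s *\<^sub>R h) \<bullet> h)) = indicator {0..1} s*((LINT x|lborel. D\<eta> x) \<bullet> h)"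
   proof (cases "0 \<le> s \<and> s \<le> 1")
    case True
    have "(LINT x|lborel. ?\<psi> x*(D\<eta> (x + s *\<^sub>R h) \<bullet> h)) = (LINT x|lborel. D\<eta> (x + s *\<^sub>R h) \<bullet> h)"
    proof (rule Lint_cong[OF refl])
     fix x
     show "?\<psi> x*(D\<eta> (x + s *\<^sub>R h) \<bullet> h) = D\<eta> (x + s *\<^sub>R h) \<bullet> h"
     proof (cases "x \<in> cball 0 R")
      case False
      have "D\<eta> (x + s *\<^sub>R h) = 0" by (rule ccontr) (use far[of s x] True False in simp)
      thus ?thesis by simp
     qed simp
    qed
    also have "... = (LINT x|lborel. D\<eta> x \<bullet> h)"
     by (rule integral_translate[of "\<lambda>x. D\<eta> x \<bullet> h"]) measurable
    also have "... = (LINT x|lborel. D\<eta> x) \<bullet> h"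
     using integral_inner_left[OF test_functionD(10)[OF t], of h] by simp
    finally show ?thesis by simp
   qed (auto simp: indicator_def)
  qed
  also have "... = (LINT x|lborel. D\<eta> x) \<bullet> h" by simp
  finally show ?thesis by simp
 qed
 thus ?thesis by (metis inner_eq_zero_iff)
qed

lemma weak_gradient_C1:
 fixes g :: "'a::euclidean_space => real"
 assumes D: "\<And>x. GDERIV g x :> Dg x" and c: "continuous_on UNIV Dg"
 shows "weak_gradient g Dg"
 unfolding weak_gradient_alt
proof (intro allI impI)
 fix \<phi> D\<phi> assume t: "test_function \<phi> (D\<phi> :: 'a => 'a)"
 note cg = GDERIV_continuous_on[OF D]
 have 1: "continuous_on UNIV (\<lambda>x. g x *\<^sub>R D\<phi> x)" "continuous_on UNIV (\<lambda>x. \<phi> x *\<^sub>R Dg x)"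
  by (intro continuous_intros cg c test_functionD[OF t])+
 have "{x. g x *\<^sub>R D\<phi> x \<noteq> 0} \<subseteq> {x. D\<phi> x \<noteq> 0}" "{x. \<phi> x *\<^sub>R Dg x \<noteq> 0} \<subseteq> {x. \<phi> x \<noteq> 0}" by auto
 hence 2: "bounded {x. g x *\<^sub>R D\<phi> x \<noteq> 0}" "bounded {x. \<phi> x *\<^sub>R Dg x \<noteq> 0}"
  using test_functionD(4,5)[OF t] bounded_subset by blast+
 note i = continuous_compact_support_integrable(1)[OF 1(1) 2(1)] continuous_compact_support_integrable(1)[OF 1(2) 2(2)]
 have "(LINT x|lborel. g x *\<^sub>R D\<phi> x + \<phi> x *\<^sub>R Dg x) = 0"
  by (rule integral_test_gradient[OF test_function_mult[OF t D c]])
 hence "(LINT x|lborel. g x *\<^sub>R D\<phi> x) = - (LINT x|lborel. \<phi> x *\<^sub>R Dg x)"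
  using i by (simp add: eq_neg_iff_add_eq_0)
 thus "(LINT x. g x *\<^sub>R D\<phi> x) = - (LINT x. \<phi> x *\<^sub>R Dg x)"
  using 1 by (simp add: integral_lebesgue_lborel BM_continuous)
qed

lemma integrable_scaleR_test:
 assumes u: "L2 u" and \<phi>: "continuous_on UNIV \<phi>" "bounded {x. \<phi> x \<noteq> 0}"
 shows "L1 (\<lambda>x. (u :: 'a::euclidean_space => real) x *\<^sub>R (\<phi> :: 'a => 'b::euclidean_space) x)"
 by (rule integrable_scaleR_L2[OF u continuous_compact_support_integrable(2)[OF \<phi>]])

lemma weak_gradient_mult_C1:
 fixes u \<psi> :: "'a::euclidean_space => real"
 assumes u: "L2 u" and Du: "L2 Du" and wg: "weak_gradient u Du"
  and D: "\<And>x. GDERIV \<psi> x :> D\<psi> x" and c: "continuous_on UNIV D\<psi>"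
 shows "weak_gradient (\<lambda>x. \<psi> x*u x) (\<lambda>x. \<psi> x *\<^sub>R Du x + u x *\<^sub>R D\<psi> x)"
 unfolding weak_gradient_alt
proof (intro allI impI)
 fix \<phi> D\<phi> assume t: "test_function \<phi> (D\<phi> :: 'a => 'a)"
 note c\<psi> = GDERIV_continuous_on[OF D]
 note t' = test_function_mult[OF t D c]
 have 1: "continuous_on UNIV (\<lambda>x. \<psi> x *\<^sub>R D\<phi> x)" "continuous_on UNIV (\<lambda>x. \<phi> x *\<^sub>R D\<psi> x)"
  by (intro continuous_intros c\<psi> c test_functionD[OF t])+
 have "{x. \<psi> x *\<^sub>R D\<phi> x \<noteq> 0} \<subseteq> {x. D\<phi> x \<noteq> 0}" "{x. \<phi> x *\<^sub>R D\<psi> x \<noteq> 0} \<subseteq> {x. \<phi> x \<noteq> 0}" by auto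
 hence 2: "bounded {x. \<psi> x *\<^sub>R D\<phi> x \<noteq> 0}" "bounded {x. \<phi> x *\<^sub>R D\<psi> x \<noteq> 0}"
  using test_functionD(4,5)[OF t] bounded_subset by blast+
 note i1 = integrable_scaleR_test[OF u 1(1) 2(1)] and i2 = integrable_scaleR_test[OF u 1(2) 2(2)]
 have i3: "L1 (\<lambda>x. (\<psi> x*\<phi> x) *\<^sub>R Du x)"
  by (rule integrable_scaleR_L2[OF test_functionD(8)[OF t'] Du])
 have "(LINT x. u x *\<^sub>R (\<psi> x *\<^sub>R D\<phi> x + \<phi> x *\<^sub>R D\<psi> x)) = - (LINT x. (\<psi> x*\<phi> x) *\<^sub>R Du x)"
  using wg t' unfolding weak_gradient_alt by blast
 moreover have "(LINT x. u x *\<^sub>R (\<psi> x *\<^sub>R D\<phi> x + \<phi> x *\<^sub>R D\<psi> x))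
   = (LINT x. u x *\<^sub>R \<psi> x *\<^sub>R D\<phi> x) + (LINT x. u x *\<^sub>R \<phi> x *\<^sub>R D\<psi> x)"
  unfolding scaleR_add_right by (rule Lint_add[OF i1 i2])
 ultimately have "(LINT x. u x *\<^sub>R \<psi> x *\<^sub>R D\<phi> x)
   = - ((LINT x. (\<psi> x*\<phi> x) *\<^sub>R Du x) + (LINT x. u x *\<^sub>R \<phi> x *\<^sub>R D\<psi> x))"
  by (simp add: algebra_simps)
 also have "(LINT x. (\<psi> x*\<phi> x) *\<^sub>R Du x) + (LINT x. u x *\<^sub>R \<phi> x *\<^sub>R D\<psi> x)
  = (LINT x. (\<psi> x*\<phi> x) *\<^sub>R Du x + u x *\<^sub>R \<phi> x *\<^sub>R D\<psi> x)"
  by (rule Lint_add[OF i3 i2, symmetric])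
 finally show "(LINT x. (\<psi> x*u x) *\<^sub>R D\<phi> x) = - (LINT x. \<phi> x *\<^sub>R (\<psi> x *\<^sub>R Du x + u x *\<^sub>R D\<psi> x))"
  by (simp add: scaleR_add_right mult_ac)
qed

lemma weak_gradient_diff:
 fixes u v :: "'a::euclidean_space => real"
 assumes u: "L2 u" "L2 Du" "weak_gradient u Du"
  and v: "L2 v" "L2 Dv" "weak_gradient v Dv"
 shows "weak_gradient (\<lambda>x. u x - v x) (\<lambda>x. Du x - Dv x)"
 unfolding weak_gradient_alt
proof (intro allI impI)
 fix \<phi> D\<phi> assume t: "test_function \<phi> (D\<phi> :: 'a => 'a)"
 note t1 = test_functionD(8,9)[OF t]
 have "(LINT x. u x *\<^sub>R D\<phi> x) = - (LINT x. \<phi> x *\<^sub>R Du x)"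
  "(LINT x. v x *\<^sub>R D\<phi> x) = - (LINT x. \<phi> x *\<^sub>R Dv x)"
  using u(3) v(3) t unfolding weak_gradient_alt by blast+
 moreover have "L1 (\<lambda>x. u x *\<^sub>R D\<phi> x)" "L1 (\<lambda>x. v x *\<^sub>R D\<phi> x)"
  "L1 (\<lambda>x. \<phi> x *\<^sub>R Du x)" "L1 (\<lambda>x. \<phi> x *\<^sub>R Dv x)"
  using t1 u v by (auto intro!: integrable_scaleR_L2)
 ultimately show "(LINT x. (u x - v x) *\<^sub>R D\<phi> x) = - (LINT x. \<phi> x *\<^sub>R (Du x - Dv x))"
  by (simp add: scaleR_diff_left scaleR_diff_right)
qed

text \<open>Extends the definition of the weak gradient to test functions without compact support,
  such as derivatives of Gaussians. The cut-offs are the squared positive parts of 1 - |x|^2/(n +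
  1)^2, whose gradients are of order 1/n.\<close>

lemma weak_gradient_test_L2:
 fixes u \<phi> :: "'a::euclidean_space => real"
 assumes u: "L2 u" and Du: "L2 Du" and wg: "weak_gradient u Du"
  and D: "\<And>x. GDERIV \<phi> x :> D\<phi> x" and c: "continuous_on UNIV D\<phi>"
  and \<phi>: "L2 \<phi>" and D\<phi>: "L2 D\<phi>"
 shows "(LINT x. u x *\<^sub>R D\<phi> x) = - (LINT x. \<phi> x *\<^sub>R Du x)"
proof -
 define \<kappa> where "\<kappa> n = inverse ((real (Suc n))^2)" for n
 define c where "c n x = 1 - \<kappa> n*(x \<bullet> x)" for n and x :: 'a
 define ct where "ct n x = (max 0 (c n x))^2" for n and x :: 'a
 define Dct where "Dct n x = (2*max 0 (c n x)) *\<^sub>R ((- 2*\<kappa> n) *\<^sub>R x)" for n and x :: 'a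
 have Dc: "GDERIV (c n) x :> (- 2*\<kappa> n) *\<^sub>R x" for n x
  unfolding c_def gderiv_def
  by (auto intro!: derivative_eq_intros simp: fun_eq_iff inner_commute)
 have Dct: "GDERIV (ct n) x :> Dct n x" for n x
 proof -
  have "((\<lambda>s::real. (max 0 s)^2) has_real_derivative 2*max 0 s) (at s)" for s
   by (rule has_real_derivative_max_0[where H="\<lambda>s. s^2" and H'="\<lambda>s. 2 * s"]) (auto intro!: derivative_eq_intros)
  from GDERIV_DERIV_compose[OF Dc this] show ?thesis unfolding ct_def Dct_def .
 qed
 have cc: "continuous_on UNIV (c n)" for n unfolding c_def by (intro continuous_intros)
 have cDct: "continuous_on UNIV (Dct n)" for n
  unfolding Dct_def by (intro continuous_intros cc)
 have cct: "continuous_on UNIV (ct n)" for n unfolding ct_def by (intro continuous_intros cc)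
 have \<kappa>: "0 < \<kappa> n" for n by (simp add: \<kappa>_def)
 have c1: "c n x \<le> 1" for n x using \<kappa>[of n] by (simp add: c_def)
 have ct01: "0 \<le> ct n x" "ct n x \<le> 1" for n x
  using c1[of n x] by (auto simp: ct_def power_le_one)
 have pos: "norm x \<le> real (Suc n)" if "0 < c n x" for n x
 proof -
  have "(norm x)^2 \<le> (real (Suc n))^2" using that by (simp add: c_def \<kappa>_def power2_norm_eq_inner inverse_eq_divide divide_less_eq)
  thus ?thesis by (rule power2_le_imp_le) simp
 qed
 have Dctb: "norm (Dct n x) \<le> 4/real (Suc n)" for n x
 proof (cases "0 < c n x")
  case True
  have "norm (Dct n x) = (2*c n x)*(2*\<kappa> n*norm x)"
   using True \<kappa>[of n] by (simp add: Dct_def)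
  also have "... \<le> (2*1)*(2*\<kappa> n*real (Suc n))"
   using pos[OF True] c1[of n x] True \<kappa>[of n] by (intro mult_mono) auto
  also have "... = 4/real (Suc n)" by (simp add: \<kappa>_def power2_eq_square field_simps del: of_nat_Suc)
  finally show ?thesis .
 next
  case False
  hence "max 0 (c n x) = 0" by simp
  thus ?thesis by (simp add: Dct_def)
 qed
 have t: "test_function (ct n) (Dct n)" for n
  unfolding test_function_def
 proof (intro conjI allI Dct cDct)
  have "{x. ct n x \<noteq> 0} \<subseteq> cball 0 (real (Suc n))"
  proof
   fix x assume "x \<in> {x. ct n x \<noteq> 0}"
   hence "0 < c n x" by (auto simp: ct_def max_def split: if_splits)
   thus "x \<in> cball 0 (real (Suc n))" using pos[of n x] by simp
  qed
  thus "bounded {x. ct n x \<noteq> 0}" using bounded_cball bounded_subset by blast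
 qed
 note t' = test_function_mult[OF t D \<open>continuous_on UNIV D\<phi>\<close>]
 note mu = L2_measurable[OF u] and mDu = L2_measurable[OF Du]
  and m\<phi> = L2_measurable[OF \<phi>] and mD\<phi> = L2_measurable[OF D\<phi>]
 have [measurable]: "ct n \<in> LM" "Dct n \<in> LM" for n
  using cct cDct by (auto intro: borel_measurable_lebesgue_continuous)
 note [measurable] = mu mDu m\<phi> mD\<phi>
 have limct: "(\<lambda>n. ct n x) \<longlonglongrightarrow> 1" for x
 proof -
  have "(\<lambda>n. (x \<bullet> x)*(inverse (real (Suc n)))^2) \<longlonglongrightarrow> (x \<bullet> x)*0^2"
   by (intro tendsto_intros LIMSEQ_inverse_real_of_nat)
  hence "(\<lambda>n. (max 0 (1 - (x \<bullet> x)*(inverse (real (Suc n)))^2))^2) \<longlonglongrightarrow> (max 0 (1 - (x \<bullet> x)*0^2))^2"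
   by (rule tendsto_power[OF tendsto_max[OF tendsto_const tendsto_diff[OF tendsto_const]]])
  thus ?thesis by (simp add: ct_def c_def \<kappa>_def power_inverse mult.commute)
 qed
 have limD: "(\<lambda>n. Dct n x) \<longlonglongrightarrow> 0" for x
 proof (rule Lim_null_comparison[OF always_eventually])
  show "\<forall>n. norm (Dct n x) \<le> 4*inverse (real (Suc n))" using Dctb[of _ x] by (simp add: divide_inverse)
  show "(\<lambda>n. 4*inverse (real (Suc n))) \<longlonglongrightarrow> 0" using tendsto_mult_right_zero[OF LIMSEQ_inverse_real_of_nat, of 4] by simp
 qed
 have eq: "(LINT x. u x *\<^sub>R (\<phi> x *\<^sub>R Dct n x + ct n x *\<^sub>R D\<phi> x)) = - (LINT x. (\<phi> x*ct n x) *\<^sub>R Du x)" for n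
  using wg t'[of n] unfolding weak_gradient_alt by blast
 have L1: "(\<lambda>n. LINT x. u x *\<^sub>R (\<phi> x *\<^sub>R Dct n x + ct n x *\<^sub>R D\<phi> x)) \<longlonglongrightarrow> (LINT x. u x *\<^sub>R D\<phi> x)"
 proof (rule integral_dominated_convergence)
  show "L1 (\<lambda>x. 4*(norm (u x)*norm (\<phi> x)) + norm (u x)*norm (D\<phi> x))"
   using integrable_norm_mult[OF u \<phi>] integrable_norm_mult[OF u D\<phi>] by simp
  have "(\<lambda>n. u x *\<^sub>R (\<phi> x *\<^sub>R Dct n x + ct n x *\<^sub>R D\<phi> x)) \<longlonglongrightarrow> u x *\<^sub>R (\<phi> x *\<^sub>R 0 + 1 *\<^sub>R D\<phi> x)" for x
   by (intro tendsto_intros limct limD)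
  thus "AE x. (\<lambda>n. u x *\<^sub>R (\<phi> x *\<^sub>R Dct n x + ct n x *\<^sub>R D\<phi> x)) \<longlonglongrightarrow> u x *\<^sub>R D\<phi> x" by simp
  fix n
  have "norm (u x *\<^sub>R (\<phi> x *\<^sub>R Dct n x + ct n x *\<^sub>R D\<phi> x)) \<le> 4*(norm (u x)*norm (\<phi> x)) + norm (u x)*norm (D\<phi> x)" for x
  proof -
   have "norm (Dct n x) \<le> 4" using Dctb[of n x] by (rule order_trans) (simp add: divide_le_eq)
   hence "norm (\<phi> x *\<^sub>R Dct n x + ct n x *\<^sub>R D\<phi> x) \<le> \<bar>\<phi> x\<bar>*4 + 1*norm (D\<phi> x)"
    using ct01[of n x] by (intro norm_triangle_le add_mono) (auto intro!: mult_left_mono mult_left_le_one_le)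
   hence "\<bar>u x\<bar>*norm (\<phi> x *\<^sub>R Dct n x + ct n x *\<^sub>R D\<phi> x) \<le> \<bar>u x\<bar>*(\<bar>\<phi> x\<bar>*4 + 1*norm (D\<phi> x))"
    by (rule mult_left_mono) simp
   thus ?thesis by (simp only: norm_scaleR real_norm_def) (simp add: algebra_simps)
  qed
  thus "AE x. norm (u x *\<^sub>R (\<phi> x *\<^sub>R Dct n x + ct n x *\<^sub>R D\<phi> x)) \<le> 4*(norm (u x)*norm (\<phi> x)) + norm (u x)*norm (D\<phi> x)"
   by simp
 qed measurable
 have L2: "(\<lambda>n. LINT x. (\<phi> x*ct n x) *\<^sub>R Du x) \<longlonglongrightarrow> (LINT x. \<phi> x *\<^sub>R Du x)"
 proof (rule integral_dominated_convergence)
  show "L1 (\<lambda>x. norm (\<phi> x)*norm (Du x))" by (rule integrable_norm_mult[OF \<phi> Du])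
  have "(\<lambda>n. (\<phi> x*ct n x) *\<^sub>R Du x) \<longlonglongrightarrow> (\<phi> x*1) *\<^sub>R Du x" for x
   by (intro tendsto_intros limct)
  thus "AE x. (\<lambda>n. (\<phi> x*ct n x) *\<^sub>R Du x) \<longlonglongrightarrow> \<phi> x *\<^sub>R Du x" by simp
  show "AE x. norm ((\<phi> x*ct n x) *\<^sub>R Du x) \<le> norm (\<phi> x)*norm (Du x)" for n
   using ct01 by (auto simp: abs_mult intro!: always_eventually mult_right_mono mult_left_le)
 qed measurable
 show ?thesis using LIMSEQ_unique[OF L1[unfolded eq] tendsto_minus[OF L2]] .
qed

text \<open>The shift by s h is moved from G to w, whose modulus of continuity in L^2 is linear.
  This gains the factor |h|, in addition to the one contained in k when k = h or -h.\<close>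

lemma line_average_close:
 fixes w :: "'a::euclidean_space => real" and G :: "'a => 'a"
 assumes m[measurable]: "w \<in> BM" "G \<in> BM"
  and w: "L2 w" and G: "L2 G"
  and mod: "\<And>z. l2_norm (\<lambda>x. w (x + z) - w x) \<le> N*norm z"
 shows "\<bar>(LINT x|lborel. w x*(LINT s|lborel. indicator {0..1} s*(G (x + s *\<^sub>R h) \<bullet> k))) - (LINT x|lborel. w x*(G x \<bullet> k))\<bar>
  \<le> N*norm h*norm k * sqrt (LINT x. (norm (G x))^2)"
proof -
 define f where "f s = (LINT x|lborel. w x*(G (x + s *\<^sub>R h) \<bullet> k))" for s :: real
 define c where "c = (LINT x|lborel. w x*(G x \<bullet> k))"
 define gn where "gn = sqrt (LINT x. (norm (G x))^2)"
 define K where "K = N*norm h*norm k*gn"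
 have gn: "0 \<le> gn" by (simp add: gn_def)
 have wi: "integrable lborel (\<lambda>x. v x*(G x \<bullet> k))" if "L2 v" "v \<in> BM" for v
 proof -
  have "L1 (\<lambda>x. (v x *\<^sub>R G x) \<bullet> k)" using that G by (intro integrable_inner_left integrable_scaleR_L2)
  thus ?thesis using that by (simp add: integrable_lebesgue_lborel)
 qed
 have close: "\<bar>f s - c\<bar> \<le> K" if "0 \<le> s" "s \<le> 1" for s
 proof -
  let ?z = "- (s *\<^sub>R h)"
  have wt: "L2 (\<lambda>x. w (x + ?z))" by (rule L2_translate[OF m(1) w])
  have "f s = (LINT x|lborel. w (x + s *\<^sub>R h + ?z)*(G (x + s *\<^sub>R h) \<bullet> k))" by (simp add: f_def)
  also have "... = (LINT x|lborel. w (x + ?z)*(G x \<bullet> k))"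
   by (rule integral_translate[of "\<lambda>x. w (x + ?z)*(G x \<bullet> k)"]) measurable
  finally have "f s - c = (LINT x|lborel. (w (x + ?z) - w x)*(G x \<bullet> k))"
   using wi[OF w m(1)] wi[OF wt] by (simp add: c_def left_diff_distrib)
  also have "\<bar>...\<bar> \<le> (LINT x|lborel. norm k*(norm (w (x + ?z) - w x)*norm (G x)))"
  proof -
   have sq: "L2 (\<lambda>x. w (x + ?z) - w x)" by (rule L2_diff[OF wt w])
   have "\<bar>LINT x|lborel. (w (x + ?z) - w x)*(G x \<bullet> k)\<bar> \<le> (LINT x|lborel. norm ((w (x + ?z) - w x)*(G x \<bullet> k)))"
    using integral_norm_bound[of lborel "\<lambda>x. (w (x + ?z) - w x)*(G x \<bullet> k)"] by simp
   also have "... \<le> (LINT x|lborel. norm k*(norm (w (x + ?z) - w x)*norm (G x)))"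
   proof (rule integral_mono)
    show "integrable lborel (\<lambda>x. norm ((w (x + ?z) - w x)*(G x \<bullet> k)))"
     by (rule integrable_norm[OF wi[OF sq]]) measurable
    have "L1 (\<lambda>x. norm (w (x + ?z) - w x)*norm (G x))" by (rule integrable_norm_mult[OF sq G])
    thus "integrable lborel (\<lambda>x. norm k*(norm (w (x + ?z) - w x)*norm (G x)))"
     by (simp add: integrable_lebesgue_lborel)
    show "norm ((w (x + ?z) - w x)*(G x \<bullet> k)) \<le> norm k*(norm (w (x + ?z) - w x)*norm (G x))" for x
    proof -
     have "\<bar>w (x + ?z) - w x\<bar>*\<bar>G x \<bullet> k\<bar> \<le> \<bar>w (x + ?z) - w x\<bar>*(norm (G x)*norm k)"
      by (intro mult_left_mono Cauchy_Schwarz_ineq2) simp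
     thus ?thesis by (simp add: abs_mult mult_ac)
    qed
   qed
   finally show ?thesis .
  qed
  also have "... = norm k*(LINT x. norm (w (x + ?z) - w x)*norm (G x))"
   by (simp add: integral_lebesgue_lborel)
  also have "... \<le> norm k*(l2_norm (\<lambda>x. w (x + ?z) - w x)*gn)"
   using Cauchy_Schwarz_norm[OF L2_diff[OF wt w] G]
   by (intro mult_left_mono) (auto simp: l2_norm_def gn_def)
  also have "... \<le> norm k*((N*norm h)*gn)"
  proof (intro mult_left_mono mult_right_mono gn)
   have "0 \<le> N*norm h" using mod[of h] l2_norm_nonneg order_trans by blast
   hence "s*(N*norm h) \<le> N*norm h" using that by (simp add: mult_left_le_one_le)
   thus "l2_norm (\<lambda>x. w (x + ?z) - w x) \<le> N*norm h" using mod[of ?z] that by (simp add: mult_ac)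
  qed simp
  finally show ?thesis by (simp add: K_def mult_ac)
 qed
 have fi: "integrable lborel (\<lambda>s. indicator {0..1::real} s*f s)"
  using lborel_pair.integrable_fst[OF integrable_line_product[OF m w G, of h k]] by (simp add: f_def)
 have "(LINT x|lborel. w x*(LINT s|lborel. indicator {0..1} s*(G (x + s *\<^sub>R h) \<bullet> k))) - c
  = (LINT s|lborel. indicator {0..1::real} s*f s) - (LINT s|lborel. indicator {0..1::real} s*c)"
  using swap_line_integral(1)[OF m w G, of h k] by (simp add: f_def)
 also have "... = (LINT s|lborel. indicator {0..1::real} s*(f s - c))"
  using fi by (simp add: right_diff_distrib)
 also have "\<bar>...\<bar> \<le> (LINT s|lborel. indicator {0..1::real} s*K)"
 proof -
  have "\<bar>LINT s|lborel. indicator {0..1::real} s*(f s - c)\<bar> \<le> (LINT s|lborel. norm (indicator {0..1::real} s*(f s - c)))"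
   using integral_norm_bound[of lborel "\<lambda>s. indicator {0..1::real} s*(f s - c)"] by simp
  also have "... \<le> (LINT s|lborel. indicator {0..1::real} s*K)"
  proof (rule integral_mono)
   have "integrable lborel (\<lambda>s. indicator {0..1::real} s*f s - indicator {0..1::real} s*c)"
    using fi by (intro Bochner_Integration.integrable_diff) auto
   thus "integrable lborel (\<lambda>s. norm (indicator {0..1::real} s*(f s - c)))"
    by (intro integrable_norm) (simp add: right_diff_distrib)
   show "norm (indicator {0..1::real} s*(f s - c)) \<le> indicator {0..1::real} s*K" for s
    using close[of s] by (auto simp: indicator_def)
  qed auto
  finally show ?thesis .
 qed
 also have "... = K" by simp
 finally show ?thesis by (simp add: c_def K_def gn_def)
qed

text \<open>The chain rule by difference quotients. For a shift t e, the quantity t (p + r) that has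
  to vanish is a combination of three errors: replacing the line average of D\<phi> by its value,
  the Taylor remainder of \<beta>, and replacing the line average of Du by its value. All are
  O(t^2), so p + r = 0 after division by t. The last error requires a linear modulus for \<psi> =
  \<beta>'(u) \<phi>; this is where the Lipschitz bound for \<beta>' enters.\<close>

lemma weak_gradient_compose_borel:
 fixes u :: "'a::euclidean_space => real" and \<beta> \<beta>' :: "real => real"
 assumes m[measurable]: "u \<in> BM" "Du \<in> BM"
  and u: "L2 u" and Du: "L2 Du" and wg: "weak_gradient u Du"
  and \<beta>m[measurable]: "\<beta> \<in> BM" "\<beta>' \<in> BM"
  and taylor: "\<And>a b. \<bar>\<beta> b - \<beta> a - \<beta>' a*(b - a)\<bar> \<le> L*(b - a)^2"
  and lip: "\<And>a b. \<bar>\<beta> b - \<beta> a\<bar> \<le> M*\<bar>b - a\<bar>" and lip': "\<And>a b. \<bar>\<beta>' b - \<beta>' a\<bar> \<le> L*\<bar>b - a\<bar>"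
  and \<beta>0: "\<beta> 0 = 0" and \<beta>'b: "\<And>a. \<bar>\<beta>' a\<bar> \<le> M"
 shows "weak_gradient (\<lambda>x. \<beta> (u x)) (\<lambda>x. \<beta>' (u x) *\<^sub>R Du x)"
 unfolding weak_gradient_alt
proof (intro allI impI)
 fix \<phi> D\<phi> assume t: "test_function \<phi> (D\<phi> :: 'a => 'a)"
 note [measurable] = test_functionD(6,7)[OF t]
 note t1 = test_functionD(8)[OF t] and t2 = test_functionD(9)[OF t]
 obtain B where B: "0 \<le> B" "\<And>x. norm (\<phi> x) \<le> B"
  using continuous_compact_support_bounded[OF test_functionD(3,4)[OF t]] by blast
 have L: "0 \<le> L" using lip'[of 0 1] by simp
 have M: "0 \<le> M" using \<beta>'b[of 0] by linarith
 define N where "N = sqrt (LINT x. (norm (Du x))^2)"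
 define N' where "N' = sqrt (LINT x. (norm (D\<phi> x))^2)"
 have modu: "l2_norm (\<lambda>x. u (x + z) - u x) \<le> N*norm z" for z
  using l2_norm_translate_diff[OF m u Du wg] by (simp add: N_def mult.commute)
 have mod\<phi>: "l2_norm (\<lambda>x. \<phi> (x + z) - \<phi> x) \<le> N'*norm z" for z
  using l2_norm_translate_diff[OF test_functionD(6,7)[OF t] t1 t2 weak_gradient_C1[OF test_functionD(1,2)[OF t]]]
  by (simp add: N'_def mult.commute)
 have ut: "L2 (\<lambda>x. u (x + z))" "L2 (\<lambda>x. \<phi> (x + z))" for z
  using u t1 by (auto intro: L2_translate)
 define w where "w x = \<beta> (u x)" for x
 define \<psi> where "\<psi> x = \<beta>' (u x)*\<phi> x" for x
 have [measurable]: "w \<in> BM" "\<psi> \<in> BM" unfolding w_def \<psi>_def by measurable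
 have w: "L2 w"
  by (rule L2_bound[OF L2_cmult[OF u, of M]])
   (use lip[of 0] \<beta>0 M in \<open>auto simp: w_def abs_mult intro!: LM_of_BM always_eventually\<close>)
 have \<psi>: "L2 \<psi>"
  by (rule L2_bound[OF L2_cmult[OF t1, of M]])
   (use \<beta>'b M in \<open>auto simp: \<psi>_def abs_mult intro!: LM_of_BM mult_right_mono always_eventually\<close>)
 have modw: "l2_norm (\<lambda>x. w (x + z) - w x) \<le> (M*N)*norm z" for z
 proof -
  have "l2_norm (\<lambda>x. w (x + z) - w x) \<le> l2_norm (\<lambda>x. M*(u (x + z) - u x))"
   using lip M by (intro l2_norm_mono L2_cmult L2_diff ut u always_eventually)
    (auto simp: w_def abs_mult intro!: LM_of_BM)
  also have "... = M*l2_norm (\<lambda>x. u (x + z) - u x)" using M by (simp add: l2_norm_cmult)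
  also have "... \<le> M*(N*norm z)" using modu M by (intro mult_left_mono)
  finally show ?thesis by simp
 qed
 have mod\<psi>: "l2_norm (\<lambda>x. \<psi> (x + z) - \<psi> x) \<le> (L*B*N + M*N')*norm z" for z
 proof -
  let ?a = "\<lambda>x. L*B*\<bar>u (x + z) - u x\<bar>" and ?b = "\<lambda>x. M*\<bar>\<phi> (x + z) - \<phi> x\<bar>"
  have sq: "L2 (\<lambda>x. \<bar>u (x + z) - u x\<bar>)" "L2 (\<lambda>x. \<bar>\<phi> (x + z) - \<phi> x\<bar>)"
   using L2_diff[OF ut(1) u, of z] L2_diff[OF ut(2) t1, of z]
   by (auto simp: square_integrable_def)
  have le: "\<bar>\<psi> (x + z) - \<psi> x\<bar> \<le> ?a x + ?b x" for x
  proof -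
   have "\<psi> (x + z) - \<psi> x = (\<beta>' (u (x + z)) - \<beta>' (u x))*\<phi> (x + z) + \<beta>' (u x)*(\<phi> (x + z) - \<phi> x)"
    by (simp add: \<psi>_def algebra_simps)
   also have "\<bar>...\<bar> \<le> \<bar>\<beta>' (u (x + z)) - \<beta>' (u x)\<bar>*\<bar>\<phi> (x + z)\<bar> + \<bar>\<beta>' (u x)\<bar>*\<bar>\<phi> (x + z) - \<phi> x\<bar>"
    by (rule order_trans[OF abs_triangle_ineq]) (simp add: abs_mult)
   also have "... \<le> (L*\<bar>u (x + z) - u x\<bar>)*B + M*\<bar>\<phi> (x + z) - \<phi> x\<bar>"
    using lip' B \<beta>'b L M by (intro add_mono mult_mono) (auto intro!: mult_nonneg_nonneg)
   finally show ?thesis by (simp add: mult_ac)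
  qed
  have "l2_norm (\<lambda>x. \<psi> (x + z) - \<psi> x) \<le> l2_norm (\<lambda>x. ?a x + ?b x)"
  proof (rule l2_norm_mono)
   show "(\<lambda>x. \<psi> (x + z) - \<psi> x) \<in> LM" by (intro LM_of_BM) measurable
   show "L2 (\<lambda>x. ?a x + ?b x)" by (intro L2_add L2_cmult sq)
   show "AE x. \<bar>\<psi> (x + z) - \<psi> x\<bar> \<le> \<bar>?a x + ?b x\<bar>"
    using le by (intro always_eventually allI order_trans[OF le abs_ge_self])
  qed
  also have "... \<le> l2_norm ?a + l2_norm ?b" by (intro l2_norm_triangle L2_cmult sq)
  also have "... = L*B*l2_norm (\<lambda>x. u (x + z) - u x) + M*l2_norm (\<lambda>x. \<phi> (x + z) - \<phi> x)"
   using L B M by (simp add: l2_norm_cmult) (simp add: l2_norm_def)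
  also have "... \<le> L*B*(N*norm z) + M*(N'*norm z)"
   using modu mod\<phi> L B M by (intro add_mono mult_left_mono) auto
  finally show ?thesis by (simp add: algebra_simps)
 qed
 have wi: "integrable lborel (\<lambda>x. v x *\<^sub>R G x)"
  if "L2 v" "v \<in> BM" "L2 G" "G \<in> BM" for v :: "'a => real" and G :: "'a => 'a"
  using integrable_scaleR_L2[OF that(1,3)] that by (simp add: integrable_lebesgue_lborel)
 have "(LINT x|lborel. w x *\<^sub>R D\<phi> x) \<bullet> e = - (LINT x|lborel. \<psi> x *\<^sub>R Du x) \<bullet> e" if e: "e \<in> Basis" for e
 proof -
  define p where "p = (LINT x|lborel. w x*(D\<phi> x \<bullet> e))"
  define r where "r = (LINT x|lborel. \<psi> x*(Du x \<bullet> e))"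
  have p: "p = (LINT x|lborel. w x *\<^sub>R D\<phi> x) \<bullet> e"
   using integral_inner_left[OF wi[OF w _ t2], of e] by (simp add: p_def)
  have r: "r = (LINT x|lborel. \<psi> x *\<^sub>R Du x) \<bullet> e"
   using integral_inner_left[OF wi[OF \<psi> _ Du], of e] by (simp add: r_def)
  define K where "K = M*N*N' + L*B*N^2 + (L*B*N + M*N')*N"
  have bound: "\<bar>t*(p + r)\<bar> \<le> K*t^2" if t0: "0 < t" for t
  proof -
   let ?h = "t *\<^sub>R e"
   have nh: "norm ?h = t" using e t0 by simp
   define A where "A = (LINT x|lborel. w x*(\<phi> (x + (- ?h)) - \<phi> x))"
   have eqA: "(LINT x|lborel. w x*(LINT s|lborel. indicator {0..1} s*(D\<phi> (x + s *\<^sub>R (- ?h)) \<bullet> (- ?h)))) = A"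
    by (simp only: A_def line_integral_C1[OF test_functionD(1)[OF t] test_functionD(2)[OF t]])
   have eqp: "(LINT x|lborel. w x*(D\<phi> x \<bullet> (- ?h))) = - t*p"
    by (simp add: p_def mult.left_commute)
   have "\<bar>(LINT x|lborel. w x*(LINT s|lborel. indicator {0..1} s*(D\<phi> (x + s *\<^sub>R (- ?h)) \<bullet> (- ?h)))) - (LINT x|lborel. w x*(D\<phi> x \<bullet> (- ?h)))\<bar>
    \<le> M*N*norm (- ?h)*norm (- ?h) * sqrt (LINT x. (norm (D\<phi> x))^2)"
    by (rule line_average_close[OF _ _ w t2 modw]) measurable
   hence A1: "\<bar>A - (- t*p)\<bar> \<le> (M*N*N')*t^2"
    unfolding eqA eqp norm_minus_cancel nh N'_def[symmetric] by (simp add: power2_eq_square mult_ac)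
   have int: "integrable lborel (\<lambda>x. v x*\<phi> (x + z))" if "L2 v" "v \<in> BM" for v z
    using integrable_mult_L2[OF that(1) ut(2)] that by (simp add: integrable_lebesgue_lborel)
   have wt: "L2 (\<lambda>x. w (x + ?h))" by (rule L2_translate[OF _ w]) measurable
   have "A = (LINT x|lborel. w x*\<phi> (x - ?h)) - (LINT x|lborel. w x*\<phi> x)"
    using int[OF w, of "- ?h"] int[OF w, of 0] by (simp add: A_def right_diff_distrib)
   also have "(LINT x|lborel. w x*\<phi> (x - ?h)) = (LINT x|lborel. w (x + ?h)*\<phi> x)"
    using integral_translate[of "\<lambda>x. w x*\<phi> (x - ?h)" ?h] by simp
   also have "... - (LINT x|lborel. w x*\<phi> x) = (LINT x|lborel. (w (x + ?h) - w x)*\<phi> x)"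
    using int[OF w, of 0] int[OF wt, of 0] by (simp add: left_diff_distrib)
   finally have A2: "A = (LINT x|lborel. (w (x + ?h) - w x)*\<phi> x)" .
   define A' where "A' = (LINT x|lborel. \<psi> x*(u (x + ?h) - u x))"
   have diff: "L2 (\<lambda>x. u (x + ?h) - u x)" by (rule L2_diff[OF ut(1) u])
   have i': "integrable lborel (\<lambda>x. \<psi> x*(u (x + ?h) - u x))"
    using integrable_mult_L2[OF \<psi> diff] by (simp add: integrable_lebesgue_lborel)
   have iA: "integrable lborel (\<lambda>x. (w (x + ?h) - w x)*\<phi> x)"
    using int[OF L2_diff[OF wt w], of 0] by simp
   have isq: "integrable lborel (\<lambda>x. (u (x + ?h) - u x)^2)" using diff by (simp add: L2_lborel)
   have "A - A' = (LINT x|lborel. (w (x + ?h) - w x)*\<phi> x - \<psi> x*(u (x + ?h) - u x))"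
    using iA i' by (simp add: A2 A'_def)
   also have "\<bar>...\<bar> \<le> (LINT x|lborel. norm ((w (x + ?h) - w x)*\<phi> x - \<psi> x*(u (x + ?h) - u x)))"
    using integral_norm_bound[of lborel "\<lambda>x. (w (x + ?h) - w x)*\<phi> x - \<psi> x*(u (x + ?h) - u x)"] by simp
   also have "... \<le> (LINT x|lborel. (L*B)*(u (x + ?h) - u x)^2)"
   proof (rule integral_mono)
    show "integrable lborel (\<lambda>x. norm ((w (x + ?h) - w x)*\<phi> x - \<psi> x*(u (x + ?h) - u x)))" using iA i' by simp
    show "integrable lborel (\<lambda>x. (L*B)*(u (x + ?h) - u x)^2)" using isq by simp
    fix x
    have "(w (x + ?h) - w x)*\<phi> x - \<psi> x*(u (x + ?h) - u x)
      = (\<beta> (u (x + ?h)) - \<beta> (u x) - \<beta>' (u x)*(u (x + ?h) - u x))*\<phi> x"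
     by (simp add: w_def \<psi>_def algebra_simps)
    also have "norm ... \<le> (L*(u (x + ?h) - u x)^2)*B"
     unfolding norm_mult using taylor B(2)[of x] L by (intro mult_mono) auto
    finally show "norm ((w (x + ?h) - w x)*\<phi> x - \<psi> x*(u (x + ?h) - u x)) \<le> (L*B)*(u (x + ?h) - u x)^2"
     by (simp add: mult_ac)
   qed
   also have "... = (L*B)*(l2_norm (\<lambda>x. u (x + ?h) - u x))^2"
    by (simp add: l2_norm_power2 integral_lebesgue_lborel)
   also have "... \<le> (L*B)*(N*t)^2"
    using modu[of ?h] nh L B by (intro mult_left_mono power_mono l2_norm_nonneg) auto
   finally have A3: "\<bar>A - A'\<bar> \<le> L*B*N^2*t^2" by (simp add: power_mult_distrib)
   have eqA': "A' = (LINT x|lborel. \<psi> x*(LINT s|lborel. indicator {0..1} s*(Du (x + s *\<^sub>R ?h) \<bullet> ?h)))"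
    unfolding A'_def
    by (rule integral_cong_AE) (use weak_gradient_line[OF m u Du wg, of ?h] in \<open>auto elim!: eventually_mono\<close>)
   have eqr: "(LINT x|lborel. \<psi> x*(Du x \<bullet> ?h)) = t*r"
    by (simp add: r_def mult.left_commute)
   have "\<bar>(LINT x|lborel. \<psi> x*(LINT s|lborel. indicator {0..1} s*(Du (x + s *\<^sub>R ?h) \<bullet> ?h))) - (LINT x|lborel. \<psi> x*(Du x \<bullet> ?h))\<bar>
    \<le> (L*B*N + M*N')*norm ?h*norm ?h * sqrt (LINT x. (norm (Du x))^2)"
    by (rule line_average_close[OF _ _ \<psi> Du mod\<psi>]) measurable
   hence A4: "\<bar>A' - t*r\<bar> \<le> (L*B*N + M*N')*N*t^2"
    unfolding eqA'[symmetric] eqr nh N_def[symmetric] by (simp add: power2_eq_square mult_ac)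
   have "t*(p + r) = (A - (- t*p)) - (A - A') - (A' - t*r)" by (simp add: algebra_simps)
   thus ?thesis using A1 A3 A4 by (simp add: K_def algebra_simps)
  qed
  have "\<bar>p + r\<bar> \<le> 0"
  proof (rule tendsto_lowerbound)
   show "((\<lambda>t. K*t) \<longlongrightarrow> 0) (at_right 0)" by (auto intro!: tendsto_eq_intros)
   have "\<bar>p + r\<bar> \<le> K*t" if t: "0 < t" for t
   proof -
    have "t*\<bar>p + r\<bar> \<le> t*(K*t)" using bound[OF t] t by (simp add: abs_mult power2_eq_square mult_ac)
    thus ?thesis using t by simp
   qed
   thus "\<forall>\<^sub>F t in at_right 0. \<bar>p + r\<bar> \<le> K*t" by (auto simp: eventually_at_right_field intro!: exI[of _ 1])
  qed simp
  hence "p + r = 0" by simp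
  thus ?thesis using p r by simp
 qed
 hence "(LINT x|lborel. w x *\<^sub>R D\<phi> x) = - (LINT x|lborel. \<psi> x *\<^sub>R Du x)"
  by (rule euclidean_eqI)
 hence "(LINT x. w x *\<^sub>R D\<phi> x) = - (LINT x. \<psi> x *\<^sub>R Du x)"
  by (simp add: integral_lebesgue_lborel)
 moreover have "(\<lambda>x. \<phi> x *\<^sub>R (\<beta>' (u x) *\<^sub>R Du x)) = (\<lambda>x. \<psi> x *\<^sub>R Du x)"
  by (simp add: \<psi>_def mult.commute fun_eq_iff)
 ultimately show "(LINT x. \<beta> (u x) *\<^sub>R D\<phi> x) = - (LINT x. \<phi> x *\<^sub>R (\<beta>' (u x) *\<^sub>R Du x))"
  by (simp only: w_def)
qed

lemma weak_gradient_compose: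
 fixes u :: "'a::euclidean_space => real" and \<beta> \<beta>' :: "real => real"
 assumes u: "L2 u" and Du: "L2 Du" and wg: "weak_gradient u Du"
  and \<beta>m: "\<beta> \<in> BM" "\<beta>' \<in> BM"
  and taylor: "\<And>a b. \<bar>\<beta> b - \<beta> a - \<beta>' a*(b - a)\<bar> \<le> L*(b - a)^2"
  and lip: "\<And>a b. \<bar>\<beta> b - \<beta> a\<bar> \<le> M*\<bar>b - a\<bar>" and lip': "\<And>a b. \<bar>\<beta>' b - \<beta>' a\<bar> \<le> L*\<bar>b - a\<bar>"
  and \<beta>0: "\<beta> 0 = 0" and \<beta>'b: "\<And>a. \<bar>\<beta>' a\<bar> \<le> M"
 shows "weak_gradient (\<lambda>x. \<beta> (u x)) (\<lambda>x. \<beta>' (u x) *\<^sub>R Du x)"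
proof -
 obtain u' Du' where v: "u' \<in> BM" "Du' \<in> BM"
  "AE x. u x = u' x" "AE x. Du x = Du' x"
  "L2 u'" "L2 Du'" "weak_gradient u' Du'"
  using weak_gradient_borel_version[OF u Du wg] .
 have "weak_gradient (\<lambda>x. \<beta> (u' x)) (\<lambda>x. \<beta>' (u' x) *\<^sub>R Du' x)"
  by (rule weak_gradient_compose_borel[OF v(1,2,5,6,7) \<beta>m taylor lip lip' \<beta>0 \<beta>'b])
 note [measurable] = \<beta>m v(1,2) L2_measurable[OF u] L2_measurable[OF Du]
  LM_of_BM[OF v(1)] LM_of_BM[OF v(2)]
 show ?thesis
 proof (rule weak_gradient_AE)
  show "weak_gradient (\<lambda>x. \<beta> (u' x)) (\<lambda>x. \<beta>' (u' x) *\<^sub>R Du' x)" by fact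
  show "AE x. \<beta> (u' x) = \<beta> (u x)" using v(3) by eventually_elim simp
  show "AE x. \<beta>' (u' x) *\<^sub>R Du' x = \<beta>' (u x) *\<^sub>R Du x" using v(3,4) by eventually_elim simp
 qed measurable
qed

subsection \<open>The Fefferman-Phong inequality\<close>

text \<open>V may be concentrated on a small part of the critical ball. By Chebyshev's inequality
  the set where V > K/m^2 has small relative volume, hence by \<open>mass_subset\<close> at most
  half of the mass. On the remaining part V is bounded and still has mass of order m^(d -
  2).\<close>

lemma (in rh_potential) critical_good_part:
 obtains K c where "0 < K" "0 < c"
  "\<And>x. \<exists>G \<in> sets lebesgue. G \<subseteq> ball x (mrad x) \<and> (\<forall>y\<in>G. V y \<le> K/(mrad x)^2) \<and> c*mrad x powr (d - 2) \<le> mass G"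
proof -
 obtain C k k1 where C: "1 \<le> C" "0 \<le> k" "0 \<le> k1"
  and up: "\<And>x r. 0 < r ==> r \<le> mrad x ==> \<Psi> x r \<le> C*(r/mrad x) powr \<delta>0"
  "\<And>x r. mrad x \<le> r ==> \<Psi> x r \<le> C*(r/mrad x) powr k"
  and low: "\<And>x. 1/C \<le> \<Psi> x (mrad x)"
  and "\<And>x. mrad x \<le> C*\<rho> x" "\<And>x y. mrad x/C*(1 + dist x y/mrad x) powr (- k1) \<le> mrad y"
  by (rule critical_scale) (rule that; blast)
 define a where "a = 1 - 1/q"
 have a: "0 < a" using q_gt_1 by (simp add: a_def)
 define \<epsilon> where "\<epsilon> = (1/(2 * RHC)) powr (1/a)"
 have \<epsilon>: "0 < \<epsilon>" "RHC*\<epsilon> powr a = 1/2" using RHC a by (auto simp: \<epsilon>_def powr_powr)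
 define \<omega> where "\<omega> = unit_ball_vol d"
 have \<omega>: "0 < \<omega>" by (simp add: \<omega>_def unit_ball_vol_pos')
 \<comment> \<open>With this level Chebyshev's inequality gives relative volume at most
   \<open>\<epsilon>\<close>, and \<open>\<epsilon>\<close> was chosen so that \<open>RHC\<close>
   times \<epsilon>^a is 1/2.\<close>
 define K where "K = C/(\<omega>*\<epsilon>)"
 have K: "0 < K" using C \<omega> \<epsilon> by (simp add: K_def)
 show ?thesis
 proof (rule that[of K "1/(2*C)"])
  show "0 < K" by fact
  show "0 < 1/(2*C)" using C by simp
  fix x
  define r where "r = mrad x"
  have r: "0 < r" by (simp add: r_def mrad_pos)
  let ?B = "ball x r"
  have "\<Psi> x r \<le> C" using up(1)[OF r, of x] r by (simp add: r_def)
  have e: "r powr (2 - d) = 1/r powr (d - 2)" using powr_minus_divide[of r "d - 2"] by simp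
  have p: "0 < r powr (d - 2)" using r by simp
  from \<open>\<Psi> x r \<le> C\<close> p have mB: "mass ?B \<le> C*r powr (d - 2)"
   by (simp add: \<Psi>_def e divide_le_eq)
  have "1/C \<le> mass ?B/r powr (d - 2)"
   using low[of x] by (simp add: \<Psi>_def e r_def[symmetric])
  hence mB': "r powr (d - 2)/C \<le> mass ?B"
   using p C(1) by (simp add: divide_le_eq le_divide_eq mult.commute)
  define E where "E = {y \<in> ?B. K/r^2 < V y}"
  have "{y. K/r^2 < V y} \<in> sets lebesgue"
   using borel_measurable_lebesgue_preimage_borel[THEN iffD1, OF V_measurable, rule_format, of "{K/r^2 <..}"] by simp
  moreover have "E = ?B \<inter> {y. K/r^2 < V y}" by (auto simp: E_def)
  ultimately have E[measurable]: "E \<in> sets lebesgue" using sets.Int[of ?B lebesgue "{y. K/r^2 < V y}"] by simp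
  have bE: "bounded E" by (rule bounded_subset[of ?B]) (auto simp: E_def)
  have emE: "emeasure lebesgue E = ennreal (measure lebesgue E)"
  proof (rule emeasure_eq_ennreal_measure)
   have "emeasure lebesgue E \<le> emeasure lebesgue ?B" by (rule emeasure_mono) (auto simp: E_def)
   also have "... = ennreal (vol r)" using emeasure_ball_vol[of r x] r by (simp only: less_imp_le)
   finally show "emeasure lebesgue E \<noteq> top" by (metis ennreal_neq_top neq_top_trans)
  qed
  have "ennreal (K/r^2*measure lebesgue E) = (\<integral>y. ennreal (K/r^2)*indicator E y)"
   unfolding nn_integral_cmult_indicator[OF E] emE using K by (intro ennreal_mult) auto
  also have "... \<le> (\<integral>y\<in>E. ennreal (V y))"
   by (intro nn_integral_mono) (auto simp: indicator_def E_def intro!: ennreal_leI)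
  also have "... = ennreal (mass E)" by (simp add: ennreal_mass bE)
  finally have "K/r^2*measure lebesgue E \<le> mass E" by (simp add: mass_nonneg)
  also have "mass E \<le> mass ?B" by (rule mass_mono) (auto simp: E_def)
  also have "... \<le> C*r powr (d - 2)" by (rule mB)
  finally have "measure lebesgue E \<le> C*(r powr (d - 2)*r^2)/K"
   using K r by (simp add: field_simps)
  also have "r powr (d - 2)*r^2 = r powr d"
   using r powr_add[of r "d - 2" 2] by simp
  finally have "measure lebesgue E/vol r \<le> C/(K*\<omega>)"
   using r \<omega> K by (simp add: vol_def \<omega>_def[symmetric] field_simps)
  also have "C/(K*\<omega>) = \<epsilon>" using C \<omega> \<epsilon> by (simp add: K_def)
  finally have "(measure lebesgue E/vol r) powr a \<le> \<epsilon> powr a"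
   using vol_pos[OF r] a by (intro powr_mono2) auto
  hence le\<epsilon>: "(measure lebesgue E/vol r) powr (1 - 1/q) \<le> \<epsilon> powr a" by (simp add: a_def)
  have "mass E \<le> RHC*(measure lebesgue E/vol r) powr (1 - 1/q)*mass ?B"
   by (rule mass_subset[OF r E]) (auto simp: E_def)
  also have "... \<le> RHC*\<epsilon> powr a*mass ?B"
   by (rule mult_right_mono[OF mult_left_mono[OF le\<epsilon> less_imp_le[OF RHC(1)]] mass_nonneg])
  finally have half: "mass E \<le> mass ?B/2" using \<epsilon> by simp
  define G where "G = ?B - E"
  have G: "G \<in> sets lebesgue" unfolding G_def by (rule sets.Diff[OF _ E]) simp
  have "mass (E \<union> G) = mass E + mass G"
   using bE G E by (intro mass_Un_disjoint) (auto simp: G_def intro: bounded_subset[OF bounded_ball])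
  moreover have "E \<union> G = ?B" by (auto simp: G_def E_def)
  ultimately have "mass ?B/2 \<le> mass G" using half by simp
  hence "1/(2*C)*r powr (d - 2) \<le> mass G" using mB' by simp
  moreover have "G \<subseteq> ?B" "\<forall>y\<in>G. V y \<le> K/r^2" by (auto simp: G_def E_def)
  ultimately show "\<exists>G \<in> sets lebesgue. G \<subseteq> ball x (mrad x) \<and> (\<forall>y\<in>G. V y \<le> K/(mrad x)^2) \<and> 1/(2*C)*mrad x powr (d - 2) \<le> mass G"
   using G by (auto simp: r_def)
 qed
qed

text \<open>Integrate u(y)^2 V(z) <= 2 V(z) (u(y) - u(z))^2 + 2 V(z) u(z)^2 over y in the ball and z
  in its good part. On the left the mass of the good part is bounded below; on the right its bound V
  <= K/r^2 lets \<open>Poincare_ball\<close> control the first term.\<close>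

lemma (in rh_potential) Fefferman_Phong_ball:
 obtains C where "0 < C"
  "\<And>u Du x. u \<in> BM ==> Du \<in> BM ==> L2 u ==>
   L2 Du ==> weak_gradient u Du ==>
   (\<integral>y\<in>ball x (mrad x). ennreal ((u y)^2))
    \<le> ennreal (C*(mrad x)^2)*(\<integral>y\<in>ball x (mrad x). ennreal ((norm (Du y))^2 + V y*(u y)^2))"
proof -
 obtain K c where K: "0 < K" "0 < c" and good:
  "\<And>x. \<exists>G \<in> sets lebesgue. G \<subseteq> ball x (mrad x) \<and> (\<forall>y\<in>G. V y \<le> K/(mrad x)^2) \<and> c*mrad x powr (d - 2) \<le> mass G"
  by (rule critical_good_part) (rule that; blast)
 define \<omega> where "\<omega> = unit_ball_vol d"
 have \<omega>: "0 < \<omega>" by (simp add: \<omega>_def unit_ball_vol_pos')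
 \<comment> \<open>The first summand is 2K/r^2 times the factor (2r)^2 vol (2r)/vol r of
   \<open>Poincare_ball\<close>; the second is the coefficient of the term V u^2.\<close>
 define K' where "K' = 8*K*2 powr d + 2"
 have K': "0 < K'" using K by (simp add: K'_def add_pos_pos)
 define C where "C = \<omega>*K'/c"
 have C: "0 < C" using K \<omega> K' by (simp add: C_def)
 show ?thesis
 proof (rule that[OF C])
  fix u :: "'a => real" and Du x
  assume mb: "u \<in> BM" "Du \<in> BM" and u: "L2 u"
   and Du: "L2 Du" and wg: "weak_gradient u Du"
  note [measurable] = L2_measurable[OF u] L2_measurable[OF Du]
  define r where "r = mrad x"
  have r: "0 < r" by (simp add: r_def mrad_pos)
  let ?B = "ball x r"
  have [measurable]: "?B \<in> sets lebesgue" by simp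
  obtain G where G[measurable]: "G \<in> sets lebesgue" and GB: "G \<subseteq> ?B" and GV: "\<And>y. y \<in> G ==> V y \<le> K/r^2"
   and Gm: "c*r powr (d - 2) \<le> mass G"
   using good[of x] by (auto simp: r_def)
  have bG: "bounded G" using GB bounded_ball bounded_subset by blast
  let ?U = "(\<integral>y\<in>?B. ennreal ((u y)^2))"
  let ?D = "(\<integral>y\<in>?B. ennreal ((norm (Du y))^2))"
  let ?W = "(\<integral>y\<in>?B. ennreal (V y*(u y)^2))"
  have [measurable]: "?B \<in> sets borel" by simp
  define a where "a y = (\<integral>\<^sup>+z. ennreal ((u y - u z)^2)*indicator ?B z \<partial>lborel)" for y
  note [measurable] = mb
  have [measurable]: "a \<in> BM" unfolding a_def by measurable
  let ?P = "\<lambda>y z. ennreal (2*K/r^2)*(ennreal ((u y - u z)^2)*indicator ?B z)*indicator ?B y"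
  let ?R = "\<lambda>y z. (ennreal 2*(ennreal (V z*(u z)^2)*indicator ?B z))*indicator ?B y"
  have mI: "indicator ?B \<in> LM" "indicator G \<in> LM" for x r
   by (intro borel_measurable_indicator; simp)+
  have "ennreal (c*r powr (d - 2))*?U \<le> ennreal (mass G)*?U"
   using Gm by (intro mult_right_mono ennreal_leI) auto
  also have "... = (\<integral>y. (ennreal ((u y)^2)*indicator ?B y)*ennreal (mass G))"
   unfolding mult.commute[of "ennreal (mass G)"]
   by (rule nn_integral_multc[symmetric]) (intro borel_measurable_times_ennreal mI, measurable)
  also have "... = (\<integral>y. \<integral>z. (ennreal ((u y)^2)*indicator ?B y)*(ennreal (V z)*indicator G z))"
   unfolding ennreal_mass[OF bG]
   by (intro nn_integral_cong nn_integral_cmult[symmetric] borel_measurable_times_ennreal mI) measurable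
  also have "... \<le> (\<integral>y. \<integral>z. ?P y z + ?R y z)"
  proof (intro nn_integral_mono)
   fix y z
   have "(u y)^2*V z \<le> 2*K/r^2*(u y - u z)^2 + 2*(V z*(u z)^2)" if "z \<in> G"
   proof -
    have "(u y)^2 \<le> 2*(u y - u z)^2 + 2*(u z)^2"
    proof -
     have "0 \<le> ((u y - u z) - u z)^2" by simp
     thus ?thesis by (simp add: power2_eq_square algebra_simps)
    qed
    hence "(u y)^2*V z \<le> (2*(u y - u z)^2 + 2*(u z)^2)*V z"
     by (intro mult_right_mono V_nonneg)
    also have "... = V z*(2*(u y - u z)^2) + 2*(V z*(u z)^2)" by (simp add: algebra_simps)
    also have "V z*(2*(u y - u z)^2) \<le> K/r^2*(2*(u y - u z)^2)"
     using GV[OF that] by (intro mult_right_mono) auto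
    finally show ?thesis by (simp add: mult_ac)
   qed
   hence key: "ennreal ((u y)^2)*ennreal (V z) \<le> ennreal (2*K/r^2)*ennreal ((u y - u z)^2) + ennreal 2*ennreal (V z*(u z)^2)" if "z \<in> G"
    using that K V_nonneg[of z]
    by (simp add: ennreal_mult[symmetric] ennreal_plus[symmetric] del: ennreal_plus ennreal_numeral)
   show "(ennreal ((u y)^2)*indicator ?B y)*(ennreal (V z)*indicator G z) \<le> ?P y z + ?R y z"
   proof (cases "z \<in> G \<and> y \<in> ?B")
    case True
    hence "z \<in> G" "z \<in> ?B" "y \<in> ?B" using GB by auto
    thus ?thesis using key by (simp only: indicator_simps mult_1_right)
   qed (auto simp: indicator_def)
  qed
  also have "... = (\<integral>y. ennreal (2*K/r^2)*(a y*indicator ?B y) + (ennreal 2*?W)*indicator ?B y)"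
  proof (rule nn_integral_cong)
   fix y
   have "(\<integral>z. ?P y z + ?R y z) = (\<integral>z. ?P y z) + (\<integral>z. ?R y z)"
    by (intro nn_integral_add borel_measurable_times_ennreal mI) measurable
   also have "(\<integral>z. ?P y z) = ennreal (2*K/r^2)*a y*indicator ?B y"
    unfolding a_def nn_integral_completion[of lborel, symmetric]
    by (subst nn_integral_multc nn_integral_cmult; (intro borel_measurable_times_ennreal mI; measurable)?)+ simp
   also have "(\<integral>z. ?R y z) = (ennreal 2*?W)*indicator ?B y"
    by (subst nn_integral_multc nn_integral_cmult; (intro borel_measurable_times_ennreal mI; measurable)?)+ simp
   finally show "(\<integral>z. ?P y z + ?R y z) = ennreal (2*K/r^2)*(a y*indicator ?B y) + (ennreal 2*?W)*indicator ?B y"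
    by (simp add: mult.assoc)
  qed
  also have "... = ennreal (2*K/r^2)*(\<integral>y\<in>?B. a y) + (ennreal 2*?W)*ennreal (vol r)"
  proof -
   have "(\<integral>y. indicator ?B y) = ennreal (vol r)"
    using emeasure_ball_vol[of r x] r by (subst nn_integral_indicator) auto
   moreover have "a \<in> LM" by (rule LM_of_BM) fact
   ultimately show ?thesis
    by (subst nn_integral_add) (auto simp: nn_integral_cmult mI intro!: borel_measurable_times_ennreal mI)
  qed
  also have "(\<integral>y\<in>?B. a y) \<le> ennreal ((2*r)^2)*emeasure lborel (ball (0::'a) (2*r))*?D"
   using Poincare_ball[OF mb u Du wg r, of x] by (simp add: nn_integral_completion a_def)
  also have "emeasure lborel (ball (0::'a) (2*r)) = ennreal (vol (2*r))"
   using emeasure_ball_vol[of "2*r" 0] r by simp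
  also have "ennreal (2*K/r^2)*(ennreal ((2*r)^2)*ennreal (vol (2*r))*?D) + (ennreal 2*?W)*ennreal (vol r)
    = ennreal (8*K * vol (2*r))*?D + ennreal (2 * vol r)*?W"
  proof -
   have "ennreal (2*K/r^2)*(ennreal ((2*r)^2)*ennreal (vol (2*r))) = ennreal (2*K/r^2*((2*r)^2 * vol (2*r)))"
    using K r vol_pos[of "2*r"] by (simp only: ennreal_mult[symmetric] divide_nonneg_nonneg mult_nonneg_nonneg zero_le_power2 less_imp_le zero_le_numeral mult_pos_pos zero_less_numeral)
   also have "2*K/r^2*((2*r)^2 * vol (2*r)) = 8*K * vol (2*r)"
    using r by (simp add: power_mult_distrib)
   finally have 1: "ennreal (2*K/r^2)*(ennreal ((2*r)^2)*ennreal (vol (2*r))) = ennreal (8*K * vol (2*r))" .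
   have 2: "ennreal 2*ennreal (vol r) = ennreal (2 * vol r)"
    using vol_pos[OF r] by (simp only: ennreal_mult[symmetric] less_imp_le zero_le_numeral)
   show ?thesis unfolding 1[symmetric] 2[symmetric] by (simp only: mult_ac)
  qed
  also have "... \<le> ennreal (vol r*K')*?D + ennreal (vol r*K')*?W"
  proof (intro add_mono mult_right_mono ennreal_leI)
   have "vol (2*r) = 2 powr d * vol r" using r by (simp add: vol_def powr_mult)
   thus "8*K * vol (2*r) \<le> vol r*K'" using vol_pos[OF r] by (simp add: K'_def algebra_simps)
   show "2 * vol r \<le> vol r*K'" using vol_pos[OF r] K by (simp add: K'_def algebra_simps)
  qed auto
  also have "... = ennreal (vol r*K')*(?D + ?W)" by (simp add: distrib_left)
  also have "?D + ?W = (\<integral>y\<in>?B. ennreal ((norm (Du y))^2 + V y*(u y)^2))"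
  proof -
   have "?D + ?W = (\<integral>y. ennreal ((norm (Du y))^2)*indicator ?B y + ennreal (V y*(u y)^2)*indicator ?B y)"
    by (rule nn_integral_add[symmetric]; intro borel_measurable_times_ennreal mI; measurable)
   also have "... = (\<integral>y\<in>?B. ennreal ((norm (Du y))^2 + V y*(u y)^2))"
    by (intro nn_integral_cong) (simp add: indicator_def ennreal_plus V_nonneg)
   finally show ?thesis .
  qed
  finally have fin: "ennreal (c*r powr (d - 2))*?U \<le> ennreal (vol r*K')*(\<integral>y\<in>?B. ennreal ((norm (Du y))^2 + V y*(u y)^2))"
   (is "_ \<le> _*?E") by (simp add: mult_left_mono add_mono)
  define b where "b = c*r powr (d - 2)"
  have b: "0 < b" using K r by (simp add: b_def)
  have "?U = ennreal (1/b)*(ennreal b*?U)"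
   using b by (simp add: mult.assoc[symmetric] ennreal_mult[symmetric])
  also have "... \<le> ennreal (1/b)*(ennreal (vol r*K')*?E)"
   using fin by (intro mult_left_mono) (auto simp: b_def)
  also have "... = ennreal (1/b*(vol r*K'))*?E"
   using b K' vol_pos[OF r] by (simp add: mult.assoc[symmetric] ennreal_mult[symmetric])
  also have "1/b*(vol r*K') = C*r^2"
  proof -
   have "r powr d = r powr (d - 2)*r^2" using r powr_add[of r "d - 2" 2] by simp
   thus ?thesis using r K by (simp add: b_def C_def vol_def \<omega>_def field_simps)
  qed
  finally show "(\<integral>y\<in>ball x (mrad x). ennreal ((u y)^2))
    \<le> ennreal (C*(mrad x)^2)*(\<integral>y\<in>ball x (mrad x). ennreal ((norm (Du y))^2 + V y*(u y)^2))"
   by (simp add: r_def)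
 qed
qed

lemma (in rh_potential) mrad_comparable:
 obtains A where "1 \<le> A" "\<And>x y. dist x y < mrad x ==> mrad x \<le> A*mrad y \<and> mrad y \<le> A*mrad x"
proof -
 obtain C k k1 where C: "1 \<le> C" "0 \<le> k" "0 \<le> k1"
  and "\<And>x r. 0 < r ==> r \<le> mrad x ==> \<Psi> x r \<le> C*(r/mrad x) powr \<delta>0"
  "\<And>x r. mrad x \<le> r ==> \<Psi> x r \<le> C*(r/mrad x) powr k"
  and "\<And>x. 1/C \<le> \<Psi> x (mrad x)"
  and "\<And>x. mrad x \<le> C*\<rho> x" and slow: "\<And>x y. mrad x/C*(1 + dist x y/mrad x) powr (- k1) \<le> mrad y"
  by (rule critical_scale) (rule that; blast)
 define A where "A = C*2 powr k1"
 have "1*1 \<le> A" unfolding A_def using C by (intro mult_mono ge_one_powr_ge_zero) auto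
 hence A: "1 \<le> A" by simp
 have le: "mrad x \<le> A*mrad y" if "dist x y < mrad x" for x y
 proof -
  have m: "0 < mrad x" by (rule mrad_pos)
  have "2 powr (- k1) \<le> (1 + dist x y/mrad x) powr (- k1)"
   using that m C by (intro powr_mono2') (auto simp: add_pos_nonneg)
  hence "mrad x/C*2 powr (- k1) \<le> mrad x/C*(1 + dist x y/mrad x) powr (- k1)"
   using m C by (intro mult_left_mono) auto
  also have "... \<le> mrad y" by (rule slow)
  finally show ?thesis using C by (simp add: A_def powr_minus_divide divide_le_eq mult_ac)
 qed
 show ?thesis
 proof (rule that[OF A])
  fix x y assume d: "dist x y < mrad x"
  have "mrad y \<le> A*mrad x"
  proof (cases "dist y x < mrad y")
   case False
   hence "mrad y \<le> mrad x" using d by (simp add: dist_commute)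
   also have "... \<le> A*mrad x" using A mrad_pos[of x] by simp
   finally show ?thesis .
  qed (rule le)
  thus "mrad x \<le> A*mrad y \<and> mrad y \<le> A*mrad x" using le[OF d] by simp
 qed
qed

text \<open>Averaging the local inequality over all critical balls gives the global one.\<close>

lemma (in rh_potential) Fefferman_Phong:
 obtains CF where "0 < CF"
  "\<And>u Du. form_domain V u Du ==>
   (\<integral>x. ennreal ((u x/mrad x)^2)) \<le> ennreal CF*(\<integral>x. ennreal ((norm (Du x))^2 + V x*(u x)^2))"
proof -
 obtain C where C: "0 < C" and ball:
  "\<And>u Du x. u \<in> BM ==> Du \<in> BM ==> L2 u ==>
   L2 Du ==> weak_gradient u Du ==>
   (\<integral>y\<in>ball x (mrad x). ennreal ((u y)^2))
    \<le> ennreal (C*(mrad x)^2)*(\<integral>y\<in>ball x (mrad x). ennreal ((norm (Du y))^2 + V y*(u y)^2))"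
  by (rule Fefferman_Phong_ball) (rule that; blast)
 obtain A where A: "1 \<le> A" and cmp: "\<And>x y. dist x y < mrad x ==> mrad x \<le> A*mrad y \<and> mrad y \<le> A*mrad x"
  by (rule mrad_comparable) (rule that; blast)
 define \<omega> where "\<omega> = unit_ball_vol d"
 have \<omega>: "0 < \<omega>" by (simp add: \<omega>_def unit_ball_vol_pos')
 \<comment> \<open>The local inequalities are averaged over their centres x with weight
   \<open>mrad x\<close> to the power -d, up to which each y is counted a bounded number of times:
   \<open>c2\<close> is the upper bound. \<open>c1\<close> is the lower bound for the weight with
   the additional factor \<open>mrad x\<close> to the power -2.\<close>
 define c1 where "c1 = \<omega>*(1/A) powr d*A powr (- d - 2)"
 define c2 where "c2 = \<omega>*A powr d*A powr d"
 have c: "0 < c1" "0 < c2" using \<omega> A by (auto simp: c1_def c2_def)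
 define I :: "'a \<times> 'a => ennreal" where "I z = indicator {z. dist (fst z) (snd z) < mrad (fst z)} z" for z
 have I[measurable]: "I \<in> LM2"
 proof (rule borel_measurable_lebesgue_pair)
  have 1: "(\<lambda>z::'a \<times> 'a. mrad (fst z)) \<in> BM"
   by (rule measurable_compose[OF _ mrad_measurable]) (intro BM_continuous continuous_intros)
  have 2: "(\<lambda>z::'a \<times> 'a. dist (fst z) (snd z)) \<in> BM"
   by (intro BM_continuous continuous_intros)
  have "{z::'a \<times> 'a. dist (fst z) (snd z) < mrad (fst z)} \<in> sets borel"
   using borel_measurable_less[OF 2 1] by simp
  thus "I \<in> BM"
   unfolding I_def[abs_def] by (intro borel_measurable_indicator)
 qed
 have Iball: "I (x, y) = indicator (ball x (mrad x)) y" for x y by (auto simp: I_def indicator_def)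
 have mm: "mrad \<in> LM" by (rule LM_of_BM[OF mrad_measurable])
 have low: "ennreal (c1/(mrad y)^2) \<le> (\<integral>x. ennreal (mrad x powr (- d - 2))*I (x, y))" for y
 proof -
  let ?m = "mrad y"
  have m: "0 < ?m" by (rule mrad_pos)
  have "ennreal (c1/?m^2) = ennreal ((A*?m) powr (- d - 2))*ennreal (vol (?m/A))"
  proof -
   have "(A*?m) powr (- d - 2) * vol (?m/A) = c1*(?m powr (- d - 2)*?m powr d)"
    using A m by (simp add: c1_def vol_def \<omega>_def powr_mult powr_divide)
   also have "?m powr (- d - 2)*?m powr d = 1/?m^2"
    using m powr_add[of ?m "- d - 2" d] powr_minus_divide[of ?m 2] by simp
   finally show ?thesis using A m vol_pos[of "?m/A"] by (simp add: ennreal_mult[symmetric])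
  qed
  also have "... = (\<integral>x. ennreal ((A*?m) powr (- d - 2))*indicator (ball y (?m/A)) x)"
   using A m emeasure_ball_vol[of "?m/A" y] by (subst nn_integral_cmult_indicator) auto
  also have "... \<le> (\<integral>x. ennreal (mrad x powr (- d - 2))*I (x, y))"
  proof (rule nn_integral_mono)
   fix x
   show "ennreal ((A*?m) powr (- d - 2))*indicator (ball y (?m/A)) x \<le> ennreal (mrad x powr (- d - 2))*I (x, y)"
   proof (cases "dist y x < ?m/A")
    case True
    have "?m/A \<le> ?m" using A m by (simp add: divide_le_eq)
    hence d: "dist y x < ?m" using True by simp
    note e = cmp[OF d]
    have "?m/A \<le> mrad x" using e A by (simp add: divide_le_eq mult.commute)
    hence "dist x y < mrad x" using True by (simp add: dist_commute)
    hence "I (x, y) = 1" by (simp add: I_def)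
    moreover have "(A*?m) powr (- d - 2) \<le> mrad x powr (- d - 2)"
     using e mrad_pos[of x] d3 by (intro powr_mono2') auto
    ultimately show ?thesis using True by (simp add: ennreal_leI)
   qed simp
  qed
  finally show ?thesis .
 qed
 have upp: "(\<integral>x. ennreal (mrad x powr (- d))*I (x, y)) \<le> ennreal c2" for y
 proof -
  let ?m = "mrad y"
  have m: "0 < ?m" by (rule mrad_pos)
  have "(\<integral>x. ennreal (mrad x powr (- d))*I (x, y))
    \<le> (\<integral>x. ennreal ((?m/A) powr (- d))*indicator (ball y (A*?m)) x)"
  proof (rule nn_integral_mono)
   fix x
   show "ennreal (mrad x powr (- d))*I (x, y) \<le> ennreal ((?m/A) powr (- d))*indicator (ball y (A*?m)) x"
   proof (cases "dist x y < mrad x")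
    case True
    note e = cmp[OF True]
    have "?m/A \<le> mrad x" using e A by (simp add: divide_le_eq mult.commute)
    hence "mrad x powr (- d) \<le> (?m/A) powr (- d)" using m A d3 by (intro powr_mono2') auto
    moreover have "x \<in> ball y (A*?m)" using True e by (simp add: dist_commute)
    ultimately show ?thesis using True by (simp add: ennreal_leI I_def)
   qed (simp add: I_def)
  qed
  also have "... = ennreal ((?m/A) powr (- d))*ennreal (vol (A*?m))"
   using A m emeasure_ball_vol[of "A*?m" y] by (subst nn_integral_cmult_indicator) auto
  also have "... = ennreal c2"
  proof -
   have "(?m/A) powr (- d) * vol (A*?m) = c2*(?m powr (- d)*?m powr d)"
    using A m by (simp add: c2_def vol_def \<omega>_def powr_mult powr_divide powr_minus_divide)
   also have "?m powr (- d)*?m powr d = 1" using m by (simp flip: powr_add)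
   finally show ?thesis using A m vol_pos[of "A*?m"] by (simp add: ennreal_mult[symmetric])
  qed
  finally show ?thesis .
 qed
 define CF where "CF = C*c2/c1"
 have CF: "0 < CF" using C c by (simp add: CF_def)
 have borel: "(\<integral>x. ennreal ((u x/mrad x)^2)) \<le> ennreal CF*(\<integral>x. ennreal ((norm (Du x))^2 + V x*(u x)^2))"
  if b: "u \<in> BM" "Du \<in> BM" "L2 u" "L2 Du" "weak_gradient u Du"
  for u and Du :: "'a => 'a"
 proof -
  define E where "E x = ennreal ((norm (Du x))^2 + V x*(u x)^2)" for x
  define U where "U x = ennreal ((u x)^2)" for x
  note [measurable] = L2_measurable[OF b(3)] L2_measurable[OF b(4)] mm
  have E: "E \<in> LM" and U: "U \<in> LM" unfolding E_def U_def by measurable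
  have pm: "(\<lambda>x. ennreal (mrad x powr p)) \<in> LM" for p by measurable
  have I1: "(\<lambda>x. I (x, y)) \<in> LM" "(\<lambda>y. I (x, y)) \<in> LM" for x y
   using measurable_compose[OF measurable_Pair2' I] measurable_compose[OF measurable_Pair1' I] by auto
  have sw: "(\<integral>x. ennreal (mrad x powr p)*(\<integral>y. F y*I (x, y)))
    = (\<integral>y. F y*(\<integral>x. ennreal (mrad x powr p)*I (x, y)))"
   if F: "F \<in> LM" for F p
  proof -
   have "(\<integral>x. ennreal (mrad x powr p)*(\<integral>y. F y*I (x, y)))
    = (\<integral>x. \<integral>y. ennreal (mrad x powr p)*(F y*I (x, y)))"
    by (intro nn_integral_cong nn_integral_cmult[symmetric] borel_measurable_times_ennreal F I1)
   also have "... = (\<integral>y. \<integral>x. ennreal (mrad x powr p)*(F y*I (x, y)))"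
   proof (rule Tonelli_lebesgue)
    have "(\<lambda>z. ennreal (mrad (fst z) powr p)*(F (snd z)*I z)) \<in> LM2"
     by (intro borel_measurable_times_ennreal I measurable_compose[OF measurable_fst pm] measurable_compose[OF measurable_snd F])
    thus "(\<lambda>(x, y). ennreal (mrad x powr p)*(F y*I (x, y))) \<in> LM2"
     by (simp add: case_prod_beta')
   qed
   also have "... = (\<integral>y. F y*(\<integral>x. ennreal (mrad x powr p)*I (x, y)))"
    unfolding mult.left_commute[of "ennreal _" "F _"]
    by (intro nn_integral_cong nn_integral_cmult borel_measurable_times_ennreal pm I1)
   finally show ?thesis .
  qed
  have "ennreal c1*(\<integral>y. ennreal ((u y/mrad y)^2)) = (\<integral>y. ennreal c1*ennreal ((u y/mrad y)^2))"
   by (rule nn_integral_cmult[symmetric]) measurable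
  also have "... = (\<integral>y. U y*ennreal (c1/(mrad y)^2))"
   using c by (intro nn_integral_cong) (simp add: U_def ennreal_mult[symmetric] power_divide mult.commute)
  also have "... \<le> (\<integral>y. U y*(\<integral>x. ennreal (mrad x powr (- d - 2))*I (x, y)))"
   by (intro nn_integral_mono mult_left_mono low) auto
  also have "... = (\<integral>x. ennreal (mrad x powr (- d - 2))*(\<integral>y. U y*I (x, y)))"
   by (rule sw[OF U, symmetric])
  also have "... \<le> (\<integral>x. ennreal C*(ennreal (mrad x powr (- d))*(\<integral>y. E y*I (x, y))))"
  proof (rule nn_integral_mono)
   fix x
   have m: "0 < mrad x" by (rule mrad_pos)
   have "ennreal (mrad x powr (- d - 2))*(\<integral>y. U y*I (x, y))
    \<le> ennreal (mrad x powr (- d - 2))*(ennreal (C*(mrad x)^2)*(\<integral>y. E y*I (x, y)))"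
    using ball[OF b, of x] by (intro mult_left_mono) (simp_all add: Iball U_def E_def)
   also have "... = ennreal (mrad x powr (- d - 2)*(C*(mrad x)^2))*(\<integral>y. E y*I (x, y))"
    using C by (subst ennreal_mult) (auto simp: mult.assoc)
   also have "mrad x powr (- d - 2)*(C*(mrad x)^2) = C*mrad x powr (- d)"
    using m powr_add[of "mrad x" "- d - 2" 2] by (simp add: mult.left_commute)
   also have "ennreal (C*mrad x powr (- d)) = ennreal C*ennreal (mrad x powr (- d))"
    using C by (intro ennreal_mult) auto
   finally show "ennreal (mrad x powr (- d - 2))*(\<integral>y. U y*I (x, y))
    \<le> ennreal C*(ennreal (mrad x powr (- d))*(\<integral>y. E y*I (x, y)))"
    by (simp add: mult.assoc)
  qed
  also have "... = ennreal C*(\<integral>x. ennreal (mrad x powr (- d))*(\<integral>y. E y*I (x, y)))"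
  proof (rule nn_integral_cmult)
   interpret sigma_finite_measure "lebesgue :: 'a measure" by (rule sigma_finite_lebesgue)
   have "(\<lambda>z. E (snd z)*I z) \<in> LM2"
    by (intro borel_measurable_times_ennreal I measurable_compose[OF measurable_snd E])
   hence "(\<lambda>x. \<integral>y. E y*I (x, y)) \<in> LM"
    by (intro borel_measurable_nn_integral) (simp add: case_prod_beta')
   thus "(\<lambda>x. ennreal (mrad x powr (- d))*(\<integral>y. E y*I (x, y))) \<in> LM"
    by (intro borel_measurable_times_ennreal pm)
  qed
  also have "... = ennreal C*(\<integral>y. E y*(\<integral>x. ennreal (mrad x powr (- d))*I (x, y)))"
   by (simp only: sw[OF E])
  also have "... \<le> ennreal C*(\<integral>y. E y*ennreal c2)"
   by (intro mult_left_mono nn_integral_mono upp) auto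
  also have "(\<integral>y. E y*ennreal c2) = (\<integral>y. E y)*ennreal c2"
   by (rule nn_integral_multc[OF E])
  finally have fin: "ennreal c1*(\<integral>y. ennreal ((u y/mrad y)^2)) \<le> ennreal C*((\<integral>y. E y)*ennreal c2)" .
  have "(\<integral>y. ennreal ((u y/mrad y)^2)) = ennreal (1/c1)*(ennreal c1*(\<integral>y. ennreal ((u y/mrad y)^2)))"
   using c by (simp add: mult.assoc[symmetric] ennreal_mult[symmetric])
  also have "... \<le> ennreal (1/c1)*(ennreal C*((\<integral>y. E y)*ennreal c2))"
   using fin by (rule mult_left_mono) simp
  also have "... = (ennreal (1/c1)*ennreal C*ennreal c2)*(\<integral>y. E y)" by (simp only: mult_ac)
  also have "ennreal (1/c1)*ennreal C*ennreal c2 = ennreal CF"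
   using c C by (simp add: CF_def ennreal_mult[symmetric])
  finally show ?thesis by (simp add: E_def)
 qed
 show ?thesis
 proof (rule that[OF CF])
  fix u and Du :: "'a => 'a" assume f: "form_domain V u Du"
  hence f': "L2 u" "L2 Du" "weak_gradient u Du" by (auto simp: form_domain_def)
  obtain u' Du' where v: "u' \<in> BM" "Du' \<in> BM"
   "AE x. u x = u' x" "AE x. Du x = Du' x"
   "L2 u'" "L2 Du'" "weak_gradient u' Du'"
   using weak_gradient_borel_version[OF f'] .
  have "(\<integral>x. ennreal ((u x/mrad x)^2)) = (\<integral>x. ennreal ((u' x/mrad x)^2))"
   by (rule nn_integral_cong_AE) (use v(3) in \<open>auto elim!: eventually_mono\<close>)
  also have "... \<le> ennreal CF*(\<integral>x. ennreal ((norm (Du' x))^2 + V x*(u' x)^2))"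
   by (rule borel[OF v(1,2,5,6,7)])
  also have "(\<integral>x. ennreal ((norm (Du' x))^2 + V x*(u' x)^2)) = (\<integral>x. ennreal ((norm (Du x))^2 + V x*(u x)^2))"
   by (rule nn_integral_cong_AE) (use v(3,4) in eventually_elim, simp)
  finally show "(\<integral>x. ennreal ((u x/mrad x)^2)) \<le> ennreal CF*(\<integral>x. ennreal ((norm (Du x))^2 + V x*(u x)^2))" .
 qed
qed

definition (in rh_potential) CFP :: real where
 "CFP = (SOME CF. 0 < CF \<and> (\<forall>u Du. form_domain V u Du -->
  (\<integral>x. ennreal ((u x/mrad x)^2)) \<le> ennreal CF*(\<integral>x. ennreal ((norm (Du x))^2 + V x*(u x)^2))))"

lemma (in rh_potential) CFP:
 "0 < CFP" "form_domain V u Du ==> (\<integral>x. ennreal ((u x/mrad x)^2)) \<le> ennreal CFP*(\<integral>x. ennreal ((norm (Du x))^2 + V x*(u x)^2))"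
proof -
 have "\<exists>CF. 0 < CF \<and> (\<forall>u Du. form_domain V u Du -->
  (\<integral>x. ennreal ((u x/mrad x)^2)) \<le> ennreal CF*(\<integral>x. ennreal ((norm (Du x))^2 + V x*(u x)^2)))"
  by (rule Fefferman_Phong) blast
 from someI_ex[OF this, folded CFP_def]
 show "0 < CFP" "form_domain V u Du ==> (\<integral>x. ennreal ((u x/mrad x)^2)) \<le> ennreal CFP*(\<integral>x. ennreal ((norm (Du x))^2 + V x*(u x)^2))" by auto
qed

section \<open>The heat flow\<close>

subsection \<open>Differentiability with values in square integrable functions\<close>

text \<open>Square integrability is required separately: \<open>l2_norm\<close> of a function whose
  square is not integrable is 0, so convergence of the norms alone would say nothing.\<close>

definition l2_deriv :: "(real => 'a::euclidean_space => real) => ('a => real) => real => bool" where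
 "l2_deriv U D t \<longleftrightarrow> L2 D \<and> L2 (U t) \<and>
  (\<forall>\<^sub>F h in at 0. L2 (U (t + h))) \<and>
  ((\<lambda>h. l2_norm (\<lambda>x. (U (t + h) x - U t x)/h - D x)) \<longlongrightarrow> 0) (at 0)"

lemma l2_derivD:
 assumes "l2_deriv U D t"
 shows "L2 D" "L2 (U t)" "\<forall>\<^sub>F h in at 0. L2 (U (t + h))"
  "((\<lambda>h. l2_norm (\<lambda>x. (U (t + h) x - U t x)/h - D x)) \<longlongrightarrow> 0) (at 0)"
 using assms by (auto simp: l2_deriv_def)

lemma L2_quotient:
 fixes u v :: "'a::euclidean_space => real"
 assumes "L2 u" "L2 v"
 shows "L2 (\<lambda>x. (u x - v x)/h)"
 using L2_cmult[OF L2_diff[OF assms], of "1/h"] by simp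

lemma l2_deriv_diff:
 assumes U: "l2_deriv U D t" and W: "l2_deriv W E t"
 shows "l2_deriv (\<lambda>t x. U t x - W t x) (\<lambda>x. D x - E x) t"
 unfolding l2_deriv_def
proof (intro conjI)
 note u = l2_derivD[OF U] and w = l2_derivD[OF W]
 show "L2 (\<lambda>x. D x - E x)" "L2 (\<lambda>x. U t x - W t x)"
  using u w by (auto intro: L2_diff)
 show "\<forall>\<^sub>F h in at 0. L2 (\<lambda>x. U (t + h) x - W (t + h) x)"
  using u(3) w(3) by eventually_elim (rule L2_diff)
 show "((\<lambda>h. l2_norm (\<lambda>x. (U (t + h) x - W (t + h) x - (U t x - W t x))/h - (D x - E x))) \<longlongrightarrow> 0) (at 0)"
 proof (rule Lim_null_comparison)
  show "((\<lambda>h. l2_norm (\<lambda>x. (U (t + h) x - U t x)/h - D x) + l2_norm (\<lambda>x. (W (t + h) x - W t x)/h - E x)) \<longlongrightarrow> 0) (at 0)"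
   using tendsto_add[OF u(4) w(4)] by simp
  show "\<forall>\<^sub>F h in at 0. norm (l2_norm (\<lambda>x. (U (t + h) x - W (t + h) x - (U t x - W t x))/h - (D x - E x)))
   \<le> l2_norm (\<lambda>x. (U (t + h) x - U t x)/h - D x) + l2_norm (\<lambda>x. (W (t + h) x - W t x)/h - E x)"
   using u(3) w(3)
  proof eventually_elim
   case (elim h)
   let ?a = "\<lambda>x. (U (t + h) x - U t x)/h - D x" and ?b = "\<lambda>x. (W (t + h) x - W t x)/h - E x"
   have sq: "L2 ?a" "L2 ?b"
    by (rule L2_diff[OF L2_quotient[OF elim(1) u(2)] u(1)],
      rule L2_diff[OF L2_quotient[OF elim(2) w(2)] w(1)])
   have "(\<lambda>x. (U (t + h) x - W (t + h) x - (U t x - W t x))/h - (D x - E x)) = (\<lambda>x. ?a x + (- 1)*?b x)"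
    by (auto simp: fun_eq_iff diff_divide_distrib)
   hence "l2_norm (\<lambda>x. (U (t + h) x - W (t + h) x - (U t x - W t x))/h - (D x - E x)) \<le> l2_norm ?a + l2_norm (\<lambda>x. (- 1)*?b x)"
    using l2_norm_triangle[OF sq(1) L2_cmult[OF sq(2), of "- 1"]] by (simp only:)
   also have "l2_norm (\<lambda>x. (- 1)*?b x) = l2_norm ?b" by (simp only: l2_norm_cmult)
   finally show ?case by (simp add: l2_norm_nonneg)
  qed
 qed
qed

lemma l2_deriv_quotient_bounded:
 assumes U: "l2_deriv U D t"
 shows "\<forall>\<^sub>F h in at 0. l2_norm (\<lambda>x. (U (t + h) x - U t x)/h) \<le> 1 + l2_norm D"
proof -
 note u = l2_derivD[OF U]
 have "\<forall>\<^sub>F h in at 0. l2_norm (\<lambda>x. (U (t + h) x - U t x)/h - D x) < 1"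
  using u(4) by (rule order_tendstoD) simp
 thus ?thesis using u(3)
 proof eventually_elim
  case (elim h)
  let ?a = "\<lambda>x. (U (t + h) x - U t x)/h - D x"
  have sq: "L2 ?a"
   by (rule L2_diff[OF L2_quotient[OF elim(2) u(2)] u(1)])
  have "l2_norm (\<lambda>x. ?a x + D x) \<le> l2_norm ?a + l2_norm D" by (rule l2_norm_triangle[OF sq u(1)])
  thus ?case using elim(1) by simp
 qed
qed

text \<open>The Taylor bound, uniform in x, makes the remainder at most L h^2 times the squared norm
  of the difference quotient, which stays bounded; the linear part converges by Cauchy-Schwarz. The
  dependence on x is for exponential weights.\<close>

lemma has_real_derivative_integral_compose:
 fixes \<Psi> \<beta> :: "'a::euclidean_space => real => real"
 assumes U: "l2_deriv U D t" and m: "\<And>v. v \<in> LM ==> (\<lambda>x. \<Psi> x (v x)) \<in> LM"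
   "\<And>v. v \<in> LM ==> (\<lambda>x. \<beta> x (v x)) \<in> LM"
  and taylor: "\<And>x a b. \<bar>\<Psi> x b - \<Psi> x a - \<beta> x a*(b - a)\<bar> \<le> L*(b - a)^2" and \<Psi>: "\<And>x a. \<bar>\<Psi> x a\<bar> \<le> L*a^2"
  and \<beta>: "\<And>x a. \<bar>\<beta> x a\<bar> \<le> M*\<bar>a\<bar>"
 shows "((\<lambda>t. LINT x. \<Psi> x (U t x)) has_real_derivative (LINT x. \<beta> x (U t x)*D x)) (at t)"
 unfolding DERIV_def
proof (rule LIM_zero_cancel, rule Lim_null_comparison)
 note u = l2_derivD[OF U]
 have L: "0 \<le> L" using \<Psi>[of undefined 1] by simp
 have M: "0 \<le> M" using \<beta>[of undefined 1] by simp
 let ?a = "\<lambda>h x. (U (t + h) x - U t x)/h"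
 let ?bd = "\<lambda>h. l2_norm (\<lambda>x. \<beta> x (U t x))*l2_norm (\<lambda>x. ?a h x - D x) + \<bar>h\<bar>*(L*(1 + l2_norm D)^2)"
 have "(?bd \<longlongrightarrow> l2_norm (\<lambda>x. \<beta> x (U t x))*0 + \<bar>0\<bar>*(L*(1 + l2_norm D)^2)) (at 0)"
  by (intro tendsto_intros u(4))
 thus "(?bd \<longlongrightarrow> 0) (at 0)" by simp
 have i\<Psi>: "L1 (\<lambda>x. \<Psi> x (v x))" if "L2 v" for v :: "'a => real"
 proof (rule Bochner_Integration.integrable_bound)
  show "L1 (\<lambda>x. L*(v x)^2)" using that by (simp add: square_integrable_def)
  show "(\<lambda>x. \<Psi> x (v x)) \<in> LM"
   by (rule m(1)[OF L2_measurable[OF that]])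
  show "AE x. norm (\<Psi> x (v x)) \<le> norm (L*(v x)^2)" using \<Psi> L by simp
 qed
 have s\<beta>: "L2 (\<lambda>x. \<beta> x (U t x))"
  by (rule L2_bound[OF L2_cmult[OF u(2), of M]])
   (use \<beta> M m(2)[OF L2_measurable[OF u(2)]] in \<open>auto simp: abs_mult\<close>)
 have "\<forall>\<^sub>F h in at (0::real). h \<noteq> 0" by (simp add: eventually_at_filter)
 thus "\<forall>\<^sub>F h in at 0. norm (((LINT x. \<Psi> x (U (t + h) x)) - (LINT x. \<Psi> x (U t x)))/h
   - (LINT x. \<beta> x (U t x)*D x)) \<le> ?bd h"
  using u(3) l2_deriv_quotient_bounded[OF U]
 proof eventually_elim
  case (elim h)
  have sa: "L2 (?a h)" using elim u by (auto intro!: L2_quotient)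
  have sd: "L2 (\<lambda>x. ?a h x - D x)" by (rule L2_diff[OF sa u(1)])
  define R where "R x = (\<Psi> x (U (t + h) x) - \<Psi> x (U t x)) - \<beta> x (U t x)*(U (t + h) x - U t x)" for x
  have iu: "L1 (\<lambda>x. \<beta> x (U t x)*(U (t + h) x - U t x))"
   by (rule integrable_mult_L2[OF s\<beta> L2_diff[OF elim(2) u(2)]])
  have iR: "L1 R" unfolding R_def
   by (intro Bochner_Integration.integrable_diff i\<Psi> elim u iu)
  have Rb: "\<bar>R x\<bar> \<le> L*h^2*(?a h x)^2" for x
   using taylor[of x "U (t + h) x" "U t x"] elim(1) by (simp add: R_def power_divide)
  have isq: "L1 (\<lambda>x. (?a h x)^2)"
   using L2_integrable[OF sa] unfolding real_norm_def power2_abs .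
  have "\<bar>LINT x. R x\<bar> \<le> (LINT x. \<bar>R x\<bar>)" by (rule integral_abs_bound)
  also have "... \<le> (LINT x. L*h^2*(?a h x)^2)"
   using iR isq Rb by (intro integral_mono integrable_abs) auto
  also have "... = L*h^2*(l2_norm (?a h))^2" by (simp add: l2_norm_power2 del: times_divide_eq_right)
  also have "... \<le> L*h^2*(1 + l2_norm D)^2"
   using elim(3) L by (intro mult_left_mono power_mono l2_norm_nonneg) auto
  finally have R: "\<bar>LINT x. R x\<bar> \<le> h^2*(L*(1 + l2_norm D)^2)" by (simp add: mult_ac)
  have "(LINT x. R x) = ((LINT x. \<Psi> x (U (t + h) x)) - (LINT x. \<Psi> x (U t x))) - (LINT x. \<beta> x (U t x)*(U (t + h) x - U t x))"
   unfolding R_def using i\<Psi>[OF elim(2)] i\<Psi>[OF u(2)] iu by simp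
  moreover have "(LINT x. \<beta> x (U t x)*(U (t + h) x - U t x)) = h*(LINT x. \<beta> x (U t x)*?a h x)"
   using elim(1) by (subst integral_mult_right_zero[symmetric]) (intro Lint_cong; simp)
  moreover have "(LINT x. \<beta> x (U t x)*?a h x) = (LINT x. \<beta> x (U t x)*D x) + (LINT x. \<beta> x (U t x)*(?a h x - D x))"
   using integrable_mult_L2[OF s\<beta> u(1)] integrable_mult_L2[OF s\<beta> sd]
   by (subst Lint_add[symmetric]) (auto simp: algebra_simps)
  ultimately have "((LINT x. \<Psi> x (U (t + h) x)) - (LINT x. \<Psi> x (U t x)))/h - (LINT x. \<beta> x (U t x)*D x)
   = (LINT x. \<beta> x (U t x)*(?a h x - D x)) + (LINT x. R x)/h"
   using elim(1) by (simp add: field_simps del: times_divide_eq_right)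
  moreover have "\<bar>LINT x. \<beta> x (U t x)*(?a h x - D x)\<bar> \<le> l2_norm (\<lambda>x. \<beta> x (U t x))*l2_norm (\<lambda>x. ?a h x - D x)"
   by (rule abs_integral_mult_le_l2_norm[OF s\<beta> sd])
  moreover have "\<bar>(LINT x. R x)/h\<bar> \<le> \<bar>h\<bar>*(L*(1 + l2_norm D)^2)"
   using R elim(1) by (simp add: abs_divide divide_le_eq power2_eq_square abs_mult mult_ac)
  ultimately show ?case unfolding real_norm_def by linarith
 qed
qed

text \<open>By polarization from the derivative of squared norms.\<close>

lemma has_real_derivative_inner_L2:
 fixes U W :: "real => 'a::euclidean_space => real"
 assumes U: "l2_deriv U D t" and W: "l2_deriv W E t"
 shows "((\<lambda>t. LINT x. U t x*W t x) has_real_derivative (LINT x. D x*W t x) + (LINT x. U t x*E x)) (at t)"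
proof -
 note u = l2_derivD[OF U] and w = l2_derivD[OF W]
 have sq: "((\<lambda>t. LINT x. (Y t x)^2) has_real_derivative (LINT x. 2*Y t x*F x)) (at t)"
  if "l2_deriv Y F t" for Y F and t :: real
 proof (rule has_real_derivative_integral_compose[OF that, where L=1 and M=2 and \<Psi>="\<lambda>_ s. s^2" and \<beta>="\<lambda>_ s. 2 * s"])
  have "b^2 - a^2 - 2*a*(b - a) = (b - a)^2" for a b :: real by (simp add: power2_eq_square algebra_simps)
  thus "\<bar>b^2 - a^2 - 2*a*(b - a)\<bar> \<le> 1*(b - a)^2" for a b :: real by simp
 qed auto
 have i: "(LINT x. f x*g x) = ((LINT x. (f x)^2) + (LINT x. (g x)^2) - (LINT x. (f x - g x)^2))/2"
  if "L2 f" "L2 g" for f g :: "'a => real"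
 proof -
  have e: "(f x - g x)^2 = f x*f x + g x*g x - 2*(f x*g x)" for x by (simp add: power2_eq_square algebra_simps)
  show ?thesis unfolding e using integrable_mult_L2[OF that] integrable_mult_L2[OF that(1,1)] integrable_mult_L2[OF that(2,2)]
   by (simp add: power2_eq_square)
 qed
 have ev: "\<forall>\<^sub>F s in nhds t. (LINT x. U s x*W s x)
  = ((LINT x. (U s x)^2) + (LINT x. (W s x)^2) - (LINT x. (U s x - W s x)^2))/2"
  unfolding eventually_nhds_conv_at eventually_at_to_0[of _ t]
  using i[OF u(2) w(2)] eventually_elim2[OF u(3) w(3), OF i] by (simp add: add.commute)
 have "((\<lambda>s. ((LINT x. (U s x)^2) + (LINT x. (W s x)^2) - (LINT x. (U s x - W s x)^2))/2)
  has_real_derivative ((LINT x. 2*U t x*D x) + (LINT x. 2*W t x*E x)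
   - (LINT x. 2*(U t x - W t x)*(D x - E x)))/2) (at t)"
  by (intro DERIV_cdivide DERIV_diff DERIV_add sq l2_deriv_diff U W)
 moreover have "((LINT x. 2*U t x*D x) + (LINT x. 2*W t x*E x)
   - (LINT x. 2*(U t x - W t x)*(D x - E x)))/2 = (LINT x. D x*W t x) + (LINT x. U t x*E x)"
 proof -
  have e: "2*((U t x - W t x)*(D x - E x)) = 2*(U t x*D x) + 2*(W t x*E x) - (2*(D x*W t x) + 2*(U t x*E x))" for x
   by (simp add: algebra_simps)
  show ?thesis unfolding mult.assoc e
   using integrable_mult_L2[OF u(2,1)] integrable_mult_L2[OF w(2,1)] integrable_mult_L2[OF u(1) w(2)] integrable_mult_L2[OF u(2) w(1)]
   by simp
 qed
 ultimately show ?thesis unfolding DERIV_cong_ev[OF refl ev refl] by (simp only:)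
qed

lemma heat_flow_l2_deriv:
 assumes hf: "heat_flow V f u" and t: "0 < t"
 obtains g where "schrodinger V (u t) g" "l2_deriv u (\<lambda>x. - g x) t"
proof -
 have sq: "L2 (u s)" if "0 < s" for s
  using hf that unfolding heat_flow_def schrodinger_def form_domain_def by blast
 obtain g where g: "schrodinger V (u t) g" "((\<lambda>h. l2_norm (\<lambda>x. (u (t + h) x - u t x)/h + g x)) \<longlongrightarrow> 0) (at 0)"
  using hf t unfolding heat_flow_def by blast
 have "L2 g" using g(1) by (simp add: schrodinger_def)
 have ev: "\<forall>\<^sub>F h in at 0. 0 < t + h"
  using t by (auto simp: eventually_at intro!: exI[of _ t])
 show ?thesis
 proof (rule that[OF g(1)], unfold l2_deriv_def, intro conjI)
  show "L2 (\<lambda>x. - g x)" using L2_cmult[OF \<open>L2 g\<close>, of "- 1"] by simp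
  show "L2 (u t)" by (rule sq[OF t])
  show "\<forall>\<^sub>F h in at 0. L2 (u (t + h))" using ev by eventually_elim (rule sq)
  show "((\<lambda>h. l2_norm (\<lambda>x. (u (t + h) x - u t x)/h - - g x)) \<longlongrightarrow> 0) (at 0)" using g(2) by simp
 qed
qed

subsection \<open>A smooth convex penalty\<close>

text \<open>With m the positive part of s, the derivative is m^2/(1 + m). So the function behaves
  like m^3/3 near 0 and like m^2/2 at infinity: its second derivative is nonnegative, bounded and
  Lipschitz, as the chain rule requires, and it is dominated by the square.\<close>

definition pen :: "real => real" where
 "pen s = (max 0 s)^2/2 - max 0 s + ln (1 + max 0 s)"

definition pen' :: "real => real" where
 "pen' s = max 0 s - 1 + 1/(1 + max 0 s)"

definition pen'' :: "real => real" where
 "pen'' s = 1 - 1/(1 + max 0 s)^2"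

lemma pen_deriv: "(pen has_real_derivative pen' s) (at s)"
 unfolding pen_def pen'_def
 by (rule has_real_derivative_max_0[where H="\<lambda>m. m^2/2 - m + ln (1 + m)" and H'="\<lambda>m. m - 1 + 1/(1 + m)"])
  (auto intro!: derivative_eq_intros simp: field_simps)

lemma pen'_deriv: "(pen' has_real_derivative pen'' s) (at s)"
 unfolding pen'_def pen''_def
 by (rule has_real_derivative_max_0[where H="\<lambda>m. m - 1 + 1/(1 + m)" and H'="\<lambda>m. 1 - 1/(1 + m)^2"])
  (auto intro!: derivative_eq_intros simp: power2_eq_square)

lemma pen''_bounds: "0 \<le> pen'' s" "pen'' s \<le> 1"
 by (auto simp: pen''_def divide_le_eq_1 one_le_power add_pos_nonneg)

lemma pen''_Lipschitz: "\<bar>pen'' b - pen'' a\<bar> \<le> 2*\<bar>b - a\<bar>"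
proof -
 define x y where "x = 1 + max 0 a" and "y = 1 + max 0 b"
 have xy: "1 \<le> x" "1 \<le> y" by (auto simp: x_def y_def)
 have "pen'' b - pen'' a = (y - x)*(x + y)/(x^2*y^2)"
  using xy unfolding pen''_def x_def[symmetric] y_def[symmetric] by (simp add: field_simps power2_eq_square)
 hence "\<bar>pen'' b - pen'' a\<bar> = \<bar>y - x\<bar>*((x + y)/(x^2*y^2))"
  using xy by (simp add: abs_mult)
 also have "... \<le> \<bar>y - x\<bar>*2"
 proof (rule mult_left_mono)
  have a: "x \<le> x^2" "y \<le> y^2" "1 \<le> x^2" "1 \<le> y^2"
   using xy by (auto intro: self_le_power one_le_power)
  have "x*1 \<le> x^2*y^2" "1*y \<le> x^2*y^2"
   using mult_mono[OF a(1,4)] mult_mono[OF a(3,2)] xy by simp_all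
  hence "x + y \<le> 2*(x^2*y^2)" by linarith
  thus "(x + y)/(x^2*y^2) \<le> 2" using xy by (simp add: divide_le_eq)
 qed simp
 also have "\<bar>y - x\<bar> \<le> \<bar>b - a\<bar>" by (auto simp: x_def y_def max_def)
 finally show ?thesis by simp
qed

lemma Lipschitz_if_derivative_bounded:
 fixes f f' :: "real => real"
 assumes d: "\<And>x. (f has_real_derivative f' x) (at x)" and b: "\<And>x. \<bar>f' x\<bar> \<le> M"
 shows "\<bar>f b - f a\<bar> \<le> M*\<bar>b - a\<bar>"
proof -
 have "norm (f b - f a) \<le> M*norm (b - a)"
  by (rule field_differentiable_bound[where S=UNIV and f'=f']) (use d b in auto)
 thus ?thesis by simp
qed

lemma Taylor_if_derivative_Lipschitz:
 fixes f f' :: "real => real"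
 assumes d: "\<And>x. (f has_real_derivative f' x) (at x)" and lip: "\<And>a b. \<bar>f' b - f' a\<bar> \<le> L*\<bar>b - a\<bar>"
 shows "\<bar>f b - f a - f' a*(b - a)\<bar> \<le> L*(b - a)^2"
proof (cases "a = b")
 case False
 have L: "0 \<le> L" using lip[of 0 1] by simp
 obtain c where c: "\<bar>c - a\<bar> \<le> \<bar>b - a\<bar>" "f b - f a = (b - a)*f' c"
 proof (cases "a < b")
  case True
  obtain z where "a < z" "z < b" "f b - f a = (b - a)*f' z" using MVT2[OF True] d by blast
  thus ?thesis using that[of z] by auto
 next
  case False
  hence "b < a" using \<open>a \<noteq> b\<close> by simp
  then obtain z where "b < z" "z < a" "f a - f b = (a - b)*f' z" using MVT2[of b a f f'] d by blast
  thus ?thesis using that[of z] by (auto simp: algebra_simps)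
 qed
 have "f b - f a - f' a*(b - a) = (f' c - f' a)*(b - a)" by (simp add: c(2) algebra_simps)
 also have "\<bar>...\<bar> \<le> (L*\<bar>b - a\<bar>)*\<bar>b - a\<bar>"
  unfolding abs_mult
  using lip[of c a] c(1) L by (intro mult_right_mono) (auto intro: order_trans[OF _ mult_left_mono])
 finally show ?thesis by (simp add: power2_eq_square mult.assoc flip: abs_mult)
qed simp

lemma pen'_Lipschitz: "\<bar>pen' b - pen' a\<bar> \<le> 1*\<bar>b - a\<bar>"
 by (rule Lipschitz_if_derivative_bounded[OF pen'_deriv]) (use pen''_bounds in \<open>auto simp: abs_le_iff intro: order_trans[of _ 0]\<close>)

lemma pen_zero: "pen 0 = 0" "pen' 0 = 0" by (auto simp: pen_def pen'_def)

lemma pen'_bounds: "0 \<le> pen' s" "pen' s \<le> max 0 s" "\<bar>pen' s\<bar> \<le> 1*\<bar>s\<bar>"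
proof -
 have "pen' s = (max 0 s)^2/(1 + max 0 s)"
  unfolding pen'_def by (simp add: field_simps power2_eq_square add_eq_0_iff max_def)
 moreover have "1 + max 0 s > 0" by (simp add: add_pos_nonneg)
 ultimately show 1: "0 \<le> pen' s" by simp
 show "pen' s \<le> max 0 s" by (simp add: pen'_def divide_le_eq_1 add_pos_nonneg)
 thus "\<bar>pen' s\<bar> \<le> 1*\<bar>s\<bar>" using 1 by (auto simp: max_def split: if_splits)
qed

lemma pen_Taylor: "\<bar>pen b - pen a - pen' a*(b - a)\<bar> \<le> 1*(b - a)^2"
 by (rule Taylor_if_derivative_Lipschitz[OF pen_deriv pen'_Lipschitz])

lemma pen'_Taylor: "\<bar>pen' b - pen' a - pen'' a*(b - a)\<bar> \<le> 2*(b - a)^2"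
 by (rule Taylor_if_derivative_Lipschitz[OF pen'_deriv pen''_Lipschitz])

lemma pen_le_square: "\<bar>pen s\<bar> \<le> 1 * s^2"
 using pen_Taylor[of s 0] by (simp add: pen_zero)

lemma pen_mono: "a \<le> b ==> pen a \<le> pen b"
 by (rule DERIV_nonneg_imp_nondecreasing) (use pen_deriv pen'_bounds in auto)

lemma pen_nonneg: "0 \<le> pen s"
proof (cases "0 \<le> s")
 case True
 thus ?thesis using pen_mono[of 0 s] pen_zero by simp
qed (simp add: pen_def)

lemma pen_pos: assumes "0 < s" shows "0 < pen s"
proof -
 have "pen 0 < pen s"
 proof (rule DERIV_pos_imp_increasing_open[OF assms])
  fix x :: real assume x: "0 < x" "x < s"
  have "pen' x = x^2/(1 + x)" using x by (simp add: pen'_def field_simps power2_eq_square)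
  hence "0 < pen' x" using x by simp
  thus "\<exists>y. (pen has_real_derivative y) (at x) \<and> 0 < y" using pen_deriv by blast
 next
  show "continuous_on {0..s} pen"
   using pen_deriv by (meson DERIV_isCont continuous_at_imp_continuous_on)
 qed
 thus ?thesis by (simp add: pen_zero)
qed

lemma pen_measurable[measurable]: "pen \<in> BM" "pen' \<in> BM" "pen'' \<in> BM"
 unfolding pen_def pen'_def pen''_def by measurable

subsection \<open>The Gaussian\<close>

text \<open>Up to a constant factor, the heat kernel of the Laplacian at time \<open>\<tau>\<close>.\<close>

definition gauss :: "real => 'a::euclidean_space => real" where
 "gauss \<tau> z = \<tau> powr (- real DIM('a)/2)*exp (- (z \<bullet> z)/(4*\<tau>))"

definition gauss_grad :: "real => 'a::euclidean_space => 'a" where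
 "gauss_grad \<tau> z = (- gauss \<tau> z/(2*\<tau>)) *\<^sub>R z"

definition gauss_lap :: "real => 'a::euclidean_space => real" where
 "gauss_lap \<tau> z = (- real DIM('a)/(2*\<tau>) + (z \<bullet> z)/(4*\<tau>^2))*gauss \<tau> z"

definition gauss_hess :: "real => 'a::euclidean_space => 'a => 'a" where
 "gauss_hess \<tau> b z = (- gauss \<tau> z/(2*\<tau>)) *\<^sub>R b + ((z \<bullet> b)/(4*\<tau>^2)*gauss \<tau> z) *\<^sub>R z"

lemma gauss_nonneg: "0 \<le> gauss \<tau> z" by (simp add: gauss_def)

lemma GDERIV_gauss:
 assumes "0 < \<tau>" shows "GDERIV (gauss \<tau>) z :> gauss_grad \<tau> z"
 unfolding gderiv_def gauss_def[abs_def] gauss_grad_def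
 by (rule derivative_eq_intros refl | (use assms in simp; fail))+
  (use assms in \<open>auto simp: fun_eq_iff inner_commute field_simps\<close>)

lemma GDERIV_gauss_grad_component:
 assumes "0 < \<tau>" shows "GDERIV (\<lambda>z. gauss_grad \<tau> z \<bullet> b) z :> gauss_hess \<tau> b z"
proof -
 have "((\<lambda>z. (- gauss \<tau> z/(2*\<tau>))*(z \<bullet> b)) has_derivative
   (\<lambda>h. (- gauss \<tau> z/(2*\<tau>))*(h \<bullet> b) + (- (h \<bullet> gauss_grad \<tau> z)/(2*\<tau>))*(z \<bullet> b))) (at z)"
  using GDERIV_gauss[OF assms, of z] assms unfolding gderiv_def
  by (auto intro!: derivative_eq_intros simp: fun_eq_iff field_simps)
 thus ?thesis
  using assms
  by (simp add: gderiv_def gauss_grad_def gauss_hess_def inner_add_right)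
   (erule has_derivative_eq_rhs, auto simp: fun_eq_iff inner_diff_right inner_add_right field_simps power2_eq_square)
qed

lemma gauss_hess_trace: "0 < \<tau> ==> (\<Sum>b\<in>Basis. gauss_hess \<tau> b z \<bullet> b) = gauss_lap \<tau> (z :: 'a::euclidean_space)"
proof -
 assume t: "0 < \<tau>"
 have "(\<Sum>b\<in>Basis. gauss_hess \<tau> b z \<bullet> b) = (\<Sum>b\<in>(Basis::'a set). - gauss \<tau> z/(2*\<tau>) + gauss \<tau> z/(4*\<tau>^2)*((z \<bullet> b)*(z \<bullet> b)))"
  by (intro sum.cong) (auto simp: gauss_hess_def inner_add_left inner_diff_left)
 also have "... = - real DIM('a)*gauss \<tau> z/(2*\<tau>) + gauss \<tau> z/(4*\<tau>^2)*(z \<bullet> z)"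
 proof -
  have "(\<Sum>b\<in>(Basis::'a set). B + A*((z \<bullet> b)*(z \<bullet> b))) = real DIM('a)*B + A*(z \<bullet> z)" for A B
   by (subst (3) euclidean_inner) (simp add: sum.distrib sum_distrib_left)
  from this[of "- gauss \<tau> z/(2*\<tau>)" "gauss \<tau> z/(4*\<tau>^2)"] show ?thesis by (simp only: times_divide_eq_right mult_minus_left mult_minus_right)
 qed
 finally show ?thesis by (simp add: gauss_lap_def algebra_simps)
qed

lemma gauss_time_deriv:
 assumes "0 < \<tau>" shows "((\<lambda>\<tau>. gauss \<tau> z) has_real_derivative gauss_lap \<tau> z) (at \<tau>)"
proof -
 have "\<tau>*\<tau> powr ((real DIM('a) - 2)/2) = \<tau> powr (1 + (real DIM('a) - 2)/2)"
  using assms by (simp add: powr_mult_base)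
 also have "1 + (real DIM('a) - 2)/2 = real DIM('a)/2" by (simp add: diff_divide_distrib)
 finally have p: "\<tau> powr (real DIM('a)/2) = \<tau>*\<tau> powr ((real DIM('a) - 2)/2)" by simp
 show ?thesis
 unfolding gauss_def gauss_lap_def
 using assms
 by (auto intro!: derivative_eq_intros simp: field_simps power2_eq_square powr_minus_divide p)
qed

lemma integrable_exp_decay:
 fixes g :: "'a::euclidean_space => 'b::euclidean_space"
 assumes g[measurable]: "g \<in> BM" and a: "0 < a"
  and b: "\<And>x. norm (g x) \<le> K*exp (- a*(norm (x - y))^2)"
 shows "integrable lborel g"
proof (rule integrableI_bounded)
 let ?d = "real DIM('a)"
 obtain C where C: "0 < C" "\<And>s (y :: 'a). 0 < s ==>
   (\<integral>x. ennreal (s powr (- ?d/2)*exp (- ((norm (x - y))^2/(8 * s))))) \<le> ennreal C"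
  by (rule nn_integral_exp_square_le) (rule that; blast)
 define s where "s = 1/(8*a)"
 have s: "0 < s" using a by (simp add: s_def)
 let ?g = "\<lambda>x. s powr (- ?d/2)*exp (- ((norm (x - y))^2/(8 * s)))"
 have e: "norm (g x) \<le> (K * s powr (?d/2))*?g x" for x
  using b[of x] s a by (simp add: s_def powr_minus field_simps)
 have "norm (g y) \<le> K" using b[of y] by simp
 hence K: "0 \<le> K" using norm_ge_zero order_trans by blast
 have "(\<integral>\<^sup>+x. ennreal (norm (g x)) \<partial>lborel) \<le> (\<integral>\<^sup>+x. ennreal (K * s powr (?d/2))*ennreal (?g x) \<partial>lborel)"
  using e K by (intro nn_integral_mono) (auto simp: ennreal_mult[symmetric] intro!: ennreal_leI)
 also have "... = ennreal (K * s powr (?d/2))*(\<integral>\<^sup>+x. ennreal (?g x) \<partial>lborel)" by (intro nn_integral_cmult) measurable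
 also have "(\<integral>\<^sup>+x. ennreal (?g x) \<partial>lborel) = (\<integral>x. ennreal (?g x))" by (subst nn_integral_completion) auto
 also have "ennreal (K * s powr (?d/2))*(\<integral>x. ennreal (?g x)) \<le> ennreal (K * s powr (?d/2))*ennreal C"
  by (intro mult_left_mono C(2) s) simp
 also have "... < \<infinity>" by (simp add: ennreal_mult_less_top)
 finally show "(\<integral>\<^sup>+x. ennreal (norm (g x)) \<partial>lborel) < \<infinity>" .
qed simp

lemma L2_exp_decay:
 fixes f :: "'a::euclidean_space => 'b::euclidean_space"
 assumes f[measurable]: "f \<in> BM" and c: "0 < c"
  and b: "\<And>x. norm (f x) \<le> K*exp (- c*(norm (x - y))^2)"
 shows "L2 f"
proof -
 have "integrable lborel (\<lambda>x. (norm (f x))^2)"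
 proof (rule integrable_exp_decay)
  show "(\<lambda>x. (norm (f x))^2) \<in> BM" by measurable
  show "0 < 2*c" using c by simp
  show "norm ((norm (f x))^2) \<le> K^2*exp (- (2*c)*(norm (x - y))^2)" for x
  proof -
   have "(norm (f x))^2 \<le> (K*exp (- c*(norm (x - y))^2))^2" using b by (intro power_mono) auto
   also have "... = K^2*exp (- (2*c)*(norm (x - y))^2)"
    by (simp add: power_mult_distrib power2_eq_square[of "exp _"] flip: exp_add)
   finally show ?thesis by simp
  qed
 qed
 thus "L2 f" by (simp add: L2_lborel)
qed

lemma le_exp_bound: "0 < a ==> (s::real) \<le> exp (a * s)/a"
proof -
 assume "0 < a"
 moreover have "a * s \<le> exp (a * s)" using exp_ge_add_one_self[of "a * s"] by linarith
 ultimately show ?thesis by (simp add: le_divide_eq mult.commute)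
qed

text \<open>The exponent is split into two equal parts: one absorbs the polynomial factors, the
  other remains as \<open>E\<close>. Uniformity over a compact interval of times yields a dominating
  function for difference quotients in time.\<close>

lemma gauss_exp_bounds:
 fixes z :: "'a::euclidean_space"
 assumes "0 < \<tau>0" "\<tau>0 \<le> \<tau>" "\<tau> \<le> \<tau>1"
 defines "N \<equiv> \<tau>0 powr (- real DIM('a)/2)"
 defines "E \<equiv> exp (- (1/(8*\<tau>1))*(norm z)^2)"
 shows "gauss \<tau> z \<le> N*E"
  "\<bar>gauss_lap \<tau> z\<bar> \<le> (N*(real DIM('a)/(2*\<tau>0) + 2*\<tau>1/\<tau>0^2))*E"
  "norm (gauss_grad \<tau> z) \<le> (N*((1 + 8*\<tau>1)/(2*\<tau>0)))*E"
  "b \<in> Basis ==> norm (gauss_hess \<tau> b z) \<le> (N*(1/(2*\<tau>0) + 2*\<tau>1/\<tau>0^2))*E"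
proof -
 let ?d = "real DIM('a)"
 have t: "0 < \<tau>" "0 < \<tau>1" using assms by auto
 define S where "S = (norm z)^2"
 have S: "0 \<le> S" "z \<bullet> z = S" by (auto simp: S_def power2_norm_eq_inner)
 have N: "0 \<le> N" by (simp add: N_def)
 have pw: "\<tau> powr (- ?d/2) \<le> N"
  unfolding N_def using assms by (intro powr_mono2') auto
 define e where "e = exp (- S/(4*\<tau>1))"
 have g: "gauss \<tau> z \<le> N*e"
  unfolding gauss_def S(2) e_def using assms t S pw
  by (intro mult_mono) (auto intro!: divide_left_mono mult_pos_pos simp: N)
 have e1: "e = E*E"
  unfolding e_def E_def S_def[symmetric] by (simp add: exp_add[symmetric])
 have E: "0 < E" "E \<le> 1" using t S by (auto simp: E_def S_def)
 have eE: "e \<le> E" using E e1 by (simp add: mult_left_le)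
 have Se: "S*e \<le> 8*\<tau>1*E"
 proof -
  have "S \<le> exp (1/(8*\<tau>1)*S)/(1/(8*\<tau>1))" using t by (intro le_exp_bound) simp
  also have "exp (1/(8*\<tau>1)*S) = 1/E" by (simp add: E_def S_def exp_minus inverse_eq_divide)
  finally have "S*E \<le> 8*\<tau>1" using E by (simp add: field_simps)
  thus ?thesis using E by (simp add: e1 mult_right_mono flip: mult.assoc)
 qed
 show "gauss \<tau> z \<le> N*E" using g eE N by (meson mult_left_mono order_trans)
 have "\<bar>gauss_lap \<tau> z\<bar> \<le> (?d/(2*\<tau>) + S/(4*\<tau>^2))*gauss \<tau> z"
  unfolding gauss_lap_def S(2) abs_mult abs_of_nonneg[OF gauss_nonneg]
 proof (rule mult_right_mono[OF _ gauss_nonneg])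
  have "0 \<le> ?d/(2*\<tau>)" "0 \<le> S/(4*\<tau>^2)" using t S(1) by auto
  thus "\<bar>- ?d/(2*\<tau>) + S/(4*\<tau>^2)\<bar> \<le> ?d/(2*\<tau>) + S/(4*\<tau>^2)"
   unfolding minus_divide_left[symmetric] by linarith
 qed
 also have "... \<le> (?d/(2*\<tau>0) + S/(4*\<tau>0^2))*(N*e)"
  using assms t S g gauss_nonneg[of \<tau> z]
  by (intro mult_mono add_mono divide_left_mono power_mono) auto
 also have "... = N*(?d/(2*\<tau>0)*e + S*e/(4*\<tau>0^2))" by (simp add: algebra_simps)
 also have "... \<le> N*(?d/(2*\<tau>0)*E + 8*\<tau>1*E/(4*\<tau>0^2))"
  using eE Se assms by (intro mult_left_mono add_mono divide_right_mono N) auto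
 also have "... = (N*(?d/(2*\<tau>0) + 2*\<tau>1/\<tau>0^2))*E" by (simp add: algebra_simps)
 finally show "\<bar>gauss_lap \<tau> z\<bar> \<le> (N*(?d/(2*\<tau>0) + 2*\<tau>1/\<tau>0^2))*E" .
 have zS: "norm z \<le> 1 + S" unfolding S_def
  using sum_squares_bound[of 1 "norm z"] zero_le_power2[of "norm z"] by (simp add: power2_eq_square) (smt (verit) mult_nonneg_nonneg norm_ge_zero)
 have "norm (gauss_grad \<tau> z) = gauss \<tau> z/(2*\<tau>)*norm z"
  using t gauss_nonneg[of \<tau> z] by (simp add: gauss_grad_def)
 also have "... \<le> (N*e)/(2*\<tau>0)*(1 + S)"
  using assms t S g zS gauss_nonneg[of \<tau> z] by (intro mult_mono frac_le) auto
 also have "... = N/(2*\<tau>0)*(e + S*e)" by (simp add: algebra_simps)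
 also have "... \<le> N/(2*\<tau>0)*(E + 8*\<tau>1*E)"
  using eE Se N assms by (intro mult_left_mono add_mono) auto
 also have "... = (N*((1 + 8*\<tau>1)/(2*\<tau>0)))*E"
  using assms(1) by (simp add: field_simps)
 finally show "norm (gauss_grad \<tau> z) \<le> (N*((1 + 8*\<tau>1)/(2*\<tau>0)))*E" .
 show "norm (gauss_hess \<tau> b z) \<le> (N*(1/(2*\<tau>0) + 2*\<tau>1/\<tau>0^2))*E" if b: "b \<in> Basis"
 proof -
  have "norm (gauss_hess \<tau> b z) \<le> gauss \<tau> z/(2*\<tau>)*1 + (norm z*1)/(4*\<tau>^2)*gauss \<tau> z*norm z"
   unfolding gauss_hess_def
   using b t gauss_nonneg[of \<tau> z] Cauchy_Schwarz_ineq2[of z b]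
   by (intro norm_triangle_le add_mono) (auto simp: abs_mult intro!: mult_right_mono divide_right_mono)
  also have "... = (1/(2*\<tau>) + S/(4*\<tau>^2))*gauss \<tau> z" by (simp add: S_def power2_eq_square algebra_simps)
  also have "... \<le> (1/(2*\<tau>0) + S/(4*\<tau>0^2))*(N*e)"
   using assms t S g gauss_nonneg[of \<tau> z]
   by (intro mult_mono add_mono divide_left_mono power_mono) auto
  also have "... = N*(1/(2*\<tau>0)*e + S*e/(4*\<tau>0^2))" by (simp add: algebra_simps)
  also have "... \<le> N*(1/(2*\<tau>0)*E + 8*\<tau>1*E/(4*\<tau>0^2))"
   using eE Se assms by (intro mult_left_mono add_mono divide_right_mono N) auto
  also have "... = (N*(1/(2*\<tau>0) + 2*\<tau>1/\<tau>0^2))*E" by (simp add: algebra_simps)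
  finally show ?thesis .
 qed
qed

lemma l2_norm_tendsto_0:
 fixes Q :: "real => 'a::euclidean_space => real"
 assumes m: "\<And>h. Q h \<in> LM" and lim: "\<And>x. ((\<lambda>h. Q h x) \<longlongrightarrow> 0) (at 0)"
  and bd: "\<forall>\<^sub>F h in at 0. \<forall>x. \<bar>Q h x\<bar> \<le> G x" and G: "L2 G"
 shows "((\<lambda>h. l2_norm (Q h)) \<longlongrightarrow> 0) (at 0)"
 unfolding tendsto_at_iff_sequentially o_def
proof (intro allI impI)
 fix X :: "nat => real" assume X: "\<forall>i. X i \<in> UNIV - {0}" "X \<longlonglongrightarrow> 0"
 hence F: "filterlim X (at 0) sequentially" by (simp add: filterlim_at)
 \<comment> \<open>Domination holds only eventually; terms for which it fails are replaced by 0, so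
   that dominated convergence applies to the whole sequence.\<close>
 define Y where "Y i x = (if \<forall>x. \<bar>Q (X i) x\<bar> \<le> G x then Q (X i) x else 0)" for i x
 have ev: "\<forall>\<^sub>F i in sequentially. \<forall>x. \<bar>Q (X i) x\<bar> \<le> G x"
  using F bd unfolding filterlim_iff by blast
 have G0: "0 \<le> G x" for x
 proof -
  obtain h where "\<forall>x. \<bar>Q h x\<bar> \<le> G x" using eventually_happens[OF bd] by auto
  thus ?thesis using abs_ge_zero order_trans by blast
 qed
 have [measurable]: "Y i \<in> LM" for i
  unfolding Y_def using m by (cases "\<forall>x. \<bar>Q (X i) x\<bar> \<le> G x") auto
 have "(\<lambda>i. LINT x. (Y i x)^2) \<longlonglongrightarrow> (LINT x|(lebesgue :: 'a measure). 0)"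
 proof (rule integral_dominated_convergence)
  show "L1 (\<lambda>x. (G x)^2)" using G by (simp add: square_integrable_def)
  have "(\<lambda>i. (Y i x)^2) \<longlonglongrightarrow> 0" for x
  proof (rule Lim_transform_eventually)
   have "(\<lambda>i. Q (X i) x) \<longlonglongrightarrow> 0" using filterlim_compose[OF lim F] .
   hence "(\<lambda>i. (Q (X i) x)^2) \<longlonglongrightarrow> 0^2" by (rule tendsto_power)
   thus "(\<lambda>i. (Q (X i) x)^2) \<longlonglongrightarrow> 0" by simp
   show "\<forall>\<^sub>F i in sequentially. (Q (X i) x)^2 = (Y i x)^2"
    using ev by eventually_elim (simp add: Y_def)
  qed
  thus "AE x. (\<lambda>i. (Y i x)^2) \<longlonglongrightarrow> 0" by simp
  show "AE x. norm ((Y i x)^2) \<le> (G x)^2" for i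
  proof (rule AE_I2)
   fix x
   have "\<bar>Y i x\<bar> \<le> G x" using G0[of x] by (auto simp: Y_def)
   thus "norm ((Y i x)^2) \<le> (G x)^2" using power_mono[of "\<bar>Y i x\<bar>" "G x" 2] by simp
  qed
 qed measurable
 hence "(\<lambda>i. sqrt (LINT x. (Y i x)^2)) \<longlonglongrightarrow> sqrt 0"
  by (intro tendsto_real_sqrt) simp
 hence "(\<lambda>i. l2_norm (Y i)) \<longlonglongrightarrow> 0" by (simp add: l2_norm_def)
 thus "(\<lambda>i. l2_norm (Q (X i))) \<longlonglongrightarrow> 0"
 proof (rule Lim_transform_eventually)
  show "\<forall>\<^sub>F i in sequentially. l2_norm (Y i) = l2_norm (Q (X i))"
   using ev by eventually_elim (simp add: Y_def[abs_def])
 qed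
qed

lemma gauss_measurable:
 fixes b :: "'a::euclidean_space"
 assumes "0 < \<tau>"
 shows "(gauss \<tau> :: 'a => real) \<in> BM" "(gauss_grad \<tau> :: 'a => 'a) \<in> BM"
  "(gauss_lap \<tau> :: 'a => real) \<in> BM" "gauss_hess \<tau> b \<in> BM"
 unfolding gauss_def[abs_def] gauss_grad_def[abs_def] gauss_lap_def[abs_def] gauss_hess_def[abs_def]
 using assms by (auto intro!: BM_continuous continuous_intros)

lemma L2_gauss:
 fixes y :: "'a::euclidean_space"
 assumes t: "0 < \<tau>"
 shows "L2 (\<lambda>x. gauss \<tau> (x - y))" "L2 (\<lambda>x. gauss_grad \<tau> (x - y))"
  "L2 (\<lambda>x. gauss_lap \<tau> (x - y))" "b \<in> Basis ==> L2 (\<lambda>x. gauss_hess \<tau> b (x - y))"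
proof -
 note [measurable] = gauss_measurable[where 'a='a, OF t]
 have c: "0 < 1/(8*\<tau>)" using t by simp
 note b = gauss_exp_bounds[where 'a='a, OF t order_refl order_refl]
 show "L2 (\<lambda>x. gauss \<tau> (x - y))"
 proof (rule L2_exp_decay[OF _ c])
  show "norm (gauss \<tau> (x - y)) \<le> \<tau> powr (- real DIM('a)/2)*exp (- (1/(8*\<tau>))*(norm (x - y))^2)" for x
   unfolding real_norm_def abs_of_nonneg[OF gauss_nonneg] by (rule b(1))
 qed measurable
 show "L2 (\<lambda>x. gauss_grad \<tau> (x - y))"
  by (rule L2_exp_decay[OF _ c b(3)]) measurable
 show "L2 (\<lambda>x. gauss_lap \<tau> (x - y))"
  by (rule L2_exp_decay[OF _ c b(2)[folded real_norm_def]]) measurable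
 show "L2 (\<lambda>x. gauss_hess \<tau> b (x - y))" if "b \<in> Basis"
  by (rule L2_exp_decay[OF _ c b(4)[OF that]]) measurable
qed

lemma gauss_quotient_le:
 fixes z :: "'a::euclidean_space"
 assumes \<tau>: "0 < \<tau>" and h: "- (\<tau>/2) \<le> h" "h \<le> \<tau>/2" "h \<noteq> 0"
  and M: "\<And>\<xi>. \<tau>/2 \<le> \<xi> ==> \<xi> \<le> 2*\<tau> ==> \<bar>gauss_lap \<xi> z\<bar> \<le> M"
 shows "\<bar>(gauss (\<tau> + h) z - gauss \<tau> z)/h\<bar> \<le> M"
proof -
 have d: "((\<lambda>\<xi>. gauss \<xi> z) has_field_derivative gauss_lap \<xi> z) (at \<xi> within {\<tau>/2 .. 2*\<tau>})"
  if "\<xi> \<in> {\<tau>/2 .. 2*\<tau>}" for \<xi>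
  by (rule has_field_derivative_at_within, rule gauss_time_deriv) (use that \<tau> in simp)
 have "norm (gauss (\<tau> + h) z - gauss \<tau> z) \<le> M*norm (\<tau> + h - \<tau>)"
  by (rule field_differentiable_bound[OF _ d]) (use \<tau> h M in auto)
 hence "\<bar>gauss (\<tau> + h) z - gauss \<tau> z\<bar> \<le> M*\<bar>h\<bar>" by simp
 thus ?thesis using h(3) by (simp add: abs_divide divide_le_eq)
qed

lemma l2_deriv_gauss:
 fixes y :: "'a::euclidean_space"
 assumes \<tau>: "0 < t + s"
 shows "l2_deriv (\<lambda>t x. a*gauss (t + s) (x - y)) (\<lambda>x. a*gauss_lap (t + s) (x - y)) t"
 unfolding l2_deriv_def
proof (intro conjI)
 let ?\<tau> = "t + s"
 show "L2 (\<lambda>x. a*gauss_lap ?\<tau> (x - y))" "L2 (\<lambda>x. a*gauss ?\<tau> (x - y))"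
  by (intro L2_cmult L2_gauss \<tau>)+
 have ev0: "\<forall>\<^sub>F h in at (0::real). \<bar>h\<bar> \<le> ?\<tau>/2 \<and> h \<noteq> 0"
  using \<tau> by (auto simp: eventually_at intro!: exI[of _ "?\<tau>/2"])
 thus "\<forall>\<^sub>F h in at 0. L2 (\<lambda>x. a*gauss (t + h + s) (x - y))"
 proof eventually_elim
  case (elim h)
  define z where "z = \<bar>h\<bar>"
  have "z \<le> (t + s)/2" "- z \<le> h" using elim by (simp_all add: z_def)
  moreover have "(t + s)/2 < t + s" using \<tau> by simp
  ultimately have "z < t + s" "- z \<le> h" by (blast intro: le_less_trans)+
  hence "0 < t + h + s" by (simp add: algebra_simps)
  thus ?case by (intro L2_cmult L2_gauss)
 qed
 define Q where "Q h x = (a*gauss (t + h + s) (x - y) - a*gauss ?\<tau> (x - y))/h - a*gauss_lap ?\<tau> (x - y)" for h and x :: 'a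
 obtain K c where K: "0 < c" "\<And>\<xi> z. ?\<tau>/2 \<le> \<xi> ==> \<xi> \<le> 2*?\<tau> ==> \<bar>gauss_lap \<xi> (z::'a)\<bar> \<le> K*exp (- c*(norm z)^2)"
 proof (rule that)
  show "0 < 1/(8*(2*?\<tau>))" using \<tau> by simp
  show "\<bar>gauss_lap \<xi> z\<bar> \<le> ((?\<tau>/2) powr (- real DIM('a)/2)*(real DIM('a)/(2*(?\<tau>/2)) + 2*(2*?\<tau>)/(?\<tau>/2)^2))*exp (- (1/(8*(2*?\<tau>)))*(norm z)^2)"
   if "?\<tau>/2 \<le> \<xi>" "\<xi> \<le> 2*?\<tau>" for \<xi> and z :: 'a
   by (rule gauss_exp_bounds(2)) (use \<tau> that in auto)
 qed
 have "((\<lambda>h. l2_norm (Q h)) \<longlongrightarrow> 0) (at 0)"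
 proof (rule l2_norm_tendsto_0)
  let ?G = "\<lambda>x. 2*\<bar>a\<bar>*(K*exp (- c*(norm (x - y))^2))"
  have "\<bar>gauss_lap ?\<tau> (0::'a)\<bar> \<le> K" using K(2)[of ?\<tau> 0] \<tau> by simp
  hence K0: "0 \<le> K" using abs_ge_zero order_trans by blast
  show "L2 ?G"
   by (rule L2_exp_decay[OF _ K(1), of _ "2*\<bar>a\<bar>*K" y]) (use K0 in \<open>auto simp: abs_mult\<close>)
  show "Q h \<in> LM" for h
  proof -
   have m: "(\<lambda>x. gauss \<xi> (x - y)) \<in> BM" for \<xi>
    unfolding gauss_def by measurable
   have "(\<lambda>x. gauss_lap ?\<tau> (x - y)) \<in> BM"
    using gauss_measurable(3)[OF \<tau>] by measurable
   hence "Q h \<in> BM" unfolding Q_def using m by measurable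
   thus ?thesis by (rule LM_of_BM)
  qed
  show "((\<lambda>h. Q h x) \<longlongrightarrow> 0) (at 0)" for x
  proof -
   have "((\<lambda>\<tau>. a*gauss \<tau> (x - y)) has_real_derivative a*gauss_lap ?\<tau> (x - y)) (at ?\<tau>)"
    by (rule DERIV_cmult[OF gauss_time_deriv[OF \<tau>]])
   thus ?thesis unfolding Q_def DERIV_def by (simp add: LIM_zero add.commute add.left_commute)
  qed
  show "\<forall>\<^sub>F h in at 0. \<forall>x. \<bar>Q h x\<bar> \<le> ?G x" using ev0
  proof eventually_elim
   case (elim h)
   show ?case
   proof
    fix x :: 'a
    define M where "M = K*exp (- c*(norm (x - y))^2)"
    have q: "\<bar>(gauss (?\<tau> + h) (x - y) - gauss ?\<tau> (x - y))/h\<bar> \<le> M"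
    proof (rule gauss_quotient_le[OF \<tau>])
     have "- (?\<tau>/2) \<le> - \<bar>h\<bar>" using elim by simp
     also have "... \<le> h" by (simp add: abs_if)
     finally show "- (?\<tau>/2) \<le> h" .
     show "h \<le> ?\<tau>/2" by (rule order_trans[OF abs_ge_self]) (use elim in simp)
     show "h \<noteq> 0" using elim by simp
     show "\<bar>gauss_lap \<xi> (x - y)\<bar> \<le> M" if "?\<tau>/2 \<le> \<xi>" "\<xi> \<le> 2*?\<tau>" for \<xi>
      unfolding M_def by (rule K(2)[OF that])
    qed
    have l: "\<bar>gauss_lap ?\<tau> (x - y)\<bar> \<le> M" using K(2)[of ?\<tau> "x - y"] \<tau> by (simp add: M_def)
    have e: "?\<tau> + h = t + h + s" by simp
    have "Q h x = a*((gauss (?\<tau> + h) (x - y) - gauss ?\<tau> (x - y))/h - gauss_lap ?\<tau> (x - y))"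
     unfolding Q_def e by (simp add: algebra_simps)
    also have "\<bar>...\<bar> \<le> \<bar>a\<bar>*(M + M)"
     unfolding abs_mult
     by (rule mult_left_mono[OF order_trans[OF abs_triangle_ineq4 add_mono[OF q l]] abs_ge_zero])
    finally show "\<bar>Q h x\<bar> \<le> ?G x" by (simp add: M_def)
   qed
  qed
 qed
 thus "((\<lambda>h. l2_norm (\<lambda>x. (a*gauss (t + h + s) (x - y) - a*gauss ?\<tau> (x - y))/h - a*gauss_lap ?\<tau> (x - y))) \<longlongrightarrow> 0) (at 0)"
  unfolding Q_def .
qed

lemma GDERIV_shift:
 assumes "GDERIV f (x - y) :> D"
 shows "GDERIV (\<lambda>x. f (x - y)) x :> D"
proof -
 have "((\<lambda>x. x - y) has_derivative (\<lambda>k. k)) (at x)" by (auto intro!: derivative_eq_intros)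
 from has_derivative_compose[OF this assms[unfolded gderiv_def]] show ?thesis by (simp add: gderiv_def)
qed

lemma continuous_gauss_shift:
 assumes "0 < \<tau>"
 shows "continuous_on UNIV (\<lambda>x. gauss_grad \<tau> (x - y))" "continuous_on UNIV (\<lambda>x. gauss_hess \<tau> b (x - y))"
 unfolding gauss_grad_def gauss_hess_def gauss_def using assms by (auto intro!: continuous_intros)

text \<open>Each component of the Gaussian gradient is used as a test function in
  \<open>weak_gradient_test_L2\<close>; the trace of the Hessian is the Laplacian.\<close>

lemma integral_gauss_lap:
 fixes v :: "'a::euclidean_space => real"
 assumes v: "L2 v" "L2 Dv" "weak_gradient v Dv" and t: "0 < \<tau>"
 shows "(LINT x. v x*gauss_lap \<tau> (x - y)) = - (LINT x. gauss_grad \<tau> (x - y) \<bullet> Dv x)"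
proof -
 have comp: "(LINT x. v x*(gauss_hess \<tau> b (x - y) \<bullet> b)) = - (LINT x. (gauss_grad \<tau> (x - y) \<bullet> b)*(Dv x \<bullet> b))"
  and i1: "L1 (\<lambda>x. v x*(gauss_hess \<tau> b (x - y) \<bullet> b))"
  and i2: "L1 (\<lambda>x. (gauss_grad \<tau> (x - y) \<bullet> b)*(Dv x \<bullet> b))"
  if b: "b \<in> Basis" for b
 proof -
  have sg: "L2 (\<lambda>x. gauss_grad \<tau> (x - y) \<bullet> b)"
  proof (rule L2_bound[OF L2_gauss(2)[OF t, of y]])
   show "(\<lambda>x. gauss_grad \<tau> (x - y) \<bullet> b) \<in> LM"
    using L2_measurable[OF L2_gauss(2)[OF t, of y]] by measurable
   show "AE x. norm (gauss_grad \<tau> (x - y) \<bullet> b) \<le> norm (gauss_grad \<tau> (x - y))"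
    using b by (auto intro!: always_eventually Basis_le_norm)
  qed
  have e: "(LINT x. v x *\<^sub>R gauss_hess \<tau> b (x - y)) = - (LINT x. (gauss_grad \<tau> (x - y) \<bullet> b) *\<^sub>R Dv x)"
   by (rule weak_gradient_test_L2[OF v GDERIV_shift[OF GDERIV_gauss_grad_component[OF t]] continuous_gauss_shift(2)[OF t] sg L2_gauss(4)[OF t b]])
  have i: "L1 (\<lambda>x. v x *\<^sub>R gauss_hess \<tau> b (x - y))" "L1 (\<lambda>x. (gauss_grad \<tau> (x - y) \<bullet> b) *\<^sub>R Dv x)"
   by (rule integrable_scaleR_L2[OF v(1) L2_gauss(4)[OF t b]], rule integrable_scaleR_L2[OF sg v(2)])
  show "L1 (\<lambda>x. v x*(gauss_hess \<tau> b (x - y) \<bullet> b))" "L1 (\<lambda>x. (gauss_grad \<tau> (x - y) \<bullet> b)*(Dv x \<bullet> b))"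
   using integrable_inner_left[OF i(1), of b] integrable_inner_left[OF i(2), of b] by simp_all
  show "(LINT x. v x*(gauss_hess \<tau> b (x - y) \<bullet> b)) = - (LINT x. (gauss_grad \<tau> (x - y) \<bullet> b)*(Dv x \<bullet> b))"
   using integral_inner_left[OF i(1), of b] integral_inner_left[OF i(2), of b] e by simp
 qed
 have "(LINT x. v x*gauss_lap \<tau> (x - y)) = (LINT x. (\<Sum>b\<in>Basis. v x*(gauss_hess \<tau> b (x - y) \<bullet> b)))"
  using t by (simp add: gauss_hess_trace[symmetric] sum_distrib_left)
 also have "... = (\<Sum>b\<in>Basis. - (LINT x. (gauss_grad \<tau> (x - y) \<bullet> b)*(Dv x \<bullet> b)))"
  using i1 comp by (subst Lint_sum) auto
 also have "... = - (LINT x. (\<Sum>b\<in>Basis. (gauss_grad \<tau> (x - y) \<bullet> b)*(Dv x \<bullet> b)))"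
  using i2 by (subst Lint_sum) (auto simp: sum_negf)
 finally show ?thesis by (subst euclidean_inner)
qed

text \<open>A shifted Gaussian is a supersolution because the potential is nonnegative. The energy argument uses
 the penalty \<open>pen\<close> instead of the positive part, so that only the chain rule for functions with
 Lipschitz derivative is needed.\<close>

lemma heat_flow_le_gauss:
 fixes f :: "'a::euclidean_space => real"
 assumes V: "weight V" and hf: "heat_flow V f u" and f: "L2 f"
  and s: "0 < s" and a: "0 \<le> a" and le: "\<And>x. f x \<le> a*gauss s (x - y)" and t: "0 < t"
 shows "AE x. u t x \<le> a*gauss (t + s) (x - y)"
proof -
 note [measurable] = weight_measurable[OF V]
 define g where "g t x = a*gauss (t + s) (x - y)" for t x
 define w where "w t x = u t x - g t x" for t x
 define F where "F t = (LINT x. pen (w t x))" for t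
 have g0: "0 \<le> g t x" for t x using a by (simp add: g_def gauss_nonneg)
 have gd: "l2_deriv g (\<lambda>x. a*gauss_lap (t + s) (x - y)) t" if "0 \<le> t" for t
  unfolding g_def using that s by (intro l2_deriv_gauss) simp
 \<comment> \<open>With v = pen'(w), the derivative of \<open>F\<close> is minus the integral of
   pen''(w) |Dw|^2 + V u v. The equation for u is tested with v, and the Gaussian is integrated by
   parts against it.\<close>
 have deriv: "\<exists>c. (F has_real_derivative c) (at t) \<and> c \<le> 0" if t: "0 < t" for t
 proof -
  define \<tau> where "\<tau> = t + s"
  have \<tau>: "0 < \<tau>" using t s by (simp add: \<tau>_def)
  obtain G where G: "schrodinger V (u t) G" "l2_deriv u (\<lambda>x. - G x) t"
   using heat_flow_l2_deriv[OF hf t] .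
  obtain Du where Du: "form_domain V (u t) Du" and eq: "\<And>v Dv. form_domain V v Dv ==>
    (LINT x. Du x \<bullet> Dv x + V x*u t x * v x) = (LINT x. G x * v x)"
   using G(1) unfolding schrodinger_def by blast
  have sG: "L2 G" using G(1) by (simp add: schrodinger_def)
  have uD: "L2 (u t)" "L2 Du" "weak_gradient (u t) Du" "L1 (\<lambda>x. V x*(u t x)^2)"
   using Du by (auto simp: form_domain_def)
  define Dg where "Dg x = a *\<^sub>R gauss_grad \<tau> (x - y)" for x
  have gt: "g t = (\<lambda>x. a*gauss \<tau> (x - y))" by (simp add: g_def \<tau>_def fun_eq_iff)
  have sg: "L2 (g t)" unfolding gt by (intro L2_cmult L2_gauss \<tau>)
  have sDg: "L2 Dg" unfolding Dg_def by (intro L2_scaleR L2_gauss \<tau>)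
  have wg: "weak_gradient (g t) Dg"
  proof (rule weak_gradient_C1)
   show "GDERIV (g t) x :> Dg x" for x
    using GDERIV_shift[OF GDERIV_gauss[OF \<tau>], where x=x and y=y] unfolding gt Dg_def gderiv_def
    by (auto intro!: derivative_eq_intros)
   show "continuous_on UNIV Dg" unfolding Dg_def by (intro continuous_intros continuous_gauss_shift \<tau>)
  qed
  have sw: "L2 (w t)" unfolding w_def by (rule L2_diff[OF uD(1) sg])
  have sDw: "L2 (\<lambda>x. Du x - Dg x)" by (rule L2_diff[OF uD(2) sDg])
  have ww: "weak_gradient (w t) (\<lambda>x. Du x - Dg x)"
   unfolding w_def by (rule weak_gradient_diff[OF uD(1-3) sg sDg wg])
  note [measurable] = L2_measurable[OF uD(1)] L2_measurable[OF uD(2)]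
   L2_measurable[OF sw] L2_measurable[OF sDw] L2_measurable[OF sg]
  define v where "v x = pen' (w t x)" for x
  define Dv where "Dv x = pen'' (w t x) *\<^sub>R (Du x - Dg x)" for x
  have [measurable]: "v \<in> LM" "Dv \<in> LM" unfolding v_def Dv_def by measurable
  have vw: "weak_gradient v Dv"
   unfolding v_def Dv_def
   by (rule weak_gradient_compose[OF sw sDw ww pen_measurable(2,3) pen'_Taylor pen'_Lipschitz pen''_Lipschitz pen_zero(2)])
    (use pen''_bounds in \<open>simp add: abs_le_iff order_trans[of _ 0]\<close>)
  have sv: "L2 v"
   by (rule L2_bound[OF sw]) (use pen'_bounds(3) in \<open>auto simp: v_def\<close>)
  have sDv: "L2 Dv"
   unfolding Dv_def
   by (rule L2_mult_bounded[OF sDw, of _ 1]) (use pen''_bounds in \<open>auto simp: abs_le_iff order_trans[of _ 0]\<close>)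
  have v0: "0 \<le> v x" for x by (simp add: v_def pen'_bounds)
  have vu: "v x \<le> \<bar>u t x\<bar>" for x
   using pen'_bounds(2)[of "w t x"] g0[of t x] by (auto simp: v_def w_def max_def split: if_splits)
  \<comment> \<open>v vanishes unless u > g, and g >= 0; this gives the potential term its
    sign.\<close>
  have uv0: "0 \<le> u t x * v x" for x
  proof (cases "w t x \<le> 0")
   case True
   hence "v x = 0" using pen'_bounds(1,2)[of "w t x"] by (simp add: v_def)
   thus ?thesis by simp
  next
   case False
   hence "0 \<le> u t x" using g0[of t x] by (simp add: w_def)
   thus ?thesis using v0 by simp
  qed
  have iVuv: "L1 (\<lambda>x. V x*u t x * v x)"
  proof (rule Bochner_Integration.integrable_bound[OF uD(4)])
   have "\<bar>V x*u t x * v x\<bar> \<le> \<bar>V x*(u t x)^2\<bar>" for x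
   proof -
    have "\<bar>u t x\<bar> * v x \<le> \<bar>u t x\<bar>*\<bar>u t x\<bar>" by (intro mult_left_mono vu) simp
    hence "V x*(\<bar>u t x\<bar> * v x) \<le> V x*(u t x)^2"
     by (intro mult_left_mono weight_nonneg[OF V]) (simp add: power2_eq_square)
    thus ?thesis using weight_nonneg[OF V, of x] v0[of x] by (simp add: abs_mult mult.assoc)
   qed
   thus "AE x. norm (V x*u t x * v x) \<le> norm (V x*(u t x)^2)" by simp
  qed measurable
  have iVv: "L1 (\<lambda>x. V x*(v x)^2)"
  proof (rule Bochner_Integration.integrable_bound[OF uD(4)])
   have "\<bar>V x*(v x)^2\<bar> \<le> \<bar>V x*(u t x)^2\<bar>" for x
    using weight_nonneg[OF V, of x] vu[of x] v0[of x]
    by (simp add: abs_mult mult_left_mono abs_le_square_iff[symmetric])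
   thus "AE x. norm (V x*(v x)^2) \<le> norm (V x*(u t x)^2)" by simp
  qed measurable
  have fv: "form_domain V v Dv" using sv sDv vw iVv by (simp add: form_domain_def)
  note iDuDv = integrable_inner_L2[OF uD(2) sDv] and iDgDv = integrable_inner_L2[OF sDg sDv]
  have d: "(F has_real_derivative (LINT x. pen' (w t x)*(- G x - a*gauss_lap (t + s) (x - y)))) (at t)"
   unfolding F_def w_def
   by (rule has_real_derivative_integral_compose[OF l2_deriv_diff[OF G(2) gd[OF less_imp_le[OF t]]] measurable_compose[OF _ pen_measurable(1)] measurable_compose[OF _ pen_measurable(2)] pen_Taylor pen_le_square pen'_bounds(3)])
  have slap: "L2 (\<lambda>x. a*gauss_lap \<tau> (x - y))"
   by (intro L2_cmult L2_gauss \<tau>)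
  have "(LINT x. pen' (w t x)*(- G x - a*gauss_lap (t + s) (x - y)))
   = (LINT x. - (G x * v x) - v x*(a*gauss_lap \<tau> (x - y)))"
   by (simp add: v_def \<tau>_def algebra_simps)
  also have "... = - (LINT x. G x * v x) - a*(LINT x. v x*gauss_lap \<tau> (x - y))"
   using integrable_mult_L2[OF sG sv] integrable_mult_L2[OF sv slap]
   by (subst Lint_diff) (auto simp: mult.left_commute)
  also have "... = - (LINT x. Du x \<bullet> Dv x + V x*u t x * v x) + (LINT x. Dg x \<bullet> Dv x)"
   using eq[OF fv] integral_gauss_lap[OF sv sDv vw \<tau>, of y] by (simp add: Dg_def)
  also have "... = - (LINT x. (Du x \<bullet> Dv x + V x*u t x * v x) - Dg x \<bullet> Dv x)"
   using iDuDv iVuv iDgDv by simp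
  also have "... \<le> 0"
  proof -
   have "0 \<le> (Du x \<bullet> Dv x + V x*u t x * v x) - Dg x \<bullet> Dv x" for x
   proof -
    have "(Du x \<bullet> Dv x + V x*u t x * v x) - Dg x \<bullet> Dv x = pen'' (w t x)*((Du x - Dg x) \<bullet> (Du x - Dg x)) + V x*(u t x * v x)"
     by (simp add: Dv_def inner_diff_left inner_diff_right algebra_simps)
    also have "... \<ge> 0"
     by (intro add_nonneg_nonneg mult_nonneg_nonneg[OF pen''_bounds(1) inner_ge_zero] mult_nonneg_nonneg[OF weight_nonneg[OF V] uv0])
    finally show ?thesis .
   qed
   thus ?thesis by (simp add: Lint_nonneg)
  qed
  finally show ?thesis using d by blast
 qed
 have mono: "F t \<le> F r" if "0 < r" "r \<le> t" for r t
 proof (rule DERIV_nonpos_imp_nonincreasing[OF that(2)])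
  fix z assume "r \<le> z" "z \<le> t"
  hence "0 < z" using that(1) by simp
  thus "\<exists>c. (F has_real_derivative c) (at z) \<and> c \<le> 0" by (rule deriv)
 qed
 have wsq: "L2 (w t)" "L2 (u t)" "L2 (g t)" if "0 < t" for t
 proof -
  note t' = that
  obtain G where "schrodinger V (u t) G" "l2_deriv u (\<lambda>x. - G x) t" using heat_flow_l2_deriv[OF hf t'] .
  hence "L2 (u t)" by (intro l2_derivD(2))
  moreover have "L2 (g t)" using gd[of t] that l2_derivD(2) by simp
  ultimately show "L2 (w t)" "L2 (u t)" "L2 (g t)"
   unfolding w_def by (auto intro: L2_diff)
 qed
 have ipen: "L1 (\<lambda>x. pen (w t x))" if "0 < t" for t
 proof (rule Bochner_Integration.integrable_bound)
  show "L1 (\<lambda>x. (w t x)^2)" using wsq(1)[OF that] by (simp add: square_integrable_def)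
  show "(\<lambda>x. pen (w t x)) \<in> LM"
   by (rule measurable_compose[OF L2_measurable[OF wsq(1)[OF that]] pen_measurable(1)])
  show "AE x. norm (pen (w t x)) \<le> norm ((w t x)^2)" using pen_le_square by simp
 qed
 have sg0: "L2 (g 0)" using gd[of 0] l2_derivD(2) by simp
 \<comment> \<open>Since f <= g 0, w t is at most (u t - f) + (g 0 - g t). Both terms tend to 0 in
   L^2, and \<open>pen\<close> is increasing and at most the square.\<close>
 have lim: "(F \<longlongrightarrow> 0) (at_right 0)"
 proof (rule Lim_null_comparison)
  let ?b = "\<lambda>t. (l2_norm (\<lambda>x. u t x - f x) + \<bar>t\<bar>*(1 + l2_norm (\<lambda>x. a*gauss_lap (0 + s) (x - y))))^2"
  have "((\<lambda>t. l2_norm (\<lambda>x. u t x - f x)) \<longlongrightarrow> 0) (at_right 0)" using hf by (simp add: heat_flow_def)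
  hence "(?b \<longlongrightarrow> (0 + \<bar>0\<bar>*(1 + l2_norm (\<lambda>x. a*gauss_lap (0 + s) (x - y))))^2) (at_right 0)"
   by (intro tendsto_intros)
  thus "(?b \<longlongrightarrow> 0) (at_right 0)" by simp
  have "\<forall>\<^sub>F h in at_right 0. l2_norm (\<lambda>x. (g (0 + h) x - g 0 x)/h) \<le> 1 + l2_norm (\<lambda>x. a*gauss_lap (0 + s) (x - y))"
   using l2_deriv_quotient_bounded[OF gd[of 0]] by (auto simp: eventually_at_split)
  thus "\<forall>\<^sub>F t in at_right 0. norm (F t) \<le> ?b t"
   using eventually_at_right_less[of 0]
  proof eventually_elim
   case (elim t)
   let ?p = "\<lambda>x. u t x - f x" and ?q = "\<lambda>x. (- t)*((g t x - g 0 x)/t)"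
   have sp: "L2 ?p" by (rule L2_diff[OF wsq(2)[OF elim(2)] f])
   have sq: "L2 ?q"
    by (rule L2_cmult[OF L2_quotient[OF wsq(3)[OF elim(2)] sg0]])
   have pw: "pen (w t x) \<le> (?p x + ?q x)^2" for x
   proof -
    have "w t x \<le> ?p x + ?q x" using le[of x] elim(2) by (simp add: w_def g_def)
    hence "pen (w t x) \<le> pen (?p x + ?q x)" by (rule pen_mono)
    also have "... \<le> (?p x + ?q x)^2" using pen_le_square[of "?p x + ?q x"] by simp
    finally show ?thesis .
   qed
   have F0: "0 \<le> F t" unfolding F_def by (intro Lint_nonneg pen_nonneg)
   have "F t \<le> (LINT x. (?p x + ?q x)^2)"
    unfolding F_def
   proof (rule integral_mono[OF ipen[OF elim(2)] _ pw])
    show "L1 (\<lambda>x. (?p x + ?q x)^2)"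
     using L2_integrable[OF L2_add[OF sp sq]] unfolding real_norm_def power2_abs .
   qed
   also have "... = (l2_norm (\<lambda>x. ?p x + ?q x))^2" by (simp only: l2_norm_power2)
   also have "... \<le> (l2_norm ?p + l2_norm ?q)^2"
    by (intro power_mono l2_norm_triangle sp sq l2_norm_nonneg)
   also have "l2_norm ?q = \<bar>t\<bar>*l2_norm (\<lambda>x. (g t x - g 0 x)/t)" by (simp only: l2_norm_cmult abs_minus_cancel)
   also have "(l2_norm ?p + \<bar>t\<bar>*l2_norm (\<lambda>x. (g t x - g 0 x)/t))^2 \<le> ?b t"
    using elim(1) by (intro power_mono add_left_mono mult_left_mono) (auto simp: l2_norm_nonneg)
   finally show ?case using F0 by simp
  qed
 qed
 have "F t \<le> 0"
 proof (rule tendsto_lowerbound[OF lim])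
  show "\<forall>\<^sub>F r in at_right 0. F t \<le> F r"
   using t mono by (auto simp: eventually_at_right_field intro!: exI[of _ t])
 qed simp
 moreover have "0 \<le> F t" unfolding F_def by (intro Lint_nonneg pen_nonneg)
 ultimately have "(LINT x. pen (w t x)) = 0" by (simp add: F_def)
 hence "AE x. pen (w t x) = 0"
  using integral_nonneg_eq_0_iff_AE[OF ipen[OF t]] pen_nonneg by simp
 thus ?thesis
 proof eventually_elim
  case (elim x)
  hence "w t x \<le> 0" using pen_pos[of "w t x"] by (cases "0 < w t x") auto
  thus ?case by (simp add: w_def g_def)
 qed
qed

section \<open>From the heat flow to a pointwise Gaussian bound for its kernel\<close>

lemma AE_lebesgue_lborel: "(AE x. P x) \<longleftrightarrow> (AE x in lborel. P x)"
 by (simp add: AE_completion_iff)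

text \<open>Bounds for the integrals of a kernel over products of small sets pass to the kernel by Lebesgue's
 differentiation theorem on the product space.\<close>

lemma kernel_bound_AE:
 fixes K G :: "'a::euclidean_space => 'a => real" and B :: "real => 'a => 'a => real"
 assumes K: "(\<lambda>z. K (fst z) (snd z)) \<in> BM"
  and int: "\<And>a b. AE x in lborel. integrable lborel (\<lambda>y. K x y*indicator (cbox a b) y)"
  and le: "\<And>x0 y0 h E Q. 0 < h ==> E \<in> sets borel ==> E \<subseteq> cbox x0 (x0 + h *\<^sub>R One) ==>
   Q \<in> sets borel ==> Q \<subseteq> cbox y0 (y0 + h *\<^sub>R One) ==>
   \<bar>LINT x|lborel. indicator E x*(LINT y|lborel. K x y*indicator Q y)\<bar> \<le> h ^ (2*DIM('a))*B h x0 y0"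
  and lim: "\<And>x y. ((\<lambda>h. B h x y) \<longlongrightarrow> G x y) (at_right 0)"
 shows "AE z in lborel. \<bar>K (fst z) (snd z)\<bar> \<le> G (fst z) (snd z)"
proof -
 have Kp[measurable]: "(\<lambda>(x, y). K x y) \<in> borel_measurable (lborel \<Otimes>\<^sub>M lborel)"
  using K by (simp add: lborel_prod split_beta')
 define C :: "nat => 'a set" where "C n = cbox (- real n *\<^sub>R One) (real n *\<^sub>R One)" for n
 have [measurable]: "C n \<in> sets borel" for n by (simp add: C_def)
 \<comment> \<open>K is not known to be locally integrable on the product space. On
   \<open>E n m\<close> its integrals in y over a box are bounded by m, and these sets exhaust
   almost all x.\<close>
 define E where "E n m = {x \<in> C n. (\<integral>\<^sup>+y. ennreal \<bar>K x y\<bar>*indicator (C n) y \<partial>lborel) \<le> ennreal (real m)}" for n m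
 have Eb[measurable]: "E n m \<in> sets borel" for n m
 proof -
  have "(\<lambda>x. \<integral>\<^sup>+y. ennreal \<bar>K x y\<bar>*indicator (C n) y \<partial>lborel) \<in> borel_measurable lborel"
   by measurable
  thus ?thesis unfolding E_def by measurable
 qed
 \<comment> \<open>The signs 1 and -1 for \<sigma> together bound the absolute value.\<close>
 have main: "AE z in lborel. \<sigma>*(K (fst z) (snd z)*indicator (E n m) (fst z)*indicator (C n) (snd z)) \<le> G (fst z) (snd z)"
  if \<sigma>: "\<bar>\<sigma>\<bar> = 1" for \<sigma> :: real and n m
 proof -
  define F :: "'a \<times> 'a => real" where "F z = \<sigma>*(K (fst z) (snd z)*indicator (E n m) (fst z)*indicator (C n) (snd z))" for z
  have Fb: "F \<in> BM"
  proof -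
   have [measurable]: "(fst :: 'a \<times> 'a => 'a) \<in> BM" "(snd :: 'a \<times> 'a => 'a) \<in> BM"
    by (auto intro!: BM_continuous continuous_intros)
   note [measurable] = K
   show ?thesis unfolding F_def by measurable
  qed
  have Fp: "F \<in> borel_measurable (lborel \<Otimes>\<^sub>M lborel)" using Fb by (simp add: lborel_prod)
  have iF: "integrable lborel F"
  proof (rule integrableI_bounded)
   show "F \<in> borel_measurable lborel" using Fb by simp
   have "(\<integral>\<^sup>+z. ennreal (norm (F z)) \<partial>lborel) = (\<integral>\<^sup>+z. ennreal (norm (F z)) \<partial>(lborel \<Otimes>\<^sub>M lborel))"
    by (simp add: lborel_prod)
   also have "... = (\<integral>\<^sup>+x. \<integral>\<^sup>+y. ennreal (norm (F (x, y))) \<partial>lborel \<partial>lborel)"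
    by (rule lborel.nn_integral_fst[symmetric]) (use Fp in measurable)
   also have "... \<le> (\<integral>\<^sup>+x. ennreal (real m)*indicator (C n) x \<partial>lborel)"
   proof (rule nn_integral_mono)
    fix x
    show "(\<integral>\<^sup>+y. ennreal (norm (F (x, y))) \<partial>lborel) \<le> ennreal (real m)*indicator (C n) x"
    proof (cases "x \<in> E n m")
     case True
     have "(\<integral>\<^sup>+y. ennreal (norm (F (x, y))) \<partial>lborel) = (\<integral>\<^sup>+y. ennreal \<bar>K x y\<bar>*indicator (C n) y \<partial>lborel)"
      using \<sigma> True by (intro nn_integral_cong) (auto simp: F_def abs_mult indicator_def)
     thus ?thesis using True by (simp add: E_def)
    qed (simp add: F_def)
   qed
   also have "... < \<infinity>"
    by (simp add: C_def nn_integral_cmult emeasure_lborel_cbox_eq ennreal_mult_less_top)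
   finally show "(\<integral>\<^sup>+z. ennreal (norm (F z)) \<partial>lborel) < \<infinity>" .
  qed
  have iFs: "set_integrable lborel S F" if "S \<in> sets borel" for S
   using iF that unfolding set_integrable_def by (intro integrable_mult_indicator) auto
  have hk: "F integrable_on cbox a b" "integral (cbox a b) F = (LINT z:cbox a b|lborel. F z)" for a b
   using set_borel_integral_eq_integral[OF iFs[of "cbox a b"]] by auto
  obtain N where N: "negligible N" and Nlim:
  "\<And>z e. z \<notin> N ==> 0 < e ==> \<exists>d>0. \<forall>h. 0 < h \<and> h < d -->
      norm (integral (cbox z (z + h *\<^sub>R One)) F /\<^sub>R h ^ DIM('a \<times> 'a) - F z) < e"
   using integrable_ccontinuous_explicit[of F] hk(1) by blast
  have box: "integral (cbox (x, y) ((x, y) + h *\<^sub>R One)) F \<le> h ^ DIM('a \<times> 'a)*B h x y" if h: "0 < h" for x y h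
  proof -
   let ?P = "cbox x (x + h *\<^sub>R One)" and ?Q = "cbox y (y + h *\<^sub>R One)"
   have cb: "cbox (x, y) ((x, y) + h *\<^sub>R One) = ?P \<times> ?Q"
    using sum_prod[of "\<lambda>_. 0::'a" "\<lambda>i. i::'a" Basis]
    by (simp add: sum_Basis_prod_eq cbox_Pair_eq sum_prod)
   have i: "integrable (lborel \<Otimes>\<^sub>M lborel) (\<lambda>z. indicator (?P \<times> ?Q) z*F z)"
    using iFs[of "?P \<times> ?Q"] by (simp add: set_integrable_def lborel_prod borel_Times)
   have "integral (cbox (x, y) ((x, y) + h *\<^sub>R One)) F = (LINT z|(lborel \<Otimes>\<^sub>M lborel). indicator (?P \<times> ?Q) z*F z)"
    unfolding hk(2) unfolding cb by (simp add: set_lebesgue_integral_def lborel_prod)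
   also have "... = (LINT x|lborel. LINT y|lborel. indicator (?P \<times> ?Q) (x, y)*F (x, y))"
    by (rule lborel_pair.integral_fst'[OF i, symmetric])
   also have "... = (LINT x|lborel. \<sigma>*(indicator (E n m \<inter> ?P) x*(LINT y|lborel. K x y*indicator (C n \<inter> ?Q) y)))"
   proof (rule Lint_cong[OF refl])
    fix x' :: 'a
    have "(LINT y'|lborel. indicator (?P \<times> ?Q) (x', y')*F (x', y'))
     = (LINT y'|lborel. (\<sigma>*indicator (E n m \<inter> ?P) x')*(K x' y'*indicator (C n \<inter> ?Q) y'))"
     by (intro Lint_cong refl) (auto simp: F_def indicator_def)
    thus "(LINT y'|lborel. indicator (?P \<times> ?Q) (x', y')*F (x', y'))
     = \<sigma>*(indicator (E n m \<inter> ?P) x'*(LINT y'|lborel. K x' y'*indicator (C n \<inter> ?Q) y'))"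
     by (simp only: integral_mult_right_zero mult.assoc)
   qed
   also have "... \<le> \<bar>LINT x|lborel. indicator (E n m \<inter> ?P) x*(LINT y|lborel. K x y*indicator (C n \<inter> ?Q) y)\<bar>"
    using \<sigma> by (auto simp: abs_if split: if_splits)
   also have "... \<le> h ^ (2*DIM('a))*B h x y"
    using h by (intro le) auto
   finally show ?thesis by (simp add: mult_2)
  qed
  have "F z \<le> G (fst z) (snd z)" if z: "z \<notin> N" for z
  proof -
   have "((\<lambda>h. integral (cbox z (z + h *\<^sub>R One)) F /\<^sub>R h ^ DIM('a \<times> 'a)) \<longlongrightarrow> F z) (at_right 0)"
   proof (rule tendstoI)
    fix e :: real assume "0 < e"
    from Nlim[OF z this] obtain d where "d > 0" "\<forall>h. 0 < h \<and> h < d -->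
      norm (integral (cbox z (z + h *\<^sub>R One)) F /\<^sub>R h ^ DIM('a \<times> 'a) - F z) < e" by blast
    thus "\<forall>\<^sub>F h in at_right 0. dist (integral (cbox z (z + h *\<^sub>R One)) F /\<^sub>R h ^ DIM('a \<times> 'a)) (F z) < e"
     by (auto simp: eventually_at_right_field dist_norm)
   qed
   moreover have "\<forall>\<^sub>F h in at_right 0. integral (cbox z (z + h *\<^sub>R One)) F /\<^sub>R h ^ DIM('a \<times> 'a) \<le> B h (fst z) (snd z)"
    using eventually_at_right_less[of 0]
   proof eventually_elim
    case (elim h)
    thus ?case using box[of h "fst z" "snd z"] by (simp add: field_simps)
   qed
   ultimately show ?thesis
    using lim by (intro tendsto_le[OF _ lim[of "fst z" "snd z"]]) auto
  qed
  hence "{z. \<not> F z \<le> G (fst z) (snd z)} \<subseteq> N" by blast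
  hence "AE z. F z \<le> G (fst z) (snd z)" using N eventually_ae_filter_negligible by blast
  thus ?thesis by (simp add: AE_lebesgue_lborel F_def)
 qed
 have "AE x in lborel. \<forall>n. integrable lborel (\<lambda>y. K x y*indicator (C n) y)"
  unfolding AE_all_countable C_def using int by blast
 note int' = this
 have intz: "AE z in (lborel :: ('a \<times> 'a) measure). \<forall>n. \<exists>m. (\<integral>\<^sup>+y. ennreal \<bar>K (fst z) y\<bar>*indicator (C n) y \<partial>lborel) \<le> ennreal (real m)"
 proof -
  have "AE x in lborel. \<forall>n. \<exists>m. (\<integral>\<^sup>+y. ennreal \<bar>K x y\<bar>*indicator (C n) y \<partial>lborel) \<le> ennreal (real m)"
   using int'
  proof eventually_elim
   case (elim x)
   show ?case
   proof
    fix n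
    have "(\<integral>\<^sup>+y. ennreal \<bar>K x y\<bar>*indicator (C n) y \<partial>lborel) = (\<integral>\<^sup>+y. ennreal (norm (K x y*indicator (C n) y)) \<partial>lborel)"
     by (intro nn_integral_cong) (auto simp: indicator_def)
    also have "... < \<infinity>" using elim by (simp add: integrable_iff_bounded)
    finally obtain r where r: "0 \<le> r" "(\<integral>\<^sup>+y. ennreal \<bar>K x y\<bar>*indicator (C n) y \<partial>lborel) = ennreal r"
     by (metis ennreal_cases less_irrefl infinity_ennreal_def)
    thus "\<exists>m. (\<integral>\<^sup>+y. ennreal \<bar>K x y\<bar>*indicator (C n) y \<partial>lborel) \<le> ennreal (real m)"
     using real_arch_simple[of r] by (auto intro!: exI ennreal_leI)
   qed
  qed
  hence "AE z in (lborel \<Otimes>\<^sub>M lborel :: ('a \<times> 'a) measure). \<forall>n. \<exists>m. (\<integral>\<^sup>+y. ennreal \<bar>K (fst z) y\<bar>*indicator (C n) y \<partial>lborel) \<le> ennreal (real m)"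
   by (intro lborel_pair.AE_pair_measure) (measurable, auto)
  thus ?thesis unfolding lborel_prod .
 qed
 have "AE z in lborel. \<forall>n m. 1*(K (fst z) (snd z)*indicator (E n m) (fst z)*indicator (C n) (snd z)) \<le> G (fst z) (snd z)"
   "AE z in lborel. \<forall>n m. (-1)*(K (fst z) (snd z)*indicator (E n m) (fst z)*indicator (C n) (snd z)) \<le> G (fst z) (snd z)"
  unfolding AE_all_countable by (intro allI main, simp)+
 thus ?thesis using intz
 proof eventually_elim
  case (elim z)
  obtain n :: nat where n: "norm (fst z) \<le> real n" "norm (snd z) \<le> real n"
   using real_arch_simple[of "max (norm (fst z)) (norm (snd z))"] by auto
  have inC: "x \<in> C n" if "norm x \<le> real n" for x
  proof -
   have "\<bar>x \<bullet> b\<bar> \<le> real n" if "b \<in> Basis" for b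
    using Basis_le_norm[OF that, of x] \<open>norm x \<le> real n\<close> by simp
   thus ?thesis by (auto simp: C_def mem_box abs_le_iff inner_sum_left_Basis minus_le_iff)
  qed
  obtain m where "(\<integral>\<^sup>+y. ennreal \<bar>K (fst z) y\<bar>*indicator (C n) y \<partial>lborel) \<le> ennreal (real m)"
   using elim(3) by blast
  hence "fst z \<in> E n m" "snd z \<in> C n" using inC n by (auto simp: E_def)
  thus ?case using elim(1)[rule_format, of n m] elim(2)[rule_format, of n m] by (simp add: abs_le_iff)
 qed
qed

lemma heat_kernelD:
 assumes k: "heat_kernel V k" and f: "L2 f"
 shows "0 < t ==> AE x. L1 (\<lambda>y. k t x y*f y)"
  and "heat_flow V f (\<lambda>t x. LINT y. k t x y*f y)"
 using assms unfolding heat_kernel_def by blast+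

lemma heat_kernel_measurable:
 assumes k: "heat_kernel V (k :: real => 'a::euclidean_space => 'a => real)"
 shows "(\<lambda>z. k t (fst z) (snd z)) \<in> BM" "k t x \<in> BM"
proof -
 have m: "(\<lambda>(t, x, y). k t x y) \<in> BM" using k by (simp add: heat_kernel_def)
 have "(\<lambda>z::'a \<times> 'a. (t, fst z, snd z)) \<in> BM"
  by (intro BM_continuous continuous_intros)
 from measurable_compose[OF this m] show "(\<lambda>z. k t (fst z) (snd z)) \<in> BM" by (simp add: split_beta)
 have "(\<lambda>y::'a. (t, x, y)) \<in> BM"
  by (intro BM_continuous continuous_intros)
 from measurable_compose[OF this m] show "k t x \<in> BM" by simp
qed

lemma L2_indicator:
 fixes Q :: "'a::euclidean_space set"
 assumes "Q \<in> sets borel" "bounded Q"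
 shows "L2 (indicator Q :: 'a => real)"
proof -
 have "emeasure lborel Q < \<infinity>" using assms by (intro emeasure_bounded_finite)
 hence "integrable lborel (indicator Q :: 'a => real)"
  using assms by (intro integrable_real_indicator) auto
 hence "L1 (indicator Q :: 'a => real)"
  using assms(1) by (subst integrable_completion) auto
 moreover have "(\<lambda>x. (norm (indicator Q x :: real))^2) = indicator Q"
  by (auto simp: indicator_def)
 moreover have "indicator Q \<in> LM"
  using assms(1) by (intro borel_measurable_indicator) auto
 ultimately show ?thesis by (simp add: square_integrable_def)
qed

lemma norm_diff_cube:
 fixes x0 :: "'a::euclidean_space"
 assumes "x \<in> cbox x0 (x0 + h *\<^sub>R One)" "0 \<le> h"
 shows "norm (x - x0) \<le> h * sqrt DIM('a)"
proof -
 have "norm (x - x0) \<le> sqrt (real DIM('a)*h^2)"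
 proof (subst norm_eq_sqrt_inner, rule real_sqrt_le_mono)
  have "(x - x0) \<bullet> (x - x0) = (\<Sum>b\<in>Basis. ((x - x0) \<bullet> b)^2)"
   by (subst euclidean_inner) (simp add: power2_eq_square)
  also have "... \<le> (\<Sum>b\<in>(Basis::'a set). h^2)"
  proof (rule sum_mono)
   fix b :: 'a assume b: "b \<in> Basis"
   have "x0 \<bullet> b \<le> x \<bullet> b" "x \<bullet> b \<le> x0 \<bullet> b + h"
    using assms(1) b by (auto simp: mem_box inner_add_left)
   thus "((x - x0) \<bullet> b)^2 \<le> h^2"
    using assms(2) by (intro power_mono) (auto simp: inner_diff_left)
  qed
  finally show "(x - x0) \<bullet> (x - x0) \<le> real DIM('a)*h^2" by simp
 qed
 thus ?thesis using assms(2) by (simp add: real_sqrt_mult mult.commute)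
qed

lemma abs_integral_cube_le:
 fixes u :: "'a::euclidean_space => real"
 assumes h: "0 < h" and E: "E \<in> sets borel" "E \<subseteq> cbox x0 (x0 + h *\<^sub>R One)"
  and b: "AE x. x \<in> E --> \<bar>u x\<bar> \<le> b" "0 \<le> b"
 shows "\<bar>LINT x. indicator E x*u x\<bar> \<le> h ^ DIM('a)*b"
proof (cases "L1 (\<lambda>x. indicator E x*u x)")
 case True
 have [measurable]: "E \<in> sets lebesgue" using E by simp
 have "emeasure lebesgue E \<le> emeasure lebesgue (cbox x0 (x0 + h *\<^sub>R One))"
  using E by (intro emeasure_mono) auto
 also have "... = ennreal (h ^ DIM('a))"
  using h by (simp add: emeasure_lborel_cbox_eq inner_add_left)
 finally have eE: "emeasure lebesgue E \<le> ennreal (h ^ DIM('a))" .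
 have mE: "measure lebesgue E \<le> h ^ DIM('a)"
  unfolding measure_def using eE h by (intro enn2real_leI) auto
 have iE: "L1 (\<lambda>x. indicator E x*b)"
  using eE E by (intro integrable_mult_left integrable_real_indicator) (auto simp: top_unique less_top[symmetric])
 have "\<bar>LINT x. indicator E x*u x\<bar> \<le> (LINT x. \<bar>indicator E x*u x\<bar>)"
  using integral_norm_bound[of lebesgue "\<lambda>x. indicator E x*u x"] by simp
 also have "... \<le> (LINT x. indicator E x*b)"
 proof (rule integral_mono_AE)
  show "L1 (\<lambda>x. \<bar>indicator E x*u x\<bar>)" using True by (rule integrable_abs)
  show "AE x. \<bar>indicator E x*u x\<bar> \<le> indicator E x*b"
   using b(1) by eventually_elim (auto simp: indicator_def)
 qed (rule iE)
 also have "... = measure lebesgue E*b" using E by simp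
 also have "... \<le> h ^ DIM('a)*b" using mE b(2) by (rule mult_right_mono)
 finally show ?thesis .
qed (use h b(2) in \<open>simp add: not_integrable_integral_eq\<close>)

text \<open>E and Q range over Borel subsets of the cubes and not over the cubes alone, because
  \<open>kernel_bound_AE\<close> intersects cubes with truncation sets.\<close>

lemma heat_kernel_bound_AE:
 fixes V :: "'a::euclidean_space => real"
 assumes k: "heat_kernel V k" and t: "0 < t"
  and le: "\<And>x0 y0 h E Q. 0 < h ==> E \<in> sets borel ==> E \<subseteq> cbox x0 (x0 + h *\<^sub>R One) ==>
   Q \<in> sets borel ==> Q \<subseteq> cbox y0 (y0 + h *\<^sub>R One) ==>
   \<bar>LINT x. indicator E x*(LINT y. k t x y*indicator Q y)\<bar> \<le> h ^ (2*DIM('a))*B h x0 y0"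
  and lim: "\<And>x y. ((\<lambda>h. B h x y) \<longlongrightarrow> G x y) (at_right 0)"
 shows "AE z in lborel. \<bar>k t (fst z) (snd z)\<bar> \<le> G (fst z) (snd z)"
proof (rule kernel_bound_AE[OF heat_kernel_measurable(1)[OF k] _ _ lim])
 have [measurable]: "k t x \<in> BM" "(\<lambda>(x, y). k t x y) \<in> borel_measurable (lborel \<Otimes>\<^sub>M lborel)" for x
  using heat_kernel_measurable[OF k, of t] by (simp_all add: lborel_prod split_beta')
 show "AE x in lborel. integrable lborel (\<lambda>y. k t x y*indicator (cbox a b) y)" for a b
 proof -
  have "AE x. L1 (\<lambda>y. k t x y*indicator (cbox a b) y)"
   by (rule heat_kernelD(1)[OF k L2_indicator t]) auto
  moreover have "L1 (\<lambda>y. k t x y*indicator (cbox a b) y) \<longleftrightarrow> integrable lborel (\<lambda>y. k t x y*indicator (cbox a b) y)" for x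
   by (intro integrable_completion) auto
  ultimately show ?thesis by (simp add: AE_lebesgue_lborel)
 qed
 show "\<bar>LINT x|lborel. indicator E x*(LINT y|lborel. k t x y*indicator Q y)\<bar> \<le> h ^ (2*DIM('a))*B h x0 y0"
  if h: "0 < h" and E: "E \<in> sets borel" "E \<subseteq> cbox x0 (x0 + h *\<^sub>R One)"
   and Q: "Q \<in> sets borel" "Q \<subseteq> cbox y0 (y0 + h *\<^sub>R One)" for x0 y0 h E Q
 proof -
  note [measurable] = Q(1) E(1)
  have kl: "(LINT y. k t x y*indicator Q y) = (LINT y|lborel. k t x y*indicator Q y)" for x
   by (rule integral_completion) measurable
  have "(\<lambda>x. indicator E x*(LINT y|lborel. k t x y*indicator Q y)) \<in> borel_measurable lborel" by measurable
  from integral_completion[OF this] show ?thesis using le[OF h E Q] unfolding kl by simp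
 qed
qed

text \<open>The indicator of a subset of a cube of side h lies below a Gaussian at time s = d h^2
  with amplitude \<open>c\<close> h^d, where \<open>c\<close> = e^(1/4) d^(d/2) makes this Gaussian
  at least 1 on the cube. Comparison bounds the flow at time t by the Gaussian at time t + s, and h
  tends to 0 after division by the volumes.\<close>

lemma heat_kernel_gauss_bound:
 fixes V :: "'a::euclidean_space => real"
 assumes V: "weight V" and k: "heat_kernel V k" and t: "0 < t"
 shows "AE z in lborel. \<bar>k t (fst z) (snd z)\<bar> \<le> exp (1/4)*real DIM('a) powr (real DIM('a)/2)*gauss t (fst z - snd z)"
proof (rule heat_kernel_bound_AE[OF k t])
 let ?d = "real DIM('a)"
 define c where "c = exp (1/4)*?d powr (?d/2)"
 \<comment> \<open>The positive part of |x - y| - h sqrt d is a lower bound for the distance of y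
   from the points of a cube with corner x and side h.\<close>
 define B where "B h x y = c*((t + h^2*?d) powr (- ?d/2)*exp (- ((max 0 (norm (x - y) - h * sqrt ?d))^2/(4*(t + h^2*?d)))))"
  for h and x y :: 'a
 have d: "0 < ?d" by simp
 have c: "0 \<le> c" by (simp add: c_def)
 show "((\<lambda>h. B h x y) \<longlongrightarrow> exp (1/4)*?d powr (?d/2)*gauss t (x - y)) (at_right 0)" for x y
 proof -
  have "((\<lambda>h. B h x y) \<longlongrightarrow> c*((t + 0^2*?d) powr (- ?d/2)*exp (- ((max 0 (norm (x - y) - 0 * sqrt ?d))^2/(4*(t + 0^2*?d)))))) (at_right 0)"
   unfolding B_def using t by (intro tendsto_intros) auto
  thus ?thesis by (simp add: c_def gauss_def power2_norm_eq_inner)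
 qed
 show "\<bar>LINT x. indicator E x*(LINT y. k t x y*indicator Q y)\<bar> \<le> h ^ (2*DIM('a))*B h x0 y0"
  if h: "0 < h" and E: "E \<in> sets borel" "E \<subseteq> cbox x0 (x0 + h *\<^sub>R One)"
   and Q: "Q \<in> sets borel" "Q \<subseteq> cbox y0 (y0 + h *\<^sub>R One)" for x0 y0 h E Q
 proof -
  define s where "s = h^2*?d"
  define a where "a = c*h ^ DIM('a)"
  have s: "0 < s" using h by (simp add: s_def)
  have a: "0 \<le> a" using c h by (simp add: a_def)
  have sQ: "L2 (indicator Q :: 'a => real)"
   using Q bounded_cbox bounded_subset by (intro L2_indicator) blast+
  have ind: "\<bar>indicator Q y\<bar> \<le> a*gauss s (y - y0)" for y
  proof (cases "y \<in> Q")
   case True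
   hence "norm (y - y0) \<le> h * sqrt ?d" using Q(2) h by (intro norm_diff_cube) auto
   hence "(norm (y - y0))^2 \<le> (h * sqrt ?d)^2" by (intro power_mono) auto
   hence "(y - y0) \<bullet> (y - y0) \<le> s" by (simp add: power2_norm_eq_inner s_def power_mult_distrib)
   hence "(y - y0) \<bullet> (y - y0)/(4 * s) \<le> 1/4" using s by (simp add: field_simps)
   hence e: "1 \<le> exp (1/4)*exp (- ((y - y0) \<bullet> (y - y0)/(4 * s)))"
    by (simp flip: exp_add)
   have "s powr (?d/2) = h ^ DIM('a)*?d powr (?d/2)"
    using h d by (simp add: s_def powr_mult powr_powr powr_realpow flip: powr_numeral)
   hence "a = exp (1/4) * s powr (?d/2)" by (simp add: a_def c_def)
   hence "a*gauss s (y - y0) = exp (1/4)*exp (- ((y - y0) \<bullet> (y - y0)/(4 * s)))"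
    using s by (simp add: gauss_def powr_minus field_simps)
   thus ?thesis using e True by simp
  qed (simp add: a gauss_nonneg)
  have up: "AE x. \<sigma>*(LINT y. k t x y*indicator Q y) \<le> a*gauss (t + s) (x - y0)"
   if \<sigma>: "\<bar>\<sigma>\<bar> = 1" for \<sigma> :: real
  proof -
   have sf: "L2 (\<lambda>y. \<sigma>*indicator Q y)" by (rule L2_cmult[OF sQ])
   have "\<sigma>*indicator Q y \<le> a*gauss s (y - y0)" for y
    by (rule order_trans[OF _ ind]) (use \<sigma> in \<open>auto simp: indicator_def abs_if split: if_splits\<close>)
   from heat_flow_le_gauss[OF V heat_kernelD(2)[OF k sf] sf s a this t]
   show ?thesis by (simp add: mult.left_commute)
  qed
  have bd: "gauss (t + s) (x - y0) \<le> (t + s) powr (- ?d/2)*exp (- ((max 0 (norm (x0 - y0) - h * sqrt ?d))^2/(4*(t + s))))"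
   if "x \<in> E" for x
  proof -
   have "norm (x - x0) \<le> h * sqrt ?d" using E(2) h that by (intro norm_diff_cube) auto
   moreover have "norm (x0 - y0) \<le> norm (x - x0) + norm (x - y0)"
    by (metis norm_minus_commute norm_triangle_sub add.commute diff_add_cancel norm_triangle_ineq add_diff_eq)
   ultimately have "(max 0 (norm (x0 - y0) - h * sqrt ?d))^2 \<le> (norm (x - y0))^2"
    by (intro power_mono) auto
   thus ?thesis using t s unfolding gauss_def
    by (intro mult_left_mono) (auto simp: power2_norm_eq_inner divide_right_mono)
  qed
  have "\<bar>LINT x. indicator E x*(LINT y. k t x y*indicator Q y)\<bar> \<le> h ^ DIM('a)*(h ^ DIM('a)*B h x0 y0)"
  proof (rule abs_integral_cube_le[OF h E])
   have "AE x. \<bar>LINT y. k t x y*indicator Q y\<bar> \<le> a*gauss (t + s) (x - y0)"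
    using up[of 1] up[of "- 1"] by (auto simp: AE_lebesgue_lborel elim!: eventually_elim2)
   thus "AE x. x \<in> E --> \<bar>LINT y. k t x y*indicator Q y\<bar> \<le> h ^ DIM('a)*B h x0 y0"
   proof eventually_elim
    case (elim x)
    show ?case
    proof
     assume "x \<in> E"
     note elim
     also have "a*gauss (t + s) (x - y0) \<le> a*((t + s) powr (- ?d/2)*exp (- ((max 0 (norm (x0 - y0) - h * sqrt ?d))^2/(4*(t + s)))))"
      by (rule mult_left_mono[OF bd[OF \<open>x \<in> E\<close>] a])
     also have "... = h ^ DIM('a)*B h x0 y0" by (simp add: a_def B_def s_def)
     finally show "\<bar>LINT y. k t x y*indicator Q y\<bar> \<le> h ^ DIM('a)*B h x0 y0" .
    qed
   qed
   show "0 \<le> h ^ DIM('a)*B h x0 y0" using h c by (simp add: B_def)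
  qed
  thus ?thesis by (simp add: mult_2 power_add mult.assoc)
 qed
qed

lemma l2_deriv_continuous:
 assumes U: "l2_deriv U D t"
 shows "((\<lambda>h. l2_norm (\<lambda>x. U (t + h) x - U t x)) \<longlongrightarrow> 0) (at 0)"
proof (rule Lim_null_comparison)
 have "((\<lambda>h. \<bar>h\<bar>*(1 + l2_norm D)) \<longlongrightarrow> \<bar>0\<bar>*(1 + l2_norm D)) (at (0::real))" by (intro tendsto_intros)
 thus "((\<lambda>h. \<bar>h\<bar>*(1 + l2_norm D)) \<longlongrightarrow> 0) (at (0::real))" by simp
 show "\<forall>\<^sub>F h in at 0. norm (l2_norm (\<lambda>x. U (t + h) x - U t x)) \<le> \<bar>h\<bar>*(1 + l2_norm D)"
  using l2_deriv_quotient_bounded[OF U] eventually_neq_at_within[of 0]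
 proof eventually_elim
  case (elim h)
  have "l2_norm (\<lambda>x. U (t + h) x - U t x) = l2_norm (\<lambda>x. h*((U (t + h) x - U t x)/h))"
   using elim(2) by simp
  also have "... \<le> \<bar>h\<bar>*(1 + l2_norm D)"
   unfolding l2_norm_cmult using elim(1) by (rule mult_left_mono) simp
  finally show ?case by (simp add: l2_norm_nonneg)
 qed
qed

lemma l2_deriv_reflect:
 assumes U: "l2_deriv U D (t - r)"
 shows "l2_deriv (\<lambda>r. U (t - r)) (\<lambda>x. - D x) r"
 unfolding l2_deriv_def
proof (intro conjI)
 note u = l2_derivD[OF U]
 have F: "filterlim (\<lambda>h. - h) (at 0) (at (0::real))"
  by (auto simp: filterlim_at intro!: tendsto_eq_intros eventually_neq_at_within[THEN eventually_mono])
 have e: "t - r + - h = t - (r + h)" for h by simp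
 show "L2 (\<lambda>x. - D x)" using L2_cmult[OF u(1), of "- 1"] by simp
 show "L2 (U (t - r))" by (rule u(2))
 show "\<forall>\<^sub>F h in at 0. L2 (U (t - (r + h)))"
  using eventually_compose_filterlim[OF u(3) F] unfolding e .
 have "((\<lambda>h. l2_norm (\<lambda>x. (U (t - (r + h)) x - U (t - r) x)/- h - D x)) \<longlongrightarrow> 0) (at 0)"
  using filterlim_compose[OF u(4) F] unfolding e .
 moreover have "l2_norm (\<lambda>x. (U (t - (r + h)) x - U (t - r) x)/- h - D x) = l2_norm (\<lambda>x. (U (t - (r + h)) x - U (t - r) x)/h - (- D x))" for h
  by (subst l2_norm_minus[symmetric]) simp
 ultimately show "((\<lambda>h. l2_norm (\<lambda>x. (U (t - (r + h)) x - U (t - r) x)/h - (- D x))) \<longlongrightarrow> 0) (at 0)"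
  by simp
qed

text \<open>The inner product of \<open>v r\<close> and \<open>u (t - r)\<close> does not depend on \<open>r\<close>.\<close>

lemma heat_flow_symmetric:
 fixes f h :: "'a::euclidean_space => real"
 assumes u: "heat_flow V f u" and v: "heat_flow V h v" and sh: "L2 h" and t: "0 < t"
 shows "(LINT x. h x*u t x) = (LINT x. v (t/2) x*u (t/2) x)"
proof -
 define I where "I r = (LINT x. v r x*u (t - r) x)" for r
 have sq: "L2 (u r)" "L2 (v r)" if "0 < r" for r
  using u v that unfolding heat_flow_def schrodinger_def form_domain_def by blast+
 have dI: "(I has_real_derivative 0) (at r)" if r: "0 < r" "r < t" for r
 proof -
  have r': "0 < t - r" using r by simp
  obtain G where G: "schrodinger V (u (t - r)) G" "l2_deriv u (\<lambda>x. - G x) (t - r)"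
   using heat_flow_l2_deriv[OF u r'] .
  obtain H where H: "schrodinger V (v r) H" "l2_deriv v (\<lambda>x. - H x) r"
   using heat_flow_l2_deriv[OF v r(1)] .
  obtain Du where Du: "form_domain V (u (t - r)) Du" and ueq: "\<And>w Dw. form_domain V w Dw ==>
    (LINT x. Du x \<bullet> Dw x + V x*u (t - r) x*w x) = (LINT x. G x*w x)"
   using G(1) unfolding schrodinger_def by blast
  obtain Dv where Dv: "form_domain V (v r) Dv" and veq: "\<And>w Dw. form_domain V w Dw ==>
    (LINT x. Dv x \<bullet> Dw x + V x * v r x*w x) = (LINT x. H x*w x)"
   using H(1) unfolding schrodinger_def by blast
  have "(I has_real_derivative (LINT x. - H x*u (t - r) x) + (LINT x. v r x*- (- G x))) (at r)"
   unfolding I_def by (rule has_real_derivative_inner_L2[OF H(2) l2_deriv_reflect[OF G(2)]])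
  moreover have "(LINT x. H x*u (t - r) x) = (LINT x. v r x*G x)"
   using veq[OF Du] ueq[OF Dv] by (simp add: inner_commute mult_ac)
  ultimately show ?thesis by simp
 qed
 have const: "I r = I (t/2)" if "0 < r" "r < t/2" for r
  using DERIV_isconst_end[of r "t/2" I] that t
  by (metis DERIV_isCont atLeastAtMost_iff continuous_at_imp_continuous_on dI dual_order.strict_trans2 half_gt_zero_iff
    less_half_sum linordered_field_class.half_gt_zero order.strict_trans order_less_le_trans field_sum_of_halves less_add_same_cancel1)
 obtain G where G: "l2_deriv u (\<lambda>x. - G x) t" using heat_flow_l2_deriv[OF u t] .
 \<comment> \<open>As r tends to 0, v r tends to its initial value h, and u (t - r) tends to u t
   because u is differentiable at the positive time t.\<close>
 let ?c = "\<lambda>r. l2_norm (\<lambda>x. u (t + (- r)) x - u t x)" and ?b = "\<lambda>r. l2_norm (\<lambda>x. v r x - h x)"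
 have F: "filterlim (\<lambda>h. - h) (at 0) (at_right (0::real))"
  by (auto simp: filterlim_at eventually_at_filter intro!: tendsto_eq_intros)
 have lc: "(?c \<longlongrightarrow> 0) (at_right 0)" using filterlim_compose[OF l2_deriv_continuous[OF G] F] .
 have lb: "(?b \<longlongrightarrow> 0) (at_right 0)" using v by (simp add: heat_flow_def)
 have "(I \<longlongrightarrow> (LINT x. h x*u t x)) (at_right 0)"
 proof (rule LIM_zero_cancel, rule Lim_null_comparison)
  have "((\<lambda>r. ?b r*(l2_norm (u t) + ?c r) + l2_norm h*?c r) \<longlongrightarrow> 0*(l2_norm (u t) + 0) + l2_norm h*0) (at_right 0)"
   by (intro tendsto_intros lb lc)
  thus "((\<lambda>r. ?b r*(l2_norm (u t) + ?c r) + l2_norm h*?c r) \<longlongrightarrow> 0) (at_right 0)" by simp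
  have "\<forall>\<^sub>F r in at_right 0. 0 < r \<and> r < t"
   using t by (auto simp: eventually_at_right_field)
  thus "\<forall>\<^sub>F r in at_right 0. norm (I r - (LINT x. h x*u t x)) \<le> ?b r*(l2_norm (u t) + ?c r) + l2_norm h*?c r"
  proof eventually_elim
   case (elim r)
   have r: "t + (- r) = t - r" by simp
   have s: "L2 (u (t - r))" "L2 (u t)" "L2 (v r)"
    using sq elim t by auto
   note s1 = L2_diff[OF s(3) sh] and s2 = L2_diff[OF s(1,2)]
   have "I r - (LINT x. h x*u t x) = (LINT x. v r x*u (t - r) x - h x*u t x)"
    unfolding I_def using integrable_mult_L2[OF s(3,1)] integrable_mult_L2[OF sh s(2)] by simp
   also have "... = (LINT x. (v r x - h x)*u (t - r) x + h x*(u (t - r) x - u t x))"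
    by (simp add: algebra_simps)
   also have "... = (LINT x. (v r x - h x)*u (t - r) x) + (LINT x. h x*(u (t - r) x - u t x))"
    by (intro Lint_add integrable_mult_L2 s1 s2 s sh)
   finally have "norm (I r - (LINT x. h x*u t x)) \<le> ?b r*l2_norm (u (t - r)) + l2_norm h*?c r"
    using abs_integral_mult_le_l2_norm[OF s1 s(1)] abs_integral_mult_le_l2_norm[OF sh s2] by (simp add: r)
   moreover have "l2_norm (u (t - r)) \<le> l2_norm (u t) + ?c r"
    using l2_norm_triangle[OF s(2) s2] by (simp add: r)
   hence "?b r*l2_norm (u (t - r)) \<le> ?b r*(l2_norm (u t) + ?c r)"
    by (rule mult_left_mono) (rule l2_norm_nonneg)
   ultimately show ?case by simp
  qed
 qed
 moreover have "(I \<longlongrightarrow> I (t/2)) (at_right 0)"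
 proof (rule tendsto_eventually)
  show "\<forall>\<^sub>F r in at_right 0. I r = I (t/2)"
   using const t by (auto simp: eventually_at_right_field intro!: exI[of _ "t/2"])
 qed
 ultimately have "(LINT x. h x*u t x) = I (t/2)" by (intro tendsto_unique[of "at_right 0"]) auto
 thus ?thesis by (simp add: I_def)
qed

section \<open>Decay of the heat kernel beyond the critical radius\<close>

context rh_potential begin

lemma form_domain_mult_C1:
 assumes u: "form_domain V u Du" and D: "\<And>x. GDERIV \<psi> x :> D\<psi> x" and c: "continuous_on UNIV D\<psi>"
  and b: "\<And>x. \<bar>\<psi> x\<bar> \<le> B" "\<And>x. norm (D\<psi> x) \<le> B'"
 shows "form_domain V (\<lambda>x. \<psi> x*u x) (\<lambda>x. \<psi> x *\<^sub>R Du x + u x *\<^sub>R D\<psi> x)"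
proof -
 have su: "L2 u" "L2 Du" "weak_gradient u Du" "L1 (\<lambda>x. V x*(u x)^2)"
  using u by (auto simp: form_domain_def)
 have m\<psi>[measurable]: "\<psi> \<in> LM" "D\<psi> \<in> LM"
  using GDERIV_continuous_on[OF D] c
  by (intro LM_of_BM BM_continuous; blast)+
 note [measurable] = L2_measurable[OF su(1)] V_measurable
 have "L2 (\<lambda>x. u x *\<^sub>R D\<psi> x)"
 proof (rule L2_bound[OF L2_cmult[OF su(1), of B']])
  show "AE x. norm (u x *\<^sub>R D\<psi> x) \<le> norm (B'*u x)"
  proof (rule AE_I2)
   fix x
   have "norm (D\<psi> x) \<le> \<bar>B'\<bar>" using b(2)[of x] by simp
   thus "norm (u x *\<^sub>R D\<psi> x) \<le> norm (B'*u x)" by (simp add: abs_mult mult.commute[of _ "\<bar>u x\<bar>"] mult_left_mono)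
  qed
 qed measurable
 moreover have "L2 (\<lambda>x. \<psi> x *\<^sub>R u x)" "L2 (\<lambda>x. \<psi> x *\<^sub>R Du x)"
  using L2_mult_bounded[OF su(1) m\<psi>(1) b(1)] L2_mult_bounded[OF su(2) m\<psi>(1) b(1)] by auto
 moreover have "L1 (\<lambda>x. V x*(\<psi> x*u x)^2)"
 proof (rule Bochner_Integration.integrable_bound)
  show "L1 (\<lambda>x. B^2*(V x*(u x)^2))" using su(4) by (rule integrable_mult_right)
  show "AE x. norm (V x*(\<psi> x*u x)^2) \<le> norm (B^2*(V x*(u x)^2))"
  proof (rule AE_I2)
   fix x
   have "(\<psi> x)^2 \<le> B^2" using power_mono[OF b(1)[of x], of 2] by simp
   hence "(\<psi> x)^2*(V x*(u x)^2) \<le> B^2*(V x*(u x)^2)"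
    using V_nonneg by (intro mult_right_mono) auto
   thus "norm (V x*(\<psi> x*u x)^2) \<le> norm (B^2*(V x*(u x)^2))"
    using V_nonneg[of x] by (simp add: power_mult_distrib abs_mult mult_ac)
  qed
 qed measurable
 ultimately show ?thesis
  unfolding form_domain_def using weak_gradient_mult_C1[OF su(1-3) D c] by (auto intro: L2_add)
qed

text \<open>With w = e^\<phi> u the cross terms cancel, and Q(u, e^(2\<phi>) u) = Q(w, w) minus the
  integral of |D\<phi>|^2 w^2. The bound on the gradient of \<phi> is exactly what lets the
  Fefferman-Phong inequality for w absorb the subtracted term.\<close>

lemma weighted_form_nonneg:
 assumes u: "form_domain V u Du" and D: "\<And>x. GDERIV \<phi> x :> D\<phi> x" and c: "continuous_on UNIV D\<phi>"
  and b: "\<And>x. \<bar>\<phi> x\<bar> \<le> M" "\<And>x. norm (D\<phi> x) \<le> M'" and g: "\<And>x. CFP*(norm (D\<phi> x)*mrad x)^2 \<le> 1"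
 shows "form_domain V (\<lambda>x. exp (2*\<phi> x)*u x) (\<lambda>x. exp (2*\<phi> x) *\<^sub>R Du x + u x *\<^sub>R ((exp (2*\<phi> x)*2) *\<^sub>R D\<phi> x))"
  and "0 \<le> (LINT x. Du x \<bullet> (exp (2*\<phi> x) *\<^sub>R Du x + u x *\<^sub>R ((exp (2*\<phi> x)*2) *\<^sub>R D\<phi> x)) + V x*u x*(exp (2*\<phi> x)*u x))"
proof -
 have M': "0 \<le> M'" using b(2) norm_ge_zero order_trans by blast
 have De: "GDERIV (\<lambda>x. exp (c*\<phi> x)) x :> (exp (c*\<phi> x)*c) *\<^sub>R D\<phi> x" for c x
  using D[of x] unfolding gderiv_def
  by (auto intro!: derivative_eq_intros simp: fun_eq_iff)
 have be: "\<bar>exp (c*\<phi> x)\<bar> \<le> exp (\<bar>c\<bar>*M)" for c x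
 proof -
  have "c*\<phi> x \<le> \<bar>c\<bar>*\<bar>\<phi> x\<bar>" by (simp flip: abs_mult)
  also have "... \<le> \<bar>c\<bar>*M" by (intro mult_left_mono b) auto
  finally show ?thesis by simp
 qed
 have fd: "form_domain V (\<lambda>x. exp (c*\<phi> x)*u x) (\<lambda>x. exp (c*\<phi> x) *\<^sub>R Du x + u x *\<^sub>R ((exp (c*\<phi> x)*c) *\<^sub>R D\<phi> x))" for c
 proof (rule form_domain_mult_C1[OF u De _ be])
  show "continuous_on UNIV (\<lambda>x. (exp (c*\<phi> x)*c) *\<^sub>R D\<phi> x)"
   by (intro continuous_intros assms GDERIV_continuous_on[OF D])
  show "norm ((exp (c*\<phi> x)*c) *\<^sub>R D\<phi> x) \<le> exp (\<bar>c\<bar>*M)*\<bar>c\<bar>*M'" for x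
   unfolding norm_scaleR abs_mult using be[of c x] b(2)[of x] M' by (intro mult_mono) auto
 qed
 show fd2: "form_domain V (\<lambda>x. exp (2*\<phi> x)*u x) (\<lambda>x. exp (2*\<phi> x) *\<^sub>R Du x + u x *\<^sub>R ((exp (2*\<phi> x)*2) *\<^sub>R D\<phi> x))"
  by (rule fd)
 define w where "w x = exp (1*\<phi> x)*u x" for x
 define Dw where "Dw x = exp (1*\<phi> x) *\<^sub>R Du x + u x *\<^sub>R ((exp (1*\<phi> x)*1) *\<^sub>R D\<phi> x)" for x
 have fw: "form_domain V w Dw" unfolding w_def[abs_def] Dw_def[abs_def] by (rule fd)
 hence sw: "L2 w" "L2 Dw" "L1 (\<lambda>x. V x*(w x)^2)"
  by (auto simp: form_domain_def)
 have iP: "L1 (\<lambda>x. (norm (Dw x))^2 + V x*(w x)^2)"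
  using L2_integrable[OF sw(2)] sw(3) by (rule Bochner_Integration.integrable_add)
 have iN: "L1 (\<lambda>x. (norm (D\<phi> x))^2*(w x)^2)"
 proof (rule Bochner_Integration.integrable_bound)
  show "L1 (\<lambda>x. M'^2*(w x)^2)"
   using L2_integrable[OF sw(1)] by (intro integrable_mult_right) simp
  have [measurable]: "D\<phi> \<in> LM"
   using c by (intro LM_of_BM BM_continuous)
  note [measurable] = L2_measurable[OF sw(1)]
  show "(\<lambda>x. (norm (D\<phi> x))^2*(w x)^2) \<in> LM" by measurable
  show "AE x. norm ((norm (D\<phi> x))^2*(w x)^2) \<le> norm (M'^2*(w x)^2)"
   using b(2) by (auto intro!: always_eventually mult_right_mono power_mono)
 qed
 have pw: "Du x \<bullet> (exp (2*\<phi> x) *\<^sub>R Du x + u x *\<^sub>R ((exp (2*\<phi> x)*2) *\<^sub>R D\<phi> x)) + V x*u x*(exp (2*\<phi> x)*u x)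
   = ((norm (Dw x))^2 + V x*(w x)^2) - (norm (D\<phi> x))^2*(w x)^2" for x
 proof -
  have e: "exp (2*\<phi> x) = exp (\<phi> x)*exp (\<phi> x)" by (simp flip: exp_add)
  show ?thesis unfolding power2_norm_eq_inner w_def Dw_def e
   by (simp add: inner_add_left inner_add_right inner_commute algebra_simps power2_eq_square)
 qed
 have "(LINT x. (norm (D\<phi> x))^2*(w x)^2) \<le> (LINT x. (norm (Dw x))^2 + V x*(w x)^2)"
 proof -
  have nn: "0 \<le> (norm (Dw x))^2 + V x*(w x)^2" for x using V_nonneg[of x] by simp
  have "ennreal CFP*(\<integral>x. ennreal ((norm (D\<phi> x))^2*(w x)^2))
    = (\<integral>x. ennreal CFP*ennreal ((norm (D\<phi> x))^2*(w x)^2))"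
   by (intro nn_integral_cmult[symmetric] measurable_compose[OF borel_measurable_integrable[OF iN] measurable_ennreal])
  also have "... \<le> (\<integral>x. ennreal ((w x/mrad x)^2))"
  proof (rule nn_integral_mono)
   fix x
   have "CFP*(norm (D\<phi> x))^2 \<le> 1/(mrad x)^2"
    using g[of x] mrad_pos[of x] by (simp add: field_simps power_mult_distrib)
   hence "CFP*(norm (D\<phi> x))^2*(w x)^2 \<le> 1/(mrad x)^2*(w x)^2" by (rule mult_right_mono) simp
   hence "CFP*((norm (D\<phi> x))^2*(w x)^2) \<le> (w x/mrad x)^2" by (simp add: power_divide mult.assoc)
   thus "ennreal CFP*ennreal ((norm (D\<phi> x))^2*(w x)^2) \<le> ennreal ((w x/mrad x)^2)"
    using CFP(1) by (simp flip: ennreal_mult)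
  qed
  also have "... \<le> ennreal CFP*(\<integral>x. ennreal ((norm (Dw x))^2 + V x*(w x)^2))"
   by (rule CFP(2)[OF fw])
  finally have "(\<integral>x. ennreal ((norm (D\<phi> x))^2*(w x)^2)) \<le> (\<integral>x. ennreal ((norm (Dw x))^2 + V x*(w x)^2))"
   using CFP(1) by (subst (asm) ennreal_mult_le_mult_iff) auto
  thus ?thesis
   using iN iP nn by (subst (asm) (1 2) nn_integral_eq_integral) (auto intro!: Lint_nonneg)
 qed
 thus "0 \<le> (LINT x. Du x \<bullet> (exp (2*\<phi> x) *\<^sub>R Du x + u x *\<^sub>R ((exp (2*\<phi> x)*2) *\<^sub>R D\<phi> x)) + V x*u x*(exp (2*\<phi> x)*u x))"
  unfolding pw using iN iP by simp
qed

text \<open>Agmon's method: the Fefferman-Phong inequality absorbs the gradient of the exponential weight.\<close>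

lemma heat_flow_weighted_decreasing:
 assumes u: "heat_flow V f u" and D: "\<And>x. GDERIV \<phi> x :> D\<phi> x" and c: "continuous_on UNIV D\<phi>"
  and b: "\<And>x. \<bar>\<phi> x\<bar> \<le> M" "\<And>x. norm (D\<phi> x) \<le> M'" and g: "\<And>x. CFP*(norm (D\<phi> x)*mrad x)^2 \<le> 1"
  and r: "0 < r" "r \<le> t"
 shows "(LINT x. exp (2*\<phi> x)*(u t x*u t x)) \<le> (LINT x. exp (2*\<phi> x)*(u r x*u r x))"
proof (rule DERIV_nonpos_imp_nonincreasing[OF r(2)])
 fix s assume "r \<le> s" "s \<le> t"
 hence s: "0 < s" using r by simp
 obtain G where G: "schrodinger V (u s) G" "l2_deriv u (\<lambda>x. - G x) s"
  using heat_flow_l2_deriv[OF u s] .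
 obtain Du where Du: "form_domain V (u s) Du" and eq: "\<And>w Dw. form_domain V w Dw ==>
   (LINT x. Du x \<bullet> Dw x + V x*u s x*w x) = (LINT x. G x*w x)"
  using G(1) unfolding schrodinger_def by blast
 have m: "(\<lambda>x. exp (2*\<phi> x)) \<in> LM"
  using GDERIV_continuous_on[OF D, of UNIV]
  by (intro LM_of_BM BM_continuous continuous_intros)
 have bd: "exp (2*\<phi> x) \<le> exp (2*M)" for x using b(1)[of x] by simp
 note w = weighted_form_nonneg[OF Du D c b g]
 have "0 \<le> (LINT x. G x*(exp (2*\<phi> x)*u s x))"
  using w(2) eq[OF w(1)] by simp
 moreover have "(LINT x. 2*exp (2*\<phi> x)*u s x*- G x) = - 2*(LINT x. G x*(exp (2*\<phi> x)*u s x))"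
  by (subst integral_mult_right_zero[symmetric]) (simp add: mult_ac)
 moreover have "((\<lambda>t. LINT x. exp (2*\<phi> x)*(u t x*u t x)) has_real_derivative (LINT x. 2*exp (2*\<phi> x)*u s x*- G x)) (at s)"
 proof (rule has_real_derivative_integral_compose[OF G(2), where \<Psi>="\<lambda>x s. exp (2*\<phi> x)*(s * s)" and \<beta>="\<lambda>x s. 2*exp (2*\<phi> x) * s"
   and L="exp (2*M)" and M="2*exp (2*M)"])
  show "\<bar>exp (2*\<phi> x)*(b*b) - exp (2*\<phi> x)*(a*a) - 2*exp (2*\<phi> x)*a*(b - a)\<bar> \<le> exp (2*M)*(b - a)^2" for x a b
  proof -
   have "exp (2*\<phi> x)*(b*b) - exp (2*\<phi> x)*(a*a) - 2*exp (2*\<phi> x)*a*(b - a) = exp (2*\<phi> x)*(b - a)^2"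
    by (simp add: power2_eq_square algebra_simps)
   thus ?thesis using bd[of x] by (simp add: mult_right_mono)
  qed
 qed (use m bd in \<open>auto simp: abs_mult power2_eq_square mult_right_mono\<close>)
 ultimately
 show "\<exists>y. ((\<lambda>t. LINT x. exp (2*\<phi> x)*(u t x*u t x)) has_real_derivative y) (at s) \<and> y \<le> 0" by auto
qed

end

lemma ennreal_abs_integral_le:
 fixes f :: "'a => real"
 shows "ennreal \<bar>integral\<^sup>L M f\<bar> \<le> (\<integral>\<^sup>+x. ennreal \<bar>f x\<bar> \<partial>M)"
 using integral_norm_bound_ennreal[of M f] by (cases "integrable M f") (auto simp: not_integrable_integral_eq)

text \<open>A weight whose logarithm is Lipschitz at the scale \<open>\<kappa>\<close> costs only a constant for times up to \<open>\<kappa>^2\<close>.\<close>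

lemma gauss_weighted_L2:
 fixes f :: "'a::euclidean_space => real"
 assumes C: "\<And>(y :: 'a). (\<integral>\<^sup>+x. ennreal (s powr (- real DIM('a)/2)*exp (- ((norm (x - y))^2/(8 * s)))) \<partial>lborel) \<le> ennreal C"
  and K: "AE z in lborel. \<bar>K (fst z) (snd z)\<bar> \<le> c*gauss s (fst z - snd z)" and c: "0 \<le> c" "0 \<le> C"
  and s: "0 < s" "s \<le> \<kappa>^2" and \<kappa>: "0 < \<kappa>" and lip: "\<And>x y. \<bar>\<phi> x - \<phi> y\<bar> \<le> norm (x - y)/\<kappa>"
  and f: "f \<in> BM" and P: "(\<integral>\<^sup>+y. ennreal (\<bar>f y\<bar>*exp (\<phi> y)) \<partial>lborel) \<le> ennreal P" "0 \<le> P"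
 shows "(\<integral>\<^sup>+x. ennreal ((exp (\<phi> x)*(LINT y|lborel. K x y*f y))^2) \<partial>lborel)
  \<le> ennreal ((c*exp 2)^2*C * s powr (- real DIM('a)/2)*P^2)"
proof -
 let ?d = "real DIM('a)"
 have "continuous_on UNIV \<phi>"
 proof (rule continuous_onI)
  fix x :: 'a and e :: real assume "0 < e"
  have "dist (\<phi> y) (\<phi> x) < e" if "dist y x < e*\<kappa>" for y
   using le_less_trans[OF lip[of y x], of e] that \<kappa> by (simp add: dist_norm divide_less_eq)
  thus "\<exists>d>0. \<forall>x'\<in>UNIV. dist x' x < d --> dist (\<phi> x') (\<phi> x) \<le> e"
   using \<open>0 < e\<close> \<kappa> by (intro exI[of _ "e*\<kappa>"]) (auto intro: less_imp_le)
 qed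
 hence [measurable]: "\<phi> \<in> BM" by (rule BM_continuous)
 note [measurable] = f
 define p where "p y = ennreal (\<bar>f y\<bar>*exp (\<phi> y))" for y
 define H where "H x y = ennreal (s powr (- ?d/2)*exp (- ((norm (x - y))^2/(8 * s))))" for x y :: 'a
 define T where "T x = (\<integral>\<^sup>+y. H x y*p y \<partial>lborel)" for x
 have [measurable]: "p \<in> BM" "(\<lambda>x. H x y) \<in> BM" "H x \<in> BM"
   "(\<lambda>(x, y). H x y) \<in> borel_measurable (lborel \<Otimes>\<^sub>M lborel)" for x y
  unfolding p_def H_def by measurable
 have [measurable]: "T \<in> BM" unfolding T_def by measurable
 have kernel: "exp (\<phi> x)*(c*gauss s (x - y)*\<bar>f y\<bar>) \<le> c*exp 2*((s powr (- ?d/2)*exp (- ((norm (x - y))^2/(8 * s))))*(\<bar>f y\<bar>*exp (\<phi> y)))" for x y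
 proof -
  define r where "r = norm (x - y)"
  have r: "0 \<le> r" by (simp add: r_def)
  have sq: "sqrt s \<le> \<kappa>" using s \<kappa> by (intro real_le_lsqrt) auto
  have "\<phi> x \<le> \<phi> y + r/\<kappa>" using lip[of x y] by (simp add: r_def abs_le_iff)
  also have "r/\<kappa> \<le> r/sqrt s" using sq s r \<kappa> by (intro divide_left_mono) auto
  finally have 1: "\<phi> x \<le> \<phi> y + r/sqrt s" by simp
  define z where "z = r/sqrt s"
  have z2: "r^2/s = z^2" using s by (simp add: z_def power_divide)
  \<comment> \<open>Completing the square: z <= 2 + z^2/8. Half of the Gaussian exponent pays for
    the growth of the weight, at the price of the factor e^2.\<close>
  have "0 \<le> (z - 4)^2" by simp
  hence "z - z^2/4 \<le> 2 - z^2/8" by (simp add: power2_eq_square algebra_simps)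
  hence "\<phi> x - r^2/(4 * s) \<le> 2 - r^2/(8 * s) + \<phi> y"
   using 1 z2[symmetric] by (simp add: z_def[symmetric] field_simps)
  hence "exp (\<phi> x)*exp (- (r^2/(4 * s))) \<le> exp 2*exp (- (r^2/(8 * s)))*exp (\<phi> y)"
   by (simp flip: exp_add)
  hence "c * s powr (- ?d/2)*\<bar>f y\<bar>*(exp (\<phi> x)*exp (- (r^2/(4 * s)))) \<le> c * s powr (- ?d/2)*\<bar>f y\<bar>*(exp 2*exp (- (r^2/(8 * s)))*exp (\<phi> y))"
   using c by (intro mult_left_mono) auto
  thus ?thesis by (simp add: gauss_def r_def power2_norm_eq_inner mult_ac)
 qed
 have "AE x in lborel. AE y in lborel. \<bar>K x y\<bar> \<le> c*gauss s (x - y)"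
 proof -
  have "AE z in lborel \<Otimes>\<^sub>M lborel. \<bar>K (fst z) (snd z)\<bar> \<le> c*gauss s (fst z - snd z)"
   unfolding lborel_prod by (rule K)
  from lborel_pair.AE_pair[OF this] show ?thesis by simp
 qed
 hence "AE x in lborel. ennreal ((exp (\<phi> x)*(LINT y|lborel. K x y*f y))^2) \<le> ennreal ((c*exp 2)^2)*(T x*T x)"
 proof eventually_elim
  case (elim x)
  have "ennreal (exp (\<phi> x)*\<bar>LINT y|lborel. K x y*f y\<bar>) = ennreal (exp (\<phi> x))*ennreal \<bar>LINT y|lborel. K x y*f y\<bar>"
   by (simp add: ennreal_mult)
  also have "... \<le> ennreal (exp (\<phi> x))*(\<integral>\<^sup>+y. ennreal (c*gauss s (x - y)*\<bar>f y\<bar>) \<partial>lborel)"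
  proof (rule mult_left_mono[OF order_trans[OF ennreal_abs_integral_le]])
   show "(\<integral>\<^sup>+y. ennreal \<bar>K x y*f y\<bar> \<partial>lborel) \<le> (\<integral>\<^sup>+y. ennreal (c*gauss s (x - y)*\<bar>f y\<bar>) \<partial>lborel)"
    using elim by (intro nn_integral_mono_AE) (auto elim!: eventually_mono intro!: ennreal_leI mult_right_mono simp: abs_mult)
  qed simp
  also have "... = (\<integral>\<^sup>+y. ennreal (exp (\<phi> x)*(c*gauss s (x - y)*\<bar>f y\<bar>)) \<partial>lborel)"
  proof -
   have "(\<lambda>y. gauss s (x - y)) \<in> BM"
    using measurable_compose[OF _ gauss_measurable(1)[OF s(1)], of "\<lambda>y. x - y"] by simp
   thus ?thesis using c by (subst nn_integral_cmult[symmetric]) (auto simp: ennreal_mult gauss_nonneg)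
  qed
  also have "... \<le> (\<integral>\<^sup>+y. ennreal (c*exp 2)*(H x y*p y) \<partial>lborel)"
  proof (rule nn_integral_mono)
   fix y
   have "ennreal (c*exp 2)*(H x y*p y) = ennreal (c*exp 2*((s powr (- ?d/2)*exp (- ((norm (x - y))^2/(8 * s))))*(\<bar>f y\<bar>*exp (\<phi> y))))"
    using c(1) unfolding H_def p_def by (simp flip: ennreal_mult)
   thus "ennreal (exp (\<phi> x)*(c*gauss s (x - y)*\<bar>f y\<bar>)) \<le> ennreal (c*exp 2)*(H x y*p y)"
    using kernel[of x y] by (simp only: ennreal_leI)
  qed
  also have "... = ennreal (c*exp 2)*T x"
   unfolding T_def by (intro nn_integral_cmult) measurable
  finally have *: "ennreal (exp (\<phi> x)*\<bar>LINT y|lborel. K x y*f y\<bar>) \<le> ennreal (c*exp 2)*T x" .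
  have "ennreal ((exp (\<phi> x)*(LINT y|lborel. K x y*f y))^2)
   = ennreal (exp (\<phi> x)*\<bar>LINT y|lborel. K x y*f y\<bar>)*ennreal (exp (\<phi> x)*\<bar>LINT y|lborel. K x y*f y\<bar>)"
   by (simp flip: ennreal_mult) (simp add: power2_eq_square abs_mult_self_eq mult_ac)
  also have "... \<le> (ennreal (c*exp 2)*T x)*(ennreal (c*exp 2)*T x)"
   by (intro mult_mono * ) auto
  also have "... = ennreal ((c*exp 2)^2)*(T x*T x)"
   using c by (simp add: power2_eq_square ennreal_mult mult_ac)
  finally show ?case .
 qed
 hence "(\<integral>\<^sup>+x. ennreal ((exp (\<phi> x)*(LINT y|lborel. K x y*f y))^2) \<partial>lborel)
   \<le> (\<integral>\<^sup>+x. ennreal ((c*exp 2)^2)*(T x*T x) \<partial>lborel)" by (rule nn_integral_mono_AE)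
 also have "... = ennreal ((c*exp 2)^2)*(\<integral>\<^sup>+x. T x*T x \<partial>lborel)"
  by (intro nn_integral_cmult) measurable
 \<comment> \<open>One factor is bounded pointwise by s^(-d/2) P, the other is integrated in x; this
   is interpolation between the L^1 and the uniform bound.\<close>
 also have "(\<integral>\<^sup>+x. T x*T x \<partial>lborel) \<le> (\<integral>\<^sup>+x. ennreal (s powr (- ?d/2)*P)*T x \<partial>lborel)"
 proof (intro nn_integral_mono mult_right_mono)
  fix x
  have "T x \<le> (\<integral>\<^sup>+y. ennreal (s powr (- ?d/2))*p y \<partial>lborel)"
   unfolding T_def H_def using s by (intro nn_integral_mono mult_right_mono ennreal_leI) (auto simp: mult_le_cancel_left2)
  also have "... = ennreal (s powr (- ?d/2))*(\<integral>\<^sup>+y. p y \<partial>lborel)" by (intro nn_integral_cmult) measurable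
  also have "... \<le> ennreal (s powr (- ?d/2))*ennreal P"
   using P(1) unfolding p_def by (intro mult_left_mono) auto
  finally show "T x \<le> ennreal (s powr (- ?d/2)*P)" using P(2) by (simp add: ennreal_mult)
 qed simp
 also have "... = ennreal (s powr (- ?d/2)*P)*(\<integral>\<^sup>+x. T x \<partial>lborel)" by (intro nn_integral_cmult) measurable
 also have "(\<integral>\<^sup>+x. T x \<partial>lborel) = (\<integral>\<^sup>+y. \<integral>\<^sup>+x. H x y*p y \<partial>lborel \<partial>lborel)"
  unfolding T_def by (rule lborel_pair.Fubini'[symmetric]) measurable
 also have "... \<le> (\<integral>\<^sup>+y. ennreal C*p y \<partial>lborel)"
 proof (rule nn_integral_mono)
  fix y
  have "(\<integral>\<^sup>+x. H x y*p y \<partial>lborel) = (\<integral>\<^sup>+x. H x y \<partial>lborel)*p y" by (intro nn_integral_multc) measurable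
  also have "... \<le> ennreal C*p y" using C[of y] unfolding H_def by (rule mult_right_mono) simp
  finally show "(\<integral>\<^sup>+x. H x y*p y \<partial>lborel) \<le> ennreal C*p y" .
 qed
 also have "... = ennreal C*(\<integral>\<^sup>+y. p y \<partial>lborel)" by (intro nn_integral_cmult) measurable
 also have "(\<integral>\<^sup>+y. p y \<partial>lborel) \<le> ennreal P" using P(1) by (simp add: p_def)
 finally have "(\<integral>\<^sup>+x. ennreal ((exp (\<phi> x)*(LINT y|lborel. K x y*f y))^2) \<partial>lborel)
  \<le> ennreal ((c*exp 2)^2)*(ennreal (s powr (- ?d/2)*P)*(ennreal C*ennreal P))"
  by (simp add: mult_left_mono)
 also have "... = ennreal ((c*exp 2)^2*C * s powr (- ?d/2)*P^2)"
  using c P(2) by (simp add: ennreal_mult[symmetric] power2_eq_square mult_ac)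
 finally show ?thesis .
qed

lemma Lipschitz_if_GDERIV_bounded:
 fixes \<phi> :: "'a::euclidean_space => real"
 assumes D: "\<And>x. GDERIV \<phi> x :> D\<phi> x" and b: "\<And>x. norm (D\<phi> x) \<le> L"
 shows "\<bar>\<phi> x - \<phi> y\<bar> \<le> L*norm (x - y)"
proof -
 have "norm (\<phi> x - \<phi> y) \<le> L*norm (x - y)"
 proof (rule differentiable_bound[of UNIV])
  show "(\<phi> has_derivative (\<lambda>h. h \<bullet> D\<phi> z)) (at z within UNIV)" for z using D by (simp add: gderiv_def)
  show "onorm (\<lambda>h. h \<bullet> D\<phi> z) \<le> L" for z
  proof (rule onorm_le)
   fix h
   have "norm (h \<bullet> D\<phi> z) \<le> norm h*norm (D\<phi> z)" using Cauchy_Schwarz_ineq2 by simp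
   also have "... \<le> norm h*L" by (intro mult_left_mono b) auto
   finally show "norm (h \<bullet> D\<phi> z) \<le> L*norm h" by (simp add: mult.commute)
  qed
 qed auto
 thus ?thesis by simp
qed

lemma l2_norm_le_nn_integral:
 assumes m: "L2 u" and le: "(\<integral>x. ennreal ((u x)^2)) \<le> ennreal (B^2)" and B: "0 \<le> B"
 shows "l2_norm u \<le> B"
proof -
 have "L1 (\<lambda>x. (u x)^2)" using m by (simp add: square_integrable_def)
 hence "(LINT x. (u x)^2) \<le> B^2"
  using le by (subst (asm) nn_integral_eq_integral) auto
 thus ?thesis unfolding l2_norm_def using B by (intro real_le_lsqrt) auto
qed

context rh_potential begin

text \<open>Up to a time s <= \<kappa>^2 the Gaussian bound is used, for which the weight costs only
  a constant. From s to t the weighted norm does not increase.\<close>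

lemma heat_flow_agmon_L2:
 assumes k: "heat_kernel V k"
  and C: "\<And>s (y :: 'a). 0 < s ==> (\<integral>\<^sup>+x. ennreal (s powr (- real DIM('a)/2)*exp (- ((norm (x - y))^2/(8 * s)))) \<partial>lborel) \<le> ennreal C" "0 \<le> C"
  and K: "\<And>s. 0 < s ==> AE z in lborel. \<bar>k s (fst z) (snd z)\<bar> \<le> c*gauss s (fst z - snd z)" "0 \<le> c"
  and D: "\<And>x. GDERIV \<phi> x :> D\<phi> x" and cont: "continuous_on UNIV D\<phi>"
  and b: "\<And>x. \<bar>\<phi> x\<bar> \<le> M" "\<And>x. norm (D\<phi> x) \<le> 1/\<kappa>" and g: "\<And>x. CFP*(norm (D\<phi> x)*mrad x)^2 \<le> 1"
  and \<kappa>: "0 < \<kappa>" and s: "0 < s" "s \<le> \<kappa>^2" "s \<le> t"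
  and h: "0 < h" and Q: "Q \<in> sets borel" "Q \<subseteq> cbox y0 (y0 + h *\<^sub>R One)"
 shows "L2 (\<lambda>x. exp (\<phi> x)*(LINT y. k t x y*indicator Q y))" (is ?sq)
  and "l2_norm (\<lambda>x. exp (\<phi> x)*(LINT y. k t x y*indicator Q y))
   \<le> sqrt ((c*exp 2)^2*C * s powr (- real DIM('a)/2))*(h ^ DIM('a)*exp (\<phi> y0 + h * sqrt (real DIM('a))/\<kappa>))" (is ?le)
proof -
 let ?d = "real DIM('a)" and ?u = "\<lambda>t x. LINT y. k t x y*indicator Q y"
 define P where "P = h ^ DIM('a)*exp (\<phi> y0 + h * sqrt ?d/\<kappa>)"
 define B where "B = sqrt ((c*exp 2)^2*C * s powr (- ?d/2))*P"
 have P: "0 \<le> P" using h by (simp add: P_def)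
 have B: "0 \<le> B" using P C(2) by (simp add: B_def)
 have t: "0 < t" using s by simp
 have sQ: "L2 (indicator Q :: 'a => real)"
  using Q bounded_cbox bounded_subset by (intro L2_indicator) blast+
 have mQ: "(indicator Q :: 'a => real) \<in> BM" using Q by simp
 note hf = heat_kernelD(2)[OF k sQ]
 have c\<phi>: "continuous_on UNIV \<phi>" by (rule GDERIV_continuous_on[OF D])
 have m\<phi>: "(\<lambda>x. exp (\<phi> x)) \<in> LM"
  by (intro LM_of_BM BM_continuous continuous_intros c\<phi>)
 have sq: "L2 (\<lambda>x. exp (\<phi> x)*?u r x)" if "0 < r" for r
 proof -
  have "L2 (?u r)"
   using hf that unfolding heat_flow_def schrodinger_def form_domain_def by blast
  moreover have "\<bar>exp (\<phi> x)\<bar> \<le> exp M" for x using b(1)[of x] by simp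
  ultimately show ?thesis using L2_mult_bounded[OF _ m\<phi>, of "?u r" "exp M"] by simp
 qed
 thus ?sq using t by simp
 have lip: "\<bar>\<phi> x - \<phi> y\<bar> \<le> norm (x - y)/\<kappa>" for x y
  using Lipschitz_if_GDERIV_bounded[OF D b(2)] by simp
 have PQ: "(\<integral>\<^sup>+y. ennreal (\<bar>indicator Q y\<bar>*exp (\<phi> y)) \<partial>lborel) \<le> ennreal P"
 proof -
  have "(\<integral>\<^sup>+y. ennreal (\<bar>indicator Q y\<bar>*exp (\<phi> y)) \<partial>lborel)
   \<le> (\<integral>\<^sup>+y. ennreal (exp (\<phi> y0 + h * sqrt ?d/\<kappa>))*indicator (cbox y0 (y0 + h *\<^sub>R One)) y \<partial>lborel)"
  proof (rule nn_integral_mono)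
   fix y
   show "ennreal (\<bar>indicator Q y\<bar>*exp (\<phi> y)) \<le> ennreal (exp (\<phi> y0 + h * sqrt ?d/\<kappa>))*indicator (cbox y0 (y0 + h *\<^sub>R One)) y"
   proof (cases "y \<in> Q")
    case True
    have "\<phi> y \<le> \<phi> y0 + norm (y - y0)/\<kappa>" using lip[of y y0] by (simp add: abs_le_iff)
    also have "norm (y - y0)/\<kappa> \<le> h * sqrt ?d/\<kappa>"
     using norm_diff_cube[of y y0 h] True Q(2) h \<kappa> by (intro divide_right_mono) auto
    finally have "\<phi> y \<le> \<phi> y0 + h * sqrt ?d/\<kappa>" by simp
    thus ?thesis using True Q(2) by (auto simp: subset_eq intro!: ennreal_leI)
   qed simp
  qed
  also have "... = ennreal (exp (\<phi> y0 + h * sqrt ?d/\<kappa>))*ennreal (h ^ DIM('a))"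
   using h by (subst nn_integral_cmult_indicator) (auto simp: emeasure_lborel_cbox_eq inner_add_left)
  also have "... = ennreal P" using h by (simp add: P_def ennreal_mult[symmetric] mult.commute)
  finally show ?thesis .
 qed
 have kl: "(LINT y|lborel. k r x y*indicator Q y) = ?u r x" for r x
  using mQ heat_kernel_measurable(2)[OF k, of r x] by (subst integral_completion) auto
 have "(\<integral>\<^sup>+x. ennreal ((exp (\<phi> x)*(LINT y|lborel. k s x y*indicator Q y))^2) \<partial>lborel)
  \<le> ennreal ((c*exp 2)^2*C * s powr (- ?d/2)*P^2)"
  by (rule gauss_weighted_L2[OF C(1)[OF s(1)] K(1)[OF s(1)] K(2) C(2) s(1,2) \<kappa> lip mQ PQ P])
 also have "(c*exp 2)^2*C * s powr (- ?d/2)*P^2 = B^2"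
  using C(2) by (simp add: B_def power_mult_distrib)
 also have "(\<integral>\<^sup>+x. ennreal ((exp (\<phi> x)*(LINT y|lborel. k s x y*indicator Q y))^2) \<partial>lborel)
   = (\<integral>x. ennreal ((exp (\<phi> x)*?u s x)^2))"
 proof -
  have "(\<lambda>z. k s (fst z) (snd z)) \<in> borel_measurable (lborel \<Otimes>\<^sub>M lborel)"
   using heat_kernel_measurable(1)[OF k, of s] by (simp add: lborel_prod)
  hence [measurable]: "(\<lambda>(x, y). k s x y) \<in> borel_measurable (lborel \<Otimes>\<^sub>M lborel)" by (simp add: split_beta')
  have [measurable]: "\<phi> \<in> BM" using c\<phi> by (rule BM_continuous)
  note [measurable] = Q(1)
  have "(\<lambda>x. ennreal ((exp (\<phi> x)*(LINT y|lborel. k s x y*indicator Q y))^2)) \<in> borel_measurable lborel"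
   by measurable
  thus ?thesis unfolding kl[symmetric] by (subst nn_integral_completion) auto
 qed
 finally have "l2_norm (\<lambda>x. exp (\<phi> x)*?u s x) \<le> B"
  by (intro l2_norm_le_nn_integral[OF sq[OF s(1)] _ B])
 moreover have "l2_norm (\<lambda>x. exp (\<phi> x)*?u t x) \<le> l2_norm (\<lambda>x. exp (\<phi> x)*?u s x)"
 proof -
  have "(exp (\<phi> x)*?u r x)^2 = exp (2*\<phi> x)*(?u r x*?u r x)" for r x
   unfolding exp_double by (simp add: power2_eq_square mult_ac)
  thus ?thesis unfolding l2_norm_def
   using heat_flow_weighted_decreasing[OF hf D cont b g s(1,3)] by (simp only: real_sqrt_le_iff)
 qed
 ultimately show ?le by (simp add: B_def P_def)
qed

text \<open>By symmetry the pairing at time t is an inner product of two flows at time t/2, one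
  weighted with e^\<phi> and one with e^(-\<phi>). Both are bounded by
  \<open>heat_flow_agmon_L2\<close> with s the minimum of \<kappa>^2 and t/2. The value 1/sqrt CFP
  for \<epsilon> makes the gradient condition of the weighted form hold.\<close>

lemma heat_kernel_agmon_bound:
 assumes k: "heat_kernel V k"
 obtains A \<epsilon> where "0 < A" "0 < \<epsilon>"
  "\<And>\<kappa> t \<phi> D\<phi> M. 0 < \<kappa> ==> 0 < t ==> (\<And>x. GDERIV \<phi> x :> D\<phi> x) ==> continuous_on UNIV D\<phi> ==>
   (\<And>x. \<bar>\<phi> x\<bar> \<le> M) ==> (\<And>x. norm (D\<phi> x) \<le> 1/\<kappa>) ==> (\<And>x. norm (D\<phi> x)*mrad x \<le> \<epsilon>) ==>
   AE z in lborel. \<bar>k t (fst z) (snd z)\<bar> \<le> A*min (\<kappa>^2) (t/2) powr (- real DIM('a)/2)*exp (\<phi> (snd z) - \<phi> (fst z))"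
proof -
 let ?d = "real DIM('a)"
 obtain C where C: "0 < C" and Cb: "\<And>s (y :: 'a). 0 < s ==>
   (\<integral>\<^sup>+x. ennreal (s powr (- ?d/2)*exp (- ((norm (x - y))^2/(8 * s)))) \<partial>lborel) \<le> ennreal C"
  using nn_integral_exp_square_le[where 'a='a] by (simp add: nn_integral_completion) blast
 define c where "c = exp (1/4)*?d powr (?d/2)"
 have c: "0 < c" by (simp add: c_def)
 have K: "AE z in lborel. \<bar>k s (fst z) (snd z)\<bar> \<le> c*gauss s (fst z - snd z)" if "0 < s" for s
  using heat_kernel_gauss_bound[OF weight_V k that] by (simp add: c_def)
 define A where "A = (c*exp 2)^2*C"
 have A: "0 < A" using c C by (simp add: A_def)
 show ?thesis
 proof (rule that[of A "1/sqrt CFP"])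
  show "0 < A" "0 < 1/sqrt CFP" using A CFP(1) by auto
  fix \<kappa> t :: real and \<phi> :: "'a => real" and D\<phi> :: "'a => 'a" and M :: real
  assume \<kappa>: "0 < \<kappa>" and t: "0 < t" and D: "\<And>x. GDERIV \<phi> x :> D\<phi> x" and cont: "continuous_on UNIV D\<phi>"
   and b: "\<And>x. \<bar>\<phi> x\<bar> \<le> M" "\<And>x. norm (D\<phi> x) \<le> 1/\<kappa>" and e: "\<And>x. norm (D\<phi> x)*mrad x \<le> 1/sqrt CFP"
  have g: "CFP*(norm (D\<phi> x)*mrad x)^2 \<le> 1" for x
  proof -
   have "(norm (D\<phi> x)*mrad x)^2 \<le> (1/sqrt CFP)^2"
    using mrad_pos[of x] by (intro power_mono e) auto
   thus ?thesis using CFP(1) by (simp add: power_divide field_simps)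
  qed
  define s where "s = min (\<kappa>^2) (t/2)"
  have s: "0 < s" "s \<le> \<kappa>^2" "s \<le> t/2" using \<kappa> t by (auto simp: s_def)
  define S where "S = A * s powr (- ?d/2)"
  have S: "0 \<le> S" using A by (simp add: S_def)
  define \<mu> where "\<mu> h = h * sqrt ?d/\<kappa>" for h
  have Dm: "GDERIV (\<lambda>x. - \<phi> x) x :> - D\<phi> x" for x
   using D[of x] unfolding gderiv_def by (auto dest: has_derivative_minus)
  have "AE z in lborel. \<bar>k t (fst z) (snd z)\<bar> \<le> S*exp (\<phi> (snd z) - \<phi> (fst z))"
  proof (rule heat_kernel_bound_AE[OF k t, where B="\<lambda>h x y. S*exp (\<phi> y - \<phi> x + 2*\<mu> h)"])
   show "((\<lambda>h. S*exp (\<phi> y - \<phi> x + 2*\<mu> h)) \<longlongrightarrow> S*exp (\<phi> y - \<phi> x)) (at_right 0)" for x y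
   proof -
    have "((\<lambda>h. S*exp (\<phi> y - \<phi> x + 2*\<mu> h)) \<longlongrightarrow> S*exp (\<phi> y - \<phi> x + 2*(0 * sqrt ?d/\<kappa>))) (at_right 0)"
     unfolding \<mu>_def using \<kappa> by (intro tendsto_intros) auto
    thus ?thesis by simp
   qed
   fix x0 y0 :: 'a and h :: real and E Q :: "'a set"
   assume h: "0 < h" and E: "E \<in> sets borel" "E \<subseteq> cbox x0 (x0 + h *\<^sub>R One)"
    and Q: "Q \<in> sets borel" "Q \<subseteq> cbox y0 (y0 + h *\<^sub>R One)"
   let ?u = "\<lambda>Q t x. LINT y. k t x y*indicator Q y"
   have sq: "L2 (indicator Q :: 'a => real)" if "Q \<in> sets borel" "Q \<subseteq> cbox y0 (y0 + h *\<^sub>R One)" for Q y0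
    using that bounded_cbox bounded_subset by (intro L2_indicator) blast+
   have "(LINT x. indicator E x*?u Q t x) = (LINT x. ?u E (t/2) x*?u Q (t/2) x)"
    by (rule heat_flow_symmetric[OF heat_kernelD(2)[OF k sq[OF Q]] heat_kernelD(2)[OF k sq[OF E]] sq[OF E] t])
   also have "... = (LINT x. (exp (- \<phi> x)*?u E (t/2) x)*(exp (\<phi> x)*?u Q (t/2) x))"
    by (intro Lint_cong refl) (simp add: exp_minus field_simps)
   finally have eq: "(LINT x. indicator E x*?u Q t x) = (LINT x. (exp (- \<phi> x)*?u E (t/2) x)*(exp (\<phi> x)*?u Q (t/2) x))" .
   note q1 = heat_flow_agmon_L2[OF k Cb less_imp_le[OF C] K less_imp_le[OF c] D cont b g \<kappa> s h Q]
   have q2: "L2 (\<lambda>x. exp (- \<phi> x)*?u E (t/2) x)"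
    "l2_norm (\<lambda>x. exp (- \<phi> x)*?u E (t/2) x) \<le> sqrt ((c*exp 2)^2*C * s powr (- ?d/2))*(h ^ DIM('a)*exp (- \<phi> x0 + h * sqrt ?d/\<kappa>))"
    by (rule heat_flow_agmon_L2[OF k Cb less_imp_le[OF C] K less_imp_le[OF c] Dm _ _ _ _ \<kappa> s h E, of M];
      use b g cont in \<open>auto intro: continuous_intros\<close>)+
   have "\<bar>LINT x. indicator E x*?u Q t x\<bar>
    \<le> l2_norm (\<lambda>x. exp (- \<phi> x)*?u E (t/2) x)*l2_norm (\<lambda>x. exp (\<phi> x)*?u Q (t/2) x)"
    unfolding eq by (rule abs_integral_mult_le_l2_norm[OF q2(1) q1(1)])
   also have "... \<le> (sqrt S*(h ^ DIM('a)*exp (- \<phi> x0 + \<mu> h)))*(sqrt S*(h ^ DIM('a)*exp (\<phi> y0 + \<mu> h)))"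
    using q1(2) q2(2) S h by (intro mult_mono) (auto simp: S_def A_def \<mu>_def l2_norm_nonneg)
   also have "... = (sqrt S * sqrt S)*(h ^ DIM('a)*h ^ DIM('a))*(exp (- \<phi> x0 + \<mu> h)*exp (\<phi> y0 + \<mu> h))" by (simp only: mult_ac)
   also have "exp (- \<phi> x0 + \<mu> h)*exp (\<phi> y0 + \<mu> h) = exp (\<phi> y0 - \<phi> x0 + 2*\<mu> h)" by (simp flip: exp_add)
   also have "sqrt S * sqrt S = S" using S by simp
   finally show "\<bar>LINT x. indicator E x*?u Q t x\<bar> \<le> h ^ (2*DIM('a))*(S*exp (\<phi> y0 - \<phi> x0 + 2*\<mu> h))"
    unfolding mult_2 power_add by (simp only: mult_ac)
  qed
  thus "AE z in lborel. \<bar>k t (fst z) (snd z)\<bar> \<le> A*min (\<kappa>^2) (t/2) powr (- ?d/2)*exp (\<phi> (snd z) - \<phi> (fst z))"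
   by (simp add: S_def s_def)
 qed
qed

text \<open>The slow variation bounds \<open>mrad y\<close> below in terms of \<open>mrad z\<close>;
  solving for \<open>mrad z\<close> gives growth with exponent k1/(1 + k1) = 1 - \<delta> in the
  distance. That this is strictly below 1 is the source of all decay at infinity.\<close>

lemma mrad_upper:
 obtains C \<delta> where "1 \<le> C" "0 < \<delta>" "\<delta> \<le> 1"
  "\<And>y z. mrad z \<le> C*mrad y*(1 + (dist z y/mrad y)^2) powr ((1 - \<delta>)/2)"
proof -
 obtain C k k1 where C: "1 \<le> C" "0 \<le> (k::real)" "0 \<le> k1"
  and lower: "\<And>x y. mrad x/C*(1 + dist x y/mrad x) powr (- k1) \<le> mrad y"
  by (rule critical_scale) (rule that; blast)
 define \<delta> where "\<delta> = 1/(1 + k1)"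
 define K where "K = C*2 powr k1"
 have \<delta>: "0 < \<delta>" "\<delta> \<le> 1" using C(3) by (auto simp: \<delta>_def)
 have K: "1 \<le> K" unfolding K_def using C(1,3) mult_mono[of 1 C 1 "2 powr k1"] by (simp add: ge_one_powr_ge_zero)
 show ?thesis
 proof (rule that[OF K \<delta>])
  fix y z
  define m \<kappa> R where "m = mrad z" and "\<kappa> = mrad y" and "R = dist z y"
  have p: "0 < m" "0 < \<kappa>" "0 \<le> R" by (auto simp: m_def \<kappa>_def R_def mrad_pos)
  define X where "X = 1 + (R/\<kappa>)^2"
  have X: "1 \<le> X" by (simp add: X_def)
  have low: "m/C*(1 + R/m) powr (- k1) \<le> \<kappa>" using lower[of z y] by (simp add: m_def \<kappa>_def R_def)
  have e: "0 \<le> (1 - \<delta>)/2" using \<delta> by simp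
  have "m/\<kappa> \<le> K*X powr ((1 - \<delta>)/2)"
  proof (cases "R \<le> m")
   case True
   have "2 powr (- k1) \<le> (1 + R/m) powr (- k1)"
    using True p C(3) by (intro powr_mono2') (auto simp: field_simps)
   hence "m/C*2 powr (- k1) \<le> m/C*(1 + R/m) powr (- k1)" using p C by (intro mult_left_mono) auto
   hence "m/C*2 powr (- k1) \<le> \<kappa>" using low by linarith
   hence "m/\<kappa> \<le> K*1" using p C by (simp add: K_def powr_minus field_simps)
   also have "... \<le> K*X powr ((1 - \<delta>)/2)"
    using ge_one_powr_ge_zero[OF X e] K by (intro mult_left_mono) auto
   finally show ?thesis .
  next
   case False
   hence R: "0 < R" "1 + R/m \<le> 2*(R/m)" using p by (auto simp: field_simps)
   have "(2*(R/m)) powr (- k1) \<le> (1 + R/m) powr (- k1)"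
    using R p C(3) by (intro powr_mono2') (auto intro: add_pos_nonneg)
   hence "m/C*(2*(R/m)) powr (- k1) \<le> m/C*(1 + R/m) powr (- k1)" using p C by (intro mult_left_mono) auto
   hence l: "m/C*(2*(R/m)) powr (- k1) \<le> \<kappa>" using low by linarith
   have "(m/\<kappa>) powr (1 + k1) \<le> K*(R/\<kappa>) powr k1"
   proof -
    have "(m/\<kappa>) powr (1 + k1) = m/\<kappa>*(m/\<kappa>) powr k1" using p by (simp add: powr_add)
    also have "... \<le> C*(2*(R/m)) powr k1*(m/\<kappa>) powr k1"
    proof (rule mult_right_mono)
     show "m/\<kappa> \<le> C*(2*(R/m)) powr k1" using l p C R by (simp add: powr_minus field_simps)
    qed simp
    also have "... = K*(R/\<kappa>) powr k1"
     using p R by (simp add: K_def powr_mult powr_divide)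
    finally show ?thesis .
   qed
   also have "(R/\<kappa>) powr k1 \<le> X powr (k1/2)"
   proof -
    have "(R/\<kappa>) powr k1 = ((R/\<kappa>)^2) powr (k1/2)" using R p by (simp add: powr_powr flip: powr_numeral)
    also have "... \<le> X powr (k1/2)" using C(3) by (intro powr_mono2) (auto simp: X_def)
    finally show ?thesis .
   qed
   finally have "(m/\<kappa>) powr (1 + k1) \<le> K*X powr (k1/2)" using K by (simp add: mult_left_mono)
   hence "((m/\<kappa>) powr (1 + k1)) powr \<delta> \<le> (K*X powr (k1/2)) powr \<delta>"
    using \<delta> by (intro powr_mono2) auto
   also have "((m/\<kappa>) powr (1 + k1)) powr \<delta> = m/\<kappa>" using p C(3) by (simp add: powr_powr \<delta>_def)
   also have "(K*X powr (k1/2)) powr \<delta> = K powr \<delta>*X powr ((1 - \<delta>)/2)"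
   proof -
    have "k1/2*\<delta> = (1 - \<delta>)/2" using C(3) by (simp add: \<delta>_def field_simps)
    thus ?thesis using K X by (simp add: powr_mult powr_powr)
   qed
   also have "K powr \<delta> \<le> K powr 1" using K \<delta> by (intro powr_mono) auto
   finally show ?thesis using K by (simp add: mult_right_mono)
  qed
  thus "mrad z \<le> K*mrad y*(1 + (dist z y/mrad y)^2) powr ((1 - \<delta>)/2)"
   using p by (simp add: m_def[symmetric] \<kappa>_def[symmetric] R_def[symmetric] X_def[symmetric] divide_le_eq mult_ac)
 qed
qed

text \<open>The distance to \<open>y0\<close> in the metric \<open>|dx|/mrad x\<close> is replaced by an explicit power function.\<close>

definition agmon :: "real => real => 'a => 'a => real" where
 "agmon \<epsilon> \<delta> y0 z = \<epsilon>*(1 + (dist z y0/mrad y0)^2) powr (\<delta>/2)"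

lemma agmon_nonneg: "0 \<le> \<epsilon> ==> 0 \<le> agmon \<epsilon> \<delta> y0 z" by (simp add: agmon_def)

text \<open>Agmon's estimate requires a bounded weight. The map a to a/(1 + \<nu> a) bounds the
  weight by 1/\<nu> and has slope at most 1, so the gradient bound survives uniformly while \<nu>
  tends to 0.\<close>

lemma agmon_truncated_gradient:
 assumes e: "0 \<le> \<epsilon>" and \<delta>: "0 < \<delta>" "\<delta> \<le> 1" and \<nu>: "0 < \<nu>"
 obtains D where "\<And>z. GDERIV (\<lambda>z. agmon \<epsilon> \<delta> y0 z/(1 + \<nu>*agmon \<epsilon> \<delta> y0 z)) z :> D z" "continuous_on UNIV D"
  "\<And>z. norm (D z) \<le> \<epsilon>*(1 + (dist z y0/mrad y0)^2) powr ((\<delta> - 1)/2)/mrad y0"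
proof -
 define \<kappa> where "\<kappa> = mrad y0"
 have \<kappa>: "0 < \<kappa>" by (simp add: \<kappa>_def mrad_pos)
 define P where "P z = 1 + ((z - y0) \<bullet> (z - y0))/\<kappa>^2" for z
 have P: "1 \<le> P z" for z by (simp add: P_def)
 have Pd: "1 + (dist z y0/mrad y0)^2 = P z" for z
  by (simp add: P_def \<kappa>_def dist_norm power_divide power2_norm_eq_inner)
 define \<phi> where "\<phi> z = \<epsilon>*P z powr (\<delta>/2)" for z
 have \<phi>: "agmon \<epsilon> \<delta> y0 = \<phi>" by (simp add: fun_eq_iff agmon_def \<phi>_def Pd)
 have \<phi>0: "0 \<le> \<phi> z" for z using e by (simp add: \<phi>_def)
 have pos: "0 < 1 + \<nu>*\<phi> z" for z using \<phi>0[of z] \<nu> by (simp add: add_pos_nonneg)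
 define h where "h z = (1/(1 + \<nu>*\<phi> z)^2)*(\<epsilon>*(\<delta>*P z powr (\<delta>/2 - 1)))/\<kappa>^2" for z
 show ?thesis
 proof (rule that[of "\<lambda>z. h z *\<^sub>R (z - y0)"])
  show "GDERIV (\<lambda>z. agmon \<epsilon> \<delta> y0 z/(1 + \<nu>*agmon \<epsilon> \<delta> y0 z)) z :> h z *\<^sub>R (z - y0)" for z
  proof -
   have dP: "(P has_derivative (\<lambda>k. (2/\<kappa>^2)*(k \<bullet> (z - y0)))) (at z)"
    unfolding P_def using \<kappa> by (auto intro!: derivative_eq_intros simp: inner_commute field_simps)
   have "((\<lambda>p. \<epsilon>*p powr (\<delta>/2)) has_real_derivative \<epsilon>*(\<delta>/2*P z powr (\<delta>/2 - 1))) (at (P z))"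
    using P[of z] by (auto intro!: derivative_eq_intros simp: powr_diff)
   from has_derivative_compose[OF dP this[unfolded has_field_derivative_def]]
   have d\<phi>: "(\<phi> has_derivative (\<lambda>k. \<epsilon>*(\<delta>/2*P z powr (\<delta>/2 - 1))*((2/\<kappa>^2)*(k \<bullet> (z - y0))))) (at z)"
    by (simp add: \<phi>_def[abs_def])
   have "((\<lambda>p. p/(1 + \<nu>*p)) has_real_derivative 1/(1 + \<nu>*\<phi> z)^2) (at (\<phi> z))"
    using pos[of z] by (auto intro!: derivative_eq_intros simp: power2_eq_square field_simps)
   from has_derivative_compose[OF d\<phi> this[unfolded has_field_derivative_def]]
   show ?thesis unfolding \<phi> gderiv_def
    by (rule has_derivative_eq_rhs) (simp only: fun_eq_iff inner_scaleR_right, simp add: h_def mult_ac)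
  qed
  show "continuous_on UNIV (\<lambda>z. h z *\<^sub>R (z - y0))"
  proof -
   have cP: "continuous_on UNIV P" unfolding P_def by (auto intro!: continuous_intros simp: \<kappa>[THEN less_imp_neq, symmetric])
   have "P z \<noteq> 0" "(1 + \<nu>*(\<epsilon>*P z powr (\<delta>/2)))^2 \<noteq> 0" "\<kappa> \<noteq> 0" for z
    using P[of z] pos[of z] \<kappa> by (auto simp: \<phi>_def)
   thus ?thesis unfolding h_def \<phi>_def by (intro continuous_intros cP) auto
  qed
  show "norm (h z *\<^sub>R (z - y0)) \<le> \<epsilon>*(1 + (dist z y0/mrad y0)^2) powr ((\<delta> - 1)/2)/mrad y0" for z
  proof -
   define r where "r = norm (z - y0)/\<kappa>"
   have r: "0 \<le> r" "r \<le> P z powr (1/2)"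
   proof -
    have "r^2 \<le> P z" by (simp add: r_def P_def power_divide power2_norm_eq_inner)
    moreover show r0: "0 \<le> r" using \<kappa> by (simp add: r_def)
    ultimately show "r \<le> P z powr (1/2)" using P[of z] by (simp add: powr_half_sqrt real_le_rsqrt)
   qed
   have "1/(1 + \<nu>*\<phi> z)^2 \<le> 1"
   proof -
    have "1 \<le> 1 + \<nu>*\<phi> z" using \<phi>0[of z] \<nu> by simp
    hence "1 \<le> (1 + \<nu>*\<phi> z)^2" by (rule one_le_power)
    thus ?thesis using pos[of z] by (simp add: divide_le_eq)
   qed
   hence 1: "(1/(1 + \<nu>*\<phi> z)^2)*(\<delta>*(\<epsilon>*P z powr (\<delta>/2 - 1)*r/\<kappa>)) \<le> 1*(1*(\<epsilon>*P z powr (\<delta>/2 - 1)*r/\<kappa>))"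
    using e \<delta> r \<kappa> by (intro mult_mono) auto
   have "norm (h z *\<^sub>R (z - y0)) = (1/(1 + \<nu>*\<phi> z)^2)*(\<delta>*(\<epsilon>*P z powr (\<delta>/2 - 1)*r/\<kappa>))"
    using e \<delta> \<kappa> by (simp add: h_def r_def abs_mult power2_eq_square)
   also note 1
   also have "1*(1*(\<epsilon>*P z powr (\<delta>/2 - 1)*r/\<kappa>)) \<le> \<epsilon>*P z powr (\<delta>/2 - 1)*P z powr (1/2)/\<kappa>"
    using e r \<kappa> by (auto intro!: divide_right_mono mult_left_mono)
   also have "\<epsilon>*P z powr (\<delta>/2 - 1)*P z powr (1/2) = \<epsilon>*P z powr ((\<delta> - 1)/2)"
    using powr_add[of "P z" "\<delta>/2 - 1" "1/2"] by (simp add: diff_divide_distrib)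
   finally show ?thesis unfolding Pd by (simp add: \<kappa>_def)
  qed
 qed
qed

text \<open>For each centre y0 of the weight the bound fails on a null set depending on y0, so y0 =
  y cannot be inserted directly. The bounds are taken simultaneously for a countable dense set of
  centres, and for given y a centre y0 with |y - y0| < mrad y is used, at which the critical scale
  is comparable.\<close>

lemma heat_kernel_decay:
 assumes k: "heat_kernel V k"
 obtains C c \<delta> where "0 < C" "0 < c" "0 < \<delta>"
  "\<And>t. 0 < t ==> AE z in lborel. \<bar>k t (fst z) (snd z)\<bar> \<le> C*min ((mrad (snd z))^2) t powr (- real DIM('a)/2)
    * exp (- c*(dist (fst z) (snd z)/mrad (snd z)) powr \<delta>)"
proof -
 let ?d = "real DIM('a)"
 obtain B \<epsilon>0 where B: "0 < B" "0 < \<epsilon>0" and agm: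
  "\<And>\<kappa> t \<phi> D\<phi> M. 0 < \<kappa> ==> 0 < t ==> (\<And>x. GDERIV \<phi> x :> D\<phi> x) ==> continuous_on UNIV D\<phi> ==>
   (\<And>x. \<bar>\<phi> x\<bar> \<le> M) ==> (\<And>x. norm (D\<phi> x) \<le> 1/\<kappa>) ==> (\<And>x. norm (D\<phi> x)*mrad x \<le> \<epsilon>0) ==>
   AE z in lborel. \<bar>k t (fst z) (snd z)\<bar> \<le> B*min (\<kappa>^2) (t/2) powr (- ?d/2)*exp (\<phi> (snd z) - \<phi> (fst z))"
  by (rule heat_kernel_agmon_bound[OF k]) (rule that; blast)
 obtain C1 \<delta> where C1: "1 \<le> C1" and \<delta>: "0 < \<delta>" "\<delta> \<le> 1" and up:
  "\<And>y z. mrad z \<le> C1*mrad y*(1 + (dist z y/mrad y)^2) powr ((1 - \<delta>)/2)"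
  by (rule mrad_upper) (rule that; blast)
 obtain A where A: "1 \<le> A" and cmp: "\<And>x y. dist x y < mrad x ==> mrad x \<le> A*mrad y \<and> mrad y \<le> A*mrad x"
  by (rule mrad_comparable) (rule that; blast)
 obtain Y :: "'a set" where Y: "countable Y" "\<And>X. open X ==> X \<noteq> {} ==> \<exists>y\<in>Y. y \<in> X"
  using countable_dense_exists[where 'a='a] by blast
 \<comment> \<open>The minimum serves two conditions on the gradient of the weight: at most 1/mrad
   y0 everywhere, and at most \<open>\<epsilon>0\<close> after multiplication by
   \<open>mrad\<close>.\<close>
 define \<epsilon> where "\<epsilon> = min 1 (\<epsilon>0/C1)"
 have \<epsilon>: "0 < \<epsilon>" "\<epsilon> \<le> 1" "\<epsilon>*C1 \<le> \<epsilon>0" using B C1 by (auto simp: \<epsilon>_def min_def field_simps)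
 \<comment> \<open>If |x - y| > 2 mrad y, then |x - y0| is at least half of |x - y|, and mrad y0 is
   at most A mrad y; together this gives 1/(2A).\<close>
 define c where "c = \<epsilon>*(1/(2*A)) powr \<delta>"
 have c: "0 < c" using \<epsilon> A by (simp add: c_def)
 define C where "C = B*(2*A^2) powr (?d/2)*exp (1 + A^2 + c*2 powr \<delta>)"
 have C: "0 < C" using B A by (simp add: C_def)
 show ?thesis
 proof (rule that[OF C c \<delta>(1)])
  fix t :: real assume t: "0 < t"
  define \<phi> where "\<phi> n y0 z = agmon \<epsilon> \<delta> y0 z/(1 + inverse (real (Suc n))*agmon \<epsilon> \<delta> y0 z)" for n y0 z
  have ag0: "0 \<le> agmon \<epsilon> \<delta> y0 z" for y0 z using \<epsilon> by (simp add: agmon_nonneg)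
  have one: "AE z in lborel. \<bar>k t (fst z) (snd z)\<bar> \<le> B*min ((mrad y0)^2) (t/2) powr (- ?d/2)*exp (\<phi> n y0 (snd z) - \<phi> n y0 (fst z))" for n y0
  proof -
   define \<nu> where "\<nu> = inverse (real (Suc n))"
   have \<nu>: "0 < \<nu>" by (simp add: \<nu>_def)
   obtain D where D: "\<And>z. GDERIV (\<lambda>z. agmon \<epsilon> \<delta> y0 z/(1 + \<nu>*agmon \<epsilon> \<delta> y0 z)) z :> D z" "continuous_on UNIV D"
    "\<And>z. norm (D z) \<le> \<epsilon>*(1 + (dist z y0/mrad y0)^2) powr ((\<delta> - 1)/2)/mrad y0"
    using agmon_truncated_gradient[OF less_imp_le[OF \<epsilon>(1)] \<delta> \<nu>] by blast
   show ?thesis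
   proof (rule agm[OF mrad_pos t, of _ D "1/\<nu>"])
    show "GDERIV (\<phi> n y0) z :> D z" for z using D(1) by (simp add: \<phi>_def[abs_def] \<nu>_def)
    show "\<bar>\<phi> n y0 z\<bar> \<le> 1/\<nu>" for z
    proof -
     have "0 \<le> agmon \<epsilon> \<delta> y0 z" by (rule ag0)
     hence "agmon \<epsilon> \<delta> y0 z/(1 + \<nu>*agmon \<epsilon> \<delta> y0 z) \<le> 1/\<nu>" "0 \<le> agmon \<epsilon> \<delta> y0 z/(1 + \<nu>*agmon \<epsilon> \<delta> y0 z)"
      using \<nu> by (auto simp: divide_simps add_pos_nonneg algebra_simps not_less intro: add_pos_nonneg)
     thus ?thesis unfolding \<phi>_def \<nu>_def[symmetric] by (simp only: abs_of_nonneg)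
    qed
    show "norm (D z) \<le> 1/mrad y0" for z
    proof -
     have "(1 + (dist z y0/mrad y0)^2) powr ((\<delta> - 1)/2) \<le> (1 + (dist z y0/mrad y0)^2) powr 0"
      using \<delta> by (intro powr_mono) auto
     hence "\<epsilon>*(1 + (dist z y0/mrad y0)^2) powr ((\<delta> - 1)/2) \<le> 1*1"
      using \<epsilon> by (intro mult_mono) (auto simp: add_nonneg_eq_0_iff)
     thus ?thesis using D(3)[of z] mrad_pos[of y0] by (intro order_trans[OF D(3)] divide_right_mono) auto
    qed
    show "norm (D z)*mrad z \<le> \<epsilon>0" for z
    proof -
     let ?P = "1 + (dist z y0/mrad y0)^2"
     have P: "0 < ?P" by (simp add: add_pos_nonneg)
     have "norm (D z)*mrad z \<le> (\<epsilon>*?P powr ((\<delta> - 1)/2)/mrad y0)*(C1*mrad y0*?P powr ((1 - \<delta>)/2))"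
      using \<epsilon> mrad_pos[of z] mrad_pos[of y0] by (intro mult_mono D(3) up) auto
     also have "... = \<epsilon>*C1*(?P powr ((\<delta> - 1)/2)*?P powr ((1 - \<delta>)/2))"
      using mrad_pos[of y0] by simp
     also have "?P powr ((\<delta> - 1)/2)*?P powr ((1 - \<delta>)/2) = 1"
      using P by (simp flip: powr_add add: add_divide_distrib[symmetric])
     finally show ?thesis using \<epsilon>(3) by simp
    qed
   qed (rule D(2))
  qed
  have "AE z in lborel. \<forall>y0\<in>Y. \<forall>n. \<bar>k t (fst z) (snd z)\<bar> \<le> B*min ((mrad y0)^2) (t/2) powr (- ?d/2)*exp (\<phi> n y0 (snd z) - \<phi> n y0 (fst z))"
   unfolding AE_ball_countable[OF Y(1)] AE_all_countable using one by blast
  thus "AE z in lborel. \<bar>k t (fst z) (snd z)\<bar> \<le> C*min ((mrad (snd z))^2) t powr (- real DIM('a)/2)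
    * exp (- c*(dist (fst z) (snd z)/mrad (snd z)) powr \<delta>)"
  proof eventually_elim
   case (elim z)
   obtain x y where z: "z = (x, y)" by (cases z)
   define m R where "m = mrad y" and "R = dist x y"
   have m: "0 < m" "0 \<le> R" by (auto simp: m_def R_def mrad_pos)
   obtain y0 where y0: "y0 \<in> Y" "y0 \<in> ball y m"
    using Y(2)[of "ball y m"] m by auto
   define \<kappa> where "\<kappa> = mrad y0"
   have \<kappa>: "0 < \<kappa>" by (simp add: \<kappa>_def mrad_pos)
   have mk: "m \<le> A*\<kappa>" "\<kappa> \<le> A*m" "dist y y0 < m"
    using cmp[of y y0] y0(2) by (auto simp: m_def \<kappa>_def)
   define a where "a = agmon \<epsilon> \<delta> y0"
   have lim: "(\<lambda>n. \<phi> n y0 w) \<longlonglongrightarrow> a w" for w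
   proof -
    have "(\<lambda>n. agmon \<epsilon> \<delta> y0 w/(1 + inverse (real (Suc n))*agmon \<epsilon> \<delta> y0 w)) \<longlonglongrightarrow> agmon \<epsilon> \<delta> y0 w/(1 + 0*agmon \<epsilon> \<delta> y0 w)"
     by (intro tendsto_intros LIMSEQ_inverse_real_of_nat) simp
    thus ?thesis by (simp add: \<phi>_def a_def)
   qed
   define S where "S = B*min (\<kappa>^2) (t/2) powr (- ?d/2)"
   have S: "0 \<le> S" using B by (simp add: S_def)
   have "\<bar>k t x y\<bar> \<le> S*exp (a y - a x)"
   proof (rule LIMSEQ_le_const)
    show "(\<lambda>n. S*exp (\<phi> n y0 y - \<phi> n y0 x)) \<longlonglongrightarrow> S*exp (a y - a x)"
     by (intro tendsto_intros lim)
    show "\<exists>N. \<forall>n\<ge>N. \<bar>k t x y\<bar> \<le> S*exp (\<phi> n y0 y - \<phi> n y0 x)"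
     using elim y0(1) by (auto simp: z S_def \<kappa>_def)
   qed
   also have "... \<le> S*exp ((1 + A^2 + c*2 powr \<delta>) - c*(R/m) powr \<delta>)"
   proof -
    have ay: "a y \<le> 1 + A^2"
    proof -
     have "dist y y0/\<kappa> \<le> A" using mk \<kappa> by (simp add: divide_le_eq)
     hence "(dist y y0/\<kappa>)^2 \<le> A^2" using \<kappa> by (intro power_mono) auto
     hence 1: "(1 + (dist y y0/\<kappa>)^2) powr (\<delta>/2) \<le> (1 + A^2) powr (\<delta>/2)" using \<delta> by (intro powr_mono2) auto
     have 2: "(1 + A^2) powr (\<delta>/2) \<le> (1 + A^2) powr 1" using \<delta> by (intro powr_mono) auto
     have "a y \<le> 1*(1 + (dist y y0/\<kappa>)^2) powr (\<delta>/2)"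
      unfolding a_def agmon_def \<kappa>_def[symmetric] using \<epsilon> by (intro mult_right_mono) auto
     also have "... \<le> 1 + A^2" using 1 2 by (simp add: add_nonneg_eq_0_iff)
     finally show ?thesis .
    qed
    have ax: "c*(R/m) powr \<delta> - c*2 powr \<delta> \<le> a x"
    proof (cases "R \<le> 2*m")
     case True
     have "(R/m) powr \<delta> \<le> 2 powr \<delta>" using True m \<delta> by (intro powr_mono2) (auto simp: field_simps)
     hence "c*(R/m) powr \<delta> \<le> c*2 powr \<delta>" using c by (intro mult_left_mono) auto
     thus ?thesis using ag0[of y0 x] by (simp add: a_def)
    next
     case False
     have "R \<le> dist x y0 + dist y y0" unfolding R_def by (rule dist_triangle2)
     hence "R/2 \<le> dist x y0" using False mk(3) by simp
     hence "R/2/(A*m) \<le> dist x y0/\<kappa>"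
      using mk(2) \<kappa> m A by (intro frac_le) auto
     hence "(1/(2*A)*(R/m)) powr \<delta> \<le> (dist x y0/\<kappa>) powr \<delta>"
      using m A \<delta> by (intro powr_mono2) auto
     also have "... \<le> (1 + (dist x y0/\<kappa>)^2) powr (\<delta>/2)"
     proof -
      have "((dist x y0/\<kappa>)^2) powr (\<delta>/2) \<le> (1 + (dist x y0/\<kappa>)^2) powr (\<delta>/2)"
       using \<delta> by (intro powr_mono2) auto
      moreover have "0 < dist x y0/\<kappa>"
       using \<open>R/2 \<le> dist x y0\<close> False m \<kappa> by (intro divide_pos_pos) linarith+
      hence "((dist x y0/\<kappa>)^2) powr (\<delta>/2) = (dist x y0/\<kappa>) powr \<delta>"
       by (simp add: powr_powr flip: powr_numeral)
      ultimately show ?thesis by simp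
     qed
     finally have "\<epsilon>*(1/(2*A)*(R/m)) powr \<delta> \<le> a x"
      unfolding a_def agmon_def \<kappa>_def[symmetric] using \<epsilon> by (intro mult_left_mono) auto
     moreover have "\<epsilon>*(1/(2*A)*(R/m)) powr \<delta> = c*(R/m) powr \<delta>"
      unfolding c_def powr_mult by (simp only: mult.assoc)
     moreover have "0 \<le> c*2 powr \<delta>" using c by simp
     ultimately show ?thesis by linarith
    qed
    have "a y - a x \<le> (1 + A^2 + c*2 powr \<delta>) - c*(R/m) powr \<delta>" using ay ax by linarith
    thus ?thesis using S by (intro mult_left_mono) auto
   qed
   also have "... = S*exp (1 + A^2 + c*2 powr \<delta>)*exp (- c*(R/m) powr \<delta>)"
    by (simp add: exp_diff exp_minus field_simps)
   also have "S \<le> B*((2*A^2) powr (?d/2)*min (m^2) t powr (- ?d/2))"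
   proof -
    have A2: "1 \<le> A^2" using A by (rule one_le_power)
    have pos: "0 < min (m^2) t" using m t by simp
    have "min (m^2) t/(2*A^2) \<le> min (\<kappa>^2) (t/2)"
    proof (rule min.boundedI)
     have "m^2 \<le> (A*\<kappa>)^2" using mk(1) m by (intro power_mono) auto
     also have "... \<le> \<kappa>^2*(2*A^2)" by (simp add: power_mult_distrib)
     finally have "min (m^2) t \<le> \<kappa>^2*(2*A^2)" by (rule min.coboundedI1)
     thus "min (m^2) t/(2*A^2) \<le> \<kappa>^2" using A2 by (subst pos_divide_le_eq) auto
     have "t*1 \<le> t*A^2" using t A2 by (intro mult_left_mono) auto
     hence "min (m^2) t \<le> t/2*(2*A^2)" by (intro min.coboundedI2) simp
     thus "min (m^2) t/(2*A^2) \<le> t/2" using A2 by (subst pos_divide_le_eq) auto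
    qed
    moreover have "0 < min (m^2) t/(2*A^2)" by (rule divide_pos_pos[OF pos]) (use A2 in linarith)
    ultimately have "min (\<kappa>^2) (t/2) powr (- ?d/2) \<le> (min (m^2) t/(2*A^2)) powr (- ?d/2)"
     by (intro powr_mono2') auto
    also have "... = (2*A^2) powr (?d/2)*min (m^2) t powr (- ?d/2)"
     using pos A2 by (simp add: powr_divide powr_minus field_simps)
    finally show ?thesis unfolding S_def using B by (intro mult_left_mono) auto
   qed
   finally show ?case unfolding z by (simp add: C_def m_def R_def mult_ac mult_right_mono)
  qed
 qed
qed

end

section \<open>Integration in time: the kernel of the fractional integral\<close>

text \<open>The shell summation on the real line around 0 with scale B replaces the substitution t =
  B/s. For t <= B the exponential is traded for a power that leaves t^(-1) (t/B); for larger t it is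
  estimated by 1.\<close>

lemma nn_integral_time_le:
 assumes a: "0 < a"
 obtains C where "0 < C" "\<And>B. 0 < B ==> (\<integral>t\<in>{0<..}. ennreal (t powr (- a - 1)*exp (- (B/t)))) \<le> ennreal (C*B powr (- a))"
proof -
 define K where "K = max 1 ((a + 1) powr (a + 1))"
 have K: "1 \<le> K" "(a + 1) powr (a + 1) \<le> K" by (auto simp: K_def)
 have "- 1 < (0::real)" by simp
 then obtain C where C: "0 < C" and D: "\<And>y m X h F k. ball_rate 1 0 0 m (y::real) X h ==> 0 \<le> k ==>
  (AE x. F x \<le> k*(h x * shell_kernel 1 (- 1) a m y x)) ==> (\<integral>x. ennreal (F x)) \<le> ennreal (k*C)*X"
  by (rule nn_integral_shell_kernel[OF _ a, where c=1]) (rule that; blast)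
 show ?thesis
 proof (rule that[of "K*C*unit_ball_vol 1"])
  show "0 < K*C*unit_ball_vol 1" using C K by simp
  fix B :: real assume B: "0 < B"
  define k where "k = K*B powr (- a)"
  have k: "0 \<le> k" using K by (simp add: k_def)
  let ?f = "\<lambda>t. t powr (- a - 1)*exp (- (B/t))"
  have rate: "ball_rate 1 0 0 B (0::real) (ennreal (unit_ball_vol 1)) (\<lambda>_. 1)" using ball_rate_const[OF B, of "0::real"] by simp
  have "(\<integral>t. ennreal (if 0 < t then ?f t else 0)) \<le> ennreal (k*C)*ennreal (unit_ball_vol 1)"
  proof (rule D[OF rate k], rule AE_I2)
   fix t :: real
   show "(if 0 < t then ?f t else 0) \<le> k*(1 * shell_kernel 1 (- 1) a B 0 t)"
   proof (cases "0 < t")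
    case t: True
    show ?thesis
    proof (cases "t \<le> B")
     case True
     have "exp (- (B/t)) \<le> ((a + 1)/(B/t)) powr (a + 1)" using t B a by (intro exp_minus_le_powr) auto
     also have "(a + 1)/(B/t) = (a + 1)*(t/B)" using t B by simp
     also have "((a + 1)*(t/B)) powr (a + 1) = (a + 1) powr (a + 1)*(t/B) powr (a + 1)" by (rule powr_mult)
     also have "... \<le> K*(t/B) powr (a + 1)" using K(2) by (rule mult_right_mono) simp
     finally have "?f t \<le> t powr (- a - 1)*(K*(t/B) powr (a + 1))" by (rule mult_left_mono) simp
     also have "... = k*(t powr (- 1)*(t/B) powr 1)"
      using t B by (simp add: k_def powr_divide powr_minus powr_diff powr_add field_simps)
     finally show ?thesis using t True by (simp add: shell_kernel_def dist_real_def)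
    next
     case False
     have "?f t \<le> t powr (- a - 1)*K" using t B K by (intro mult_left_mono) (auto intro: order_trans[of _ 1])
     also have "... = k*(t powr (- 1)*(t/B) powr (- a))"
      using t B by (simp add: k_def powr_divide powr_minus powr_diff field_simps)
     finally show ?thesis using t False by (simp add: shell_kernel_def dist_real_def)
    qed
   qed (simp add: k shell_kernel_nonneg)
  qed
  also have "(\<integral>t. ennreal (if 0 < t then ?f t else 0)) = (\<integral>t\<in>{0<..}. ennreal (?f t))"
   by (intro nn_integral_cong) (auto simp: indicator_def)
  also have "ennreal (k*C)*ennreal (unit_ball_vol 1) = ennreal (K*C*unit_ball_vol 1*B powr (- a))"
   using C K by (subst ennreal_mult[symmetric]) (auto simp: k_def mult_ac)
  finally show "(\<integral>t\<in>{0<..}. ennreal (?f t)) \<le> ennreal (K*C*unit_ball_vol 1*B powr (- a))" .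
 qed
qed

lemma powr_exp_decay:
 fixes \<beta> c \<delta> N :: real
 assumes "0 \<le> \<beta>" "0 < c" "0 < \<delta>" "0 < N"
 obtains K where "0 < K" "\<And>X. 0 \<le> X ==> (X powr \<beta> + 1)*exp (- c*X powr \<delta>) \<le> K*(1 + X) powr (- N)"
proof -
 define M where "M = (N + \<beta>)/\<delta>"
 define K where "K = max 1 ((M/c) powr M)"
 have M: "0 < M" using assms by (simp add: M_def)
 have K: "1 \<le> K" "(M/c) powr M \<le> K" by (auto simp: K_def)
 have two: "2 powr (- N) \<le> (1 + X) powr (- N)" if "0 \<le> X" "X \<le> 1" for X
  using that assms by (intro powr_mono2') auto
 show ?thesis
 proof (rule that[of "2*K*2 powr N"])
  show "0 < 2*K*2 powr N" using K by simp
  fix X :: real assume X: "0 \<le> X"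
  show "(X powr \<beta> + 1)*exp (- c*X powr \<delta>) \<le> 2*K*2 powr N*(1 + X) powr (- N)"
  proof (cases "X \<le> 1")
   case True
   have "(X powr \<beta> + 1)*exp (- c*X powr \<delta>) \<le> (1 + 1)*1"
    using X True assms by (intro mult_mono add_right_mono powr_le1) auto
   also have "... \<le> 2*K*(2 powr N*2 powr (- N))" using K by (simp flip: powr_add)
   also have "... \<le> 2*K*(2 powr N*(1 + X) powr (- N))" using two[OF X True] K by (intro mult_left_mono) auto
   finally show ?thesis by (simp add: mult.assoc)
  next
   case False
   hence X1: "1 < X" by simp
   have "exp (- (c*X powr \<delta>)) \<le> (M/(c*X powr \<delta>)) powr M" using X1 assms M by (intro exp_minus_le_powr) auto
   also have "M/(c*X powr \<delta>) = (M/c)*X powr (- \<delta>)" by (simp add: powr_minus divide_inverse mult_ac)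
   also have "((M/c)*X powr (- \<delta>)) powr M = (M/c) powr M*X powr (- (N + \<beta>))"
   proof -
    have "(- \<delta>)*M = - (N + \<beta>)" using assms by (simp add: M_def)
    thus ?thesis unfolding powr_mult powr_powr by simp
   qed
   also have "... \<le> K*X powr (- (N + \<beta>))" using K(2) by (rule mult_right_mono) simp
   finally have e: "exp (- c*X powr \<delta>) \<le> K*X powr (- (N + \<beta>))" by simp
   have "X powr \<beta> + 1 \<le> 2*X powr \<beta>" using ge_one_powr_ge_zero[of X \<beta>] X1 assms by simp
   hence "(X powr \<beta> + 1)*exp (- c*X powr \<delta>) \<le> (2*X powr \<beta>)*(K*X powr (- (N + \<beta>)))"
    using e by (intro mult_mono) auto
   also have "... = 2*K*X powr (- N)"
    using powr_add[of X \<beta> "- (N + \<beta>)"] by simp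
   also have "X powr (- N) \<le> ((1 + X)/2) powr (- N)" using X1 assms by (intro powr_mono2') auto
   also have "((1 + X)/2) powr (- N) = 2 powr N*(1 + X) powr (- N)"
    using X1 by (simp add: powr_divide powr_minus field_simps)
   finally show ?thesis using K by (simp add: mult.assoc mult_left_mono)
  qed
 qed
qed

lemma le_powr_interpolation:
 assumes "0 \<le> x" "x \<le> a" "x \<le> b" "0 \<le> \<eta>" "\<eta> \<le> (1::real)"
 shows "x \<le> a powr (1 - \<eta>)*b powr \<eta>"
proof (cases "x = 0")
 case False
 hence "x = x powr (1 - \<eta>)*x powr \<eta>" using assms by (simp flip: powr_add)
 also have "... \<le> a powr (1 - \<eta>)*b powr \<eta>" using assms by (intro mult_mono powr_mono2) auto
 finally show ?thesis .
qed simp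

context rh_potential begin

text \<open>The geometric mean with weights 1 - \<eta> and \<eta>; the negative power of a minimum
  is at most the sum of the powers. The known bounds hold for every t and almost every pair, whereas
  the time integral asks for almost every t at a given pair. The two quantifiers are exchanged using
  joint measurability of the kernel.\<close>

lemma heat_kernel_joint_bound:
 assumes k: "heat_kernel V k" and \<eta>: "0 < \<eta>" "\<eta> < 1"
 obtains C c \<delta> where "0 < C" "0 < c" "0 < \<delta>"
  "AE z in lborel. AE t in lborel. 0 < t --> \<bar>k t (fst z) (snd z)\<bar> \<le> C*exp (- c*(dist (fst z) (snd z)/mrad (snd z)) powr \<delta>)
   * (t powr (- d*(1 - \<eta>)/2)*mrad (snd z) powr (- d*\<eta>) + t powr (- d/2))
   * exp (- ((1 - \<eta>)*(dist (fst z) (snd z))^2/4/t))"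
proof -
 obtain C c \<delta> where C: "0 < C" "0 < c" "0 < \<delta>" and dec:
  "\<And>t. 0 < t ==> AE z in lborel. \<bar>k t (fst z) (snd z)\<bar> \<le> C*min ((mrad (snd z))^2) t powr (- real DIM('a)/2)
    * exp (- c*(dist (fst z) (snd z)/mrad (snd z)) powr \<delta>)"
  by (rule heat_kernel_decay[OF k]) (rule that; blast)
 define c0 where "c0 = exp (1/4)*real DIM('a) powr (real DIM('a)/2)"
 have c0: "0 < c0" by (simp add: c0_def)
 define Z where "Z t x y = C powr \<eta>*c0 powr (1 - \<eta>)*exp (- (c*\<eta>)*(dist x y/mrad y) powr \<delta>)
   * (t powr (- d*(1 - \<eta>)/2)*mrad y powr (- d*\<eta>) + t powr (- d/2))
   * exp (- ((1 - \<eta>)*(dist x y)^2/4/t))" for t x y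
 have one: "AE z in lborel. 0 < t --> \<bar>k t (fst z) (snd z)\<bar> \<le> Z t (fst z) (snd z)" for t
 proof (cases "0 < t")
  case True
  note t = True
  from heat_kernel_gauss_bound[OF weight_V k True] dec[OF True] show ?thesis
  proof eventually_elim
   case (elim z)
   obtain x y where z: "z = (x, y)" by (cases z)
   define m R where "m = mrad y" and "R = dist x y"
   have m: "0 < m" "0 \<le> R" by (auto simp: m_def R_def mrad_pos)
   define E where "E = exp (- c*(R/m) powr \<delta>)"
   have "\<bar>k t x y\<bar> \<le> (c0*gauss t (x - y)) powr (1 - \<eta>)*(C*min (m^2) t powr (- d/2)*E) powr \<eta>"
    using elim \<eta> unfolding z by (intro le_powr_interpolation) (auto simp: c0_def m_def R_def E_def d)
   also have "(c0*gauss t (x - y)) powr (1 - \<eta>) = c0 powr (1 - \<eta>)*(t powr (- d*(1 - \<eta>)/2)*exp (- ((1 - \<eta>) * R^2/4/t)))"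
   proof -
    have "exp (- ((x - y) \<bullet> (x - y)/(4*t))) powr (1 - \<eta>) = exp (- ((1 - \<eta>) * R^2/4/t))"
     using t by (simp add: powr_def R_def dist_norm power2_norm_eq_inner field_simps)
    moreover have "- d/2*(1 - \<eta>) = - d*(1 - \<eta>)/2" by simp
    ultimately show ?thesis unfolding gauss_def powr_mult powr_powr d[symmetric] by simp
   qed
   also have "(C*min (m^2) t powr (- d/2)*E) powr \<eta> = C powr \<eta>*min (m^2) t powr (- d*\<eta>/2)*exp (- (c*\<eta>)*(R/m) powr \<delta>)"
   proof -
    have "E powr \<eta> = exp (- (c*\<eta>)*(R/m) powr \<delta>)" by (simp add: E_def powr_def mult_ac)
    moreover have "- d/2*\<eta> = - d*\<eta>/2" by simp
    ultimately show ?thesis unfolding powr_mult powr_powr by simp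
   qed
   also have "C powr \<eta>*min (m^2) t powr (- d*\<eta>/2)*exp (- (c*\<eta>)*(R/m) powr \<delta>)
     \<le> C powr \<eta>*(m powr (- d*\<eta>) + t powr (- d*\<eta>/2))*exp (- (c*\<eta>)*(R/m) powr \<delta>)"
   proof (intro mult_right_mono mult_left_mono)
    have "(m^2) powr (- d*\<eta>/2) = m powr (- d*\<eta>)" using m by (simp add: powr_powr flip: powr_numeral)
    thus "min (m^2) t powr (- d*\<eta>/2) \<le> m powr (- d*\<eta>) + t powr (- d*\<eta>/2)"
     by (cases "m^2 \<le> t") (auto simp: min_def)
   qed auto
   also have "c0 powr (1 - \<eta>)*(t powr (- d*(1 - \<eta>)/2)*exp (- ((1 - \<eta>) * R^2/4/t)))
     * (C powr \<eta>*(m powr (- d*\<eta>) + t powr (- d*\<eta>/2))*exp (- (c*\<eta>)*(R/m) powr \<delta>)) = Z t x y"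
   proof -
    have "t powr (- d*(1 - \<eta>)/2)*t powr (- d*\<eta>/2) = t powr (- d/2)"
     by (simp flip: powr_add add: field_simps)
    hence "t powr (- d*(1 - \<eta>)/2)*(m powr (- d*\<eta>) + t powr (- d*\<eta>/2)) = t powr (- d*(1 - \<eta>)/2)*m powr (- d*\<eta>) + t powr (- d/2)"
     by (simp add: distrib_left)
    thus ?thesis unfolding Z_def m_def[symmetric] R_def[symmetric] by (simp add: mult.assoc[symmetric])
   qed
   finally show ?case by (simp add: z mult_left_mono)
  qed
 qed simp
 show ?thesis
 proof (rule that[of "C powr \<eta>*c0 powr (1 - \<eta>)" "c*\<eta>" \<delta>])
  show "0 < C powr \<eta>*c0 powr (1 - \<eta>)" "0 < c*\<eta>" "0 < \<delta>" using C c0 \<eta> by auto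
  define PP where "PP t z \<longleftrightarrow> (0 < t --> \<bar>k t (fst z) (snd z)\<bar> \<le> Z t (fst z) (snd z))" for t z
  have "(AE t in lborel. AE z in lborel. PP t z) \<longleftrightarrow> (AE z in lborel. AE t in lborel. PP t z)"
  proof (rule lborel_pair.AE_commute)
   have sp: "space (lborel \<Otimes>\<^sub>M lborel :: (real \<times> 'a \<times> 'a) measure) = UNIV" by (simp add: space_pair_measure)
   have 1: "(fst :: real \<times> 'a \<times> 'a => real) \<in> BM"
    "(\<lambda>w :: real \<times> 'a \<times> 'a. dist (fst (snd w)) (snd (snd w))) \<in> BM" "(\<lambda>w :: real \<times> 'a \<times> 'a. snd (snd w)) \<in> BM"
    by (auto intro!: BM_continuous continuous_intros)
   have 2: "(\<lambda>w :: real \<times> 'a \<times> 'a. mrad (snd (snd w))) \<in> BM"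
    by (rule measurable_compose[OF 1(3) mrad_measurable])
   have 3: "(\<lambda>w. k (fst w) (fst (snd w)) (snd (snd w))) \<in> BM"
    using k unfolding heat_kernel_def by (simp add: split_beta')
   have 4: "(\<lambda>w. Z (fst w) (fst (snd w)) (snd (snd w))) \<in> BM"
    unfolding Z_def
    by (intro borel_measurable_times borel_measurable_add borel_measurable_const measurable_compose[OF _ borel_measurable_exp] borel_measurable_uminus
      powr_real_measurable borel_measurable_divide borel_measurable_power 1(1,2) 2)
   have "{w :: real \<times> 'a \<times> 'a. fst w \<le> 0} \<union> {w. \<bar>k (fst w) (fst (snd w)) (snd (snd w))\<bar> \<le> Z (fst w) (fst (snd w)) (snd (snd w))} \<in> sets borel"
    by (intro sets.Un borel_measurable_le[where M=borel, simplified] borel_measurable_abs 3 4 1(1) borel_measurable_const)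
   also have "{w :: real \<times> 'a \<times> 'a. fst w \<le> 0} \<union> {w. \<bar>k (fst w) (fst (snd w)) (snd (snd w))\<bar> \<le> Z (fst w) (fst (snd w)) (snd (snd w))}
     = {w. PP (fst w) (snd w)}"
    by (auto simp: PP_def)
   finally show "{w \<in> space (lborel \<Otimes>\<^sub>M lborel). PP (fst w) (snd w)} \<in> sets (lborel \<Otimes>\<^sub>M lborel)"
    unfolding sp lborel_prod by simp
  qed
  thus "AE z in lborel. AE t in lborel. 0 < t --> \<bar>k t (fst z) (snd z)\<bar>
   \<le> C powr \<eta>*c0 powr (1 - \<eta>)*exp (- (c*\<eta>)*(dist (fst z) (snd z)/mrad (snd z)) powr \<delta>)
   * (t powr (- d*(1 - \<eta>)/2)*mrad (snd z) powr (- d*\<eta>) + t powr (- d/2))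
   * exp (- ((1 - \<eta>)*(dist (fst z) (snd z))^2/4/t))"
   using one unfolding PP_def Z_def by simp
 qed
qed

text \<open>The two powers of t in the joint bound are integrated separately. The one that carries
  \<open>mrad\<close> produces the growing factor X^(d \<eta>) with X = |x - y|/mrad y, which the
  exponential decay absorbs together with any power N.\<close>

lemma frac_kernel_bound:
 assumes k: "heat_kernel V k" and \<gamma>: "0 < \<gamma>" "2*\<gamma> < d" and N: "0 < N"
 obtains C where "0 < C"
  "AE z in lborel. \<bar>frac_kernel k \<gamma> (fst z) (snd z)\<bar>
   \<le> C*(dist (fst z) (snd z) powr (2*\<gamma> - d)*(1 + dist (fst z) (snd z)/mrad (snd z)) powr (- N))"
proof -
 \<comment> \<open>\<eta> is chosen so that d \<eta> is half of the gap d - 2\<gamma>. Then \<gamma>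
   - d (1 - \<eta>)/2 = -a1 is still negative, which is convergence at infinity; -a2 = \<gamma> -
   d/2 is the exponent of the other term, and \<open>b\<close> is the Gaussian constant left in the
   mean.\<close>
 define \<eta> a1 a2 b where "\<eta> = (1 - 2*\<gamma>/d)/2" and "a1 = (d - 2*\<gamma>)/4" and "a2 = (d - 2*\<gamma>)/2" and "b = (1 - \<eta>)/4"
 have \<eta>: "0 < \<eta>" "\<eta> < 1" and a: "0 < a1" "0 < a2" and b: "0 < b" and d\<eta>: "d*\<eta> = (d - 2*\<gamma>)/2"
  using \<gamma> d3 by (auto simp: \<eta>_def a1_def a2_def b_def field_simps)
 obtain C c \<delta> where C: "0 < C" "0 < c" "0 < \<delta>" and kb:
  "AE z in lborel. AE t in lborel. 0 < t --> \<bar>k t (fst z) (snd z)\<bar> \<le> C*exp (- c*(dist (fst z) (snd z)/mrad (snd z)) powr \<delta>)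
   * (t powr (- d*(1 - \<eta>)/2)*mrad (snd z) powr (- d*\<eta>) + t powr (- d/2))
   * exp (- ((1 - \<eta>)*(dist (fst z) (snd z))^2/4/t))"
  by (rule heat_kernel_joint_bound[OF k \<eta>]) (rule that; blast)
 obtain C1 where C1: "0 < C1" "\<And>B. 0 < B ==> (\<integral>t\<in>{0<..}. ennreal (t powr (- a1 - 1)*exp (- (B/t)))) \<le> ennreal (C1*B powr (- a1))"
  by (rule nn_integral_time_le[OF a(1)]) (rule that; blast)
 obtain C2 where C2: "0 < C2" "\<And>B. 0 < B ==> (\<integral>t\<in>{0<..}. ennreal (t powr (- a2 - 1)*exp (- (B/t)))) \<le> ennreal (C2*B powr (- a2))"
  by (rule nn_integral_time_le[OF a(2)]) (rule that; blast)
 have "0 \<le> d*\<eta>" using d\<eta> \<gamma> by simp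
 then obtain K where K: "0 < K" "\<And>X. 0 \<le> X ==> (X powr (d*\<eta>) + 1)*exp (- c*X powr \<delta>) \<le> K*(1 + X) powr (- N)"
  by (rule powr_exp_decay[OF _ C(2,3) N]) (rule that; blast)
 define C3 where "C3 = C1*b powr (- a1) + C2*b powr (- a2)"
 have C3: "0 < C3" using C1 C2 b by (simp add: C3_def add_pos_pos)
 have G: "0 < Gamma \<gamma>" by (rule Gamma_real_pos[OF \<gamma>(1)])
 show ?thesis
 proof (rule that[of "C*C3*K/Gamma \<gamma>"])
  show "0 < C*C3*K/Gamma \<gamma>" using C C3 K G by simp
  have "AE z in (lborel \<Otimes>\<^sub>M lborel :: ('a \<times> 'a) measure). fst z \<noteq> snd z"
  proof (rule lborel_pair.AE_pair_measure)
   have "{z :: 'a \<times> 'a. fst z \<noteq> snd z} \<in> sets borel"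
    by (intro borel_open open_Collect_neq continuous_intros)
   thus "{z \<in> space (lborel \<Otimes>\<^sub>M lborel). fst z \<noteq> snd z} \<in> sets (lborel \<Otimes>\<^sub>M lborel :: ('a \<times> 'a) measure)"
    unfolding lborel_prod by simp
   show "AE x in lborel. AE y in lborel. fst (x, y :: 'a) \<noteq> snd (x, y)"
    using AE_lborel_singleton by (auto simp: eq_commute)
  qed
  hence "AE z in (lborel :: ('a \<times> 'a) measure). fst z \<noteq> snd z" unfolding lborel_prod .
  with kb show "AE z in lborel. \<bar>frac_kernel k \<gamma> (fst z) (snd z)\<bar>
   \<le> C*C3*K/Gamma \<gamma>*(dist (fst z) (snd z) powr (2*\<gamma> - d)*(1 + dist (fst z) (snd z)/mrad (snd z)) powr (- N))"
  proof eventually_elim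
   case (elim z)
   obtain x y where z: "z = (x, y)" by (cases z)
   define m R where "m = mrad y" and "R = dist x y"
   have m: "0 < m" "0 < R" using elim(2) by (auto simp: z m_def R_def mrad_pos)
   define X B where "X = R/m" and "B = b * R^2"
   have X: "0 < X" and B: "0 < B" using m b by (auto simp: X_def B_def)
   define A0 where "A0 = C*exp (- c*X powr \<delta>)"
   have A0: "0 < A0" using C by (simp add: A0_def)
   have "ennreal (\<bar>LINT t:{0<..}|lebesgue. t powr (\<gamma> - 1) * k t x y\<bar>)
     \<le> (\<integral>t. ennreal \<bar>indicator {0<..} t *\<^sub>R (t powr (\<gamma> - 1) * k t x y)\<bar>)"
    unfolding set_lebesgue_integral_def by (rule ennreal_abs_integral_le)
   also have "... \<le> (\<integral>t. ennreal (A0*m powr (- d*\<eta>))*(ennreal (t powr (- a1 - 1)*exp (- (B/t)))*indicator {0<..} t)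
     + ennreal A0*(ennreal (t powr (- a2 - 1)*exp (- (B/t)))*indicator {0<..} t))"
   proof (rule nn_integral_mono_AE)
    have "AE t. 0 < t --> \<bar>k t x y\<bar> \<le> A0*(t powr (- d*(1 - \<eta>)/2)*m powr (- d*\<eta>) + t powr (- d/2))*exp (- (B/t))"
     using elim(1) unfolding AE_lebesgue_lborel by (simp add: z A0_def X_def m_def R_def B_def b_def)
    thus "AE t. ennreal \<bar>indicator {0<..} t *\<^sub>R (t powr (\<gamma> - 1) * k t x y)\<bar>
     \<le> ennreal (A0*m powr (- d*\<eta>))*(ennreal (t powr (- a1 - 1)*exp (- (B/t)))*indicator {0<..} t)
     + ennreal A0*(ennreal (t powr (- a2 - 1)*exp (- (B/t)))*indicator {0<..} t)"
    proof eventually_elim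
     case (elim t)
     show ?case
     proof (cases "0 < t")
      case True
      have e: "t powr (\<gamma> - 1)*t powr (- d*(1 - \<eta>)/2) = t powr (- a1 - 1)" "t powr (\<gamma> - 1)*t powr (- d/2) = t powr (- a2 - 1)"
      proof -
       have "\<gamma> - 1 + - d*(1 - \<eta>)/2 = - a1 - 1" "\<gamma> - 1 + - d/2 = - a2 - 1"
        using d\<eta> by (auto simp: a1_def a2_def field_simps)
       thus "t powr (\<gamma> - 1)*t powr (- d*(1 - \<eta>)/2) = t powr (- a1 - 1)" "t powr (\<gamma> - 1)*t powr (- d/2) = t powr (- a2 - 1)"
        unfolding powr_add[symmetric] by (simp_all only:)
      qed
      have "\<bar>t powr (\<gamma> - 1) * k t x y\<bar> \<le> t powr (\<gamma> - 1)*(A0*(t powr (- d*(1 - \<eta>)/2)*m powr (- d*\<eta>) + t powr (- d/2))*exp (- (B/t)))"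
       using elim True by (simp add: abs_mult mult_left_mono)
      also have "... = A0*m powr (- d*\<eta>)*((t powr (\<gamma> - 1)*t powr (- d*(1 - \<eta>)/2))*exp (- (B/t)))
        + A0*((t powr (\<gamma> - 1)*t powr (- d/2))*exp (- (B/t)))"
       by (simp only: ring_distribs mult_ac)
      finally have "\<bar>t powr (\<gamma> - 1) * k t x y\<bar> \<le> A0*m powr (- d*\<eta>)*(t powr (- a1 - 1)*exp (- (B/t)))
        + A0*(t powr (- a2 - 1)*exp (- (B/t)))" unfolding e .
      thus ?thesis using True A0
       by (simp add: ennreal_mult[symmetric] ennreal_plus[symmetric] del: ennreal_plus)
     qed simp
    qed
   qed
   also have "... = ennreal (A0*m powr (- d*\<eta>))*(\<integral>t\<in>{0<..}. ennreal (t powr (- a1 - 1)*exp (- (B/t))))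
     + ennreal A0*(\<integral>t\<in>{0<..}. ennreal (t powr (- a2 - 1)*exp (- (B/t))))"
   proof -
    have mm: "(\<lambda>t. ennreal (t powr (- a - 1)*exp (- (B/t)))*indicator {0<..} t) \<in> LM" for a :: real
     by (rule LM_of_BM) measurable
    show ?thesis
     unfolding nn_integral_cmult[OF mm, symmetric]
     by (rule nn_integral_add) (intro borel_measurable_times_ennreal borel_measurable_const mm)+
   qed
   also have "... \<le> ennreal (A0*m powr (- d*\<eta>))*ennreal (C1*B powr (- a1)) + ennreal A0*ennreal (C2*B powr (- a2))"
    by (intro add_mono mult_left_mono C1(2) C2(2) B) auto
   also have "... = ennreal (A0*m powr (- d*\<eta>)*(C1*B powr (- a1)) + A0*(C2*B powr (- a2)))"
    using A0 C1 C2 by (simp add: ennreal_mult[symmetric] ennreal_plus[symmetric] del: ennreal_plus)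
   finally have "\<bar>LINT t:{0<..}|lebesgue. t powr (\<gamma> - 1) * k t x y\<bar> \<le> A0*m powr (- d*\<eta>)*(C1*B powr (- a1)) + A0*(C2*B powr (- a2))"
    using A0 C1 C2 by (subst (asm) ennreal_le_iff) (auto intro!: add_nonneg_nonneg)
   \<comment> \<open>The exponents satisfy -2 a1 = (2\<gamma> - d) + d \<eta> and -2 a2 = 2\<gamma>
     - d, so that both terms contain the factor |x - y|^(2\<gamma> - d) and the first one also X^(d
     \<eta>).\<close>
   also have "... \<le> A0*(C3*(R powr (2*\<gamma> - d)*(X powr (d*\<eta>) + 1)))"
   proof -
    have B1: "B powr (- a) = b powr (- a) * R powr (- 2*a)" for a
     using m b by (simp add: B_def powr_mult powr_powr flip: powr_numeral)
    have e: "- 2*a1 = (2*\<gamma> - d) + d*\<eta>" "- 2*a2 = 2*\<gamma> - d" using d\<eta> by (auto simp: a1_def a2_def field_simps)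
    have "X powr (d*\<eta>) = m powr (- d*\<eta>) * R powr (d*\<eta>)"
     using m by (simp add: X_def powr_divide powr_minus) (simp add: field_simps)
    hence "m powr (- d*\<eta>)*(C1*B powr (- a1)) + C2*B powr (- a2)
     = C1*b powr (- a1)*(R powr (2*\<gamma> - d)*X powr (d*\<eta>)) + C2*b powr (- a2) * R powr (2*\<gamma> - d)"
     unfolding B1 e powr_add by (simp only: mult_ac)
    also have "... \<le> C3*(R powr (2*\<gamma> - d)*X powr (d*\<eta>)) + C3 * R powr (2*\<gamma> - d)"
     using C1 C2 by (intro add_mono mult_right_mono) (auto simp: C3_def)
    finally have "m powr (- d*\<eta>)*(C1*B powr (- a1)) + C2*B powr (- a2) \<le> C3*(R powr (2*\<gamma> - d)*(X powr (d*\<eta>) + 1))"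
     by (simp add: distrib_left)
    hence "A0*(m powr (- d*\<eta>)*(C1*B powr (- a1)) + C2*B powr (- a2)) \<le> A0*(C3*(R powr (2*\<gamma> - d)*(X powr (d*\<eta>) + 1)))"
     using A0 by (intro mult_left_mono) auto
    thus ?thesis by (simp add: distrib_left mult.assoc)
   qed
   also have "... = C*C3 * R powr (2*\<gamma> - d)*((X powr (d*\<eta>) + 1)*exp (- c*X powr \<delta>))"
    by (simp add: A0_def)
   also have "... \<le> C*C3 * R powr (2*\<gamma> - d)*(K*(1 + X) powr (- N))"
    using C C3 X by (intro mult_left_mono K(2)) auto
   finally have "\<bar>frac_kernel k \<gamma> x y\<bar> \<le> C*C3 * R powr (2*\<gamma> - d)*(K*(1 + X) powr (- N))/Gamma \<gamma>"
    unfolding frac_kernel_def using G by (simp add: abs_divide divide_right_mono)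
   thus ?case by (simp add: z m_def R_def X_def mult_ac)
  qed
 qed
qed

end

section \<open>Schur's test with weights\<close>

text \<open>Hoelder's inequality after writing K f as (K A^(-e) f) A^e with e = (p - 1)/p. Where A
  vanishes the splitting breaks down, so K has to vanish there too. This matters even for p = 1,
  because \<open>0 powr 0\<close> is 0.\<close>

lemma Schur_pointwise:
 fixes K A f :: "'a => real"
 assumes p: "1 \<le> p" and [measurable]: "K \<in> borel_measurable M" "A \<in> borel_measurable M" "f \<in> borel_measurable M"
  and nn: "\<And>y. 0 \<le> K y" "\<And>y. 0 \<le> A y" "\<And>y. 0 \<le> f y"
  and zero: "AE y in M. A y = 0 --> K y = 0" and Ca: "(\<integral>\<^sup>+y. ennreal (A y) \<partial>M) \<le> ennreal Ca" "0 < Ca"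
 shows "ennreal_powr (\<integral>\<^sup>+y. ennreal (K y*f y) \<partial>M) p
  \<le> ennreal (Ca powr (p - 1))*(\<integral>\<^sup>+y. ennreal (K y powr p*A y powr (1 - p)*f y powr p) \<partial>M)"
proof (cases "p = 1")
 case True
 have "(\<integral>\<^sup>+y. ennreal (K y*f y) \<partial>M) \<le> (\<integral>\<^sup>+y. ennreal (K y powr 1*A y powr 0*f y powr 1) \<partial>M)"
 proof (rule nn_integral_mono_AE)
  show "AE y in M. ennreal (K y*f y) \<le> ennreal (K y powr 1*A y powr 0*f y powr 1)"
   using zero by eventually_elim (use nn in auto)
 qed
 thus ?thesis using True Ca(2) by (simp add: ennreal_powr_one)
next
 case False
 hence p1: "1 < p" using p by simp
 define e r where "e = (p - 1)/p" and "r = p/(p - 1)"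
 have r: "0 < r" "r*e = 1" "e*p = p - 1" "1/r*p = p - 1" using p1 by (auto simp: r_def e_def)
 define \<alpha> where "\<alpha> = (\<integral>\<^sup>+y. ennreal ((K y*A y powr (- e)*f y) powr p) \<partial>M)"
 have "(\<integral>\<^sup>+y. ennreal (K y*f y) \<partial>M) \<le> (\<integral>\<^sup>+y. ennreal ((K y*A y powr (- e)*f y)*A y powr e) \<partial>M)"
 proof (rule nn_integral_mono_AE)
  show "AE y in M. ennreal (K y*f y) \<le> ennreal ((K y*A y powr (- e)*f y)*A y powr e)"
   using zero
  proof eventually_elim
   case (elim y)
   show ?case
   proof (cases "A y = 0")
    case False
    hence "A y powr (- e)*A y powr e = 1" using nn(2)[of y] by (simp flip: powr_add)
    hence "(K y*A y powr (- e)*f y)*A y powr e = K y*f y"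
     by (metis mult.assoc mult.commute mult.right_neutral)
    thus ?thesis by (simp only: order_refl)
   qed (use elim in simp)
  qed
 qed
 also have "... \<le> ennreal_powr \<alpha> (1/p)*ennreal_powr (\<integral>\<^sup>+y. ennreal ((A y powr e) powr r) \<partial>M) (1/r)"
  unfolding \<alpha>_def using nn by (intro Hoelder_nn_integral p1 r_def) auto
 also have "(\<integral>\<^sup>+y. ennreal ((A y powr e) powr r) \<partial>M) = (\<integral>\<^sup>+y. ennreal (A y) \<partial>M)"
  using nn(2) r by (simp add: powr_powr mult.commute)
 also have "ennreal_powr \<alpha> (1/p)*ennreal_powr (\<integral>\<^sup>+y. ennreal (A y) \<partial>M) (1/r) \<le> ennreal_powr \<alpha> (1/p)*ennreal_powr (ennreal Ca) (1/r)"
  using r Ca by (intro mult_left_mono ennreal_powr_mono) auto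
 also have "ennreal_powr (ennreal Ca) (1/r) = ennreal (Ca powr (1/r))" using Ca by (simp add: ennreal_powr_ennreal)
 finally have "ennreal_powr (\<integral>\<^sup>+y. ennreal (K y*f y) \<partial>M) p \<le> ennreal_powr (ennreal (Ca powr (1/r))*ennreal_powr \<alpha> (1/p)) p"
  using p1 by (intro ennreal_powr_mono) (auto simp: mult.commute)
 also have "... = ennreal ((Ca powr (1/r)) powr p)*\<alpha>"
  using p1 Ca by (simp add: ennreal_powr_mult ennreal_powr_powr ennreal_powr_one)
 also have "(Ca powr (1/r)) powr p = Ca powr (p - 1)" unfolding powr_powr r(4) ..
 also have "\<alpha> = (\<integral>\<^sup>+y. ennreal (K y powr p*A y powr (1 - p)*f y powr p) \<partial>M)"
  unfolding \<alpha>_def using r(3) by (intro nn_integral_cong) (simp add: powr_mult powr_powr)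
 finally show ?thesis .
qed

lemma Schur_weighted:
 fixes K A :: "'a::euclidean_space => 'a => real"
 assumes p: "1 \<le> p"
  and [measurable]: "(\<lambda>(x, y). K x y) \<in> LM2" "(\<lambda>(x, y). A x y) \<in> LM2"
   "w \<in> LM" "f \<in> LM"
  and nn: "\<And>x y. 0 \<le> K x y" "\<And>x y. 0 \<le> A x y" "\<And>x. 0 \<le> w x" "\<And>y. 0 \<le> f y"
  and zero: "AE x. AE y. A x y = 0 --> K x y = 0"
  and Ca: "\<And>x. (\<integral>y. ennreal (A x y)) \<le> ennreal Ca" "0 < Ca"
  and C: "AE y. (\<integral>x. ennreal (K x y powr p*A x y powr (1 - p)*w x)) \<le> ennreal C*W y" "0 < C"
 shows "(\<integral>x. ennreal_powr (\<integral>y. ennreal (K x y*f y)) p*ennreal (w x))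
  \<le> ennreal (Ca powr (p - 1)*C)*(\<integral>y. ennreal (f y powr p)*W y)"
proof -
 interpret L: sigma_finite_measure "lebesgue :: 'a measure" by (rule sigma_finite_lebesgue)
 define I where "I y = (\<integral>x. ennreal (K x y powr p*A x y powr (1 - p)*w x))" for y
 have [measurable]: "I \<in> LM"
  unfolding I_def by measurable
 have "(\<integral>x. ennreal_powr (\<integral>y. ennreal (K x y*f y)) p*ennreal (w x))
  \<le> (\<integral>x. ennreal (Ca powr (p - 1))*(\<integral>y. ennreal (K x y powr p*A x y powr (1 - p)*w x)*ennreal (f y powr p)))"
 proof (rule nn_integral_mono_AE)
  show "AE x. ennreal_powr (\<integral>y. ennreal (K x y*f y)) p*ennreal (w x)
   \<le> ennreal (Ca powr (p - 1))*(\<integral>y. ennreal (K x y powr p*A x y powr (1 - p)*w x)*ennreal (f y powr p))"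
   using zero
  proof eventually_elim
   case (elim x)
   have "ennreal_powr (\<integral>y. ennreal (K x y*f y)) p*ennreal (w x)
    \<le> ennreal (Ca powr (p - 1))*(\<integral>y. ennreal (K x y powr p*A x y powr (1 - p)*f y powr p))*ennreal (w x)"
    using elim by (intro mult_right_mono Schur_pointwise[OF p]) (auto simp: nn Ca)
   also have "... = ennreal (Ca powr (p - 1))*(\<integral>y. ennreal (K x y powr p*A x y powr (1 - p)*f y powr p)*ennreal (w x))"
    by (subst nn_integral_multc) (auto simp: mult.assoc)
   also have "(\<integral>y. ennreal (K x y powr p*A x y powr (1 - p)*f y powr p)*ennreal (w x))
    = (\<integral>y. ennreal (K x y powr p*A x y powr (1 - p)*w x)*ennreal (f y powr p))"
    using nn by (intro nn_integral_cong) (simp add: ennreal_mult[symmetric] mult_ac)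
   finally show ?case .
  qed
 qed
 also have "... = ennreal (Ca powr (p - 1))*(\<integral>x. \<integral>y. ennreal (K x y powr p*A x y powr (1 - p)*w x)*ennreal (f y powr p))"
  by (rule nn_integral_cmult) measurable
 also have "(\<integral>x. \<integral>y. ennreal (K x y powr p*A x y powr (1 - p)*w x)*ennreal (f y powr p))
  = (\<integral>y. \<integral>x. ennreal (K x y powr p*A x y powr (1 - p)*w x)*ennreal (f y powr p))"
  by (rule Tonelli_lebesgue) measurable
 also have "... = (\<integral>y. I y*ennreal (f y powr p))"
  unfolding I_def by (intro nn_integral_cong nn_integral_multc) measurable
 \<comment> \<open>W will be a maximal function and enters only by monotonicity. The measurable
   function I/C, at most W, stands in for it while the constant is pulled out of the
   integral.\<close>
 also have "... = (\<integral>y. ennreal C*(ennreal (f y powr p)*(ennreal (1/C)*I y)))"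
 proof (rule nn_integral_cong)
  fix y
  have "ennreal C*ennreal (1/C) = 1" using C(2) by (simp flip: ennreal_mult)
  thus "I y*ennreal (f y powr p) = ennreal C*(ennreal (f y powr p)*(ennreal (1/C)*I y))"
   by (metis mult.assoc mult.commute mult.left_neutral)
 qed
 also have "... = ennreal C*(\<integral>y. ennreal (f y powr p)*(ennreal (1/C)*I y))"
  by (rule nn_integral_cmult) measurable
 also have "(\<integral>y. ennreal (f y powr p)*(ennreal (1/C)*I y)) \<le> (\<integral>y. ennreal (f y powr p)*W y)"
 proof (rule nn_integral_mono_AE)
  show "AE y. ennreal (f y powr p)*(ennreal (1/C)*I y) \<le> ennreal (f y powr p)*W y"
   using C(1)
  proof eventually_elim
   case (elim y)
   have "ennreal (1/C)*I y \<le> ennreal (1/C)*(ennreal C*W y)" using elim unfolding I_def by (rule mult_left_mono) simp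
   also have "... = W y" using C(2) by (simp add: mult.assoc[symmetric] flip: ennreal_mult)
   finally show ?case by (rule mult_left_mono) simp
  qed
 qed
 finally show ?thesis using C(2) by (simp add: ennreal_mult mult.assoc mult_left_mono)
qed

text \<open>The estimate is made with absolute values inside the operator. Its finiteness makes the
  inner integral finite wherever w > 0, which is the existence clause of
  \<open>weighted_inequality\<close>; the norm inequality then follows from the triangle inequality,
  with a nonexistent integral counting as 0.\<close>

lemma weighted_inequalityI:
 fixes K :: "'a::euclidean_space => 'a => real" and f :: "'a => complex"
 assumes p: "1 \<le> p" and [measurable]: "(\<lambda>(x, y). K x y) \<in> LM2"
   "w \<in> LM" "f \<in> LM" and w: "\<And>x. 0 \<le> w x"
  and main: "(\<integral>x. ennreal_powr (\<integral>y. ennreal (\<bar>K x y\<bar>*norm (f y))) p*ennreal (w x))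
   \<le> ennreal C*(\<integral>y. ennreal (norm (f y) powr p)*W y)"
 shows "weighted_inequality K p C w W f"
 unfolding weighted_inequality_def
proof (intro conjI impI)
 interpret L: sigma_finite_measure "lebesgue :: 'a measure" by (rule sigma_finite_lebesgue)
 define T where "T x = (\<integral>y. ennreal (\<bar>K x y\<bar>*norm (f y)))" for x
 have [measurable]: "T \<in> LM" unfolding T_def by measurable
 show "AE x. 0 < w x --> L1 (\<lambda>y. K x y *\<^sub>R f y)"
  if fin: "(\<integral>x. ennreal (norm (f x) powr p)*W x) < \<infinity>"
 proof -
  have "(\<integral>x. ennreal_powr (T x) p*ennreal (w x)) \<noteq> \<infinity>"
   using main fin unfolding T_def by (metis ennreal_mult_less_top ennreal_less_top infinity_ennreal_def leD top_neq_ennreal)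
  moreover have "(\<lambda>x. ennreal_powr (T x) p*ennreal (w x)) \<in> LM"
   unfolding ennreal_powr_def by measurable
  ultimately have "AE x. ennreal_powr (T x) p*ennreal (w x) \<noteq> \<infinity>"
   using nn_integral_noteq_infinite by blast
  thus ?thesis
  proof eventually_elim
   case (elim x)
   show ?case
   proof
    assume "0 < w x"
    hence "T x < \<infinity>" using elim by (auto simp: ennreal_powr_def ennreal_top_mult less_top split: if_splits)
    thus "L1 (\<lambda>y. K x y *\<^sub>R f y)"
     unfolding integrable_iff_bounded T_def by simp
   qed
  qed
 qed
 have "(\<integral>x. ennreal (norm (kernel_op K f x) powr p*w x)) \<le> (\<integral>x. ennreal_powr (T x) p*ennreal (w x))"
 proof (rule nn_integral_mono)
  fix x
  have "ennreal (norm (kernel_op K f x)) \<le> T x"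
  proof (cases "L1 (\<lambda>y. K x y *\<^sub>R f y)")
   case True
   thus ?thesis unfolding kernel_op_def T_def using integral_norm_bound_ennreal[OF True] by simp
  qed (simp add: kernel_op_def not_integrable_integral_eq)
  hence "ennreal_powr (ennreal (norm (kernel_op K f x))) p \<le> ennreal_powr (T x) p"
   using p by (intro ennreal_powr_mono) auto
  thus "ennreal (norm (kernel_op K f x) powr p*w x) \<le> ennreal_powr (T x) p*ennreal (w x)"
   using w[of x] by (simp add: ennreal_powr_ennreal ennreal_mult mult_right_mono)
 qed
 also note main[folded T_def]
 finally show "(\<integral>x. ennreal (norm (kernel_op K f x) powr p*w x)) \<le> ennreal C*(\<integral>y. ennreal (norm (f y) powr p)*W y)" .
qed

text \<open>The condition on the zeros of A is asked off the diagonal, because a shell kernel is 0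
  at distance 0; for fixed x this excludes a single point.\<close>

lemma weighted_inequality_Schur:
 fixes K A :: "'a::euclidean_space => 'a => real" and f :: "'a => complex"
 assumes p: "1 \<le> p" and K: "(\<lambda>(x, y). K x y) \<in> LM2"
  and A: "(\<lambda>(x, y). A x y) \<in> LM2"
  and wf: "w \<in> LM" "f \<in> LM"
  and nn: "\<And>x y. 0 \<le> A x y" "\<And>x. 0 \<le> w x"
  and zero: "\<And>x y. x \<noteq> y ==> A x y = 0 ==> K x y = 0"
  and Ca: "\<And>x. (\<integral>y. ennreal (A x y)) \<le> ennreal Ca" "0 < Ca"
  and C: "AE y. (\<integral>x. ennreal (\<bar>K x y\<bar> powr p*A x y powr (1 - p)*w x)) \<le> ennreal C*W y" "0 < C"
 shows "weighted_inequality K p (Ca powr (p - 1)*C) w W f"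
proof (rule weighted_inequalityI[OF p K wf nn(2)])
 have K': "(\<lambda>(x, y). \<bar>K x y\<bar>) \<in> LM2" using borel_measurable_abs[OF K] by (simp add: split_beta')
 have f': "(\<lambda>y. norm (f y)) \<in> LM" using wf(2) by measurable
 have "AE y. A x y = 0 --> \<bar>K x y\<bar> = 0" for x
  using zero[of x] AE_lborel_singleton[of x] unfolding AE_lebesgue_lborel by (auto elim!: eventually_mono)
 thus "(\<integral>x. ennreal_powr (\<integral>y. ennreal (\<bar>K x y\<bar>*norm (f y))) p*ennreal (w x))
  \<le> ennreal (Ca powr (p - 1)*C)*(\<integral>y. ennreal (norm (f y) powr p)*W y)"
  by (intro Schur_weighted[OF p K' A wf(1) f' _ nn norm_ge_zero _ Ca C]) auto
qed

lemma frac_kernel_measurable: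
 fixes k :: "real => 'a::euclidean_space => 'a => real"
 assumes k: "heat_kernel V k"
 shows "(\<lambda>z. frac_kernel k \<gamma> (fst z) (snd z)) \<in> BM"
proof -
 have f: "(fst :: ('a \<times> 'a) \<times> real => 'a \<times> 'a) \<in> BM" "(snd :: ('a \<times> 'a) \<times> real => real) \<in> BM"
  "(\<lambda>w :: ('a \<times> 'a) \<times> real. (snd w, fst w)) \<in> BM"
  by (auto intro!: BM_continuous continuous_intros)
 have k1: "(\<lambda>u. k (fst u) (fst (snd u)) (snd (snd u))) \<in> BM"
  using k unfolding heat_kernel_def by (simp add: split_beta')
 have "(\<lambda>w. k (snd w) (fst (fst w)) (snd (fst w))) \<in> borel_measurable (borel :: (('a \<times> 'a) \<times> real) measure)"
  using measurable_compose[OF f(3) k1] by simp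
 moreover have "(\<lambda>w :: ('a \<times> 'a) \<times> real. indicator {0<..} (snd w)) \<in> BM"
  by (rule measurable_compose[OF f(2)]) simp
 moreover have "(\<lambda>w :: ('a \<times> 'a) \<times> real. snd w powr (\<gamma> - 1)) \<in> BM"
  by (intro powr_real_measurable f(2) borel_measurable_const)
 ultimately have "(\<lambda>w. indicator {0<..} (snd w) *\<^sub>R (snd w powr (\<gamma> - 1) * k (snd w) (fst (fst w)) (snd (fst w)))) \<in> borel_measurable (borel :: (('a \<times> 'a) \<times> real) measure)"
  by (intro borel_measurable_scaleR borel_measurable_times)
 hence "(\<lambda>(z, t). indicator {0<..} t *\<^sub>R (t powr (\<gamma> - 1) * k t (fst z) (snd z))) \<in> borel_measurable (borel \<Otimes>\<^sub>M lborel)"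
 proof -
  assume a: "(\<lambda>w. indicator {0<..} (snd w) *\<^sub>R (snd w powr (\<gamma> - 1) * k (snd w) (fst (fst w)) (snd (fst w)))) \<in> borel_measurable (borel :: (('a \<times> 'a) \<times> real) measure)"
  have "sets (borel \<Otimes>\<^sub>M lborel :: (('a \<times> 'a) \<times> real) measure) = sets (borel \<Otimes>\<^sub>M borel)"
   by (rule sets_pair_measure_cong) simp_all
  hence "sets (borel \<Otimes>\<^sub>M lborel :: (('a \<times> 'a) \<times> real) measure) = sets borel" unfolding borel_prod .
  hence c: "measurable (borel \<Otimes>\<^sub>M lborel :: (('a \<times> 'a) \<times> real) measure) (borel :: real measure) = measurable borel borel"
   by (rule measurable_cong_sets) simp
  show ?thesis unfolding c split_beta' by (rule a)
 qed
 hence m: "(\<lambda>z. LINT t|lborel. indicator {0<..} t *\<^sub>R (t powr (\<gamma> - 1) * k t (fst z) (snd z))) \<in> BM"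
  by (rule lborel.borel_measurable_lebesgue_integral)
 have e: "(LINT t:{0<..}|lebesgue. t powr (\<gamma> - 1) * k t x y) = (LINT t|lborel. indicator {0<..} t *\<^sub>R (t powr (\<gamma> - 1) * k t x y))" for x y
 proof -
  have "(\<lambda>t::real. (t, x, y)) \<in> BM"
   by (intro BM_continuous continuous_intros)
  from measurable_compose[OF this k1] have [measurable]: "(\<lambda>t. k t x y) \<in> BM" by simp
  show ?thesis unfolding set_lebesgue_integral_def by (rule integral_lebesgue_lborel) measurable
 qed
 show ?thesis unfolding frac_kernel_def e using m by (rule borel_measurable_divide) simp
qed

section \<open>Growth of weighted masses in terms of the maximal functions\<close>

context rh_potential begin

lemma nn_integral_ball_power_mean:
 fixes y :: 'a and w :: "'a => real"
 assumes r: "0 < r" and s: "0 < s"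
 shows "ennreal_powr (\<integral>x\<in>ball y r. ennreal (w x powr s)) (1/s) = ennreal (vol r powr (1/s))*power_mean s w (ball y r)"
proof -
 define I where "I = (\<integral>x\<in>ball y r. ennreal (w x powr s))"
 have v: "0 < vol r" using r by (rule vol_pos)
 have "I = ennreal (vol r)*(I/ennreal (vol r))"
  using v by (cases I) (auto simp: divide_ennreal ennreal_mult[symmetric] ennreal_top_divide ennreal_mult_top)
 hence "ennreal_powr I (1/s) = ennreal_powr (ennreal (vol r)*(I/ennreal (vol r))) (1/s)" by simp
 also have "... = ennreal (vol r powr (1/s))*ennreal_powr (I/ennreal (vol r)) (1/s)"
  using s v by (intro ennreal_powr_mult) auto
 finally show ?thesis unfolding power_mean_def I_def emeasure_ball_vol[OF less_imp_le[OF r]] .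
qed

text \<open>Hoelder's exponent q/\<sigma> raises V^\<sigma> to V^q, where the reverse Hoelder
  inequality applies. The conjugate exponent is left for w; for \<sigma> = \<gamma> p it is the r of
  the first inequality.\<close>

lemma potential_power_mean:
 assumes \<sigma>: "0 < \<sigma>" "\<sigma> < q" and r: "0 < r" and w: "w \<in> LM" "\<And>x. 0 \<le> w x"
 shows "(\<integral>x\<in>ball y r. ennreal (V x powr \<sigma>*w x))
  \<le> ennreal (unit_ball_vol d*(RHC/unit_ball_vol d) powr \<sigma>*(r powr (d - 2*\<sigma>)*\<Psi> y r powr \<sigma>))
    * power_mean (conj_exp (q/\<sigma>)) w (ball y r)"
proof -
 note [measurable] = w(1)
 define s t where "s = q/\<sigma>" and "t = conj_exp s"
 have s: "1 < s" using \<sigma> by (simp add: s_def)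
 have t: "t = s/(s - 1)" by (simp add: t_def conj_exp_def)
 have tp: "0 < t" "1/s + 1/t = 1" using s by (auto simp: t field_simps)
 let ?B = "ball y r" and ?\<omega> = "unit_ball_vol d"
 have v: "0 < vol r" using r by (rule vol_pos)
 define b where "b = RHC*mass ?B/vol r"
 have b: "0 \<le> b" using RHC(1) v mass_nonneg by (simp add: b_def)
 have "(\<integral>x\<in>?B. ennreal (V x powr \<sigma>*w x)) = (\<integral>x. ennreal ((V x powr \<sigma>*indicator ?B x)*(w x*indicator ?B x)))"
  by (intro nn_integral_cong) (auto simp: indicator_def)
 also have "... \<le> ennreal_powr (\<integral>x. ennreal ((V x powr \<sigma>*indicator ?B x) powr s)) (1/s)
   * ennreal_powr (\<integral>x. ennreal ((w x*indicator ?B x) powr t)) (1/t)"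
 proof (rule Hoelder_nn_integral[OF _ _ _ _ s t])
  have [measurable]: "?B \<in> sets lebesgue" by simp
  show "(\<lambda>x. V x powr \<sigma>*indicator ?B x) \<in> LM" "(\<lambda>x. w x*indicator ?B x) \<in> LM"
   by measurable
 qed (use w(2) in auto)
 also have "(\<integral>x. ennreal ((w x*indicator ?B x) powr t)) = (\<integral>x\<in>?B. ennreal (w x powr t))"
  using tp by (intro nn_integral_cong) (auto simp: indicator_def)
 also have "(\<integral>x. ennreal ((V x powr \<sigma>*indicator ?B x) powr s)) = (\<integral>x\<in>?B. ennreal (V x powr q))"
  using \<sigma> by (intro nn_integral_cong) (auto simp: indicator_def powr_powr s_def)
 also have "ennreal_powr (\<integral>x\<in>?B. ennreal (w x powr t)) (1/t) = ennreal (vol r powr (1/t))*power_mean t w ?B"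
  by (rule nn_integral_ball_power_mean[OF r tp(1)])
 also have "ennreal_powr (\<integral>x\<in>?B. ennreal (V x powr q)) (1/s)*(ennreal (vol r powr (1/t))*power_mean t w ?B)
  \<le> ennreal_powr (ennreal (vol r*b powr q)) (1/s)*(ennreal (vol r powr (1/t))*power_mean t w ?B)"
  using s RHC(2)[OF r, of y] by (intro mult_right_mono ennreal_powr_mono) (auto simp: b_def)
 also have "ennreal_powr (ennreal (vol r*b powr q)) (1/s) = ennreal (vol r powr (1/s)*b powr \<sigma>)"
 proof -
  have "q*(1/s) = \<sigma>" using \<sigma> by (simp add: s_def)
  hence "(vol r*b powr q) powr (1/s) = vol r powr (1/s)*b powr \<sigma>" unfolding powr_mult powr_powr by simp
  thus ?thesis using v by (simp add: ennreal_powr_ennreal)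
 qed
 also have "ennreal (vol r powr (1/s)*b powr \<sigma>)*(ennreal (vol r powr (1/t))*power_mean t w ?B)
  = ennreal ((vol r powr (1/s) * vol r powr (1/t))*b powr \<sigma>)*power_mean t w ?B"
 proof -
  have "ennreal (vol r powr (1/s)*b powr \<sigma>)*ennreal (vol r powr (1/t)) = ennreal ((vol r powr (1/s) * vol r powr (1/t))*b powr \<sigma>)"
   by (subst ennreal_mult[symmetric]) (auto simp: mult_ac)
  thus ?thesis by (simp only: mult.assoc[symmetric])
 qed
 also have "vol r powr (1/s) * vol r powr (1/t) = vol r" using v tp(2) by (simp flip: powr_add)
 also have "vol r*b powr \<sigma> = ?\<omega>*(RHC/?\<omega>) powr \<sigma>*(r powr (d - 2*\<sigma>)*\<Psi> y r powr \<sigma>)"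
 proof -
  have \<omega>: "0 < ?\<omega>" by (rule unit_ball_vol_pos')
  have "r powr (2 - d) = r powr 2/r powr d" by (rule powr_diff)
  hence b2: "b = RHC/?\<omega>*(\<Psi> y r*r powr (- 2))"
   using r \<omega> by (simp add: b_def \<Psi>_def vol_def powr_minus field_simps)
  have "b powr \<sigma> = (RHC/?\<omega>) powr \<sigma>*(\<Psi> y r powr \<sigma>*r powr (- 2*\<sigma>))"
   unfolding b2 powr_mult powr_powr ..
  hence "vol r*b powr \<sigma> = ?\<omega>*(RHC/?\<omega>) powr \<sigma>*((r powr d*r powr (- 2*\<sigma>))*\<Psi> y r powr \<sigma>)"
   unfolding vol_def by (simp only: mult_ac)
  also have "r powr d*r powr (- 2*\<sigma>) = r powr (d - 2*\<sigma>)" by (simp flip: powr_add)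
  finally show ?thesis .
 qed
 finally show ?thesis by (simp add: s_def t_def)
qed

lemma power_mean_le_maximal_fun:
 assumes r: "0 < r"
 shows "power_mean s w (ball y r) \<le> ennreal ((1 + r/\<rho> y) powr \<theta>)*maximal_fun V \<theta> s w y"
proof -
 have p: "0 < 1 + r/\<rho> y" using r \<rho>_pos[of y] by (simp add: add_pos_nonneg)
 have "ennreal ((1 + r/\<rho> y) powr (- \<theta>))*power_mean s w (ball y r) \<le> maximal_fun V \<theta> s w y"
  unfolding maximal_fun_def by (rule SUP_upper2[of "(y, r)"]) (use r in auto)
 hence "ennreal ((1 + r/\<rho> y) powr \<theta>)*(ennreal ((1 + r/\<rho> y) powr (- \<theta>))*power_mean s w (ball y r))
  \<le> ennreal ((1 + r/\<rho> y) powr \<theta>)*maximal_fun V \<theta> s w y" by (rule mult_left_mono) simp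
 moreover have "(1 + r/\<rho> y) powr \<theta>*(1 + r/\<rho> y) powr (- \<theta>) = 1" using p by (simp flip: powr_add)
 ultimately show ?thesis by (simp add: mult.assoc[symmetric] ennreal_mult[symmetric])
qed

text \<open>Below the critical scale the rate comes from the decay of \<open>\<Psi>\<close>. Above
  it, the growth of \<open>\<Psi>\<close> to the power \<sigma> and the factor (1 + r/\<rho>
  y)^\<theta> from the maximal function add up. The upper rate may be large, since the kernel has
  arbitrarily fast decay there; it is the lower rate \<delta>0 \<sigma> > 0 that leaves room for
  Schur's test.\<close>

lemma maximal_fun_ball_rate:
 assumes \<sigma>: "0 < \<sigma>" "\<sigma> < q" and \<theta>: "0 \<le> \<theta>"
 obtains D A where "0 < D" "0 \<le> A"
  "\<And>w y. weight w ==> ball_rate (d - 2*\<sigma>) (\<delta>0*\<sigma>) A (mrad y) y (ennreal D*maximal_fun V \<theta> (conj_exp (q/\<sigma>)) w y) (\<lambda>x. V x powr \<sigma>*w x)"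
  "\<And>w y. weight w ==> ball_rate d 0 \<theta> (mrad y) y (ennreal D*maximal_fun V \<theta> 1 w y) w"
proof -
 obtain C k k1 where C: "1 \<le> C" "0 \<le> k" "0 \<le> (k1::real)" and
  P: "\<And>x r. 0 < r ==> r \<le> mrad x ==> \<Psi> x r \<le> C*(r/mrad x) powr \<delta>0"
  "\<And>x r. mrad x \<le> r ==> \<Psi> x r \<le> C*(r/mrad x) powr k"
  and \<rho>: "\<And>x. mrad x \<le> C*\<rho> x"
  by (rule critical_scale) (rule that; blast)
 define \<omega> where "\<omega> = unit_ball_vol d"
 have \<omega>: "0 < \<omega>" unfolding \<omega>_def by (rule unit_ball_vol_pos')
 define K where "K = \<omega>*(RHC/\<omega>) powr \<sigma>*C powr \<sigma>"
 have K: "0 < K" using \<omega> RHC(1) C by (simp add: K_def)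
 define L where "L = (1 + C) powr \<theta>"
 have L: "0 < L" using C by (simp add: L_def)
 define D where "D = K*L + \<omega>*L"
 have D: "0 < D" "K*L \<le> D" "\<omega>*L \<le> D" using K L \<omega> by (auto simp: D_def intro: add_pos_pos)
 have mean: "power_mean s w (ball y r) \<le> ennreal (L*(r/mrad y) powr (if r \<le> mrad y then 0 else \<theta>))*maximal_fun V \<theta> s w y"
  if r: "0 < r" for s w y r
 proof -
  define X where "X = r/mrad y"
  have X: "0 < X" "X \<le> 1 \<longleftrightarrow> r \<le> mrad y" using r mrad_pos[of y] by (auto simp: X_def divide_le_eq)
  have "r/\<rho> y \<le> C*X" using \<rho>[of y] r mrad_pos[of y] \<rho>_pos[of y] C by (simp add: X_def field_simps)
  also have "1 + C*X \<le> (1 + C)*max 1 X" using C X by (auto simp: max_def algebra_simps)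
  finally have "(1 + r/\<rho> y) powr \<theta> \<le> ((1 + C)*max 1 X) powr \<theta>"
   using \<theta> r \<rho>_pos[of y] by (intro powr_mono2) auto
  also have "... = L*X powr (if r \<le> mrad y then 0 else \<theta>)" using X by (auto simp: L_def powr_mult max_def)
  finally show ?thesis unfolding X_def
   by (intro order_trans[OF power_mean_le_maximal_fun[OF r, where \<theta>=\<theta>] mult_right_mono[OF ennreal_leI]]) auto
 qed
 have DM: "ennreal c*(ennreal b*M) \<le> (ennreal D*M)*ennreal e" if "c*b \<le> D*e" "0 \<le> c" "0 \<le> b" "0 \<le> e" for c b e M
 proof -
  have "ennreal c*(ennreal b*M) = ennreal (c*b)*M" using that by (simp add: ennreal_mult mult.assoc)
  also have "... \<le> ennreal (D*e)*M" using that by (intro mult_right_mono ennreal_leI) auto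
  also have "... = (ennreal D*M)*ennreal e" using that D by (simp add: ennreal_mult mult_ac)
  finally show ?thesis .
 qed
 show ?thesis
 proof (rule that[of D "k*\<sigma> + \<theta>"])
  show "0 < D" "0 \<le> k*\<sigma> + \<theta>" using D C \<sigma> \<theta> by auto
  fix w y assume w: "weight (w :: 'a => real)"
  note wm[measurable] = weight_measurable[OF w] and wn = weight_nonneg[OF w]
  show "ball_rate (d - 2*\<sigma>) (\<delta>0*\<sigma>) (k*\<sigma> + \<theta>) (mrad y) y (ennreal D*maximal_fun V \<theta> (conj_exp (q/\<sigma>)) w y) (\<lambda>x. V x powr \<sigma>*w x)"
   unfolding ball_rate_def
  proof (intro conjI allI impI)
   fix r :: real assume r: "0 < r"
   define X e where "X = r/mrad y" and "e = (if r \<le> mrad y then 0 else \<theta>)"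
   let ?c = "\<omega>*(RHC/\<omega>) powr \<sigma>*(r powr (d - 2*\<sigma>)*\<Psi> y r powr \<sigma>)"
   have "\<Psi> y r \<le> C*X powr (if r \<le> mrad y then \<delta>0 else k)" using P r by (simp add: X_def)
   hence "\<Psi> y r powr \<sigma> \<le> (C*X powr (if r \<le> mrad y then \<delta>0 else k)) powr \<sigma>" using \<sigma> \<Psi>_nonneg by (intro powr_mono2) auto
   also have "... = C powr \<sigma>*X powr ((if r \<le> mrad y then \<delta>0 else k)*\<sigma>)" unfolding powr_mult powr_powr ..
   finally have "\<Psi> y r powr \<sigma>*X powr e \<le> C powr \<sigma>*X powr ((if r \<le> mrad y then \<delta>0 else k)*\<sigma>)*X powr e"
    by (rule mult_right_mono) simp
   also have "... = C powr \<sigma>*X powr (if r \<le> mrad y then \<delta>0*\<sigma> else k*\<sigma> + \<theta>)" by (simp add: e_def powr_add)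
   finally have "\<omega>*(RHC/\<omega>) powr \<sigma>*L*r powr (d - 2*\<sigma>)*(\<Psi> y r powr \<sigma>*X powr e)
    \<le> \<omega>*(RHC/\<omega>) powr \<sigma>*L*r powr (d - 2*\<sigma>)*(C powr \<sigma>*X powr (if r \<le> mrad y then \<delta>0*\<sigma> else k*\<sigma> + \<theta>))"
    using \<omega> L by (intro mult_left_mono) auto
   hence 1: "?c*(L*X powr e) \<le> K*L*(r powr (d - 2*\<sigma>)*X powr (if r \<le> mrad y then \<delta>0*\<sigma> else k*\<sigma> + \<theta>))"
    by (simp add: K_def mult_ac)
   have "(\<integral>x\<in>ball y r. ennreal (V x powr \<sigma>*w x)) \<le> ennreal ?c*power_mean (conj_exp (q/\<sigma>)) w (ball y r)"
    unfolding \<omega>_def by (rule potential_power_mean[OF \<sigma> r wm wn])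
   also have "... \<le> ennreal ?c*(ennreal (L*X powr e)*maximal_fun V \<theta> (conj_exp (q/\<sigma>)) w y)"
    unfolding X_def e_def by (rule mult_left_mono[OF mean[OF r]]) simp
   also have "... \<le> (ennreal D*maximal_fun V \<theta> (conj_exp (q/\<sigma>)) w y)
    * ennreal (r powr (d - 2*\<sigma>)*X powr (if r \<le> mrad y then \<delta>0*\<sigma> else k*\<sigma> + \<theta>))"
    by (rule DM[OF order_trans[OF 1 mult_right_mono[OF D(2)]]]) (use \<omega> L in auto)
   finally show "(\<integral>x\<in>ball y r. ennreal (V x powr \<sigma>*w x)) \<le> (ennreal D*maximal_fun V \<theta> (conj_exp (q/\<sigma>)) w y)
    * ennreal (r powr (d - 2*\<sigma>)*(r/mrad y) powr (if r \<le> mrad y then \<delta>0*\<sigma> else k*\<sigma> + \<theta>))"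
    unfolding X_def .
  qed (use mrad_pos wn in auto)
  show "ball_rate d 0 \<theta> (mrad y) y (ennreal D*maximal_fun V \<theta> 1 w y) w"
   unfolding ball_rate_def
  proof (intro conjI allI impI)
   fix r :: real assume r: "0 < r"
   define b where "b = (r/mrad y) powr (if r \<le> mrad y then 0 else \<theta>)"
   have "\<omega>*L*(r powr d*b) \<le> D*(r powr d*b)" using D by (intro mult_right_mono) (auto simp: b_def)
   hence 1: "vol r*(L*b) \<le> D*(r powr d*b)" by (simp add: vol_def \<omega>_def mult_ac)
   have "(\<integral>x\<in>ball y r. ennreal (w x)) = ennreal (vol r)*power_mean 1 w (ball y r)"
    using nn_integral_ball_power_mean[OF r, of 1 w y] wn vol_pos[OF r] by (simp add: ennreal_powr_one)
   also have "... \<le> ennreal (vol r)*(ennreal (L*b)*maximal_fun V \<theta> 1 w y)"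
    unfolding b_def by (rule mult_left_mono[OF mean[OF r]]) simp
   also have "... \<le> (ennreal D*maximal_fun V \<theta> 1 w y)*ennreal (r powr d*b)"
    using L vol_pos[OF r] by (intro DM 1) (auto simp: b_def)
   finally show "(\<integral>x\<in>ball y r. ennreal (w x))
    \<le> (ennreal D*maximal_fun V \<theta> 1 w y)*ennreal (r powr d*(r/mrad y) powr (if r \<le> mrad y then 0 else \<theta>))"
    unfolding b_def .
  qed (use mrad_pos wn in auto)
 qed
qed

text \<open>Moving the scale from one argument to the other only worsens the decay rate at infinity.\<close>

lemma shell_comparison:
 obtains \<delta> where "0 < \<delta>"
  "\<And>\<alpha> \<beta>. 0 < \<alpha> ==> 0 < \<beta> ==> \<exists>C>0. \<forall>c x y.
   shell_kernel c (- \<alpha>) \<beta> (mrad y) x y \<le> C * shell_kernel c (- \<alpha>) (\<beta>*\<delta>) (mrad x) x y"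
proof -
 obtain C1 \<delta> where C1: "1 \<le> C1" and \<delta>: "0 < \<delta>" "\<delta> \<le> 1" and up:
  "\<And>y z. mrad z \<le> C1*mrad y*(1 + (dist z y/mrad y)^2) powr ((1 - \<delta>)/2)"
  by (rule mrad_upper) (rule that; blast)
 obtain C k k1 where C: "1 \<le> C" "0 \<le> (k::real)" "0 \<le> k1"
  and lower: "\<And>x y. mrad x/C*(1 + dist x y/mrad x) powr (- k1) \<le> mrad y"
  by (rule critical_scale) (rule that; blast)
 show ?thesis
 proof (rule that[OF \<delta>(1)])
  fix \<alpha> \<beta> :: real assume ab: "0 < \<alpha>" "0 < \<beta>"
  \<comment> \<open>\<open>K1\<close> comes from the lower bound for \<open>mrad y\<close> and
    serves distances up to the scale of x; \<open>K2\<close> comes from \<open>mrad_upper\<close>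
    and serves larger ones.\<close>
  define K1 K2 where "K1 = (C*2 powr k1) powr \<alpha>" and "K2 = (2*C1) powr \<beta>"
  have K: "0 < K1" "0 < K2" using C C1 by (auto simp: K1_def K2_def)
  have "shell_kernel c (- \<alpha>) \<beta> (mrad y) x y \<le> (K1 + K2) * shell_kernel c (- \<alpha>) (\<beta>*\<delta>) (mrad x) x y" for c x y
  proof (cases "x = y")
   case False
   define R X Y where "R = dist x y" and "X = R/mrad y" and "Y = R/mrad x"
   have R: "0 < R" using False by (simp add: R_def)
   have XY: "0 < X" "0 < Y" "R \<le> mrad y \<longleftrightarrow> X \<le> 1" "R \<le> mrad x \<longleftrightarrow> Y \<le> 1"
    using R mrad_pos[of x] mrad_pos[of y] by (auto simp: X_def Y_def divide_le_eq)
   \<comment> \<open>Each of the two powers is an upper bound on either side of X = 1, since the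
     kernel takes the smaller one. The case distinction can therefore be made on Y alone.\<close>
   have min: "X powr (- (if X \<le> 1 then - \<alpha> else \<beta>)) \<le> X powr \<alpha>" "X powr (- (if X \<le> 1 then - \<alpha> else \<beta>)) \<le> X powr (- \<beta>)"
    using XY ab by (auto intro: powr_mono powr_mono' simp: powr_mono')
   have "X powr (- (if X \<le> 1 then - \<alpha> else \<beta>)) \<le> (K1 + K2)*Y powr (- (if Y \<le> 1 then - \<alpha> else \<beta>*\<delta>))"
   proof (cases "Y \<le> 1")
    case True
    have "2 powr (- k1) \<le> (1 + Y) powr (- k1)" using True XY C(3) by (intro powr_mono2') auto
    hence "mrad x/C*2 powr (- k1) \<le> mrad x/C*(1 + Y) powr (- k1)"
     using mrad_pos[of x] C by (intro mult_left_mono) auto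
    also have "... \<le> mrad y" using lower[of x y] by (simp add: Y_def R_def)
    finally have "R*mrad x \<le> R*(C*2 powr k1*mrad y)" using C R by (simp add: powr_minus field_simps)
    hence "X \<le> C*2 powr k1*Y" using mrad_pos[of x] mrad_pos[of y] by (simp add: X_def Y_def field_simps)
    hence "X powr \<alpha> \<le> (C*2 powr k1*Y) powr \<alpha>" using XY ab by (intro powr_mono2) auto
    also have "... = K1*Y powr \<alpha>" by (simp add: K1_def powr_mult)
    also have "... \<le> (K1 + K2)*Y powr \<alpha>" using K by (intro mult_right_mono) auto
    finally show ?thesis using True min by simp
   next
    case False
    have "1 + Y^2 \<le> 2*Y^2" using False one_le_power[of Y 2] by simp
    hence "(1 + Y^2) powr ((1 - \<delta>)/2) \<le> (2*Y^2) powr ((1 - \<delta>)/2)" using \<delta> by (intro powr_mono2) auto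
    also have "... = 2 powr ((1 - \<delta>)/2)*(Y powr 2) powr ((1 - \<delta>)/2)" using XY by (simp add: powr_mult powr_numeral)
    also have "... = 2 powr ((1 - \<delta>)/2)*Y powr (1 - \<delta>)" by (simp add: powr_powr diff_divide_distrib)
    also have "... \<le> 2 powr 1*Y powr (1 - \<delta>)" using \<delta> by (intro mult_right_mono powr_mono) auto
    finally have "C1*mrad x*(1 + Y^2) powr ((1 - \<delta>)/2) \<le> C1*mrad x*(2*Y powr (1 - \<delta>))"
     using C1 mrad_pos[of x] by (intro mult_left_mono) auto
    with up[of y x] have "mrad y \<le> 2*C1*mrad x*Y powr (1 - \<delta>)" by (simp add: Y_def R_def dist_commute)
    hence "R*mrad y \<le> R*(2*C1*mrad x*Y powr (1 - \<delta>))" using R by (intro mult_left_mono) auto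
    hence "Y \<le> 2*C1*X*Y powr (1 - \<delta>)" using mrad_pos[of x] mrad_pos[of y] by (simp add: X_def Y_def field_simps)
    hence "Y*Y powr (\<delta> - 1) \<le> 2*C1*X*Y powr (1 - \<delta>)*Y powr (\<delta> - 1)" by (rule mult_right_mono) simp
    moreover have "Y*Y powr (\<delta> - 1) = Y powr \<delta>" "Y powr (1 - \<delta>)*Y powr (\<delta> - 1) = 1"
     using XY by (simp_all add: powr_mult_base flip: powr_add)
    ultimately have "(Y powr \<delta>) powr \<beta> \<le> (2*C1*X) powr \<beta>" using ab by (intro powr_mono2) (auto simp: mult.assoc)
    also have "... = K2*X powr \<beta>" by (simp add: K2_def powr_mult)
    finally have "X powr (- \<beta>) \<le> K2*Y powr (- (\<beta>*\<delta>))"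
     using XY by (simp add: powr_powr powr_minus field_simps)
    also have "... \<le> (K1 + K2)*Y powr (- (\<beta>*\<delta>))" using K by (intro mult_right_mono) auto
    finally show ?thesis using False min by simp
   qed
   from mult_left_mono[OF this, of "R powr (- c)"] show ?thesis
    by (simp only: shell_kernel_def R_def[symmetric] X_def[symmetric] Y_def[symmetric] XY powr_ge_zero mult.left_commute)
  qed (simp add: shell_kernel_def)
  thus "\<exists>C>0. \<forall>c x y. shell_kernel c (- \<alpha>) \<beta> (mrad y) x y \<le> C * shell_kernel c (- \<alpha>) (\<beta>*\<delta>) (mrad x) x y"
   using K by (intro exI[of _ "K1 + K2"]) (auto simp: add_pos_pos)
 qed
qed

end

section \<open>The two weighted inequalities\<close>

text \<open>The exceptional set is first enclosed in a Borel null set, because exchanging the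
  quantifiers requires a measurable set.\<close>

lemma AE_lborel_swap:
 fixes P :: "'a::euclidean_space \<times> 'b::euclidean_space => bool"
 assumes "AE z in lborel. P z"
 shows "AE y in lborel. AE x in lborel. P (x, y)"
proof -
 obtain N where N: "N \<in> null_sets (lborel :: ('a \<times> 'b) measure)" "{z. \<not> P z} \<subseteq> N"
  using assms unfolding eventually_ae_filter by auto
 have "AE z in (lborel :: ('a \<times> 'b) measure). z \<notin> N" using N(1) by (rule AE_not_in)
 hence "AE z in (lborel \<Otimes>\<^sub>M lborel :: ('a \<times> 'b) measure). z \<notin> N" unfolding lborel_prod .
 from lborel_pair.AE_pair[OF this] have "AE x in lborel. AE y in lborel. (x, y) \<notin> N" by simp
 moreover have "{z \<in> space (lborel \<Otimes>\<^sub>M lborel). (fst z, snd z) \<notin> N} \<in> sets (lborel \<Otimes>\<^sub>M lborel :: ('a \<times> 'b) measure)"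
 proof -
  have "- N \<in> sets (lborel :: ('a \<times> 'b) measure)" using N(1) by (auto simp: null_sets_def)
  moreover have "{z \<in> space (lborel :: ('a \<times> 'b) measure). (fst z, snd z) \<notin> N} = - N" by auto
  ultimately show ?thesis unfolding lborel_prod by simp
 qed
 ultimately have "AE y in lborel. AE x in lborel. (x, y) \<notin> N"
  by (subst (asm) lborel_pair.AE_commute) auto
 thus ?thesis using N(2) by (auto elim!: eventually_mono)
qed

lemma measurable_sections_lebesgue:
 fixes f :: "'a::euclidean_space => real"
 assumes f: "f \<in> LM"
 shows "(\<lambda>(x, y). f x) \<in> borel_measurable ((lebesgue :: 'a measure) \<Otimes>\<^sub>M (lebesgue :: 'b::euclidean_space measure))"
  "(\<lambda>(y, x). f x) \<in> borel_measurable ((lebesgue :: 'b measure) \<Otimes>\<^sub>M (lebesgue :: 'a measure))"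
 using measurable_compose[OF measurable_fst f] measurable_compose[OF measurable_snd f] by (simp_all add: split_beta')

context rh_potential begin

lemma shell_kernel_measurable:
 "(\<lambda>(x, y). shell_kernel c B1 B2 (mrad x) x y) \<in> borel_measurable (lebesgue \<Otimes>\<^sub>M (lebesgue :: 'a measure))"
 "(\<lambda>(x, y). shell_kernel c B1 B2 (mrad y) x y) \<in> borel_measurable (lebesgue \<Otimes>\<^sub>M (lebesgue :: 'a measure))"
proof -
 have D: "(\<lambda>z. dist (fst z) (snd z)) \<in> borel_measurable (lebesgue \<Otimes>\<^sub>M (lebesgue :: 'a measure))"
  by (rule borel_measurable_lebesgue_pair) (intro BM_continuous continuous_intros)
 have m: "mrad \<in> LM" by (rule LM_of_BM[OF mrad_measurable])
 have "(\<lambda>z. shell_kernel c B1 B2 (h z) (fst z) (snd z)) \<in> borel_measurable (lebesgue \<Otimes>\<^sub>M (lebesgue :: 'a measure))"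
  if h[measurable]: "h \<in> borel_measurable (lebesgue \<Otimes>\<^sub>M (lebesgue :: 'a measure))" for h
 proof -
  note [measurable] = D
  have "(\<lambda>z. - (if dist (fst z) (snd z) \<le> h z then B1 else B2)) \<in> borel_measurable (lebesgue \<Otimes>\<^sub>M (lebesgue :: 'a measure))"
   by measurable
  thus ?thesis unfolding shell_kernel_def
   by (intro borel_measurable_times powr_real_measurable borel_measurable_divide D h borel_measurable_const)
 qed
 from this[OF measurable_compose[OF measurable_fst m]] this[OF measurable_compose[OF measurable_snd m]]
 show "(\<lambda>(x, y). shell_kernel c B1 B2 (mrad x) x y) \<in> borel_measurable (lebesgue \<Otimes>\<^sub>M (lebesgue :: 'a measure))"
  "(\<lambda>(x, y). shell_kernel c B1 B2 (mrad y) x y) \<in> borel_measurable (lebesgue \<Otimes>\<^sub>M (lebesgue :: 'a measure))"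
  by (simp_all add: split_beta')
qed

lemma frac_kernel_measurable_lebesgue:
 assumes k: "heat_kernel V k"
 shows "(\<lambda>(x, y). frac_kernel k \<gamma> x y) \<in> borel_measurable (lebesgue \<Otimes>\<^sub>M (lebesgue :: 'a measure))"
  "(\<lambda>(x, y). frac_kernel k \<gamma> y x) \<in> borel_measurable (lebesgue \<Otimes>\<^sub>M (lebesgue :: 'a measure))"
proof -
 note J = frac_kernel_measurable[OF k, of \<gamma>]
 show "(\<lambda>(x, y). frac_kernel k \<gamma> x y) \<in> borel_measurable (lebesgue \<Otimes>\<^sub>M (lebesgue :: 'a measure))"
  using borel_measurable_lebesgue_pair[OF J] by (simp add: split_beta')
 have "(\<lambda>z :: 'a \<times> 'a. (snd z, fst z)) \<in> BM"
  by (intro BM_continuous continuous_intros)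
 from borel_measurable_lebesgue_pair[OF measurable_compose[OF this J]]
 show "(\<lambda>(x, y). frac_kernel k \<gamma> y x) \<in> borel_measurable (lebesgue \<Otimes>\<^sub>M (lebesgue :: 'a measure))"
  by (simp add: split_beta')
qed

text \<open>The Schur kernel \<open>a\<close> is |x - y|^(-d), flattened by \<epsilon> on both sides
  of the critical scale of y to become integrable. For the integral in y its scale is moved to x. In
  the other integral, V^(\<gamma> p) w is summed over shells around y, whose scale is already the
  right one.\<close>

lemma VL_weighted:
 assumes k: "heat_kernel V k" and \<gamma>: "0 < \<gamma>" "2*\<gamma> < d" and \<theta>: "0 \<le> \<theta>" and p: "1 \<le> p" "p < q/\<gamma>"
 shows "\<exists>C::real. \<forall>w f. weight w --> f \<in> LM -->
  weighted_inequality (VL_kernel V k \<gamma>) p C w (maximal_fun V \<theta> (conj_exp (q/(\<gamma>*p))) w) f"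
proof -
 define \<sigma> where "\<sigma> = \<gamma>*p"
 have \<sigma>: "0 < \<sigma>" "\<sigma> < q" using \<gamma> p by (auto simp: \<sigma>_def field_simps)
 \<comment> \<open>Small enough that the singularity \<epsilon> (p - 1) introduced by a^(1 - p) near
   y stays below the gain \<delta>0 \<sigma> from the potential.\<close>
 define \<epsilon> where "\<epsilon> = \<delta>0*\<sigma>/(2*p)"
 have \<epsilon>: "0 < \<epsilon>" "\<epsilon>*(p - 1) < \<delta>0*\<sigma>"
 proof -
  show "0 < \<epsilon>" using \<delta>0_pos \<sigma> p by (simp add: \<epsilon>_def)
  have "0 < \<delta>0*\<sigma>" using \<delta>0_pos \<sigma> by simp
  hence "\<delta>0*\<sigma>*(p - 1) < \<delta>0*\<sigma>*(2*p)" using p by (intro mult_strict_left_mono) auto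
  thus "\<epsilon>*(p - 1) < \<delta>0*\<sigma>" using p by (simp add: \<epsilon>_def divide_less_eq mult_ac)
 qed
 obtain D A where D: "0 < D" "0 \<le> A" and rate: "\<And>w y. weight w ==>
   ball_rate (d - 2*\<sigma>) (\<delta>0*\<sigma>) A (mrad y) y (ennreal D*maximal_fun V \<theta> (conj_exp (q/\<sigma>)) w y) (\<lambda>x. V x powr \<sigma>*w x)"
  by (rule maximal_fun_ball_rate[OF \<sigma> \<theta>]) (rule that; blast)
 obtain \<delta> Cs where \<delta>: "0 < \<delta>" and Cs: "0 < Cs" and shell: "\<And>c x y.
   shell_kernel c (- \<epsilon>) \<epsilon> (mrad y) x y \<le> Cs * shell_kernel c (- \<epsilon>) (\<epsilon>*\<delta>) (mrad x) x y"
  using shell_comparison \<epsilon>(1) by metis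
 \<comment> \<open>The decay N p has to outweigh the growth \<open>A\<close> of the weighted mass
   and the loss \<epsilon> (p - 1) caused by a^(1 - p).\<close>
 define N where "N = A + 1 + \<epsilon>"
 define B where "B = N*p + \<epsilon>*(1 - p)"
 have N: "0 < N" using D \<epsilon> by (simp add: N_def)
 have B: "A < B"
 proof -
  have "B = (A + 1)*p + \<epsilon>" by (simp add: B_def N_def algebra_simps)
  moreover have "(A + 1)*1 \<le> (A + 1)*p" using D p by (intro mult_left_mono) auto
  ultimately show ?thesis using \<epsilon> by simp
 qed
 obtain C1 where C1: "0 < C1" and J: "AE z in lborel. \<bar>frac_kernel k \<gamma> (fst z) (snd z)\<bar>
   \<le> C1*(dist (fst z) (snd z) powr (2*\<gamma> - d)*(1 + dist (fst z) (snd z)/mrad (snd z)) powr (- N))"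
  by (rule frac_kernel_bound[OF k \<gamma> N]) (rule that; blast)
 have "- \<epsilon> < 0" "0 < \<epsilon>*\<delta>" using \<epsilon> \<delta> by auto
 then obtain Ca where Ca: "0 < Ca" and Cai: "\<And>y m X h F k. ball_rate d 0 0 m (y::'a) X h ==> 0 \<le> k ==>
  (AE x. F x \<le> k*(h x * shell_kernel d (- \<epsilon>) (\<epsilon>*\<delta>) m y x)) ==> (\<integral>x. ennreal (F x)) \<le> ennreal (k*Ca)*X"
  by (rule nn_integral_shell_kernel[where c=d]) (rule that; blast)
 obtain Cb where Cb: "0 < Cb" and Cbi: "\<And>y m X h F k. ball_rate (d - 2*\<sigma>) (\<delta>0*\<sigma>) A m (y::'a) X h ==> 0 \<le> k ==>
  (AE x. F x \<le> k*(h x * shell_kernel (d - 2*\<sigma>) (\<epsilon>*(p - 1)) B m y x)) ==> (\<integral>x. ennreal (F x)) \<le> ennreal (k*Cb)*X"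
  by (rule nn_integral_shell_kernel[OF \<epsilon>(2) B, where c="d - 2*\<sigma>"]) (rule that; blast)
 define a where "a x y = shell_kernel d (- \<epsilon>) \<epsilon> (mrad y) x y" for x y
 have exps: "(d - 2*\<gamma>)*p + d*(1 - p) = d - 2*\<sigma>" "- \<epsilon>*(1 - p) = \<epsilon>*(p - 1)"
  by (simp_all add: \<sigma>_def algebra_simps)
 have Jy: "AE y. AE x. \<bar>frac_kernel k \<gamma> x y\<bar> \<le> C1*(dist x y powr (2*\<gamma> - d)*(1 + dist x y/mrad y) powr (- N))"
  using AE_lborel_swap[OF J] by (simp add: AE_lebesgue_lborel)
 have pt: "\<bar>VL_kernel V k \<gamma> x y\<bar> powr p*a x y powr (1 - p) \<le> C1 powr p*(V x powr \<sigma> * shell_kernel (d - 2*\<sigma>) (\<epsilon>*(p - 1)) B (mrad y) y x)"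
  if J: "\<bar>frac_kernel k \<gamma> x y\<bar> \<le> C1*(dist x y powr (2*\<gamma> - d)*(1 + dist x y/mrad y) powr (- N))" for x y
 proof -
  let ?g = "dist x y powr (- (d - 2*\<gamma>))*(1 + dist x y/mrad y) powr (- N)"
  have "\<bar>frac_kernel k \<gamma> x y\<bar> powr p \<le> (C1*?g) powr p" using J p by (intro powr_mono2) auto
  hence "V x powr \<sigma>*\<bar>frac_kernel k \<gamma> x y\<bar> powr p*a x y powr (1 - p) \<le> V x powr \<sigma>*(C1 powr p*?g powr p)*a x y powr (1 - p)"
   unfolding powr_mult[of C1] by (intro mult_right_mono mult_left_mono) auto
  also have "... = C1 powr p*(V x powr \<sigma>*(?g powr p*a x y powr (1 - p)))" by (simp only: mult_ac)
  also have "... \<le> C1 powr p*(V x powr \<sigma> * shell_kernel (d - 2*\<sigma>) (\<epsilon>*(p - 1)) B (mrad y) x y)"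
   using shell_kernel_Schur[OF mrad_pos p(1) less_imp_le[OF N], of x y "d - 2*\<gamma>" y d "- \<epsilon>" \<epsilon>, unfolded exps] C1
   by (intro mult_left_mono) (auto simp: a_def B_def)
  finally show ?thesis by (simp add: VL_kernel_def abs_mult powr_mult powr_powr \<sigma>_def shell_kernel_commute[of _ _ _ _ y])
 qed
 have ai: "(\<integral>y. ennreal (a x y)) \<le> ennreal (Cs*Ca*unit_ball_vol d)" for x
  using Cai[OF ball_rate_const[of "mrad x" x, folded d] less_imp_le[OF Cs], of "a x"] shell Cs Ca mrad_pos less_imp_le[OF unit_ball_vol_pos']
  by (simp add: a_def flip: ennreal_mult'')
 have Ki: "AE y. (\<integral>x. ennreal (\<bar>VL_kernel V k \<gamma> x y\<bar> powr p*a x y powr (1 - p)*w x))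
   \<le> ennreal (C1 powr p*Cb*D)*maximal_fun V \<theta> (conj_exp (q/\<sigma>)) w y" if w: "weight w" for w
  using Jy
 proof eventually_elim
  case (elim y)
  have "(\<integral>x. ennreal (\<bar>VL_kernel V k \<gamma> x y\<bar> powr p*a x y powr (1 - p)*w x))
    \<le> ennreal (C1 powr p*Cb)*(ennreal D*maximal_fun V \<theta> (conj_exp (q/\<sigma>)) w y)"
  proof (rule Cbi[OF rate[OF w]])
   show "AE x. \<bar>VL_kernel V k \<gamma> x y\<bar> powr p*a x y powr (1 - p)*w x
    \<le> C1 powr p*((V x powr \<sigma>*w x) * shell_kernel (d - 2*\<sigma>) (\<epsilon>*(p - 1)) B (mrad y) y x)"
    using elim by eventually_elim (use mult_right_mono[OF pt weight_nonneg[OF w]] in \<open>simp add: mult_ac\<close>)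
  qed simp
  thus ?case using D Cb by (simp add: ennreal_mult mult.assoc)
 qed
 have Km: "(\<lambda>(x, y). VL_kernel V k \<gamma> x y) \<in> LM2"
  unfolding VL_kernel_def
  using borel_measurable_times[OF powr_real_measurable[OF measurable_sections_lebesgue(1)[OF V_measurable] borel_measurable_const] frac_kernel_measurable_lebesgue(1)[OF k]]
  by (simp add: split_beta')
 have am: "(\<lambda>(x, y). a x y) \<in> LM2" unfolding a_def by (rule shell_kernel_measurable)
 show ?thesis
 proof (intro exI allI impI)
  fix w :: "'a => real" and f :: "'a => complex" assume w: "weight w" and f: "f \<in> LM"
  show "weighted_inequality (VL_kernel V k \<gamma>) p ((Cs*Ca*unit_ball_vol d) powr (p - 1)*(C1 powr p*Cb*D)) w (maximal_fun V \<theta> (conj_exp (q/(\<gamma>*p))) w) f"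
   unfolding \<sigma>_def[symmetric]
  proof (rule weighted_inequality_Schur[OF p(1) Km am weight_measurable[OF w] f _ weight_nonneg[OF w] _ ai _ Ki[OF w]])
   show "VL_kernel V k \<gamma> x y = 0" if "x \<noteq> y" "a x y = 0" for x y
    using that mrad_pos[of y] by (simp add: a_def shell_kernel_def split: if_splits)
  qed (use C1 Cb D Cs Ca unit_ball_vol_pos' in \<open>auto simp: a_def shell_kernel_nonneg\<close>)
 qed
qed

text \<open>With the constant weight 1 the rate for V^\<sigma> w becomes one for V^\<sigma> itself,
  as required by the first Schur integral of the adjoint.\<close>

lemma maximal_fun_one_le: "0 < s ==> maximal_fun V 0 s (\<lambda>_. 1) y \<le> 1"
 unfolding maximal_fun_def
proof (rule SUP_least, clarify)
 fix x0 :: 'a and r0 :: real assume s: "0 < s" and r: "0 < r0"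
 have "emeasure lebesgue (ball x0 r0) = ennreal (vol r0)" using r by (intro emeasure_ball_vol) simp
 hence "(\<integral>x\<in>ball x0 r0. ennreal (1 powr s))/emeasure lebesgue (ball x0 r0) = ennreal 1"
  using vol_pos[OF r] by (simp add: divide_ennreal)
 hence "power_mean s (\<lambda>_. 1) (ball x0 r0) = ennreal (1 powr (1/s))"
  unfolding power_mean_def by (simp only: ennreal_powr_ennreal zero_le_one)
 thus "ennreal ((1 + r0/\<rho> x0) powr - 0)*power_mean s (\<lambda>_. 1) (ball x0 r0) \<le> 1"
  by (simp add: ennreal_leI[of _ 1, simplified])
qed

text \<open>Here the potential stands at the variable of integration y. It is put into the Schur
  kernel \<open>B\<close> with the power \<sigma> = \<gamma> p', so that it cancels from K^p B^(1 -
  p) and a plain average of w remains. The bound for the kernel has its scale at x, which suits the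
  integral in y; for the integral in x it is moved to y.\<close>

lemma LV_weighted:
 assumes k: "heat_kernel V k" and \<gamma>: "0 < \<gamma>" "2*\<gamma> < d" and \<theta>: "0 \<le> \<theta>" and p: "conj_exp (q/\<gamma>) < p"
 shows "\<exists>C::real. \<forall>w f. weight w --> f \<in> LM -->
  weighted_inequality (LV_kernel V k \<gamma>) p C w (maximal_fun V \<theta> 1 w) f"
proof -
 have s1: "1 < q/\<gamma>" using \<gamma> q by simp
 have p1: "1 < p"
 proof -
  have "1 < t/(t - 1)" if "1 < t" for t :: real using that by simp
  hence "1 < conj_exp (q/\<gamma>)" unfolding conj_exp_def using s1 by blast
  thus ?thesis using p by simp
 qed
 \<comment> \<open>The condition on p amounts to \<sigma> < q, which makes V^\<sigma> accessible to
   the reverse Hoelder inequality.\<close>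
 define \<sigma> where "\<sigma> = \<gamma>*(p/(p - 1))"
 have \<sigma>p: "\<sigma>*(p - 1) = \<gamma>*p" using p1 by (simp add: \<sigma>_def)
 have \<sigma>: "0 < \<sigma>" "\<sigma> < q"
 proof -
  show "0 < \<sigma>" using \<gamma> p1 by (simp add: \<sigma>_def)
  have "q/\<gamma> < p*(q/\<gamma> - 1)" using p s1 by (simp only: conj_exp_def pos_divide_less_eq[of "q/\<gamma> - 1"] diff_gt_0_iff_gt)
  hence "\<gamma>*(q/\<gamma>) < \<gamma>*(p*(q/\<gamma> - 1))" using \<gamma>(1) by (rule mult_strict_left_mono)
  also have "\<gamma>*(p*(q/\<gamma> - 1)) = p*q - p*\<gamma>" using \<gamma> by (simp add: algebra_simps)
  finally have "p*\<gamma> < q*(p - 1)" using \<gamma> by (simp add: algebra_simps)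
  thus "\<sigma> < q" using p1 by (simp add: \<sigma>_def pos_divide_less_eq mult_ac)
 qed
 define \<epsilon> where "\<epsilon> = \<delta>0*\<sigma>/2"
 have \<epsilon>: "0 < \<epsilon>" "\<epsilon> < \<delta>0*\<sigma>" using \<delta>0_pos \<sigma> by (auto simp: \<epsilon>_def)
 obtain D A where D: "0 < D" "0 \<le> A" and rate: "\<And>w y. weight w ==>
   ball_rate (d - 2*\<sigma>) (\<delta>0*\<sigma>) A (mrad y) y (ennreal D*maximal_fun V 0 (conj_exp (q/\<sigma>)) w y) (\<lambda>x. V x powr \<sigma>*w x)"
  by (rule maximal_fun_ball_rate[OF \<sigma> order_refl]) (rule that; blast)
 obtain D' where D': "0 < D'" and rate': "\<And>w y. weight w ==> ball_rate d 0 \<theta> (mrad y) y (ennreal D'*maximal_fun V \<theta> 1 w y) w"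
  by (rule maximal_fun_ball_rate[OF \<sigma> \<theta>]) (rule that; blast)
 obtain \<delta> where \<delta>: "0 < \<delta>" and shell: "\<And>\<alpha> \<beta>. 0 < \<alpha> ==> 0 < \<beta> ==> \<exists>C>0. \<forall>c x y.
   shell_kernel c (- \<alpha>) \<beta> (mrad y) x y \<le> C * shell_kernel c (- \<alpha>) (\<beta>*\<delta>) (mrad x) x y"
  by (rule shell_comparison) (rule that; blast)
 \<comment> \<open>The singularity \<epsilon> of \<open>B\<close> turns into the gain \<alpha> under
   the power 1 - p. The rate \<beta> becomes \<beta> \<delta> = \<theta> + 1 after the change of
   scale, which exceeds the growth \<theta> of the averages of w.\<close>
 define \<alpha> \<beta> where "\<alpha> = \<epsilon>*(p - 1)" and "\<beta> = (\<theta> + 1)/\<delta>"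
 have ab: "0 < \<alpha>" "0 < \<beta>" "- \<alpha> < 0" "\<theta> < \<beta>*\<delta>" using \<epsilon> p1 \<theta> \<delta> by (auto simp: \<alpha>_def \<beta>_def)
 obtain Cs where Cs: "0 < Cs" and shell': "\<And>c x y.
   shell_kernel c (- \<alpha>) \<beta> (mrad y) x y \<le> Cs * shell_kernel c (- \<alpha>) (\<beta>*\<delta>) (mrad x) x y"
  using shell[OF ab(1,2)] by blast
 \<comment> \<open>\<open>N'\<close> makes \<open>B\<close> integrable at infinity; \<open>N\<close>
   is solved from N p + N' (1 - p) = \<beta>.\<close>
 define N' N where "N' = A + 1" and "N = (\<beta> + N'*(p - 1))/p"
 have N': "A < N'" "0 < N'" using D by (auto simp: N'_def)
 have N: "0 < N" "N*p = \<beta> + N'*(p - 1)" using ab N' p1 by (auto simp: N_def intro!: divide_pos_pos add_pos_pos)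
 obtain C1 where C1: "0 < C1" and J: "AE z in lborel. \<bar>frac_kernel k \<gamma> (fst z) (snd z)\<bar>
   \<le> C1*(dist (fst z) (snd z) powr (2*\<gamma> - d)*(1 + dist (fst z) (snd z)/mrad (snd z)) powr (- N))"
  by (rule frac_kernel_bound[OF k \<gamma> N(1)]) (rule that; blast)
 obtain Ca where Ca: "0 < Ca" and Cai: "\<And>y m X h F k. ball_rate (d - 2*\<sigma>) (\<delta>0*\<sigma>) A m (y::'a) X h ==> 0 \<le> k ==>
  (AE x. F x \<le> k*(h x * shell_kernel (d - 2*\<sigma>) \<epsilon> N' m y x)) ==> (\<integral>x. ennreal (F x)) \<le> ennreal (k*Ca)*X"
  by (rule nn_integral_shell_kernel[OF \<epsilon>(2) N'(1), where c="d - 2*\<sigma>"]) (rule that; blast)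
 obtain Cb where Cb: "0 < Cb" and Cbi: "\<And>y m X h F k. ball_rate d 0 \<theta> m (y::'a) X h ==> 0 \<le> k ==>
  (AE x. F x \<le> k*(h x * shell_kernel d (- \<alpha>) (\<beta>*\<delta>) m y x)) ==> (\<integral>x. ennreal (F x)) \<le> ennreal (k*Cb)*X"
  by (rule nn_integral_shell_kernel[OF ab(3,4), where c=d]) (rule that; blast)
 define B where "B x y = V y powr \<sigma> * shell_kernel (d - 2*\<sigma>) \<epsilon> N' (mrad x) x y" for x y
 have exps: "(d - 2*\<gamma>)*p + (d - 2*\<sigma>)*(1 - p) = d" "\<epsilon>*(1 - p) = - \<alpha>" "N*p + N'*(1 - p) = \<beta>" "\<gamma>*p + \<sigma>*(1 - p) = 0"
  using \<sigma>p N(2) by (simp_all add: \<alpha>_def algebra_simps)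
 have bi: "(\<integral>y. ennreal (B x y)) \<le> ennreal (Ca*D)" for x
 proof -
  have s: "0 < conj_exp (q/\<sigma>)" using \<sigma> by (simp add: conj_exp_def)
  have w1: "weight (\<lambda>_::'a. 1)" by (simp add: weight_def absolutely_integrable_on_const lmeasurable_compact)
  have "(\<integral>y. ennreal (B x y)) \<le> ennreal (1*Ca)*(ennreal D*maximal_fun V 0 (conj_exp (q/\<sigma>)) (\<lambda>_. 1) x)"
   by (rule Cai[OF rate[OF w1]]) (auto simp: B_def)
  also have "... \<le> ennreal Ca*(ennreal D*1)"      by (simp only: mult_1_left, intro mult_left_mono maximal_fun_one_le s) auto
  finally show ?thesis using Ca D by (simp add: ennreal_mult)
 qed
 have Jy: "AE y. AE x. \<bar>frac_kernel k \<gamma> y x\<bar> \<le> C1*(dist y x powr (2*\<gamma> - d)*(1 + dist y x/mrad x) powr (- N))"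
  using lborel_pair.AE_pair[OF J[unfolded lborel_prod[symmetric]]] by (simp add: AE_lebesgue_lborel)
 have pt: "\<bar>LV_kernel V k \<gamma> x y\<bar> powr p*B x y powr (1 - p) \<le> C1 powr p*Cs * shell_kernel d (- \<alpha>) (\<beta>*\<delta>) (mrad y) y x"
  if J: "\<bar>frac_kernel k \<gamma> y x\<bar> \<le> C1*(dist y x powr (2*\<gamma> - d)*(1 + dist y x/mrad x) powr (- N))" for x y
 proof -
  let ?g = "dist x y powr (- (d - 2*\<gamma>))*(1 + dist x y/mrad x) powr (- N)" and ?s = "shell_kernel (d - 2*\<sigma>) \<epsilon> N' (mrad x) x y"
  have "\<bar>frac_kernel k \<gamma> y x\<bar> powr p \<le> (C1*?g) powr p" using J p1 by (intro powr_mono2) (auto simp: dist_commute)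
  \<comment> \<open>The product of the two powers of V is V^0, which under \<open>powr\<close> is 1
    where V is positive and 0 where V vanishes, hence at most 1.\<close>
  hence "(V y powr (\<gamma>*p)*V y powr (\<sigma>*(1 - p)))*(\<bar>frac_kernel k \<gamma> y x\<bar> powr p*?s powr (1 - p)) \<le> 1*((C1 powr p*?g powr p)*?s powr (1 - p))"
   unfolding powr_mult[of C1] powr_add[symmetric] exps by (intro mult_mono) auto
  also have "... = C1 powr p*(?g powr p*?s powr (1 - p))" by simp
  also have "... \<le> C1 powr p * shell_kernel d (- \<alpha>) \<beta> (mrad x) y x"
   using shell_kernel_Schur[OF mrad_pos less_imp_le[OF p1] less_imp_le[OF N(1)], of x y "d - 2*\<gamma>" x "d - 2*\<sigma>" \<epsilon> N', unfolded exps]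
   by (intro mult_left_mono) (auto simp: shell_kernel_commute[of _ _ _ _ y])
  also have "... \<le> C1 powr p*(Cs * shell_kernel d (- \<alpha>) (\<beta>*\<delta>) (mrad y) y x)" by (intro mult_left_mono shell') simp
  finally show ?thesis by (simp add: LV_kernel_def VL_kernel_def B_def abs_mult powr_mult powr_powr mult_ac)
 qed
 have Ki: "AE y. (\<integral>x. ennreal (\<bar>LV_kernel V k \<gamma> x y\<bar> powr p*B x y powr (1 - p)*w x))
   \<le> ennreal (C1 powr p*Cs*Cb*D')*maximal_fun V \<theta> 1 w y" if w: "weight w" for w
  using Jy
 proof eventually_elim
  case (elim y)
  have "(\<integral>x. ennreal (\<bar>LV_kernel V k \<gamma> x y\<bar> powr p*B x y powr (1 - p)*w x))
    \<le> ennreal (C1 powr p*Cs*Cb)*(ennreal D'*maximal_fun V \<theta> 1 w y)"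
  proof (rule Cbi[OF rate'[OF w]])
   show "AE x. \<bar>LV_kernel V k \<gamma> x y\<bar> powr p*B x y powr (1 - p)*w x
    \<le> C1 powr p*Cs*(w x * shell_kernel d (- \<alpha>) (\<beta>*\<delta>) (mrad y) y x)"
    using elim by eventually_elim (use mult_right_mono[OF pt weight_nonneg[OF w]] in \<open>simp add: mult_ac\<close>)
  qed (use Cs in simp)
  thus ?case using D' Cb Cs by (simp add: ennreal_mult mult.assoc)
 qed
 have Vm: "(\<lambda>(x, y). V y powr s) \<in> borel_measurable ((lebesgue :: 'a measure) \<Otimes>\<^sub>M lebesgue)" for s
  using powr_real_measurable[OF measurable_sections_lebesgue(2)[OF V_measurable] borel_measurable_const] by (simp add: split_beta')
 have Km: "(\<lambda>(x, y). LV_kernel V k \<gamma> x y) \<in> LM2"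
  unfolding LV_kernel_def VL_kernel_def
  using borel_measurable_times[OF Vm frac_kernel_measurable_lebesgue(2)[OF k]] by (simp add: split_beta')
 have Bm: "(\<lambda>(x, y). B x y) \<in> LM2"
  using borel_measurable_times[OF Vm shell_kernel_measurable(1)] by (simp add: B_def split_beta')
 show ?thesis
 proof (intro exI allI impI)
  fix w :: "'a => real" and f :: "'a => complex" assume w: "weight w" and f: "f \<in> LM"
  show "weighted_inequality (LV_kernel V k \<gamma>) p ((Ca*D) powr (p - 1)*(C1 powr p*Cs*Cb*D')) w (maximal_fun V \<theta> 1 w) f"
  proof (rule weighted_inequality_Schur[OF less_imp_le[OF p1] Km Bm weight_measurable[OF w] f _ weight_nonneg[OF w] _ bi _ Ki[OF w]])
   show "LV_kernel V k \<gamma> x y = 0" if "x \<noteq> y" "B x y = 0" for x y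
    using that mrad_pos[of x] by (auto simp: B_def shell_kernel_def LV_kernel_def VL_kernel_def split: if_splits)
  qed (use C1 Cb D Cs Ca D' in \<open>auto simp: B_def shell_kernel_nonneg\<close>)
 qed
qed

end

theorem theorem8:
  fixes V :: "'a::euclidean_space \<Rightarrow> real"
    and k :: "real \<Rightarrow> 'a \<Rightarrow> 'a \<Rightarrow> real"
    and q \<gamma> \<theta> :: real
  assumes "DIM('a) \<ge> 3"
    and "q > real DIM('a) / 2"
    and "reverse_holder q V"
    and "\<not> (AE x in lebesgue. V x = 0)"
    and "0 < \<gamma>" and "\<gamma> < real DIM('a) / 2"
    and "\<theta> \<ge> 0"
    and "heat_kernel V k"
  shows "(\<forall>p. 1 \<le> p \<and> p < q / \<gamma> \<longrightarrow>
            (\<exists>C::real. \<forall>w f. weight w \<longrightarrow> f \<in> borel_measurable lebesgue \<longrightarrow>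
               weighted_inequality (VL_kernel V k \<gamma>) p C w
                 (maximal_fun V \<theta> (conj_exp (q / (\<gamma> * p))) w) f)) \<and>
         (\<forall>p. conj_exp (q / \<gamma>) < p \<longrightarrow>
            (\<exists>C::real. \<forall>w f. weight w \<longrightarrow> f \<in> borel_measurable lebesgue \<longrightarrow>
               weighted_inequality (LV_kernel V k \<gamma>) p C w (maximal_fun V \<theta> 1 w) f))"
proof -
 interpret rh_potential V q "real DIM('a)"
  by unfold_locales (use assms in auto)
 have "2*\<gamma> < real DIM('a)" using assms(6) by simp
 thus ?thesis
  using VL_weighted[OF assms(8,5) _ assms(7)] LV_weighted[OF assms(8,5) _ assms(7)] by blast
qed

end
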